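(* Let $r\ge2$. Up to graded Morita equivalence the gradings on $C_r$ are in one-to-one correspondence with $\mathbb{Z}^2$.
   Context: $k$ is an algebraically closed field of characteristic 2. A grading on a finite dimensional $k$-algebra $A$ is a vector space decomposition $A=\bigoplus_{i\in\mathbb{Z}}A_i$ with $A_iA_j\subseteq A_{i+j}$; write $(A,\pi)$ for $A$ with a grading $\pi$. Graded Morita equivalence: let $S_1,\dots,S_s$ be the isomorphism classes of simple $A$-modules, with projective covers $P_1,\dots,P_s$. Gradings $(A,\pi)$ and $(A,\pi')$ are graded Morita equivalent if there are integers $d_{ij}$ ($1\le j\le\dim S_i$, $1\le i\le s$) such that the graded algebras $(A,\pi')$ and $\mathrm{Endgr}_{(A,\pi)}(\bigoplus_{i,j}P_i\langle d_{ij}\rangle)^{\mathrm{op}}$ are isomorphic. Here $M\langle i\rangle_j=M_{i+j}$, and $\mathrm{Endgr}(M)=\bigoplus_i\mathrm{Hom}_{gr}(M,M\langle i\rangle)$, with $\mathrm{Hom}_{gr}$ the degree preserving module homomorphisms. $C_r$ is the quotient of the path algebra over $k$ (paths written left to right: $xy$ means first $x$, then $y$) of the quiver with vertices $1,2,3$, arrows $a_1:1\to2$, $b_1:2\to1$, $a_2:2\to3$, $b_2:3\to2$, and a loop $c$ at $3$, by the relations $a_1b_1=b_2a_2=a_2c=cb_2=0$, $c^r=b_2b_1a_1a_2$, $a_2b_2b_1a_1=b_1a_1a_2b_2$. *)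

theory Defs
  imports
    "HOL-Algebra.Algebraic_Closure"
    "HOL-Algebra.QuotRing"
    "Jordan_Normal_Form.Missing_VectorSpace"
    "Graph_Theory.Arc_Walk"
begin

section \<open>Gradings on algebras\<close>

text \<open>
  A \<open>K\<close>-algebra is carried by a \<^typ>\<open>('k, 'a) module\<close> record, which has the ring operations
  and the scalar multiplication by \<open>K\<close>.  The locale \<^locale>\<open>algebra\<close> is not used, because it
  demands commutativity.
\<close>

definition direct_decomposition ::
  "('k, 'x) ring_scheme \<Rightarrow> ('k, 'v, 'y) module_scheme \<Rightarrow> (int \<Rightarrow> 'v set) \<Rightarrow> bool" where
  "direct_decomposition K V \<gamma> \<longleftrightarrow>
     (\<forall>i. VectorSpace.subspace K (\<gamma> i) V) \<and>
     (\<forall>x\<in>carrier V. \<exists>!f. (\<forall>i. f i \<in> \<gamma> i) \<and> finite {i. f i \<noteq> \<zero>\<^bsub>V\<^esub>} \<and>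
        x = (\<Oplus>\<^bsub>V\<^esub>i\<in>{i. f i \<noteq> \<zero>\<^bsub>V\<^esub>}. f i))"

definition gradings ::
  "('k, 'x) ring_scheme \<Rightarrow> ('k, 'a, 'y) module_scheme \<Rightarrow> (int \<Rightarrow> 'a set) set" where
  "gradings K A = {\<pi>. direct_decomposition K A \<pi> \<and>
     (\<forall>i j. \<forall>x\<in>\<pi> i. \<forall>y\<in>\<pi> j. x \<otimes>\<^bsub>A\<^esub> y \<in> \<pi> (i + j))}"

definition graded_algebras_isomorphic ::
  "('k, 'x) ring_scheme \<Rightarrow> ('k, 'a, 'y) module_scheme \<Rightarrow> (int \<Rightarrow> 'a set) \<Rightarrow>
   ('k, 'b, 'z) module_scheme \<Rightarrow> (int \<Rightarrow> 'b set) \<Rightarrow> bool" where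
  "graded_algebras_isomorphic K A \<alpha> B \<beta> \<longleftrightarrow>
     (\<exists>\<phi>\<in>ring_iso A B.
        (\<forall>c\<in>carrier K. \<forall>x\<in>carrier A. \<phi> (c \<odot>\<^bsub>A\<^esub> x) = c \<odot>\<^bsub>B\<^esub> \<phi> x) \<and>
        (\<forall>i. \<phi> ` \<alpha> i = \<beta> i))"

definition opposite_algebra :: "('k, 'a, 'y) module_scheme \<Rightarrow> ('k, 'a, 'y) module_scheme" where
  "opposite_algebra A = A\<lparr>monoid.mult := \<lambda>x y. y \<otimes>\<^bsub>A\<^esub> x\<rparr>"


section \<open>Modules over a noncommutative algebra\<close>

text \<open>
  The locale \<^locale>\<open>module\<close> demands a commutative ring; here the ring \<open>A\<close> is arbitrary.
  The notions \<^const>\<open>Module.submodule\<close> and \<^const>\<open>module_hom\<close> make no use of commutativity.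
  A module over \<open>A\<close> uses only the additive structure and \<^const>\<open>smult\<close> of its record.
\<close>

locale left_module = ring A + M: abelian_group M
  for A :: "('a, 'y) ring_scheme" (structure) and M :: "('a, 'm, 'z) module_scheme" (structure) +
  assumes act_closed: "\<lbrakk>a \<in> carrier A; x \<in> carrier M\<rbrakk> \<Longrightarrow> a \<odot>\<^bsub>M\<^esub> x \<in> carrier M"
    and act_l_distr: "\<lbrakk>a \<in> carrier A; b \<in> carrier A; x \<in> carrier M\<rbrakk> \<Longrightarrow>
      (a \<oplus>\<^bsub>A\<^esub> b) \<odot>\<^bsub>M\<^esub> x = a \<odot>\<^bsub>M\<^esub> x \<oplus>\<^bsub>M\<^esub> b \<odot>\<^bsub>M\<^esub> x"
    and act_r_distr: "\<lbrakk>a \<in> carrier A; x \<in> carrier M; y \<in> carrier M\<rbrakk> \<Longrightarrow>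
      a \<odot>\<^bsub>M\<^esub> (x \<oplus>\<^bsub>M\<^esub> y) = a \<odot>\<^bsub>M\<^esub> x \<oplus>\<^bsub>M\<^esub> a \<odot>\<^bsub>M\<^esub> y"
    and act_assoc: "\<lbrakk>a \<in> carrier A; b \<in> carrier A; x \<in> carrier M\<rbrakk> \<Longrightarrow>
      (a \<otimes>\<^bsub>A\<^esub> b) \<odot>\<^bsub>M\<^esub> x = a \<odot>\<^bsub>M\<^esub> (b \<odot>\<^bsub>M\<^esub> x)"
    and act_one: "x \<in> carrier M \<Longrightarrow> \<one>\<^bsub>A\<^esub> \<odot>\<^bsub>M\<^esub> x = x"

definition restrict_scalars ::
  "('k, 'a, 'y) module_scheme \<Rightarrow> ('a, 'm, 'z) module_scheme \<Rightarrow> ('k, 'm) module" where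
  "restrict_scalars A M =
     \<lparr>carrier = carrier M, monoid.mult = monoid.mult M, one = one M, zero = zero M, add = add M,
      smult = \<lambda>c x. (c \<odot>\<^bsub>A\<^esub> \<one>\<^bsub>A\<^esub>) \<odot>\<^bsub>M\<^esub> x\<rparr>"

definition isomorphic_modules ::
  "('a, 'y) ring_scheme \<Rightarrow> ('a, 'm) module \<Rightarrow> ('a, 'n) module \<Rightarrow> bool" where
  "isomorphic_modules A M N \<longleftrightarrow>
     (\<exists>f\<in>module_hom A M N. bij_betw f (carrier M) (carrier N))"

definition simple_module :: "('a, 'y) ring_scheme \<Rightarrow> ('a, 'm) module \<Rightarrow> bool" where
  "simple_module A S \<longleftrightarrow> left_module A S \<and> carrier S \<noteq> {\<zero>\<^bsub>S\<^esub>} \<and>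
     (\<forall>N. Module.submodule N A S \<longrightarrow> N = {\<zero>\<^bsub>S\<^esub>} \<or> N = carrier S)"

text \<open>
  The lifting property ranges over modules carried by the same type as \<open>P\<close>.  Below that type is
  \<^typ>\<open>nat \<Rightarrow> 'k\<close>, which carries a copy of every finite dimensional module.
\<close>

definition projective_module :: "('a, 'y) ring_scheme \<Rightarrow> ('a, 'm) module \<Rightarrow> bool" where
  "projective_module A P \<longleftrightarrow> left_module A P \<and>
     (\<forall>(M :: ('a, 'm) module) (N :: ('a, 'm) module) g h.
        left_module A M \<and> left_module A N \<and>
        g \<in> module_hom A M N \<and> g ` carrier M = carrier N \<and> h \<in> module_hom A P N \<longrightarrow>
        (\<exists>h'\<in>module_hom A P M. \<forall>x\<in>carrier P. g (h' x) = h x))"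

definition projective_cover ::
  "('a, 'y) ring_scheme \<Rightarrow> ('a, 'm) module \<Rightarrow> ('a, 'm) module \<Rightarrow> bool" where
  "projective_cover A P S \<longleftrightarrow> projective_module A P \<and>
     (\<exists>f\<in>module_hom A P S. f ` carrier P = carrier S \<and>
        (\<forall>N. Module.submodule N A P \<and>
             N <+>\<^bsub>P\<^esub> {x \<in> carrier P. f x = \<zero>\<^bsub>S\<^esub>} = carrier P \<longrightarrow> N = carrier P))"

definition direct_sum_module :: "'i set \<Rightarrow> ('i \<Rightarrow> ('a, 'm) module) \<Rightarrow> ('a, 'i \<Rightarrow> 'm) module" where
  "direct_sum_module I M =
     \<lparr>carrier = (\<Pi>\<^sub>E i\<in>I. carrier (M i)), monoid.mult = undefined, one = undefined,
      zero = (\<lambda>i\<in>I. \<zero>\<^bsub>M i\<^esub>),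
      add = (\<lambda>x y. \<lambda>i\<in>I. x i \<oplus>\<^bsub>M i\<^esub> y i),
      smult = (\<lambda>a x. \<lambda>i\<in>I. a \<odot>\<^bsub>M i\<^esub> x i)\<rparr>"


section \<open>Graded modules\<close>

definition graded_module ::
  "('k, 'x) ring_scheme \<Rightarrow> ('k, 'a, 'y) module_scheme \<Rightarrow> (int \<Rightarrow> 'a set) \<Rightarrow>
   ('a, 'm) module \<Rightarrow> (int \<Rightarrow> 'm set) \<Rightarrow> bool" where
  "graded_module K A \<pi> M \<gamma> \<longleftrightarrow> left_module A M \<and>
     direct_decomposition K (restrict_scalars A M) \<gamma> \<and>
     (\<forall>i j. \<forall>a\<in>\<pi> i. \<forall>x\<in>\<gamma> j. a \<odot>\<^bsub>M\<^esub> x \<in> \<gamma> (i + j))"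

definition shift :: "int \<Rightarrow> (int \<Rightarrow> 'm set) \<Rightarrow> int \<Rightarrow> 'm set" where
  "shift i \<gamma> = (\<lambda>j. \<gamma> (i + j))"

definition direct_sum_grading :: "'i set \<Rightarrow> ('i \<Rightarrow> int \<Rightarrow> 'm set) \<Rightarrow> int \<Rightarrow> ('i \<Rightarrow> 'm) set" where
  "direct_sum_grading I \<gamma> = (\<lambda>n. \<Pi>\<^sub>E i\<in>I. \<gamma> i n)"

definition graded_hom ::
  "('a, 'y) ring_scheme \<Rightarrow> ('a, 'm) module \<Rightarrow> (int \<Rightarrow> 'm set) \<Rightarrow>
   ('a, 'n) module \<Rightarrow> (int \<Rightarrow> 'n set) \<Rightarrow> ('m \<Rightarrow> 'n) set" where
  "graded_hom A M \<gamma> N \<delta> =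
     {f \<in> module_hom A M N \<inter> extensional (carrier M). \<forall>j. f ` \<gamma> j \<subseteq> \<delta> j}"

text \<open>Multiplication is composition of maps written on the left: \<open>f g\<close> is first \<open>g\<close>, then \<open>f\<close>.\<close>

definition endomorphism_algebra ::
  "('k, 'a, 'y) module_scheme \<Rightarrow> ('a, 'm) module \<Rightarrow> ('k, 'm \<Rightarrow> 'm) module" where
  "endomorphism_algebra A M =
     \<lparr>carrier = module_hom A M M \<inter> extensional (carrier M),
      monoid.mult = compose (carrier M),
      one = (\<lambda>x\<in>carrier M. x),
      zero = (\<lambda>x\<in>carrier M. \<zero>\<^bsub>M\<^esub>),
      add = (\<lambda>f g. \<lambda>x\<in>carrier M. f x \<oplus>\<^bsub>M\<^esub> g x),
      smult = (\<lambda>c f. \<lambda>x\<in>carrier M. (c \<odot>\<^bsub>A\<^esub> \<one>\<^bsub>A\<^esub>) \<odot>\<^bsub>M\<^esub> f x)\<rparr>"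

definition Endgr_component ::
  "('k, 'a, 'y) module_scheme \<Rightarrow> ('a, 'm) module \<Rightarrow> (int \<Rightarrow> 'm set) \<Rightarrow> int \<Rightarrow> ('m \<Rightarrow> 'm) set" where
  "Endgr_component A M \<gamma> i = graded_hom A M \<gamma> M (shift i \<gamma>)"

text \<open>
  The components \<open>Hom\<^sub>g\<^sub>r(M, M\<langle>i\<rangle>)\<close> are linearly independent subspaces of the algebra of all
  endomorphisms, so their direct sum is formed inside it.
\<close>

definition Endgr ::
  "('k, 'a, 'y) module_scheme \<Rightarrow> ('a, 'm) module \<Rightarrow> (int \<Rightarrow> 'm set) \<Rightarrow> ('k, 'm \<Rightarrow> 'm) module" where
  "Endgr A M \<gamma> = (endomorphism_algebra A M)\<lparr>carrier :=
     {\<Oplus>\<^bsub>endomorphism_algebra A M\<^esub>i\<in>J. f i | f J.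
        finite J \<and> (\<forall>i\<in>J. f i \<in> Endgr_component A M \<gamma> i)}\<rparr>"


section \<open>Graded Morita equivalence\<close>

definition simple_representatives ::
  "('a, 'y) ring_scheme \<Rightarrow> nat \<Rightarrow> (nat \<Rightarrow> ('a, 'm) module) \<Rightarrow> bool" where
  "simple_representatives A s S \<longleftrightarrow>
     (\<forall>i\<in>{1..s}. simple_module A (S i)) \<and>
     (\<forall>i\<in>{1..s}. \<forall>j\<in>{1..s}. isomorphic_modules A (S i) (S j) \<longrightarrow> i = j) \<and>
     (\<forall>T :: ('a, 'm) module. simple_module A T \<longrightarrow>
        (\<exists>i\<in>{1..s}. isomorphic_modules A T (S i)))"

text \<open>
  The modules \<open>S i\<close> and \<open>P i\<close> are determined up to isomorphism, and the grading \<open>\<gamma> i\<close> on the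
  indecomposable module \<open>P i\<close> up to isomorphism and shift; hence it does not matter that they are
  quantified existentially together with \<open>d\<close>.
\<close>

definition graded_Morita_equivalent ::
  "('k, 'x) ring_scheme \<Rightarrow> ('k, 'a, 'y) module_scheme \<Rightarrow>
   (int \<Rightarrow> 'a set) \<Rightarrow> (int \<Rightarrow> 'a set) \<Rightarrow> bool" where
  "graded_Morita_equivalent K A \<pi> \<pi>' \<longleftrightarrow>
     (\<exists>(s :: nat) (S :: nat \<Rightarrow> ('a, nat \<Rightarrow> 'k) module) (P :: nat \<Rightarrow> ('a, nat \<Rightarrow> 'k) module)
        (\<gamma> :: nat \<Rightarrow> int \<Rightarrow> (nat \<Rightarrow> 'k) set) (d :: nat \<Rightarrow> nat \<Rightarrow> int).
        simple_representatives A s S \<and>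
        (\<forall>i\<in>{1..s}. projective_cover A (P i) (S i) \<and> graded_module K A \<pi> (P i) (\<gamma> i)) \<and>
        (let I = (SIGMA i:{1..s}. {1..vectorspace.dim K (restrict_scalars A (S i))});
             M = direct_sum_module I (\<lambda>(i, j). P i);
             \<delta> = direct_sum_grading I (\<lambda>(i, j). shift (d i j) (\<gamma> i))
         in graded_algebras_isomorphic K A \<pi>'
              (opposite_algebra (Endgr A M \<delta>)) (Endgr_component A M \<delta>)))"

definition graded_Morita_rel ::
  "('k, 'x) ring_scheme \<Rightarrow> ('k, 'a, 'y) module_scheme \<Rightarrow> ((int \<Rightarrow> 'a set) \<times> (int \<Rightarrow> 'a set)) set"
  where
  "graded_Morita_rel K A =
     {(\<pi>, \<pi>'). \<pi> \<in> gradings K A \<and> \<pi>' \<in> gradings K A \<and> graded_Morita_equivalent K A \<pi> \<pi>'}"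


section \<open>Path algebras and their quotients\<close>

text \<open>A path is given by its initial vertex and the list of its arrows, in the order of travel.\<close>

definition quiver_paths :: "('v, 'e) pre_digraph \<Rightarrow> ('v \<times> 'e list) set" where
  "quiver_paths Q = {(u, p). \<exists>v. pre_digraph.awalk Q u p v}"

text \<open>
  Elements are the finitely supported functions on paths.  The product is the bilinear extension
  of concatenation: the decompositions of a path \<open>(u, p)\<close> into two paths are given by the
  \<open>n \<le> length p\<close>.
\<close>

definition path_algebra ::
  "('k, 'x) ring_scheme \<Rightarrow> ('v, 'e) pre_digraph \<Rightarrow> ('k, 'v \<times> 'e list \<Rightarrow> 'k) module" where
  "path_algebra K Q =
     \<lparr>carrier = {f. (\<forall>x. f x \<in> carrier K) \<and> finite {x. f x \<noteq> \<zero>\<^bsub>K\<^esub>} \<and>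
                    {x. f x \<noteq> \<zero>\<^bsub>K\<^esub>} \<subseteq> quiver_paths Q},
      monoid.mult = (\<lambda>f g (u, p). \<Oplus>\<^bsub>K\<^esub>n\<in>{..length p}.
        f (u, take n p) \<otimes>\<^bsub>K\<^esub> g (pre_digraph.awlast Q u (take n p), drop n p)),
      one = (\<lambda>(u, p). if u \<in> verts Q \<and> p = [] then \<one>\<^bsub>K\<^esub> else \<zero>\<^bsub>K\<^esub>),
      zero = (\<lambda>x. \<zero>\<^bsub>K\<^esub>),
      add = (\<lambda>f g x. f x \<oplus>\<^bsub>K\<^esub> g x),
      smult = (\<lambda>c f x. c \<otimes>\<^bsub>K\<^esub> f x)\<rparr>"

definition path_element ::
  "('k, 'x) ring_scheme \<Rightarrow> 'v \<Rightarrow> 'e list \<Rightarrow> 'v \<times> 'e list \<Rightarrow> 'k" where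
  "path_element K u p = (\<lambda>x. if x = (u, p) then \<one>\<^bsub>K\<^esub> else \<zero>\<^bsub>K\<^esub>)"

definition quotient_algebra ::
  "('k, 'a, 'y) module_scheme \<Rightarrow> 'a set \<Rightarrow> ('k, 'a set) module" where
  "quotient_algebra A I =
     \<lparr>carrier = carrier (A Quot I), monoid.mult = monoid.mult (A Quot I), one = one (A Quot I),
      zero = zero (A Quot I), add = add (A Quot I),
      smult = (\<lambda>c B. \<Union>x\<in>B. I +>\<^bsub>A\<^esub> (c \<odot>\<^bsub>A\<^esub> x))\<rparr>"


section \<open>The algebra \<open>C\<^sub>r\<close>\<close>

datatype C_arrow = arr_a1 | arr_b1 | arr_a2 | arr_b2 | arr_c

fun C_source :: "C_arrow \<Rightarrow> nat" where
  "C_source arr_a1 = 1"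
| "C_source arr_b1 = 2"
| "C_source arr_a2 = 2"
| "C_source arr_b2 = 3"
| "C_source arr_c = 3"

fun C_target :: "C_arrow \<Rightarrow> nat" where
  "C_target arr_a1 = 2"
| "C_target arr_b1 = 1"
| "C_target arr_a2 = 3"
| "C_target arr_b2 = 2"
| "C_target arr_c = 3"

definition C_quiver :: "(nat, C_arrow) pre_digraph" where
  "C_quiver = \<lparr>verts = {1, 2, 3}, arcs = UNIV, tail = C_source, head = C_target\<rparr>"

definition C_relations :: "('k, 'x) ring_scheme \<Rightarrow> nat \<Rightarrow> (nat \<times> C_arrow list \<Rightarrow> 'k) set" where
  "C_relations K r =
     {path_element K 1 [arr_a1, arr_b1],
      path_element K 3 [arr_b2, arr_a2],
      path_element K 2 [arr_a2, arr_c],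
      path_element K 3 [arr_c, arr_b2],
      path_element K 3 (replicate r arr_c)
        \<ominus>\<^bsub>path_algebra K C_quiver\<^esub> path_element K 3 [arr_b2, arr_b1, arr_a1, arr_a2],
      path_element K 2 [arr_a2, arr_b2, arr_b1, arr_a1]
        \<ominus>\<^bsub>path_algebra K C_quiver\<^esub> path_element K 2 [arr_b1, arr_a1, arr_a2, arr_b2]}"

definition C_algebra ::
  "('k, 'x) ring_scheme \<Rightarrow> nat \<Rightarrow> ('k, (nat \<times> C_arrow list \<Rightarrow> 'k) set) module" where
  "C_algebra K r = quotient_algebra (path_algebra K C_quiver)
     (Idl\<^bsub>path_algebra K C_quiver\<^esub> (C_relations K r))"

end

theory Submission
  imports Defs
begin

text \<open>
The algebra \<open>C\<^sub>r\<close> has a basis of monomials: the vertices, the paths of length at most three along the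
cycle \<open>1 \<rightarrow> 2 \<rightarrow> 3 \<rightarrow> 2 \<rightarrow> 1\<close>, the powers of the loop and one socle element at each vertex. The product of
two monomials is a monomial or zero. Call a family of elements with this multiplication table a frame if
it is a basis. A frame together with a function that gives degrees to monomials, additive on nonzero
products, determines a grading, called standard.

Every grading is standard (\<open>gradings_are_standard\<close>). In characteristic 2 the maps \<open>x \<mapsto> x ^ (2 ^ k)\<close> are
additive on commuting elements, so a high power of the degree 0 part of a vertex is an idempotent of
degree 0; such idempotents give a frame whose vertices are homogeneous. Homogeneous parts of the arrows
then have the form arrow plus a multiple of the opposite path of length three (for the loop: a polynomial
in the loop), and the multiples can be chosen so that the relations hold again.

Two standard gradings with the same degrees on different frames are isomorphic, and the degrees of
the arrows can be recovered from the grading: only the identity permutation of the vertices respects the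
arrows, and no two arrows have the same source and target.

For a standard grading, the graded projective covers of the simple modules are shifts of the left ideals
\<open>A e\<^sub>v\<close>. The sum of their shifts is free of rank one, and its graded endomorphism algebra is \<open>A\<close> with the
degree of each monomial \<open>b\<close> changed by \<open>D (source b) - D (target b)\<close>, where the integers \<open>D v\<close> are arbitrary
(\<open>shifted_endomorphism_algebra\<close>). This change preserves the degrees of closed paths, and the degree
functions modulo it correspond to the pairs (degree of the cycle \<open>b\<^sub>1 a\<^sub>1\<close>, degree of the loop \<open>c\<close>): the
relations fix the degree of \<open>a\<^sub>2 b\<^sub>2\<close> in terms of these two, and nothing else constrains them. Hence the
pairs of integers classify the gradings up to graded Morita equivalence (\<open>gradings_classified\<close>).

It remains to see that \<open>C\<^sub>r\<close>, defined by generators and relations, has a frame (\<open>frame_exists\<close>). Rewriting paths to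
monomials shows that the monomials span. They are independent because the elements of the path algebra
whose image under this rewriting is zero form an ideal that contains the relations.
\<close>

section \<open>The monomial basis of \<open>C\<^sub>r\<close>\<close>

text \<open>
The cyclic walk \<open>a\<^sub>1 a\<^sub>2 b\<^sub>2 b\<^sub>1\<close> has period four. \<open>Arc p l\<close> is its segment of length \<open>l\<close> that starts with
the arrow number \<open>p mod 4\<close>; \<open>vertex_at p\<close> is the vertex where that arrow starts. \<open>Socle v\<close> is the full turn at
\<open>v\<close>, and \<open>Socle 3\<close> is also the power \<open>c ^ r\<close> of the loop. \<open>Null\<close> stands for the zero of the algebra.
\<close>

datatype C_monomial = Vertex nat | Arc nat nat | Socle nat | Loop nat | Null

definition vertex_at :: "nat => nat" where
 "vertex_at p = (if p mod 4 = 0 then 1 else if p mod 4 = 2 then 3 else 2)"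

fun monomial_source :: "C_monomial => nat" where
 "monomial_source (Vertex v) = v"
| "monomial_source (Arc p l) = vertex_at p"
| "monomial_source (Socle v) = v"
| "monomial_source (Loop i) = 3"
| "monomial_source Null = 0"

fun monomial_target :: "C_monomial => nat" where
 "monomial_target (Vertex v) = v"
| "monomial_target (Arc p l) = vertex_at (p + l)"
| "monomial_target (Socle v) = v"
| "monomial_target (Loop i) = 3"
| "monomial_target Null = 0"

fun mm :: "nat => C_monomial => C_monomial => C_monomial" where
 "mm r (Vertex v) t = (if monomial_source t = v then t else Null)"
| "mm r s (Vertex v) = (if monomial_target s = v then s else Null)"
| "mm r (Arc p l) (Arc q m) =
   (if q = (p + l) mod 4 then
    if l + m < 4 then Arc p (l + m) else if l + m = 4 then Socle (vertex_at p) else Null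
   else Null)"
| "mm r (Loop i) (Loop j) =
   (if i + j < r then Loop (i + j) else if i + j = r then Socle 3 else Null)"
| "mm r _ _ = Null"

fun basis_monomial :: "nat => C_monomial => bool" where
 "basis_monomial r (Vertex v) \<longleftrightarrow> v \<in> {1, 2, 3}"
| "basis_monomial r (Arc p l) \<longleftrightarrow> p < 4 \<and> 1 \<le> l \<and> l \<le> 3"
| "basis_monomial r (Socle v) \<longleftrightarrow> v \<in> {1, 2, 3}"
| "basis_monomial r (Loop i) \<longleftrightarrow> 1 \<le> i \<and> i < r"
| "basis_monomial r Null \<longleftrightarrow> False"

definition monomials :: "nat => C_monomial set" where
 "monomials r = {b. basis_monomial r b}"

text \<open>
Multiplication does not lower the depth, so elements of positive depth are nilpotent. The value
\<open>r + 4\<close> makes the socle deeper than all segments and loop powers whose products reach it.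
\<close>

fun depth :: "nat => C_monomial => nat" where
 "depth r (Vertex v) = 0"
| "depth r (Arc p l) = l"
| "depth r (Socle v) = r + 4"
| "depth r (Loop i) = i"
| "depth r Null = 0"

lemma vertex_at_in: "vertex_at p \<in> {1, 2, 3}"
 by (simp add: vertex_at_def)

lemma vertex_at_mod [simp]: "vertex_at (p mod 4) = vertex_at p"
 by (simp add: vertex_at_def)

lemma vertex_at_mod_add [simp]: "vertex_at (p mod 4 + l) = vertex_at (p + l)"
 by (simp add: vertex_at_def mod_add_left_eq)

lemma vertex_at_add_four [simp]: "vertex_at (p + 4) = vertex_at p" "vertex_at (4 + p) = vertex_at p"
 by (simp_all add: vertex_at_def)

lemma vertex_at_small [simp]:
 "vertex_at 0 = 1" "vertex_at 1 = 2" "vertex_at (Suc 0) = 2" "vertex_at 2 = 3" "vertex_at 3 = 2"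
 by (simp_all add: vertex_at_def)

lemma finite_monomials [simp]: "finite (monomials r)"
proof (rule finite_subset)
 show "monomials r \<subseteq> Vertex ` {1, 2, 3} \<union> (\<lambda>(p, l). Arc p l) ` ({..<4} \<times> {..3})
   \<union> Socle ` {1, 2, 3} \<union> Loop ` {..<r}"
 proof
  fix b assume "b \<in> monomials r"
  then show "b \<in> Vertex ` {1, 2, 3} \<union> (\<lambda>(p, l). Arc p l) ` ({..<4} \<times> {..3})
   \<union> Socle ` {1, 2, 3} \<union> Loop ` {..<r}"
   by (cases b) (auto simp: monomials_def)
 qed
qed auto

lemma Null_notin_monomials [simp]: "Null \<notin> monomials r"
 by (simp add: monomials_def)

lemma Vertex_in_monomials [simp]: "Vertex v \<in> monomials r \<longleftrightarrow> v \<in> {1, 2, 3}"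
 by (simp add: monomials_def)

lemma Socle_in_monomials [simp]: "Socle v \<in> monomials r \<longleftrightarrow> v \<in> {1, 2, 3}"
 by (simp add: monomials_def)

lemma Arc_in_monomials [simp]: "Arc p l \<in> monomials r \<longleftrightarrow> p < 4 \<and> 1 \<le> l \<and> l \<le> 3"
 by (simp add: monomials_def)

lemma Loop_in_monomials [simp]: "Loop i \<in> monomials r \<longleftrightarrow> 1 \<le> i \<and> i < r"
 by (simp add: monomials_def)

lemma monomial_source_in: "b \<in> monomials r ==> monomial_source b \<in> {1, 2, 3}"
 using vertex_at_in by (cases b) auto

lemma monomial_target_in: "b \<in> monomials r ==> monomial_target b \<in> {1, 2, 3}"
 using vertex_at_in by (cases b) auto

lemma mm_Null [simp]: "mm r Null t = Null" "mm r s Null = Null"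
 by (cases t; simp) (cases s; simp)

lemma mm_closed:
 "[|s \<in> monomials r; t \<in> monomials r|] ==> mm r s t \<in> insert Null (monomials r)"
 using vertex_at_in by (cases s; cases t) auto

lemma mm_Vertex_right: "mm r s (Vertex v) = (if monomial_target s = v then s else Null)"
 by (cases s) auto

lemma mm_source_target:
 assumes "s \<in> monomials r" "t \<in> monomials r" "mm r s t \<noteq> Null"
 shows "monomial_source (mm r s t) = monomial_source s"
  and "monomial_target (mm r s t) = monomial_target t"
  and "monomial_target s = monomial_source t"
 using assms by (cases s; cases t; force split: if_splits simp: add.assoc)+

lemma depth_mm:
 assumes "mm r s t \<noteq> Null"
 shows "depth r s + depth r t \<le> depth r (mm r s t)"
 using assms by (cases s; cases t) (auto split: if_splits)

lemma depth_le: "b \<in> monomials r ==> depth r b \<le> r + 4"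
 by (cases b) auto

lemma depth_pos: "b \<in> monomials r ==> depth r b = 0 \<longleftrightarrow> (\<exists>v. b = Vertex v)"
 by (cases b) auto

lemma mm_eq_Vertex:
 assumes "s \<in> monomials r" "t \<in> monomials r"
 shows "mm r s t = Vertex v \<longleftrightarrow> s = Vertex v \<and> t = Vertex v"
 using assms by (cases s; cases t) auto

definition arrow_monomials :: "C_monomial set" where
 "arrow_monomials = {Arc 0 1, Arc 1 1, Arc 2 1, Arc 3 1, Loop 1}"

lemma arrow_in_monomials: "r \<ge> 2 ==> b \<in> arrow_monomials ==> b \<in> monomials r"
 by (auto simp: arrow_monomials_def)

lemma mm_eq_arrow:
 assumes "s \<in> monomials r" "t \<in> monomials r" "b \<in> arrow_monomials" "r \<ge> 2"
 shows "mm r s t = b \<longleftrightarrow>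
  s = Vertex (monomial_source b) \<and> t = b \<or> s = b \<and> t = Vertex (monomial_target b)"
proof -
 from assms(3) have "(\<exists>p<4. b = Arc p 1) \<or> b = Loop 1"
  by (auto simp: arrow_monomials_def)
 then show ?thesis
  using assms(1,2,4) by (cases s; cases t) (force split: if_splits)+
qed

lemma monomial_factorisation:
 assumes "b \<in> monomials r" "b \<notin> arrow_monomials" "\<And>v. b \<noteq> Vertex v" "r \<ge> 2"
 obtains s t where "s \<in> monomials r" "t \<in> monomials r" "depth r s > 0" "depth r t > 0"
  "mm r s t = b"
proof (cases b)
 case (Arc p l)
 with assms have p: "p = 0 \<or> p = 1 \<or> p = 2 \<or> p = 3" and l: "l = 2 \<or> l = 3"
  by (auto simp: arrow_monomials_def)
 show thesis
  by (rule that[of "Arc p 1" "Arc ((p + 1) mod 4) (l - 1)"]) (use Arc l p in auto)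
next
 case (Socle v)
 with assms have v: "v = 1 \<or> v = 2 \<or> v = 3" by auto
 show thesis
  by (rule that[of "Arc (v - 1) 1" "Arc v 3"]) (use Socle v in auto)
next
 case (Loop i)
 with assms have "i \<ge> 2" "i < r" by (auto simp: arrow_monomials_def)
 then show thesis
  by (intro that[of "Loop 1" "Loop (i - 1)"]) (use Loop in auto)
qed (use assms in auto)

definition degree_function :: "nat => (C_monomial => int) => bool" where
 "degree_function r d \<longleftrightarrow>
   (\<forall>s\<in>monomials r. \<forall>t\<in>monomials r. mm r s t \<noteq> Null \<longrightarrow> d (mm r s t) = d s + d t)"

lemma degree_functionD:
 "[|degree_function r d; s \<in> monomials r; t \<in> monomials r; mm r s t \<noteq> Null|]
  ==> d (mm r s t) = d s + d t"
 by (simp add: degree_function_def)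

lemma degree_Vertex: "degree_function r d ==> v \<in> {1, 2, 3} ==> d (Vertex v) = 0"
 using degree_functionD[of r d "Vertex v" "Vertex v"] by auto

text \<open>
The degrees obtained when the left ideal generated by the vertex \<open>v\<close> is shifted by \<open>D v\<close>.
\<close>

definition regrade :: "(nat => int) => (C_monomial => int) => C_monomial => int" where
 "regrade D d b = d b + D (monomial_source b) - D (monomial_target b)"

lemma degree_function_regrade:
 assumes "degree_function r d"
 shows "degree_function r (regrade D d)"
 using assms by (auto simp: degree_function_def regrade_def mm_source_target)

text \<open>Degree of the cycle at vertex 2 through vertex 1, and degree of the loop.\<close>

definition cycle_degrees :: "(C_monomial => int) => int \<times> int" where
 "cycle_degrees d = (d (Arc 3 2), d (Loop 1))"

lemma cycle_degrees_regrade [simp]: "cycle_degrees (regrade D d) = cycle_degrees d"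
 by (simp add: cycle_degrees_def regrade_def vertex_at_def)

lemma sum_lessThan_small:
 fixes f :: "nat => int"
 shows "(\<Sum>k<2. f k) = f 0 + f 1" "(\<Sum>k<3. f k) = f 0 + f 1 + f 2"
  "(\<Sum>k<4. f k) = f 0 + f 1 + f 2 + f 3"
 by (simp_all add: eval_nat_numeral)

lemma degree_Arc:
 assumes d: "degree_function r d" and "p < 4" "1 \<le> l" "l \<le> 3"
 shows "d (Arc p l) = (\<Sum>k<l. d (Arc ((p + k) mod 4) 1))"
 using assms(3,4)
proof (induction l rule: nat_induct_at_least)
 case base
 then show ?case using assms by simp
next
 case (Suc l)
 then show ?case
  using degree_functionD[OF d, of "Arc p l" "Arc ((p + l) mod 4) 1"] \<open>p < 4\<close> by simp
qed

lemma degree_Loop: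
 assumes d: "degree_function r d" and "1 \<le> i" "i < r"
 shows "d (Loop i) = int i * d (Loop 1)"
 using assms(2,3)
proof (induction i rule: nat_induct_at_least)
 case (Suc i)
 then show ?case
  using degree_functionD[OF d, of "Loop i" "Loop 1"] by (simp add: algebra_simps)
qed simp

lemma degree_Socle:
 assumes d: "degree_function r d" and v: "v \<in> {1, 2, 3}"
 shows "d (Socle v) = (\<Sum>k<4. d (Arc k 1))"
proof -
 have "d (Socle v) = d (Arc (v - 1) 1) + d (Arc v 3)"
  using degree_functionD[OF d, of "Arc (v - 1) 1" "Arc v 3"] v by auto
 then show ?thesis
  using v degree_Arc[OF d, of v 3] by (auto simp: sum_lessThan_small One_nat_def[symmetric] simp del: One_nat_def)
qed

lemma degree_Socle_Loop:
 assumes d: "degree_function r d" and "r \<ge> 2"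
 shows "d (Socle 3) = int r * d (Loop 1)"
 using degree_functionD[OF d, of "Loop 1" "Loop (r - 1)"] degree_Loop[OF d, of "r - 1"] assms(2)
 by (simp add: algebra_simps of_nat_diff)

lemma degree_function_eqI:
 assumes d: "degree_function r d" and d': "degree_function r d'" and "r \<ge> 2"
  and eq: "\<And>b. b \<in> arrow_monomials ==> d b = d' b" and b: "b \<in> monomials r"
 shows "d b = d' b"
proof -
 have arc: "d (Arc (p mod 4) 1) = d' (Arc (p mod 4) 1)" for p
 proof -
  have "p mod 4 < 4" by simp
  then have "p mod 4 = 0 \<or> p mod 4 = 1 \<or> p mod 4 = 2 \<or> p mod 4 = 3" by presburger
  then show ?thesis using eq by (auto simp: arrow_monomials_def)
 qed
 show ?thesis
 proof (cases b)
  case (Arc p l)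
  then show ?thesis using b degree_Arc[OF d, of p l] degree_Arc[OF d', of p l] arc by simp
 next
  case (Socle v)
  then show ?thesis
   using b degree_Socle[OF d, of v] degree_Socle[OF d', of v] arc[of 0] arc[of 1] arc[of 2] arc[of 3]
   by (simp add: sum_lessThan_small)
 next
  case (Loop i)
  then show ?thesis
   using b degree_Loop[OF d, of i] degree_Loop[OF d', of i] eq[of "Loop 1"]
   by (simp add: arrow_monomials_def)
 qed (use b degree_Vertex[OF d] degree_Vertex[OF d'] in auto)
qed

text \<open>
The arrows \<open>a\<^sub>1\<close> and \<open>a\<^sub>2\<close> form a spanning tree of the quiver without the loop, so \<open>D\<close> can be chosen to match the
degrees on them. Then \<open>b\<^sub>1\<close> matches because the cycle \<open>b\<^sub>1 a\<^sub>1\<close> does, and \<open>b\<^sub>2\<close> because the degree of the full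
turn is \<open>r\<close> times that of the loop.
\<close>

lemma regrade_exists:
 assumes d: "degree_function r d" and d': "degree_function r d'" and r: "r \<ge> 2"
  and eq: "cycle_degrees d = cycle_degrees d'"
 obtains D where "\<And>b. b \<in> monomials r ==> d' b = regrade D d b"
proof -
 define D :: "nat => int" where
  "D = (\<lambda>v. if v = 1 then 0 else if v = 2 then d (Arc 0 1) - d' (Arc 0 1)
    else d (Arc 0 1) - d' (Arc 0 1) + d (Arc 1 1) - d' (Arc 1 1))"
 have l: "d (Loop 1) = d' (Loop 1)" and a: "d (Arc 3 2) = d' (Arc 3 2)"
  using eq by (auto simp: cycle_degrees_def)
 have x: "d (Arc 3 2) = d (Arc 3 1) + d (Arc 0 1)" "d' (Arc 3 2) = d' (Arc 3 1) + d' (Arc 0 1)"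
  using degree_Arc[OF d, of 3 2] degree_Arc[OF d', of 3 2] by (auto simp: sum_lessThan_small)
 have s: "d (Socle 3) = d' (Socle 3)"
  using degree_Socle_Loop[OF d r] degree_Socle_Loop[OF d' r] l by simp
 have y: "d (Socle 3) = d (Arc 0 1) + d (Arc 1 1) + d (Arc 2 1) + d (Arc 3 1)"
   "d' (Socle 3) = d' (Arc 0 1) + d' (Arc 1 1) + d' (Arc 2 1) + d' (Arc 3 1)"
  using degree_Socle[OF d, of 3] degree_Socle[OF d', of 3] by (auto simp: sum_lessThan_small)
 have "d' b = regrade D d b" if "b \<in> monomials r" for b
 proof (rule degree_function_eqI[OF d' degree_function_regrade[OF d] r _ that])
  fix b assume "b \<in> arrow_monomials"
  then show "d' b = regrade D d b"
   unfolding arrow_monomials_def using l a x s y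
   by (auto simp: regrade_def D_def vertex_at_def)
 qed
 then show thesis by (rule that)
qed

text \<open>
All of the degree of the cycle through vertex 1 is put on \<open>a\<^sub>1\<close>. The arrow \<open>a\<^sub>2\<close> receives what is missing
from the degree \<open>r * y\<close> of \<open>c ^ r\<close>.
\<close>

definition degree_with :: "nat => int => int => C_monomial => int" where
 "degree_with r x y b =
  (let w = (\<lambda>p. if p mod 4 = 0 then x else if p mod 4 = 1 then int r * y - x else 0)
   in case b of Vertex v => 0 | Arc p l => (\<Sum>k<l. w (p + k)) | Socle v => int r * y
    | Loop i => int i * y | Null => 0)"

lemma degree_function_degree_with: "degree_function r (degree_with r x y)"
proof -
 define w :: "nat => int" where
  "w = (\<lambda>p. if p mod 4 = 0 then x else if p mod 4 = 1 then int r * y - x else 0)"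
 have wmod: "w (p mod 4 + k) = w (p + k)" for p k
  by (simp add: w_def mod_add_left_eq)
 have w4: "w p + w (p + 1) + w (p + 2) + w (p + 3) = int r * y" for p
 proof -
  have "w q + w (q + 1) + w (q + 2) + w (q + 3) = int r * y" if "q = p mod 4" for q
  proof -
   from that have "q = 0 \<or> q = 1 \<or> q = 2 \<or> q = 3" by presburger
   then show ?thesis by (elim disjE) (simp_all add: w_def)
  qed
  from this[OF refl] show ?thesis
   using wmod[of p 0] wmod[of p 1] wmod[of p 2] wmod[of p 3] by simp
 qed
 have split: "(\<Sum>k<l + m. w (p + k)) = (\<Sum>k<l. w (p + k)) + (\<Sum>k<m. w ((p + l) mod 4 + k))"
  for p l m
 proof -
  have "(\<Sum>k<l + m. w (p + k)) = (\<Sum>k<l. w (p + k)) + (\<Sum>k<m. w (p + (l + k)))"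
   by (induction m) (simp_all add: algebra_simps)
  then show ?thesis by (simp add: wmod add.assoc)
 qed
 have four: "(\<Sum>k<4. w (p + k)) = int r * y" for p
  using w4[of p] by (simp add: sum_lessThan_small algebra_simps)
 show ?thesis
  unfolding degree_function_def
 proof (intro ballI impI)
  fix s t assume st: "s \<in> monomials r" "t \<in> monomials r" and nz: "mm r s t \<noteq> Null"
  show "degree_with r x y (mm r s t) = degree_with r x y s + degree_with r x y t"
  proof (cases "\<exists>p l q m. s = Arc p l \<and> t = Arc q m")
   case True
   then obtain p l q m where "s = Arc p l" "t = Arc q m" by blast
   then show ?thesis
    using nz split[of p l m] four[of p]
    by (auto simp: degree_with_def w_def[symmetric] split: if_splits)
  next
   case False
   then show ?thesis
    using nz by (cases s; cases t)
     (auto simp: degree_with_def algebra_simps split: if_splits)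
  qed
 qed
qed

lemma cycle_degrees_degree_with: "cycle_degrees (degree_with r x y) = (x, y)"
 by (simp add: cycle_degrees_def degree_with_def sum_lessThan_small)

section \<open>Algebras with a monomial basis\<close>

lemma finsum_additive:
 assumes G: "abelian_monoid G" and H: "abelian_monoid H"
  and h: "h \<in> carrier G \<rightarrow> carrier H" "h \<zero>\<^bsub>G\<^esub> = \<zero>\<^bsub>H\<^esub>"
   "\<And>x y. [|x \<in> carrier G; y \<in> carrier G|] ==> h (x \<oplus>\<^bsub>G\<^esub> y) = h x \<oplus>\<^bsub>H\<^esub> h y"
  and z: "\<And>i. i \<in> I ==> z i \<in> carrier G"
 shows "h (\<Oplus>\<^bsub>G\<^esub>i\<in>I. z i) = (\<Oplus>\<^bsub>H\<^esub>i\<in>I. h (z i))"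
proof -
 interpret G: abelian_monoid G by fact
 interpret H: abelian_monoid H by fact
 show ?thesis
  using z
 proof (induction I rule: infinite_finite_induct)
  case (insert i I)
  have "(\<lambda>i. h (z i)) \<in> I \<rightarrow> carrier H" "z \<in> I \<rightarrow> carrier G" using insert.prems h by auto
  then show ?case using insert h by (simp add: G.finsum_insert H.finsum_insert Pi_iff)
 qed (use h in auto)
qed

locale kalgebra = K: field K + ring A
 for K :: "('k, 'x) ring_scheme" and A :: "('k, 'a, 'y) module_scheme" (structure) +
 assumes smult_closed [simp, intro]: "[|c \<in> carrier K; x \<in> carrier A|] ==> c \<odot> x \<in> carrier A"
  and smult_l_distr: "[|c \<in> carrier K; d \<in> carrier K; x \<in> carrier A|] ==>
   (c \<oplus>\<^bsub>K\<^esub> d) \<odot> x = c \<odot> x \<oplus> d \<odot> x"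
  and smult_r_distr: "[|c \<in> carrier K; x \<in> carrier A; y \<in> carrier A|] ==>
   c \<odot> (x \<oplus> y) = c \<odot> x \<oplus> c \<odot> y"
  and smult_assoc1: "[|c \<in> carrier K; d \<in> carrier K; x \<in> carrier A|] ==>
   (c \<otimes>\<^bsub>K\<^esub> d) \<odot> x = c \<odot> (d \<odot> x)"
  and smult_one [simp]: "x \<in> carrier A ==> \<one>\<^bsub>K\<^esub> \<odot> x = x"
  and smult_mult_left: "[|c \<in> carrier K; x \<in> carrier A; y \<in> carrier A|] ==>
   (c \<odot> x) \<otimes> y = c \<odot> (x \<otimes> y)"
  and smult_mult_right: "[|c \<in> carrier K; x \<in> carrier A; y \<in> carrier A|] ==>
   x \<otimes> (c \<odot> y) = c \<odot> (x \<otimes> y)"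
begin

abbreviation "K0 \<equiv> \<zero>\<^bsub>K\<^esub>"

abbreviation "K1 \<equiv> \<one>\<^bsub>K\<^esub>"

lemma module: "module K A"
 by (intro module.intro module_axioms.intro K.cring_axioms abelian_group_axioms)
  (simp_all add: smult_l_distr smult_r_distr smult_assoc1)

lemma vectorspace: "vectorspace K A"
 by (intro vectorspace.intro module K.field_axioms)

lemma smult_zero [simp]: "x \<in> carrier A ==> K0 \<odot> x = \<zero>" "c \<in> carrier K ==> c \<odot> \<zero> = \<zero>"
 using module.smult_l_null[OF module] module.smult_r_null[OF module] by auto

lemma finsum_smult:
 "[|c \<in> carrier K; z \<in> I \<rightarrow> carrier A|] ==> c \<odot> (\<Oplus>i\<in>I. z i) = (\<Oplus>i\<in>I. c \<odot> z i)"
 by (rule finsum_additive) (auto simp: smult_r_distr abelian_monoid_axioms)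

lemma finsum_mult_left:
 "[|x \<in> carrier A; z \<in> I \<rightarrow> carrier A|] ==> x \<otimes> (\<Oplus>i\<in>I. z i) = (\<Oplus>i\<in>I. x \<otimes> z i)"
 by (rule finsum_additive) (auto simp: r_distr abelian_monoid_axioms)

lemma finsum_mult_right:
 "[|x \<in> carrier A; z \<in> I \<rightarrow> carrier A|] ==> (\<Oplus>i\<in>I. z i) \<otimes> x = (\<Oplus>i\<in>I. z i \<otimes> x)"
 by (rule finsum_additive[where h = "\<lambda>y. y \<otimes> x"]) (auto simp: l_distr abelian_monoid_axioms)

end

locale C_type_algebra = kalgebra K A
 for K :: "('k, 'x) ring_scheme" and A :: "('k, 'a, 'y) module_scheme" (structure) +
 fixes r :: nat
 assumes r: "r \<ge> 2" and char_two: "K1 \<oplus>\<^bsub>K\<^esub> K1 = K0"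
begin

abbreviation "Mon \<equiv> monomials r"

lemma K_double [simp]: "c \<in> carrier K ==> c \<oplus>\<^bsub>K\<^esub> c = K0"
 using K.l_distr[of "K1" "K1" c] char_two by simp

lemma K_add_eq_zero: "[|c \<in> carrier K; d \<in> carrier K; c \<oplus>\<^bsub>K\<^esub> d = K0|] ==> c = d"
 by (metis K.add.inv_equality K.minus_equality K_double)

lemma A_double [simp]: "x \<in> carrier A ==> x \<oplus> x = \<zero>"
 using smult_l_distr[of "K1" "K1" x] char_two by simp

lemma A_add_eq_zero: "[|x \<in> carrier A; y \<in> carrier A; x \<oplus> y = \<zero>|] ==> x = y"
 by (metis add.inv_equality A_double)

lemma A_double_left [simp]: "[|x \<in> carrier A; y \<in> carrier A|] ==> x \<oplus> (x \<oplus> y) = y"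
 by (simp add: a_assoc[symmetric])

definition comb :: "(C_monomial => 'a) => (C_monomial => 'k) => 'a" where
 "comb Z f = (\<Oplus>b\<in>Mon. f b \<odot> Z b)"

text \<open>A basis of \<open>A\<close> which multiplies like the monomials.\<close>

definition frame :: "(C_monomial => 'a) => bool" where
 "frame Z \<longleftrightarrow> (\<forall>b\<in>Mon. Z b \<in> carrier A) \<and> Z Null = \<zero> \<and>
   (\<forall>s\<in>Mon. \<forall>t\<in>Mon. Z s \<otimes> Z t = Z (mm r s t)) \<and>
   Z (Vertex 1) \<oplus> Z (Vertex 2) \<oplus> Z (Vertex 3) = \<one> \<and>
   (\<forall>x\<in>carrier A. \<exists>!f. f \<in> (Mon \<rightarrow>\<^sub>E carrier K) \<and> comb Z f = x)"

definition coord :: "(C_monomial => 'a) => 'a => C_monomial => 'k" where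
 "coord Z x = (THE f. f \<in> (Mon \<rightarrow>\<^sub>E carrier K) \<and> comb Z f = x)"

lemma comb_closed:
 assumes "\<And>b. b \<in> Mon ==> Z b \<in> carrier A" "\<And>b. b \<in> Mon ==> f b \<in> carrier K"
 shows "comb Z f \<in> carrier A"
 unfolding comb_def using assms by (intro finsum_closed) auto

lemma comb_cong:
 assumes "\<And>b. b \<in> Mon ==> Z b = Z' b" "\<And>b. b \<in> Mon ==> f b = g b"
  "\<And>b. b \<in> Mon ==> Z b \<in> carrier A" "\<And>b. b \<in> Mon ==> f b \<in> carrier K"
 shows "comb Z f = comb Z' g"
 unfolding comb_def using assms by (intro finsum_cong') auto

lemma comb_restrict:
 assumes "\<And>b. b \<in> Mon ==> Z b \<in> carrier A" "\<And>b. b \<in> Mon ==> f b \<in> carrier K"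
 shows "comb Z (restrict f (Mon)) = comb Z f"
 using assms by (intro comb_cong) auto

text \<open>
Uniqueness of coordinates follows from independence because sums serve as differences in
characteristic 2.
\<close>

lemma frame_combI:
 assumes Z: "\<And>b. b \<in> Mon ==> Z b \<in> carrier A" "Z Null = \<zero>"
  "\<And>s t. [|s \<in> Mon; t \<in> Mon|] ==> Z s \<otimes> Z t = Z (mm r s t)"
  "Z (Vertex 1) \<oplus> Z (Vertex 2) \<oplus> Z (Vertex 3) = \<one>"
  and span: "\<And>x. x \<in> carrier A ==> \<exists>f\<in>Mon \<rightarrow> carrier K. comb Z f = x"
  and indep: "\<And>f b. [|f \<in> Mon \<rightarrow> carrier K; comb Z f = \<zero>; b \<in> Mon|] ==> f b = K0"
 shows "frame Z"
 unfolding frame_def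
proof (intro conjI ballI)
 fix x assume x: "x \<in> carrier A"
 then obtain f where f: "f \<in> Mon \<rightarrow> carrier K" "comb Z f = x" using span by blast
 show "\<exists>!f. f \<in> (Mon \<rightarrow>\<^sub>E carrier K) \<and> comb Z f = x"
 proof (rule ex1I)
  show "restrict f (Mon) \<in> (Mon \<rightarrow>\<^sub>E carrier K) \<and> comb Z (restrict f (Mon)) = x"
   using f Z(1) comb_restrict[of Z f] by auto
 next
  fix g assume g: "g \<in> (Mon \<rightarrow>\<^sub>E carrier K) \<and> comb Z g = x"
  let ?h = "\<lambda>b. f b \<oplus>\<^bsub>K\<^esub> g b"
  have "comb Z ?h = (\<Oplus>b\<in>Mon. f b \<odot> Z b \<oplus> g b \<odot> Z b)"
   unfolding comb_def using f g Z(1) by (intro finsum_cong') (auto simp: smult_l_distr Pi_iff PiE_iff)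
  also have "\<dots> = comb Z f \<oplus> comb Z g"
   unfolding comb_def using f g Z(1) by (intro finsum_addf) (auto simp: Pi_iff PiE_iff)
  also have "\<dots> = \<zero>" using f g x by simp
  finally have "comb Z ?h = \<zero>" .
  then have "?h b = K0" if "b \<in> Mon" for b
   using f g that by (intro indep) (auto simp: PiE_iff Pi_iff)
  moreover have "f b \<in> carrier K" "g b \<in> carrier K" if "b \<in> Mon" for b
   using f g that by (auto simp: PiE_iff Pi_iff)
  ultimately have "f b = g b" if "b \<in> Mon" for b
   using that K_add_eq_zero by blast
  then show "g = restrict f (Mon)"
   using g by (intro extensionalityI[of _ "Mon"]) (auto simp: PiE_iff)
 qed
qed (use Z in auto)

context
 fixes Z assumes Z: "frame Z"
begin

lemma frame_closed [simp]: "b \<in> Mon ==> Z b \<in> carrier A"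
 using Z by (simp add: frame_def)

lemma frame_Null [simp]: "Z Null = \<zero>"
 using Z by (simp add: frame_def)

lemma frame_closed' [simp]: "b \<in> insert Null (Mon) ==> Z b \<in> carrier A"
 by auto

lemma frame_mult: "[|s \<in> Mon; t \<in> Mon|] ==> Z s \<otimes> Z t = Z (mm r s t)"
 using Z by (simp add: frame_def)

lemma frame_one: "Z (Vertex 1) \<oplus> Z (Vertex 2) \<oplus> Z (Vertex 3) = \<one>"
 using Z by (simp add: frame_def)

lemma coord_spec:
 assumes "x \<in> carrier A"
 shows "coord Z x \<in> (Mon \<rightarrow>\<^sub>E carrier K)" "comb Z (coord Z x) = x"
proof -
 have "\<exists>!f. f \<in> (Mon \<rightarrow>\<^sub>E carrier K) \<and> comb Z f = x"
  using Z assms by (simp add: frame_def)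
 from theI'[OF this] show "coord Z x \<in> (Mon \<rightarrow>\<^sub>E carrier K)" "comb Z (coord Z x) = x"
  by (simp_all add: coord_def)
qed

lemma coord_closed [simp]: "[|x \<in> carrier A; b \<in> Mon|] ==> coord Z x b \<in> carrier K"
 using coord_spec(1) by (auto simp: PiE_iff)

lemma coord_comb:
 assumes f: "\<And>b. b \<in> Mon ==> f b \<in> carrier K" and b: "b \<in> Mon"
 shows "coord Z (comb Z f) b = f b"
proof -
 let ?x = "comb Z f"
 have x: "?x \<in> carrier A" using f by (intro comb_closed) auto
 then have ex: "\<exists>!f. f \<in> (Mon \<rightarrow>\<^sub>E carrier K) \<and> comb Z f = ?x"
  using Z by (simp add: frame_def)
 have "restrict f (Mon) \<in> (Mon \<rightarrow>\<^sub>E carrier K) \<and> comb Z (restrict f (Mon)) = ?x"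
  using f by (auto intro!: comb_restrict)
 then have "coord Z ?x = restrict f (Mon)"
  using ex coord_spec[OF x] by blast
 then show ?thesis using b by simp
qed

lemma coord_eqI:
 assumes "x \<in> carrier A" "y \<in> carrier A" "\<And>b. b \<in> Mon ==> coord Z x b = coord Z y b"
 shows "x = y"
proof -
 have "comb Z (coord Z x) = comb Z (coord Z y)" using assms by (intro comb_cong) auto
 then show ?thesis using assms coord_spec by simp
qed

lemma coord_add:
 assumes "x \<in> carrier A" "y \<in> carrier A" "b \<in> Mon"
 shows "coord Z (x \<oplus> y) b = coord Z x b \<oplus>\<^bsub>K\<^esub> coord Z y b"
proof -
 let ?h = "\<lambda>b. coord Z x b \<oplus>\<^bsub>K\<^esub> coord Z y b"
 have "comb Z ?h = (\<Oplus>b\<in>Mon. coord Z x b \<odot> Z b \<oplus> coord Z y b \<odot> Z b)"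
  unfolding comb_def using assms by (intro finsum_cong') (auto simp: smult_l_distr)
 also have "\<dots> = comb Z (coord Z x) \<oplus> comb Z (coord Z y)"
  unfolding comb_def using assms by (intro finsum_addf) auto
 also have "\<dots> = x \<oplus> y" using assms coord_spec by simp
 finally show ?thesis using coord_comb[of ?h b] assms by simp
qed

lemma coord_smult:
 assumes "c \<in> carrier K" "x \<in> carrier A" "b \<in> Mon"
 shows "coord Z (c \<odot> x) b = c \<otimes>\<^bsub>K\<^esub> coord Z x b"
proof -
 let ?h = "\<lambda>b. c \<otimes>\<^bsub>K\<^esub> coord Z x b"
 have "comb Z ?h = (\<Oplus>b\<in>Mon. c \<odot> (coord Z x b \<odot> Z b))"
  unfolding comb_def using assms by (intro finsum_cong') (auto simp: smult_assoc1)
 also have "\<dots> = c \<odot> comb Z (coord Z x)"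
  unfolding comb_def using assms by (intro finsum_smult[symmetric]) auto
 also have "\<dots> = c \<odot> x" using assms coord_spec by simp
 finally show ?thesis using coord_comb[of ?h b] assms by simp
qed

lemma coord_zero [simp]: "b \<in> Mon ==> coord Z \<zero> b = K0"
 using coord_smult[of "K0" "\<zero>" b] by simp

lemma coord_finsum:
 assumes "z \<in> I \<rightarrow> carrier A" "b \<in> Mon"
 shows "coord Z (\<Oplus>i\<in>I. z i) b = (\<Oplus>\<^bsub>K\<^esub>i\<in>I. coord Z (z i) b)"
 using assms
 by (intro finsum_additive[where h = "\<lambda>x. coord Z x b"])
  (auto simp: coord_add abelian_monoid_axioms K.abelian_monoid_axioms)

lemma coord_basis:
 assumes "m \<in> insert Null (Mon)" "b \<in> Mon"
 shows "coord Z (Z m) b = (if m = b then K1 else K0)"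
proof (cases "m = Null")
 case False
 then have m: "m \<in> Mon" using assms by simp
 let ?h = "\<lambda>b. if m = b then K1 else K0"
 have "comb Z ?h = (\<Oplus>b\<in>Mon. if m = b then Z b else \<zero>)"
  unfolding comb_def using assms by (intro finsum_cong') auto
 also have "\<dots> = Z m" using m by (intro finsum_singleton) auto
 finally show ?thesis using coord_comb[of ?h b] assms by simp
qed (use assms in auto)

lemma coord_mult_left:
 assumes s: "s \<in> Mon" and y: "y \<in> carrier A" and b: "b \<in> Mon"
 shows "coord Z (Z s \<otimes> y) b =
  (\<Oplus>\<^bsub>K\<^esub>t\<in>Mon. if mm r s t = b then coord Z y t else K0)"
proof -
 have "Z s \<otimes> y = Z s \<otimes> (\<Oplus>t\<in>Mon. coord Z y t \<odot> Z t)"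
  using coord_spec(2)[OF y] by (simp add: comb_def)
 also have "\<dots> = (\<Oplus>t\<in>Mon. Z s \<otimes> (coord Z y t \<odot> Z t))"
  using s y by (intro finsum_mult_left) auto
 also have "\<dots> = (\<Oplus>t\<in>Mon. coord Z y t \<odot> Z (mm r s t))"
  using s y mm_closed[OF s] by (intro finsum_cong') (auto simp: smult_mult_right frame_mult)
 finally have "coord Z (Z s \<otimes> y) b = coord Z (\<Oplus>t\<in>Mon. coord Z y t \<odot> Z (mm r s t)) b"
  by simp
 also have "\<dots> = (\<Oplus>\<^bsub>K\<^esub>t\<in>Mon. coord Z (coord Z y t \<odot> Z (mm r s t)) b)"
  using y b mm_closed[OF s] by (intro coord_finsum) auto
 also have "\<dots> = (\<Oplus>\<^bsub>K\<^esub>t\<in>Mon. if mm r s t = b then coord Z y t else K0)"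
  using y b mm_closed[OF s] by (intro K.finsum_cong') (auto simp: coord_smult coord_basis)
 finally show ?thesis .
qed

lemma coord_mult:
 assumes x: "x \<in> carrier A" and y: "y \<in> carrier A" and b: "b \<in> Mon"
 shows "coord Z (x \<otimes> y) b = (\<Oplus>\<^bsub>K\<^esub>s\<in>Mon. \<Oplus>\<^bsub>K\<^esub>t\<in>Mon.
  if mm r s t = b then coord Z x s \<otimes>\<^bsub>K\<^esub> coord Z y t else K0)"
proof -
 have "x \<otimes> y = (\<Oplus>s\<in>Mon. coord Z x s \<odot> Z s) \<otimes> y"
  using coord_spec(2)[OF x] by (simp add: comb_def)
 also have "\<dots> = (\<Oplus>s\<in>Mon. (coord Z x s \<odot> Z s) \<otimes> y)"
  using x y by (intro finsum_mult_right) auto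
 also have "\<dots> = (\<Oplus>s\<in>Mon. coord Z x s \<odot> (Z s \<otimes> y))"
  using x y by (intro finsum_cong') (auto simp: smult_mult_left)
 finally have "coord Z (x \<otimes> y) b = coord Z (\<Oplus>s\<in>Mon. coord Z x s \<odot> (Z s \<otimes> y)) b"
  by simp
 also have "\<dots> = (\<Oplus>\<^bsub>K\<^esub>s\<in>Mon. coord Z (coord Z x s \<odot> (Z s \<otimes> y)) b)"
  using x y b by (intro coord_finsum) auto
 also have "\<dots> = (\<Oplus>\<^bsub>K\<^esub>s\<in>Mon. coord Z x s \<otimes>\<^bsub>K\<^esub>
   (\<Oplus>\<^bsub>K\<^esub>t\<in>Mon. if mm r s t = b then coord Z y t else K0))"
  using x y b
  by (intro K.finsum_cong') (auto simp: coord_smult coord_mult_left intro!: K.m_closed K.finsum_closed)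
 also have "\<dots> = (\<Oplus>\<^bsub>K\<^esub>s\<in>Mon. \<Oplus>\<^bsub>K\<^esub>t\<in>Mon.
  if mm r s t = b then coord Z x s \<otimes>\<^bsub>K\<^esub> coord Z y t else K0)"
  using x y b
  by (intro K.finsum_cong' refl)
   (auto simp: K.finsum_rdistr intro!: K.finsum_cong' K.finsum_closed)
 finally show ?thesis .
qed

lemma coord_mult_support:
 assumes x: "x \<in> carrier A" and y: "y \<in> carrier A" and b: "b \<in> Mon"
  and nz: "coord Z (x \<otimes> y) b \<noteq> K0"
 obtains s t where "s \<in> Mon" "t \<in> Mon" "mm r s t = b"
  "coord Z x s \<noteq> K0" "coord Z y t \<noteq> K0"
proof -
 have "\<exists>s\<in>Mon. \<exists>t\<in>Mon. mm r s t = b \<and> coord Z x s \<noteq> K0 \<and> coord Z y t \<noteq> K0"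
 proof (rule ccontr)
  assume neg: "\<not> ?thesis"
  have "(if mm r s t = b then coord Z x s \<otimes>\<^bsub>K\<^esub> coord Z y t else K0) = K0"
   if st: "s \<in> Mon" "t \<in> Mon" for s t
  proof (cases "mm r s t = b")
   case True
   then have "coord Z x s = K0 \<or> coord Z y t = K0" using neg st by blast
   then show ?thesis using x y st by auto
  qed simp
  then have "coord Z (x \<otimes> y) b = K0"
   unfolding coord_mult[OF x y b] by (intro K.add.finprod_one_eqI)
  with nz show False by simp
 qed
 with that show thesis by blast
qed

lemma coord_mult_single:
 assumes x: "x \<in> carrier A" and y: "y \<in> carrier A"
  and st: "s \<in> Mon" "t \<in> Mon" "mm r s t \<in> Mon"
  and single: "\<And>s' t'. [|s' \<in> Mon; t' \<in> Mon; mm r s' t' = mm r s t;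
    coord Z x s' \<noteq> K0; coord Z y t' \<noteq> K0|] ==> s' = s \<and> t' = t"
 shows "coord Z (x \<otimes> y) (mm r s t) = coord Z x s \<otimes>\<^bsub>K\<^esub> coord Z y t"
proof -
 have inner: "(\<Oplus>\<^bsub>K\<^esub>t'\<in>Mon. if mm r s' t' = mm r s t
   then coord Z x s' \<otimes>\<^bsub>K\<^esub> coord Z y t' else K0) =
   (if s = s' then coord Z x s' \<otimes>\<^bsub>K\<^esub> coord Z y t else K0)"
  if s': "s' \<in> Mon" for s'
 proof -
  have "(\<Oplus>\<^bsub>K\<^esub>t'\<in>Mon. if mm r s' t' = mm r s t
    then coord Z x s' \<otimes>\<^bsub>K\<^esub> coord Z y t' else K0) =
   (\<Oplus>\<^bsub>K\<^esub>t'\<in>Mon. if t = t'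
    then (if s = s' then coord Z x s' \<otimes>\<^bsub>K\<^esub> coord Z y t' else K0) else K0)"
  proof (intro K.finsum_cong' refl)
   fix t' assume t': "t' \<in> Mon"
   have zero: "coord Z x s' \<otimes>\<^bsub>K\<^esub> coord Z y t' = K0"
    if "mm r s' t' = mm r s t" "\<not> (s' = s \<and> t' = t)"
    using single[OF s' t'] that x y s' t' by fastforce
   show "(if mm r s' t' = mm r s t then coord Z x s' \<otimes>\<^bsub>K\<^esub> coord Z y t' else K0) =
    (if t = t' then (if s = s' then coord Z x s' \<otimes>\<^bsub>K\<^esub> coord Z y t' else K0) else K0)"
   proof (cases "s' = s \<and> t' = t")
    case False
    then have "\<not> (t = t' \<and> s = s')" by blast
    with zero False show ?thesis by (simp only: if_cancel split: if_split) blast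
   qed simp
  qed (use x y s' in auto)
  also have "\<dots> = (if s = s' then coord Z x s' \<otimes>\<^bsub>K\<^esub> coord Z y t else K0)"
   by (rule K.finsum_singleton) (use x y s' st in auto)
  finally show ?thesis .
 qed
 have "coord Z (x \<otimes> y) (mm r s t) =
   (\<Oplus>\<^bsub>K\<^esub>s'\<in>Mon. if s = s' then coord Z x s' \<otimes>\<^bsub>K\<^esub> coord Z y t else K0)"
  unfolding coord_mult[OF x y st(3)] using x y st inner by (intro K.finsum_cong') auto
 also have "\<dots> = coord Z x s \<otimes>\<^bsub>K\<^esub> coord Z y t"
  by (rule K.finsum_singleton) (use x y st in auto)
 finally show ?thesis .
qed

lemma coord_mult_Vertex:
 assumes x: "x \<in> carrier A" and y: "y \<in> carrier A" and v: "v \<in> {1, 2, 3}"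
 shows "coord Z (x \<otimes> y) (Vertex v) = coord Z x (Vertex v) \<otimes>\<^bsub>K\<^esub> coord Z y (Vertex v)"
 using coord_mult_single[OF x y, of "Vertex v" "Vertex v"] v mm_eq_Vertex by simp

lemma coord_Vertex_mult:
 assumes x: "x \<in> carrier A" and v: "v \<in> {1, 2, 3}" and b: "b \<in> Mon"
 shows "coord Z (Z (Vertex v) \<otimes> x) b = (if monomial_source b = v then coord Z x b else K0)"
proof -
 have "coord Z (Z (Vertex v) \<otimes> x) b = (\<Oplus>\<^bsub>K\<^esub>t\<in>Mon.
   if b = t then (if monomial_source t = v then coord Z x t else K0) else K0)"
  unfolding coord_mult_left[OF _ x b, of "Vertex v", simplified Vertex_in_monomials, OF v]
  using x b by (intro K.finsum_cong') auto
 also have "\<dots> = (if monomial_source b = v then coord Z x b else K0)"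
  by (rule K.finsum_singleton) (use x b in auto)
 finally show ?thesis .
qed

lemma coord_mult_Vertex_right:
 assumes x: "x \<in> carrier A" and v: "v \<in> {1, 2, 3}" and b: "b \<in> Mon"
 shows "coord Z (x \<otimes> Z (Vertex v)) b = (if monomial_target b = v then coord Z x b else K0)"
proof (cases "monomial_target b = v")
 case True
 have "coord Z (x \<otimes> Z (Vertex v)) (mm r b (Vertex v)) = coord Z x b \<otimes>\<^bsub>K\<^esub> coord Z (Z (Vertex v)) (Vertex v)"
  by (rule coord_mult_single)
   (use x v b True in \<open>auto simp: mm_Vertex_right coord_basis split: if_splits\<close>)
 then show ?thesis using True x b v by (simp add: mm_Vertex_right coord_basis)
next
 case False
 have "coord Z (x \<otimes> Z (Vertex v)) b = K0"
 proof (rule ccontr)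
  assume "coord Z (x \<otimes> Z (Vertex v)) b \<noteq> K0"
  then show False
   by (rule coord_mult_support[rotated 3])
    (use False v x b in \<open>auto simp: coord_basis mm_Vertex_right split: if_splits\<close>)
 qed
 with False show ?thesis by simp
qed

lemma coord_one_Vertex [simp]: "v \<in> {1, 2, 3} ==> coord Z \<one> (Vertex v) = K1"
 unfolding frame_one[symmetric] by (auto simp: coord_add coord_basis)

lemma coord_mult_arrow:
 assumes x: "x \<in> carrier A" and y: "y \<in> carrier A" and b: "b \<in> arrow_monomials"
  and x0: "\<And>v. v \<in> {1, 2, 3} ==> coord Z x (Vertex v) = K0"
  and y0: "\<And>v. v \<in> {1, 2, 3} ==> coord Z y (Vertex v) = K0"
 shows "coord Z (x \<otimes> y) b = K0"
proof (rule ccontr)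
 note bm = arrow_in_monomials[OF r b]
 assume "coord Z (x \<otimes> y) b \<noteq> K0"
 then show False
  by (rule coord_mult_support[OF x y bm])
   (use x0[OF monomial_source_in[OF bm]] y0[OF monomial_target_in[OF bm]] mm_eq_arrow[OF _ _ b r] in auto)
qed

end

end

section \<open>Generators and relations\<close>

locale C_generators = C_type_algebra K A r
 for K :: "('k, 'x) ring_scheme" and A :: "('k, 'a, 'y) module_scheme" (structure) and r :: nat +
 fixes e :: "nat => 'a" and g :: "nat => 'a" and c :: 'a
 assumes e_closed: "v \<in> {1, 2, 3} ==> e v \<in> carrier A"
  and e_mult: "[|v \<in> {1, 2, 3}; w \<in> {1, 2, 3}|] ==> e v \<otimes> e w = (if v = w then e v else \<zero>)"
  and g_closed: "p < 4 ==> g p \<in> carrier A"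
  and g_source: "p < 4 ==> e (vertex_at p) \<otimes> g p = g p"
  and g_target: "p < 4 ==> g p \<otimes> e (vertex_at (p + 1)) = g p"
  and c_closed: "c \<in> carrier A"
  and c_source: "e 3 \<otimes> c = c"
  and c_target: "c \<otimes> e 3 = c"
  and rel_a1b1: "g 0 \<otimes> g 3 = \<zero>"
  and rel_b2a2: "g 2 \<otimes> g 1 = \<zero>"
  and rel_a2c: "g 1 \<otimes> c = \<zero>"
  and rel_cb2: "c \<otimes> g 2 = \<zero>"
  and rel_loop: "c [^] r = g 2 \<otimes> (g 3 \<otimes> (g 0 \<otimes> g 1))"
  and rel_cycle: "g 1 \<otimes> (g 2 \<otimes> (g 3 \<otimes> g 0)) = g 3 \<otimes> (g 0 \<otimes> (g 1 \<otimes> g 2))"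
begin

fun cycle_path :: "nat => nat => 'a" where
 "cycle_path p 0 = e (vertex_at p)"
| "cycle_path p (Suc l) = g (p mod 4) \<otimes> cycle_path (Suc p) l"

definition generated :: "C_monomial => 'a" where
 "generated b = (case b of Vertex v => e v | Arc p l => cycle_path p l
   | Socle v => cycle_path (v - 1) 4 | Loop i => c [^] i | Null => \<zero>)"

lemma e_vertex_closed [simp]: "e (vertex_at p) \<in> carrier A"
 using e_closed vertex_at_in by blast

lemma g_mod_closed [simp]: "g (p mod 4) \<in> carrier A"
 by (simp add: g_closed)

lemma cycle_path_closed [simp]: "cycle_path p l \<in> carrier A"
 by (induction l arbitrary: p) auto

lemma cycle_path_mod: "cycle_path (p mod 4) l = cycle_path p l"
proof (induction l arbitrary: p)
 case (Suc l)
 have "cycle_path (Suc (p mod 4)) l = cycle_path (Suc p) l"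
  using Suc[of "Suc (p mod 4)"] Suc[of "Suc p"] by (simp add: mod_Suc_eq)
 then show ?case by simp
qed simp

lemma cycle_path_source: "e (vertex_at p) \<otimes> cycle_path p l = cycle_path p l"
proof (cases l)
 case 0
 then show ?thesis using e_mult[OF vertex_at_in vertex_at_in, of p p] by simp
next
 case (Suc l)
 then show ?thesis using g_source[of "p mod 4"] by (simp add: m_assoc[symmetric])
qed

lemma cycle_path_add: "cycle_path p l \<otimes> cycle_path (p + l) m = cycle_path p (l + m)"
 by (induction l arbitrary: p) (simp_all add: cycle_path_source m_assoc, metis add_Suc)

lemma cycle_path_target: "cycle_path p l \<otimes> e (vertex_at (p + l)) = cycle_path p l"
 using cycle_path_add[of p l 0] by simp

lemma cycle_path_one: "cycle_path p 1 = g (p mod 4)"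
 using g_target[of "p mod 4"] vertex_at_mod_add[of p 1] by simp

lemma g_mult_zero: "[|p < 4; q < 4; q \<noteq> (p + 1) mod 4|] ==> g p \<otimes> g q = \<zero>"
proof (cases "vertex_at (p + 1) = vertex_at q")
 case False
 assume p: "p < 4" and q: "q < 4"
 have "g p \<otimes> g q = (g p \<otimes> e (vertex_at (p + 1))) \<otimes> (e (vertex_at q) \<otimes> g q)"
  using g_source g_target p q by simp
 also have "\<dots> = g p \<otimes> ((e (vertex_at (p + 1)) \<otimes> e (vertex_at q)) \<otimes> g q)"
  using p q g_closed by (simp add: m_assoc)
 also have "\<dots> = \<zero>"
  using False p q g_closed e_mult[OF vertex_at_in vertex_at_in, of "p + 1" q] by simp
 finally show ?thesis .
next
 case True
 assume pq: "p < 4" "q < 4" "q \<noteq> (p + 1) mod 4"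
 have "p = 0 \<or> p = 1 \<or> p = 2 \<or> p = 3" "q = 0 \<or> q = 1 \<or> q = 2 \<or> q = 3"
  using pq by linarith+
 with True pq(3) have "p = 0 \<and> q = 3 \<or> p = 2 \<and> q = 1"
  by (auto simp: vertex_at_def)
 then show ?thesis using rel_a1b1 rel_b2a2 by auto
qed

lemma g_c_zero: "p < 4 ==> g p \<otimes> c = \<zero>"
proof (cases "p = 1")
 case False
 assume p: "p < 4"
 have "g p \<otimes> c = (g p \<otimes> e (vertex_at (p + 1))) \<otimes> (e 3 \<otimes> c)"
  using g_target c_source p by simp
 also have "\<dots> = g p \<otimes> ((e (vertex_at (p + 1)) \<otimes> e 3) \<otimes> c)"
  using p g_closed c_closed e_closed[of 3] by (simp add: m_assoc)
 also have "vertex_at (p + 1) \<noteq> 3"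
 proof -
  have "p = 0 \<or> p = 2 \<or> p = 3" using p False by linarith
  then show ?thesis by (auto simp: vertex_at_def)
 qed
 then have "g p \<otimes> ((e (vertex_at (p + 1)) \<otimes> e 3) \<otimes> c) = \<zero>"
  using p g_closed c_closed e_mult[OF vertex_at_in, of 3 "p + 1"] by simp
 finally show ?thesis .
qed (use rel_a2c in auto)

lemma c_g_zero: "p < 4 ==> c \<otimes> g p = \<zero>"
proof (cases "p = 2")
 case False
 assume p: "p < 4"
 have "c \<otimes> g p = (c \<otimes> e 3) \<otimes> (e (vertex_at p) \<otimes> g p)"
  using g_source c_target p by simp
 also have "\<dots> = c \<otimes> ((e 3 \<otimes> e (vertex_at p)) \<otimes> g p)"
  using p g_closed c_closed e_closed[of 3] by (simp add: m_assoc)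
 also have "vertex_at p \<noteq> 3"
 proof -
  have "p = 0 \<or> p = 1 \<or> p = 3" using p False by linarith
  then show ?thesis by (auto simp: vertex_at_def)
 qed
 then have "c \<otimes> ((e 3 \<otimes> e (vertex_at p)) \<otimes> g p) = \<zero>"
  using p g_closed c_closed e_mult[OF _ vertex_at_in, of 3 p] by simp
 finally show ?thesis .
qed (use rel_cb2 in auto)

lemma cycle_path_last: "cycle_path p (Suc l) = cycle_path p l \<otimes> g ((p + l) mod 4)"
 using cycle_path_add[of p l 1] cycle_path_one[of "p + l"] by simp

lemma cycle_path_expand:
 "cycle_path p 4 =
  g (p mod 4) \<otimes> (g ((p + 1) mod 4) \<otimes> (g ((p + 2) mod 4) \<otimes> g ((p + 3) mod 4)))"
proof -
 have four: "4 = Suc (Suc (Suc 1))" by simp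
 show ?thesis
  unfolding four cycle_path.simps cycle_path_one by (simp add: add.commute)
qed

lemma cycle_path_four: "cycle_path 1 4 = cycle_path 3 4" "cycle_path 2 4 = c [^] r"
 unfolding cycle_path_expand rel_loop using rel_cycle by (simp_all del: One_nat_def)

lemma cycle_path_nonadjacent:
 assumes "(p + l) mod 4 \<noteq> q mod 4" "l \<ge> 1" "m \<ge> 1"
 shows "cycle_path p l \<otimes> cycle_path q m = \<zero>"
proof -
 obtain l' m' where lm: "l = Suc l'" "m = Suc m'" using assms by (metis Suc_le_D One_nat_def)
 have "cycle_path p l \<otimes> cycle_path q m =
   cycle_path p l' \<otimes> ((g ((p + l') mod 4) \<otimes> g (q mod 4)) \<otimes> cycle_path (Suc q) m')"
  unfolding lm(1) cycle_path_last[of p] unfolding lm(2) cycle_path.simps by (simp add: m_assoc)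
 moreover have "g ((p + l') mod 4) \<otimes> g (q mod 4) = \<zero>"
  using assms lm by (intro g_mult_zero) (auto simp: mod_Suc_eq)
 ultimately show ?thesis by simp
qed

lemma cycle_path_five: "cycle_path p 5 = \<zero>"
proof -
 have "cycle_path q 5 = \<zero>" if "q < 4" for q
 proof -
  from that consider "q = 0" | "q = 1" | "q = 2" | "q = 3" by linarith
  then show ?thesis
  proof cases
   case 1
   have "cycle_path 0 5 = cycle_path 0 1 \<otimes> cycle_path 1 4"
    using cycle_path_add[of 0 1 4] by (simp del: One_nat_def cycle_path.simps)
   then show ?thesis using 1 cycle_path_nonadjacent[of 0 1 3 4] cycle_path_four(1)
    by (simp del: One_nat_def cycle_path.simps)
  next
   case 2
   have "cycle_path 1 5 = cycle_path 1 4 \<otimes> cycle_path 5 1"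
    using cycle_path_add[of 1 4 1] by (simp del: One_nat_def cycle_path.simps)
   then show ?thesis using 2 cycle_path_nonadjacent[of 3 4 5 1] cycle_path_four(1)
    by (simp del: One_nat_def cycle_path.simps)
  next
   case 3
   have "cycle_path 2 5 = cycle_path 2 4 \<otimes> cycle_path 6 1"
    using cycle_path_add[of 2 4 1] by (simp del: One_nat_def cycle_path.simps)
   moreover have "cycle_path 6 1 = g 2" using cycle_path_one[of 6] by (simp del: One_nat_def cycle_path.simps)
   moreover obtain r' where "r = Suc r'" using r by (cases r) auto
   ultimately have "cycle_path 2 5 = c [^] r' \<otimes> (c \<otimes> g 2)"
    using c_closed g_closed[of 2] by (simp add: cycle_path_four(2) m_assoc del: One_nat_def cycle_path.simps)
   then show ?thesis using 3 c_closed rel_cb2 by simp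
  next
   case 4
   have "cycle_path 3 5 = cycle_path 3 4 \<otimes> cycle_path 7 1"
    using cycle_path_add[of 3 4 1] by (simp del: One_nat_def cycle_path.simps)
   then show ?thesis
    using 4 cycle_path_nonadjacent[of 1 4 7 1] cycle_path_four(1)
    by (simp del: One_nat_def cycle_path.simps)
  qed
 qed
 from this[of "p mod 4"] show ?thesis by (simp add: cycle_path_mod)
qed

lemma cycle_path_mult:
 assumes "l \<ge> 1" "m \<ge> 1"
 shows "cycle_path p l \<otimes> cycle_path q m =
  (if q mod 4 = (p + l) mod 4 \<and> l + m \<le> 4 then cycle_path p (l + m) else \<zero>)"
proof (cases "q mod 4 = (p + l) mod 4")
 case True
 then have "cycle_path q m = cycle_path (p + l) m" by (metis cycle_path_mod)
 then have prod: "cycle_path p l \<otimes> cycle_path q m = cycle_path p (l + m)"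
  using cycle_path_add by simp
 have "cycle_path p (l + m) = \<zero>" if "l + m > 4"
  using cycle_path_add[of p 5 "l + m - 5"] that by (simp add: cycle_path_five)
 with prod True show ?thesis by auto
qed (use assms cycle_path_nonadjacent in auto)

lemma cycle_path_c: "l \<ge> 1 ==> cycle_path p l \<otimes> c = \<zero>"
 using c_closed by (cases l) (simp_all add: cycle_path_last m_assoc g_c_zero del: cycle_path.simps(2))

lemma c_cycle_path: "l \<ge> 1 ==> c \<otimes> cycle_path p l = \<zero>"
 using c_closed by (cases l) (simp_all add: m_assoc[symmetric] c_g_zero)

lemma c_power_left: "(i :: nat) \<ge> 1 ==> c [^] i = c \<otimes> c [^] (i - 1)"
 using c_closed nat_pow_mult[of c 1 "i - 1"] by simp

lemma cycle_path_c_power: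
 assumes "l \<ge> 1" "(i :: nat) \<ge> 1"
 shows "cycle_path p l \<otimes> c [^] i = \<zero>"
proof -
 have "cycle_path p l \<otimes> c [^] i = (cycle_path p l \<otimes> c) \<otimes> c [^] (i - 1)"
  using c_power_left[OF assms(2)] c_closed by (simp add: m_assoc)
 then show ?thesis using cycle_path_c[OF assms(1)] c_closed by simp
qed

lemma c_power_cycle_path: "[|l \<ge> 1; (i :: nat) \<ge> 1|] ==> c [^] i \<otimes> cycle_path p l = \<zero>"
 using c_closed c_cycle_path[of l p] by (cases i) (simp_all add: m_assoc)

lemma c_power_source:
 assumes "(i :: nat) \<ge> 1"
 shows "e 3 \<otimes> c [^] i = c [^] i"
proof -
 have "e 3 \<otimes> c [^] i = (e 3 \<otimes> c) \<otimes> c [^] (i - 1)"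
  using c_power_left[OF assms] c_closed e_closed[of 3] by (simp add: m_assoc)
 then show ?thesis using c_source c_power_left[OF assms] by simp
qed

lemma c_power_target: "(i :: nat) \<ge> 1 ==> c [^] i \<otimes> e 3 = c [^] i"
 using c_closed c_target e_closed[of 3] by (cases i) (simp_all add: m_assoc)

lemma generated_closed [simp]: "b \<in> Mon ==> generated b \<in> carrier A"
 using c_closed e_closed by (cases b) (auto simp: generated_def)

lemma vertex_at_pred: "v \<in> {1, 2, 3} ==> vertex_at (v - 1) = v"
 by (auto simp: vertex_at_def)

lemma generated_source:
 "b \<in> Mon ==> e (monomial_source b) \<otimes> generated b = generated b"
proof (cases b)
 case (Socle v)
 assume "b \<in> Mon"
 then have v: "v \<in> {1, 2, 3}" using Socle by simp
 then show ?thesis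
  using cycle_path_source[of "v - 1" 4] vertex_at_pred[OF v] Socle
  by (simp add: generated_def del: cycle_path.simps)
qed (use cycle_path_source c_power_source e_mult in \<open>auto simp: generated_def\<close>)

lemma generated_target:
 "b \<in> Mon ==> generated b \<otimes> e (monomial_target b) = generated b"
proof (cases b)
 case (Socle v)
 assume "b \<in> Mon"
 then have v: "v \<in> {1, 2, 3}" using Socle by simp
 have "vertex_at (v - 1 + 4) = v" using vertex_at_pred[OF v] by simp
 then show ?thesis using cycle_path_target[of "v - 1" 4] Socle by (simp add: generated_def del: cycle_path.simps)
qed (use cycle_path_target c_power_target e_mult in \<open>auto simp: generated_def\<close>)

lemma generated_Socle: "p < 4 ==> generated (Socle (vertex_at p)) = cycle_path p 4"
proof -
 assume "p < 4"
 then have "p = 0 \<or> p = 1 \<or> p = 2 \<or> p = 3" by linarith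
 then show ?thesis
  by (elim disjE) (simp_all add: generated_def cycle_path_four(1)[unfolded One_nat_def] del: cycle_path.simps)
qed

text \<open>
The four monomial relations and the two binomial ones suffice for the whole table: they make the
segments of length five vanish and let the loop annihilate every segment.
\<close>

theorem generated_mult:
 assumes s: "s \<in> Mon" and t: "t \<in> Mon"
 shows "generated s \<otimes> generated t = generated (mm r s t)"
proof -
 have vl: "e v \<otimes> generated t = generated (mm r (Vertex v) t)" if v: "v \<in> {1, 2, 3}" for v
 proof -
  have "e v \<otimes> generated t = (e v \<otimes> e (monomial_source t)) \<otimes> generated t"
   using v t generated_source[OF t] e_closed monomial_source_in[OF t] by (simp add: m_assoc)
  also have "\<dots> = generated (mm r (Vertex v) t)"
   using generated_source[OF t] e_mult[OF v monomial_source_in[OF t]] t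
   by (cases "monomial_source t = v") (simp_all add: generated_def[of Null])
  finally show ?thesis .
 qed
 have vr: "generated s \<otimes> e v = generated (mm r s (Vertex v))" if v: "v \<in> {1, 2, 3}" for v
 proof -
  have "generated s \<otimes> e v = generated s \<otimes> (e (monomial_target s) \<otimes> e v)"
   using m_assoc[OF generated_closed[OF s] e_closed[OF monomial_target_in[OF s]] e_closed[OF v]]
    generated_target[OF s] by simp
  also have "\<dots> = generated (mm r s (Vertex v))"
   using generated_target[OF s] e_mult[OF monomial_target_in[OF s] v] s
   by (cases "monomial_target s = v") (simp_all add: generated_def[of Null] mm_Vertex_right)
  finally show ?thesis .
 qed
 show ?thesis
 proof (cases "\<exists>v. s = Vertex v \<or> t = Vertex v")
  case True
  then obtain v where v: "s = Vertex v \<or> t = Vertex v" by blast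
  have ev: "generated (Vertex v) = e v" by (simp add: generated_def)
  from v show ?thesis
  proof
   assume sv: "s = Vertex v"
   then have "v \<in> {1, 2, 3}" using s by simp
   from vl[OF this] show ?thesis using sv ev by simp
  next
   assume tv: "t = Vertex v"
   then have "v \<in> {1, 2, 3}" using t by simp
   from vr[OF this] show ?thesis using tv ev by simp
  qed
 next
  case nv: False
  show ?thesis
  proof (cases s)
   case s': (Arc p l)
   then have pl: "p < 4" "1 \<le> l" "l \<le> 3" using s by auto
   show ?thesis
   proof (cases t)
    case t': (Arc q m)
    then have qm: "q < 4" "1 \<le> m" "m \<le> 3" using t by auto
    have "generated s \<otimes> generated t =
     (if q mod 4 = (p + l) mod 4 \<and> l + m \<le> 4 then cycle_path p (l + m) else \<zero>)"
     using s' t' pl qm by (simp only: generated_def C_monomial.simps cycle_path_mult)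
    also have "\<dots> = generated (mm r s t)"
    proof (cases "q = (p + l) mod 4")
     case True
     then show ?thesis
      unfolding s' t' using generated_Socle[OF pl(1)]
      by (cases "l + m < 4"; cases "l + m = 4")
       (simp_all add: generated_def[of Null] generated_def[of "Arc _ _"] del: cycle_path.simps)
    next
     case False
     then have "q mod 4 \<noteq> (p + l) mod 4" using qm(1) by simp
     with False show ?thesis unfolding s' t' by (simp add: generated_def[of Null])
    qed
    finally show ?thesis .
   next
    case t': (Socle v)
    then show ?thesis using s' pl
     by (simp only: generated_def C_monomial.simps cycle_path_mult mm.simps) simp
   next
    case t': (Loop i)
    then show ?thesis using s' pl t by (simp add: generated_def cycle_path_c_power)
   qed (use nv t in auto)
  next
   case s': (Socle v)
   show ?thesis
   proof (cases t)
    case t': (Arc q m)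
    then show ?thesis using s' t
     by (simp only: generated_def C_monomial.simps cycle_path_mult mm.simps Arc_in_monomials) simp
   next
    case t': (Socle v)
    then show ?thesis using s'
     by (simp only: generated_def C_monomial.simps cycle_path_mult mm.simps) simp
   next
    case t': (Loop i)
    then show ?thesis using s' t
     by (simp only: generated_def C_monomial.simps mm.simps cycle_path_c_power Loop_in_monomials)
   qed (use nv t in auto)
  next
   case s': (Loop i)
   then have i: "1 \<le> i" "i < r" using s by auto
   show ?thesis
   proof (cases t)
    case t': (Arc q m)
    then show ?thesis using s' i t by (simp add: generated_def c_power_cycle_path)
   next
    case t': (Socle v)
    then show ?thesis using s' i
     by (simp only: generated_def C_monomial.simps mm.simps c_power_cycle_path)
   next
    case t': (Loop j)
    then have j: "1 \<le> j" "j < r" using t by auto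
    have pow: "generated s \<otimes> generated t = c [^] (i + j)"
     using s' t' c_closed by (simp add: generated_def nat_pow_mult)
    have "c [^] (i + j) = \<zero>" if "i + j > r"
    proof -
     have "c [^] (i + j) = cycle_path 2 4 \<otimes> c [^] (i + j - r)"
      using c_closed that nat_pow_mult[of c r "i + j - r"] cycle_path_four(2) by simp
     then show ?thesis using cycle_path_c_power[of 4 "i + j - r" 2] that by simp
    qed
    then show ?thesis
     unfolding pow unfolding s' t' using generated_Socle[of 2]
     by (cases "i + j < r"; cases "i + j = r")
      (simp_all add: generated_def[of "Loop _"] generated_def[of Null] cycle_path_four(2)
       del: cycle_path.simps)
   qed (use nv t in auto)
  qed (use nv s in auto)
 qed
qed

end

subsection \<open>Triangular change of basis\<close>

context C_type_algebra
begin

lemma comb_add: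
 assumes "\<And>b. b \<in> Mon ==> Z b \<in> carrier A" "\<And>b. b \<in> Mon ==> f b \<in> carrier K"
  "\<And>b. b \<in> Mon ==> h b \<in> carrier K"
 shows "comb Z (\<lambda>b. f b \<oplus>\<^bsub>K\<^esub> h b) = comb Z f \<oplus> comb Z h"
proof -
 have "comb Z (\<lambda>b. f b \<oplus>\<^bsub>K\<^esub> h b) = (\<Oplus>b\<in>Mon. f b \<odot> Z b \<oplus> h b \<odot> Z b)"
  unfolding comb_def using assms by (intro finsum_cong') (auto simp: smult_l_distr)
 also have "\<dots> = comb Z f \<oplus> comb Z h"
  unfolding comb_def using assms by (intro finsum_addf) auto
 finally show ?thesis .
qed

lemma coord_comb_other:
 assumes "frame Z" "\<And>m. m \<in> Mon ==> Z' m \<in> carrier A"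
  "\<And>m. m \<in> Mon ==> f m \<in> carrier K" "b \<in> Mon"
 shows "coord Z (comb Z' f) b = (\<Oplus>\<^bsub>K\<^esub>m\<in>Mon. f m \<otimes>\<^bsub>K\<^esub> coord Z (Z' m) b)"
proof -
 have "coord Z (comb Z' f) b = (\<Oplus>\<^bsub>K\<^esub>m\<in>Mon. coord Z (f m \<odot> Z' m) b)"
  unfolding comb_def using assms by (intro coord_finsum) auto
 also have "\<dots> = (\<Oplus>\<^bsub>K\<^esub>m\<in>Mon. f m \<otimes>\<^bsub>K\<^esub> coord Z (Z' m) b)"
  using assms by (intro K.finsum_cong') (auto simp: coord_smult)
 finally show ?thesis .
qed

lemma coord_comb_triangular:
 assumes Z: "frame Z" and Z': "\<And>m. m \<in> Mon ==> Z' m \<in> carrier A"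
  and f: "\<And>m. m \<in> Mon ==> f m \<in> carrier K" and b: "b \<in> Mon"
  and diag: "coord Z (Z' b) b = K1"
  and off: "\<And>m. [|m \<in> Mon; m \<noteq> b; f m \<noteq> K0|] ==> coord Z (Z' m) b = K0"
 shows "coord Z (comb Z' f) b = f b"
proof -
 have "coord Z (comb Z' f) b = (\<Oplus>\<^bsub>K\<^esub>m\<in>Mon. f m \<otimes>\<^bsub>K\<^esub> coord Z (Z' m) b)"
  using assms by (intro coord_comb_other) auto
 also have "\<dots> = (\<Oplus>\<^bsub>K\<^esub>m\<in>Mon. if b = m then f m else K0)"
 proof (intro K.finsum_cong' refl)
  fix m assume m: "m \<in> Mon"
  show "f m \<otimes>\<^bsub>K\<^esub> coord Z (Z' m) b = (if b = m then f m else K0)"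
  proof (cases "m = b")
   case False
   then have "f m = K0 \<or> coord Z (Z' m) b = K0" using off m by blast
   then show ?thesis using False m f b Z Z' by auto
  qed (use diag f m in auto)
 qed (use f in auto)
 also have "\<dots> = f b" using b f by (intro K.finsum_singleton) auto
 finally show ?thesis .
qed

text \<open>
A family whose members are monomials plus deeper terms is a basis: at a monomial of minimal depth with
nonzero coefficient, a linear combination keeps that coefficient.
\<close>

lemma frame_triangular:
 assumes Z: "frame Z"
  and closed: "\<And>b. b \<in> Mon ==> Z' b \<in> carrier A" and Null: "Z' Null = \<zero>"
  and mult: "\<And>s t. [|s \<in> Mon; t \<in> Mon|] ==> Z' s \<otimes> Z' t = Z' (mm r s t)"
  and one: "Z' (Vertex 1) \<oplus> Z' (Vertex 2) \<oplus> Z' (Vertex 3) = \<one>"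
  and diag: "\<And>b. b \<in> Mon ==> coord Z (Z' b) b = K1"
  and off: "\<And>m b. [|m \<in> Mon; b \<in> Mon; m \<noteq> b; coord Z (Z' m) b \<noteq> K0|]
   ==> depth r m < depth r b"
 shows "frame Z'"
proof (rule frame_combI)
 fix f b assume f: "f \<in> Mon \<rightarrow> carrier K" and 0: "comb Z' f = \<zero>" and b: "b \<in> Mon"
 from b show "f b = K0"
 proof (induction "depth r b" arbitrary: b rule: less_induct)
  case less
  have "coord Z (comb Z' f) b = f b"
  proof (rule coord_comb_triangular[OF Z closed])
   fix m assume m: "m \<in> Mon" "m \<noteq> b" "f m \<noteq> K0"
   then have "\<not> depth r m < depth r b" using less by blast
   then show "coord Z (Z' m) b = K0" using off m less.prems by blast
  qed (use f less.prems diag in auto)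
  then show ?case using 0 less.prems Z by simp
 qed
next
 have span: "\<exists>f\<in>Mon \<rightarrow> carrier K. comb Z' f = x"
  if "x \<in> carrier A" "\<And>b. [|b \<in> Mon; coord Z x b \<noteq> K0|] ==> r + 5 - n \<le> depth r b" for x n
  using that
 proof (induction n arbitrary: x)
  case 0
  have "coord Z x b = K0" if "b \<in> Mon" for b
   using 0(2)[OF that] depth_le[OF that] by force
  then have "x = \<zero>" using Z 0(1) by (intro coord_eqI[OF Z]) auto
  moreover have "comb Z' (\<lambda>b. K0) = \<zero>"
   unfolding comb_def using closed by (intro add.finprod_one_eqI) auto
  ultimately show ?case by (intro bexI[of _ "\<lambda>b. K0"]) auto
 next
  case (Suc n)
  \<comment> \<open>All coordinates of depth less than this vanish; those of this depth are removed.\<close>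
  define k where "k = r + 5 - Suc n"
  define f where "f = (\<lambda>b. if depth r b = k then coord Z x b else K0)"
  have f: "f b \<in> carrier K" if "b \<in> Mon" for b
   using that Suc.prems(1) Z by (simp add: f_def)
  have y: "comb Z' f \<in> carrier A" using closed f by (intro comb_closed) auto
  have "\<exists>h\<in>Mon \<rightarrow> carrier K. comb Z' h = x \<oplus> comb Z' f"
  proof (rule Suc.IH)
   show "x \<oplus> comb Z' f \<in> carrier A" using y Suc.prems by simp
   fix b assume b: "b \<in> Mon" and nz: "coord Z (x \<oplus> comb Z' f) b \<noteq> K0"
   have ge: "r + 5 - n \<le> depth r b" if "k < depth r b" using that by (simp add: k_def)
   show "r + 5 - n \<le> depth r b"
   proof (rule ge, rule ccontr)
    assume le: "\<not> k < depth r b"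
    have "coord Z (comb Z' f) b = f b"
    proof (rule coord_comb_triangular[OF Z closed])
     fix m assume m: "m \<in> Mon" "m \<noteq> b" "f m \<noteq> K0"
     then have "depth r m = k" by (auto simp: f_def split: if_splits)
     then show "coord Z (Z' m) b = K0" using off[OF m(1) b m(2)] le by auto
    qed (use f b diag in auto)
    moreover have "f b = coord Z x b"
    proof (cases "coord Z x b = K0")
     case False
     have "k \<le> depth r b" using Suc.prems(2)[OF b False] unfolding k_def .
     with le have "depth r b = k" by linarith
     then show ?thesis by (simp add: f_def)
    qed (simp add: f_def)
    ultimately have "coord Z (x \<oplus> comb Z' f) b = K0"
     using b Z y Suc.prems(1) by (simp add: coord_add)
    with nz show False by simp
   qed
  qed
  then obtain h where h: "h \<in> Mon \<rightarrow> carrier K" "comb Z' h = x \<oplus> comb Z' f" by blast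
  have "comb Z' (\<lambda>b. h b \<oplus>\<^bsub>K\<^esub> f b) = (x \<oplus> comb Z' f) \<oplus> comb Z' f"
   using h f closed by (subst comb_add) auto
  also have "\<dots> = x" using y Suc.prems(1) by (simp add: a_assoc)
  finally show ?case using h f by (intro bexI[of _ "\<lambda>b. h b \<oplus>\<^bsub>K\<^esub> f b"]) auto
 qed
 show "\<exists>f\<in>Mon \<rightarrow> carrier K. comb Z' f = x" if "x \<in> carrier A" for x
  using span[of x "r + 5"] that by simp
qed (use closed Null mult one in auto)

end

section \<open>Decompositions of vector spaces\<close>

locale decomposed =
 fixes K :: "('k, 'x) ring_scheme" and V :: "('k, 'v, 'y) module_scheme" (structure)
  and \<gamma> :: "int => 'v set"
 assumes decomposition: "direct_decomposition K V \<gamma>"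
begin

lemma subspace_piece: "VectorSpace.subspace K (\<gamma> i) V"
 using decomposition by (simp add: direct_decomposition_def)

lemma vectorspace_V: "vectorspace K V"
 using subspace_piece[of 0] by (rule subspace.vs)

sublocale V: vectorspace K V
 by (rule vectorspace_V)

lemma piece_subset: "\<gamma> i \<subseteq> carrier V"
 using subspace.submod[OF subspace_piece] by (rule submodule.subset)

lemma piece_closed: "x \<in> \<gamma> i ==> x \<in> carrier V"
 using piece_subset by blast

lemma piece_zero [simp]: "\<zero> \<in> \<gamma> i"
 using subspace.submod[OF subspace_piece] by (rule submodule.zero_closed)

lemma piece_add: "[|x \<in> \<gamma> i; y \<in> \<gamma> i|] ==> x \<oplus> y \<in> \<gamma> i"
 using subspace.submod[OF subspace_piece] by (rule submodule.m_closed)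

lemma piece_smult: "[|c \<in> carrier K; x \<in> \<gamma> i|] ==> c \<odot> x \<in> \<gamma> i"
 using subspace.submod[OF subspace_piece] by (rule submodule.smult_closed)

definition part :: "'v => int => 'v" where
 "part x = (THE f. (\<forall>i. f i \<in> \<gamma> i) \<and> finite {i. f i \<noteq> \<zero>} \<and> x = (\<Oplus>i\<in>{i. f i \<noteq> \<zero>}. f i))"

lemma part_ex1:
 "x \<in> carrier V ==>
  \<exists>!f. (\<forall>i. f i \<in> \<gamma> i) \<and> finite {i. f i \<noteq> \<zero>} \<and> x = (\<Oplus>i\<in>{i. f i \<noteq> \<zero>}. f i)"
 using decomposition by (simp add: direct_decomposition_def)

lemma part_spec:
 assumes "x \<in> carrier V"
 shows "\<And>i. part x i \<in> \<gamma> i" "finite {i. part x i \<noteq> \<zero>}"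
  "x = (\<Oplus>i\<in>{i. part x i \<noteq> \<zero>}. part x i)"
 using theI'[OF part_ex1[OF assms]] by (simp_all add: part_def)

lemma part_in [simp]: "x \<in> carrier V ==> part x i \<in> \<gamma> i"
 by (rule part_spec)

lemma part_closed [simp]: "x \<in> carrier V ==> part x i \<in> carrier V"
 using part_in piece_closed by blast

lemma part_sum:
 assumes "x \<in> carrier V" "finite I" "{i. part x i \<noteq> \<zero>} \<subseteq> I"
 shows "(\<Oplus>i\<in>I. part x i) = x"
proof -
 have "(\<Oplus>i\<in>I. part x i) = (\<Oplus>i\<in>{i. part x i \<noteq> \<zero>}. part x i)"
  using assms by (intro V.add.finprod_mono_neutral_cong_right) auto
 then show ?thesis using part_spec(3)[OF assms(1)] by simp
qed

lemma part_unique: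
 assumes I: "finite I" and f: "\<And>i. i \<in> I ==> f i \<in> \<gamma> i" and x: "x = (\<Oplus>i\<in>I. f i)"
 shows "part x i = (if i \<in> I then f i else \<zero>)"
proof -
 let ?f = "\<lambda>i. if i \<in> I then f i else \<zero>"
 have fc: "f i \<in> carrier V" if "i \<in> I" for i using f[OF that] by (rule piece_closed)
 have sub: "{i. ?f i \<noteq> \<zero>} \<subseteq> I" by auto
 have xV: "x \<in> carrier V" unfolding x using fc by (intro V.finsum_closed) auto
 have "(\<Oplus>i\<in>{i. ?f i \<noteq> \<zero>}. ?f i) = (\<Oplus>i\<in>I. f i)"
 proof (rule V.add.finprod_mono_neutral_cong_left[OF I sub])
  show "f \<in> I \<rightarrow> carrier V" using fc by simp
 qed (simp_all split: if_splits)
 then have "(\<forall>i. ?f i \<in> \<gamma> i) \<and> finite {i. ?f i \<noteq> \<zero>} \<and> x = (\<Oplus>i\<in>{i. ?f i \<noteq> \<zero>}. ?f i)"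
  using f x finite_subset[OF sub I] by simp
 then have "part x = ?f" unfolding part_def by (rule the1_equality[OF part_ex1[OF xV]])
 then show ?thesis by simp
qed

lemma part_homogeneous: "x \<in> \<gamma> n ==> part x i = (if i = n then x else \<zero>)"
 using part_unique[of "{n}" "\<lambda>_. x" x i] piece_closed[of x n] by simp

lemma piece_disjoint: "[|x \<in> \<gamma> m; x \<in> \<gamma> n; x \<noteq> \<zero>|] ==> m = n"
 using part_homogeneous[of x m m] part_homogeneous[of x n m] by (auto split: if_splits)

lemma part_of_zero [simp]: "part \<zero> i = \<zero>"
 using part_homogeneous[of \<zero> i i] by simp

end

lemma part_hom:
 assumes "decomposed K V \<gamma>" "decomposed K W \<delta>"
  and h: "\<And>x. x \<in> carrier V ==> h x \<in> carrier W"
   "\<And>x y. [|x \<in> carrier V; y \<in> carrier V|] ==> h (x \<oplus>\<^bsub>V\<^esub> y) = h x \<oplus>\<^bsub>W\<^esub> h y"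
   "h \<zero>\<^bsub>V\<^esub> = \<zero>\<^bsub>W\<^esub>"
   "\<And>i x. x \<in> \<gamma> i ==> h x \<in> \<delta> (i + n)"
  and x: "x \<in> carrier V"
 shows "decomposed.part W \<delta> (h x) (i + n) = h (decomposed.part V \<gamma> x i)"
proof -
 interpret V: decomposed K V \<gamma> by fact
 interpret W: decomposed K W \<delta> by fact
 let ?S = "{i. V.part x i \<noteq> \<zero>\<^bsub>V\<^esub>}"
 have S: "finite ?S" using x by (rule V.part_spec)
 have "h x = h (\<Oplus>\<^bsub>V\<^esub>i\<in>?S. V.part x i)" using V.part_spec(3)[OF x] by simp
 also have "\<dots> = (\<Oplus>\<^bsub>W\<^esub>i\<in>?S. h (V.part x i))"
  using h x by (intro finsum_additive V.V.abelian_monoid_axioms W.V.abelian_monoid_axioms) auto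
 also have "\<dots> = (\<Oplus>\<^bsub>W\<^esub>j\<in>(\<lambda>i. i + n) ` ?S. h (V.part x (j - n)))"
 proof (subst W.V.add.finprod_reindex)
  show "(\<lambda>j. h (V.part x (j - n))) \<in> (\<lambda>i. i + n) ` ?S \<rightarrow> carrier W" using h x by auto
 qed (simp_all add: inj_on_def)
 finally have hx: "h x = (\<Oplus>\<^bsub>W\<^esub>j\<in>(\<lambda>i. i + n) ` ?S. h (V.part x (j - n)))" .
 have "W.part (h x) (i + n) = (if i + n \<in> (\<lambda>i. i + n) ` ?S then h (V.part x (i + n - n)) else \<zero>\<^bsub>W\<^esub>)"
 proof (rule W.part_unique[OF _ _ hx])
  fix j assume "j \<in> (\<lambda>i. i + n) ` ?S"
  then show "h (V.part x (j - n)) \<in> \<delta> j" using h(4)[OF V.part_in[OF x], of "j - n"] by simp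
 qed (use S in auto)
 then show ?thesis using h(3) by (simp add: image_iff)
qed

lemma decomposition_eqI:
 assumes "decomposed K V \<gamma>" "decomposed K V \<delta>" and sub: "\<And>i. \<delta> i \<subseteq> \<gamma> i"
 shows "\<gamma> = \<delta>"
proof
 fix n
 interpret G: decomposed K V \<gamma> by fact
 interpret D: decomposed K V \<delta> by fact
 have "x \<in> \<delta> n" if x: "x \<in> \<gamma> n" for x
 proof -
  have xV: "x \<in> carrier V" using x by (rule G.piece_closed)
  have "G.part x (n + 0) = D.part x n"
   by (rule part_hom[OF assms(2,1)]) (use sub xV in auto)
  then show ?thesis using D.part_in[OF xV, of n] G.part_homogeneous[OF x, of n] by simp
 qed
 with sub show "\<gamma> n = \<delta> n" by blast
qed

text \<open>The part of degree \<open>i\<close> collects the coordinates at the basis members of degree \<open>i\<close>.\<close>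

lemma direct_decomposition_by_basis:
 fixes K :: "('k, 'x) ring_scheme" and V :: "('k, 'v, 'y) module_scheme"
  and coo :: "'v => 'b => 'k" and d :: "'b => int"
 assumes V: "vectorspace K V" and B: "finite B"
  and closed: "\<And>x b. [|x \<in> carrier V; b \<in> B|] ==> coo x b \<in> carrier K"
  and add: "\<And>x y b. [|x \<in> carrier V; y \<in> carrier V; b \<in> B|] ==> coo (x \<oplus>\<^bsub>V\<^esub> y) b = coo x b \<oplus>\<^bsub>K\<^esub> coo y b"
  and smult: "\<And>c x b. [|c \<in> carrier K; x \<in> carrier V; b \<in> B|] ==> coo (c \<odot>\<^bsub>V\<^esub> x) b = c \<otimes>\<^bsub>K\<^esub> coo x b"
  and inj: "\<And>x y. [|x \<in> carrier V; y \<in> carrier V; \<And>b. b \<in> B ==> coo x b = coo y b|] ==> x = y"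
  and surj: "\<And>f. (\<And>b. b \<in> B ==> f b \<in> carrier K) ==> \<exists>x\<in>carrier V. \<forall>b\<in>B. coo x b = f b"
 shows "direct_decomposition K V (\<lambda>n. {x \<in> carrier V. \<forall>b\<in>B. coo x b \<noteq> \<zero>\<^bsub>K\<^esub> \<longrightarrow> d b = n})"
  (is "direct_decomposition K V ?\<gamma>")
proof -
 interpret V: vectorspace K V by fact
 have zero: "coo \<zero>\<^bsub>V\<^esub> b = \<zero>\<^bsub>K\<^esub>" if "b \<in> B" for b
  using smult[of "\<zero>\<^bsub>K\<^esub>" "\<zero>\<^bsub>V\<^esub>" b] closed[of "\<zero>\<^bsub>V\<^esub>" b] that by simp
 have coo_sum: "coo (\<Oplus>\<^bsub>V\<^esub>i\<in>I. f i) b = (\<Oplus>\<^bsub>K\<^esub>i\<in>I. coo (f i) b)"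
  if "\<And>i. i \<in> I ==> f i \<in> carrier V" "b \<in> B" for f :: "int => 'v" and I b
  using that closed add zero
  by (intro finsum_additive[where h = "\<lambda>x. coo x b"]) (auto simp: V.M.abelian_monoid_axioms V.R.abelian_monoid_axioms)
 have sub: "VectorSpace.subspace K (?\<gamma> n) V" for n
 proof (rule VectorSpace.subspace.intro[OF V LinearCombinations.submodule.intro])
  show "module K V" by (rule V.module_axioms)
 next
  fix v w assume "v \<in> ?\<gamma> n" "w \<in> ?\<gamma> n"
  then have vw: "v \<in> carrier V" "w \<in> carrier V"
   and nz: "\<And>b. b \<in> B ==> coo v b \<noteq> \<zero>\<^bsub>K\<^esub> ==> d b = n"
    "\<And>b. b \<in> B ==> coo w b \<noteq> \<zero>\<^bsub>K\<^esub> ==> d b = n" by auto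
  have "d b = n" if "b \<in> B" "coo (v \<oplus>\<^bsub>V\<^esub> w) b \<noteq> \<zero>\<^bsub>K\<^esub>" for b
   using that add[OF vw that(1)] nz[OF that(1)] by (metis V.R.l_zero V.R.zero_closed)
  with vw show "v \<oplus>\<^bsub>V\<^esub> w \<in> ?\<gamma> n" by auto
 next
  fix c v assume "c \<in> carrier K" "v \<in> ?\<gamma> n"
  then show "c \<odot>\<^bsub>V\<^esub> v \<in> ?\<gamma> n" by (auto simp: smult)
 qed (auto simp: zero)
 have ex1: "\<exists>!f. (\<forall>i. f i \<in> ?\<gamma> i) \<and> finite {i. f i \<noteq> \<zero>\<^bsub>V\<^esub>} \<and> x = (\<Oplus>\<^bsub>V\<^esub>i\<in>{i. f i \<noteq> \<zero>\<^bsub>V\<^esub>}. f i)"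
  if x: "x \<in> carrier V" for x
 proof -
  have sum_at: "coo (\<Oplus>\<^bsub>V\<^esub>i\<in>{i. f i \<noteq> \<zero>\<^bsub>V\<^esub>}. f i) b = coo (f (d b)) b"
   if f: "\<forall>i. f i \<in> ?\<gamma> i" "finite {i. f i \<noteq> \<zero>\<^bsub>V\<^esub>}" and b: "b \<in> B" for f b
  proof -
   have fc: "f i \<in> carrier V" for i using f by auto
   have z: "coo (f i) b = \<zero>\<^bsub>K\<^esub>" if "d b \<noteq> i" for i using f(1) b that by blast
   have "coo (\<Oplus>\<^bsub>V\<^esub>i\<in>{i. f i \<noteq> \<zero>\<^bsub>V\<^esub>}. f i) b = (\<Oplus>\<^bsub>K\<^esub>i\<in>{i. f i \<noteq> \<zero>\<^bsub>V\<^esub>}. coo (f i) b)"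
    using fc b by (intro coo_sum) auto
   also have "\<dots> = (\<Oplus>\<^bsub>K\<^esub>i\<in>{d b}. coo (f i) b)"
    using f(2) z zero[OF b] closed[OF fc b]
    by (intro V.R.add.finprod_mono_neutral_cong) auto
   finally show ?thesis using closed[OF fc b] by simp
  qed
  have "\<exists>y\<in>carrier V. \<forall>b\<in>B. coo y b = (if d b = i then coo x b else \<zero>\<^bsub>K\<^esub>)" for i
   by (rule surj) (use x closed in auto)
  then obtain f where f: "\<And>i. f i \<in> carrier V"
   "\<And>i b. b \<in> B ==> coo (f i) b = (if d b = i then coo x b else \<zero>\<^bsub>K\<^esub>)" by metis
  have fin: "finite {i. f i \<noteq> \<zero>\<^bsub>V\<^esub>}"
  proof (rule finite_subset)
   show "{i. f i \<noteq> \<zero>\<^bsub>V\<^esub>} \<subseteq> d ` B"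
   proof
    fix i assume i: "i \<in> {i. f i \<noteq> \<zero>\<^bsub>V\<^esub>}"
    show "i \<in> d ` B"
    proof (rule ccontr)
     assume "i \<notin> d ` B"
     then have "f i = \<zero>\<^bsub>V\<^esub>" using f zero by (intro inj) auto
     with i show False by simp
    qed
   qed
  qed (use B in simp)
  have fg: "\<forall>i. f i \<in> ?\<gamma> i" using f by auto
  show ?thesis
  proof (rule ex1I[of _ f])
   have "x = (\<Oplus>\<^bsub>V\<^esub>i\<in>{i. f i \<noteq> \<zero>\<^bsub>V\<^esub>}. f i)"
    using x f sum_at[OF fg fin] by (intro inj) (auto intro!: V.M.finsum_closed)
   with fg fin show "(\<forall>i. f i \<in> ?\<gamma> i) \<and> finite {i. f i \<noteq> \<zero>\<^bsub>V\<^esub>} \<and> x = (\<Oplus>\<^bsub>V\<^esub>i\<in>{i. f i \<noteq> \<zero>\<^bsub>V\<^esub>}. f i)"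
    by blast
  next
   fix g assume g: "(\<forall>i. g i \<in> ?\<gamma> i) \<and> finite {i. g i \<noteq> \<zero>\<^bsub>V\<^esub>} \<and> x = (\<Oplus>\<^bsub>V\<^esub>i\<in>{i. g i \<noteq> \<zero>\<^bsub>V\<^esub>}. g i)"
   show "g = f"
   proof
    fix i
    show "g i = f i"
    proof (rule inj)
     fix b assume b: "b \<in> B"
     have "coo x b = coo (g (d b)) b" using sum_at[of g b] g b by simp
     moreover have "coo (g i) b = \<zero>\<^bsub>K\<^esub>" if "d b \<noteq> i" using g b that by blast
     ultimately show "coo (g i) b = coo (f i) b" using f(2)[OF b, of i] by auto
    qed (use g f in auto)
   qed
  qed
 qed
 show ?thesis unfolding direct_decomposition_def using sub ex1 by blast
qed

section \<open>Idempotents of degree zero\<close>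

context C_type_algebra
begin

definition deep :: "(C_monomial => 'a) => nat => 'a => bool" where
 "deep Z n x \<longleftrightarrow> x \<in> carrier A \<and> (\<forall>b\<in>Mon. coord Z x b \<noteq> K0 \<longrightarrow> n \<le> depth r b)"

lemma deep_mult:
 assumes Z: "frame Z" and x: "deep Z m x" and y: "deep Z n y"
 shows "deep Z (m + n) (x \<otimes> y)"
 unfolding deep_def
proof (intro conjI ballI impI)
 have xy: "x \<in> carrier A" "y \<in> carrier A" using x y by (auto simp: deep_def)
 then show "x \<otimes> y \<in> carrier A" by simp
 fix b assume b: "b \<in> Mon" and nz: "coord Z (x \<otimes> y) b \<noteq> K0"
 obtain s t where st: "s \<in> Mon" "t \<in> Mon" "mm r s t = b"
  "coord Z x s \<noteq> K0" "coord Z y t \<noteq> K0"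
  using coord_mult_support[OF Z xy b nz] by blast
 have "mm r s t \<noteq> Null" using st(3) b by auto
 from depth_mm[OF this] st have "depth r s + depth r t \<le> depth r b" by simp
 moreover have "m \<le> depth r s" "n \<le> depth r t" using x y st by (auto simp: deep_def)
 ultimately show "m + n \<le> depth r b" by linarith
qed

lemma deep_zero:
 assumes Z: "frame Z" and x: "deep Z n x" and n: "n \<ge> r + 5"
 shows "x = \<zero>"
proof (rule coord_eqI[OF Z])
 fix b assume b: "b \<in> Mon"
 have "coord Z x b = K0"
 proof (rule ccontr)
  assume "coord Z x b \<noteq> K0"
  then have "n \<le> depth r b" using x b by (simp add: deep_def)
  with depth_le[OF b] n show False by simp
 qed
 then show "coord Z x b = coord Z \<zero> b" using Z b by simp
qed (use x in \<open>auto simp: deep_def\<close>)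

lemma deep_oneI:
 assumes "x \<in> carrier A" "\<And>v. v \<in> {1, 2, 3} ==> coord Z x (Vertex v) = K0"
 shows "deep Z 1 x"
 unfolding deep_def
proof (intro conjI ballI impI)
 fix b assume b: "b \<in> Mon" and nz: "coord Z x b \<noteq> K0"
 have "b \<noteq> Vertex v" for v using assms(2)[of v] b nz by auto
 then show "1 \<le> depth r b" using depth_pos[OF b] by auto
qed fact

lemma deep_pow: "[|frame Z; deep Z 1 x|] ==> deep Z n (x [^] n)"
proof (induction n)
 case 0
 then show ?case by (simp add: deep_def)
next
 case (Suc n)
 then show ?case using deep_mult[of Z n "x [^] n" 1 x] by simp
qed

lemma deep_nilpotent: "[|frame Z; deep Z 1 x; n \<ge> r + 5|] ==> x [^] n = \<zero>"
 using deep_zero deep_pow by blast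

lemma coord_pow_Vertex:
 "[|frame Z; x \<in> carrier A; v \<in> {1, 2, 3}|]
  ==> coord Z (x [^] (n :: nat)) (Vertex v) = coord Z x (Vertex v) [^]\<^bsub>K\<^esub> n"
 by (induction n) (simp_all add: coord_one_Vertex coord_mult_Vertex)

lemma square_add:
 assumes "x \<in> carrier A" "y \<in> carrier A" "x \<otimes> y = y \<otimes> x"
 shows "(x \<oplus> y) \<otimes> (x \<oplus> y) = x \<otimes> x \<oplus> y \<otimes> y"
proof -
 have "(x \<oplus> y) \<otimes> (x \<oplus> y) = x \<otimes> x \<oplus> (x \<otimes> y \<oplus> (x \<otimes> y \<oplus> y \<otimes> y))"
  using assms by (simp add: l_distr r_distr a_assoc)
 then show ?thesis using assms by simp
qed

lemma pow_two_Suc: "x \<in> carrier A ==> x [^] ((2 :: nat) ^ Suc k) = (x \<otimes> x) [^] ((2 :: nat) ^ k)"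
 using nat_pow_pow[of x 2 "2 ^ k"] by (simp add: numeral_2_eq_2)

lemma frobenius_add:
 "[|x \<in> carrier A; y \<in> carrier A; x \<otimes> y = y \<otimes> x|]
  ==> (x \<oplus> y) [^] ((2 :: nat) ^ k) = x [^] ((2 :: nat) ^ k) \<oplus> y [^] ((2 :: nat) ^ k)"
proof (induction k arbitrary: x y)
 case (Suc k)
 note xy = Suc.prems
 have comm: "(x \<otimes> x) \<otimes> (y \<otimes> y) = (y \<otimes> y) \<otimes> (x \<otimes> x)"
  using xy by (smt (verit) m_assoc m_closed)
 show ?case
  unfolding pow_two_Suc[OF a_closed[OF xy(1,2)]] square_add[OF xy] pow_two_Suc[OF xy(1)] pow_two_Suc[OF xy(2)]
  using Suc.IH[OF _ _ comm] xy by simp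
qed simp

text \<open>
A power of 2, so that raising to it is additive on commuting elements, and larger than every depth,
so that it kills the elements of positive depth.
\<close>

definition big :: nat where "big = 2 ^ (r + 5)"

lemma big_ge: "r + 5 \<le> big" "1 \<le> big"
 using less_exp[of "r + 5"] unfolding big_def by (simp_all only: less_imp_le one_le_power)

lemma unipotent:
 assumes Z: "frame Z" and x: "x \<in> carrier A"
  and 1: "\<And>v. v \<in> {1, 2, 3} ==> coord Z x (Vertex v) = K1"
 shows "x [^] big = \<one>"
proof -
 have "deep Z 1 (x \<oplus> \<one>)"
  using x Z 1 by (intro deep_oneI) (auto simp: coord_add coord_one_Vertex char_two)
 then have "\<zero> = (x \<oplus> \<one>) [^] big" using deep_nilpotent[OF Z _ big_ge(1)] by simp
 also have "\<dots> = x [^] big \<oplus> \<one>"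
  using frobenius_add[of x "\<one>" "r + 5"] x by (simp add: big_def)
 finally show ?thesis using A_add_eq_zero[of "x [^] big" "\<one>"] x by simp
qed

lemma unipotent_inverse:
 assumes Z: "frame Z" and x: "x \<in> carrier A"
  and 1: "\<And>v. v \<in> {1, 2, 3} ==> coord Z x (Vertex v) = K1"
 shows "x [^] (big - 1) \<otimes> x = \<one>" "x \<otimes> x [^] (big - 1) = \<one>"
 using unipotent[OF assms] x big_ge(2) nat_pow_mult[OF x, of "big - 1" 1] nat_pow_mult[OF x, of 1 "big - 1"]
 by simp_all

text \<open>
If \<open>x\<close> is idempotent modulo the radical then \<open>x\<^sup>2 + x\<close> is nilpotent, and its big power is the sum of those of
\<open>x\<^sup>2\<close> and \<open>x\<close>.
\<close>

lemma big_power_idempotent: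
 assumes Z: "frame Z" and x: "x \<in> carrier A"
  and 1: "\<And>v. v \<in> {1, 2, 3} ==>
   coord Z x (Vertex v) \<otimes>\<^bsub>K\<^esub> coord Z x (Vertex v) = coord Z x (Vertex v)"
 shows "x [^] big \<otimes> x [^] big = x [^] big"
proof -
 have "deep Z 1 (x \<otimes> x \<oplus> x)"
  using x Z 1 by (intro deep_oneI) (auto simp: coord_add coord_mult_Vertex)
 then have "\<zero> = (x \<otimes> x \<oplus> x) [^] big" using deep_nilpotent[OF Z _ big_ge(1)] by simp
 also have "\<dots> = (x \<otimes> x) [^] big \<oplus> x [^] big"
  using frobenius_add[of "x \<otimes> x" x "r + 5"] x by (simp add: big_def m_assoc)
 also have "(x \<otimes> x) [^] big = x [^] big \<otimes> x [^] big"
  using pow_mult_distrib[of x x big] x by simp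
 finally show ?thesis using A_add_eq_zero[of "x [^] big \<otimes> x [^] big" "x [^] big"] x by simp
qed

lemma frame_conjugate:
 assumes Z: "frame Z" and u: "u \<in> carrier A" "u' \<in> carrier A" "u \<otimes> u' = \<one>" "u' \<otimes> u = \<one>"
 shows "frame (\<lambda>b. u' \<otimes> (Z b \<otimes> u))"
proof -
 define \<phi> where "\<phi> = (\<lambda>x. u' \<otimes> (x \<otimes> u))"
 have \<phi>_closed: "\<phi> x \<in> carrier A" if "x \<in> carrier A" for x using that u by (simp add: \<phi>_def)
 have \<phi>_mult: "\<phi> x \<otimes> \<phi> y = \<phi> (x \<otimes> y)" if "x \<in> carrier A" "y \<in> carrier A" for x y
 proof -
  have "\<phi> x \<otimes> \<phi> y = u' \<otimes> (x \<otimes> ((u \<otimes> u') \<otimes> (y \<otimes> u)))"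
   unfolding \<phi>_def using u(1,2) that by (simp add: m_assoc)
  then show ?thesis unfolding \<phi>_def using u that by (simp add: m_assoc)
 qed
 have \<phi>_add: "\<phi> (x \<oplus> y) = \<phi> x \<oplus> \<phi> y" if "x \<in> carrier A" "y \<in> carrier A" for x y
  unfolding \<phi>_def using u that by (simp add: l_distr r_distr)
 have \<phi>_smult: "\<phi> (c \<odot> x) = c \<odot> \<phi> x" if "x \<in> carrier A" "c \<in> carrier K" for c x
  unfolding \<phi>_def using u that by (simp add: smult_mult_left smult_mult_right)
 have \<phi>_zero: "\<phi> \<zero> = \<zero>" unfolding \<phi>_def using u by simp
 have inv: "\<phi> (u \<otimes> (x \<otimes> u')) = x" if "x \<in> carrier A" for x
 proof -
  have "\<phi> (u \<otimes> (x \<otimes> u')) = (u' \<otimes> u) \<otimes> (x \<otimes> (u' \<otimes> u))"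
   unfolding \<phi>_def using u(1,2) that by (simp add: m_assoc)
  then show ?thesis using u that by simp
 qed
 have inj: "x = \<zero>" if "x \<in> carrier A" "\<phi> x = \<zero>" for x
 proof -
  have "x = (u \<otimes> u') \<otimes> (x \<otimes> (u \<otimes> u'))" using u that(1) by simp
  also have "\<dots> = u \<otimes> (\<phi> x \<otimes> u')" unfolding \<phi>_def using u(1,2) that(1) by (simp add: m_assoc)
  finally show ?thesis using that(2) u by simp
 qed
 have comb: "comb (\<lambda>b. \<phi> (Z b)) f = \<phi> (comb Z f)" if f: "\<And>b. b \<in> Mon ==> f b \<in> carrier K" for f
 proof -
  have "\<phi> (comb Z f) = (\<Oplus>b\<in>Mon. \<phi> (f b \<odot> Z b))"
   unfolding comb_def using Z f \<phi>_closed \<phi>_add \<phi>_zero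
   by (intro finsum_additive abelian_monoid_axioms) auto
  also have "\<dots> = comb (\<lambda>b. \<phi> (Z b)) f"
   unfolding comb_def using Z f \<phi>_closed \<phi>_smult by (intro finsum_cong') auto
  finally show ?thesis by simp
 qed
 have "frame (\<lambda>b. \<phi> (Z b))"
 proof (rule frame_combI)
  fix s t assume "s \<in> Mon" "t \<in> Mon"
  then show "\<phi> (Z s) \<otimes> \<phi> (Z t) = \<phi> (Z (mm r s t))"
   using Z \<phi>_mult by (simp add: frame_mult)
 next
  have "\<phi> (Z (Vertex 1) \<oplus> Z (Vertex 2) \<oplus> Z (Vertex 3)) = \<one>"
   unfolding frame_one[OF Z] \<phi>_def using u by simp
  then show "\<phi> (Z (Vertex 1)) \<oplus> \<phi> (Z (Vertex 2)) \<oplus> \<phi> (Z (Vertex 3)) = \<one>"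
   using Z by (simp add: \<phi>_add)
 next
  fix x assume x: "x \<in> carrier A"
  let ?y = "u \<otimes> (x \<otimes> u')"
  have y: "?y \<in> carrier A" using x u by simp
  have "comb (\<lambda>b. \<phi> (Z b)) (coord Z ?y) = x"
   using comb[of "coord Z ?y"] coord_spec(2)[OF Z y] coord_closed[OF Z y] inv[OF x] by simp
  then show "\<exists>f\<in>Mon \<rightarrow> carrier K. comb (\<lambda>b. \<phi> (Z b)) f = x"
   using coord_closed[OF Z y] by blast
 next
  fix f b assume f: "f \<in> Mon \<rightarrow> carrier K" and 0: "comb (\<lambda>b. \<phi> (Z b)) f = \<zero>"
   and b: "b \<in> Mon"
  have fc: "\<And>b. b \<in> Mon ==> f b \<in> carrier K" using f by auto
  have "comb Z f = \<zero>"
   using inj[of "comb Z f"] comb[OF fc] 0 comb_closed[of Z f] Z fc by simp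
  then have "coord Z \<zero> b = f b" using coord_comb[of Z f b] Z fc b by simp
  then show "f b = K0" using Z b by simp
 qed (use Z \<phi>_closed \<phi>_zero in auto)
 then show ?thesis by (simp add: \<phi>_def)
qed

end

locale graded_C_type_algebra = C_type_algebra K A r
 for K :: "('k, 'x) ring_scheme" and A :: "('k, 'a, 'y) module_scheme" (structure) and r :: nat +
 fixes \<pi> :: "int => 'a set"
 assumes grading: "\<pi> \<in> gradings K A"
begin

sublocale G: decomposed K A \<pi>
 using grading by (simp add: decomposed_def gradings_def)

lemma piece_mult: "[|x \<in> \<pi> i; y \<in> \<pi> j|] ==> x \<otimes> y \<in> \<pi> (i + j)"
 using grading by (simp add: gradings_def)

lemma piece_one: "\<one> \<in> \<pi> 0"
proof -
 let ?u = "G.part \<one> 0"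
 have u: "?u \<in> carrier A" by simp
 have hom: "x \<otimes> ?u = x" if x: "x \<in> \<pi> j" for x j
 proof -
  have xc: "x \<in> carrier A" using x by (rule G.piece_closed)
  have "G.part (x \<otimes> \<one>) (0 + j) = x \<otimes> ?u"
  proof (rule part_hom[OF G.decomposed_axioms G.decomposed_axioms])
   show "x \<otimes> y \<in> \<pi> (i + j)" if "y \<in> \<pi> i" for i y
    using piece_mult[OF x that] by (simp add: add.commute)
  qed (use xc in \<open>auto simp: r_distr\<close>)
  then show ?thesis using xc G.part_homogeneous[OF x] by simp
 qed
 let ?S = "{i. G.part \<one> i \<noteq> \<zero>}"
 have "?u = \<one> \<otimes> ?u" using u by simp
 also have "\<dots> = (\<Oplus>i\<in>?S. G.part \<one> i) \<otimes> ?u" using G.part_spec(3)[of \<one>] by simp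
 also have "\<dots> = (\<Oplus>i\<in>?S. G.part \<one> i \<otimes> ?u)" using u by (intro finsum_mult_right) auto
 also have "\<dots> = (\<Oplus>i\<in>?S. G.part \<one> i)"
  using hom[OF G.part_in[of \<one>]] by (intro finsum_cong') auto
 also have "\<dots> = \<one>" using G.part_spec(3)[of \<one>] by simp
 finally show ?thesis using G.part_in[of \<one> 0] by simp
qed

lemma piece_pow: "x \<in> \<pi> i ==> x [^] (n :: nat) \<in> \<pi> (int n * i)"
proof (induction n)
 case (Suc n)
 then show ?case using piece_mult[of "x [^] n" "int n * i" x i] by (simp add: algebra_simps)
qed (simp add: piece_one)

lemma part_add:
 assumes x: "x \<in> carrier A" and y: "y \<in> carrier A"
 shows "G.part (x \<oplus> y) n = G.part x n \<oplus> G.part y n"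
proof -
 let ?I = "insert n ({i. G.part x i \<noteq> \<zero>} \<union> {i. G.part y i \<noteq> \<zero>})"
 have fin: "finite ?I" using G.part_spec(2)[OF x] G.part_spec(2)[OF y] by simp
 have "x \<oplus> y = (\<Oplus>i\<in>?I. G.part x i) \<oplus> (\<Oplus>i\<in>?I. G.part y i)"
  by (subst G.part_sum[OF x fin], blast, subst G.part_sum[OF y fin], blast, rule refl)
 also have "\<dots> = (\<Oplus>i\<in>?I. G.part x i \<oplus> G.part y i)"
  using x y by (intro finsum_addf[symmetric]) auto
 finally have "G.part (x \<oplus> y) n = (if n \<in> ?I then G.part x n \<oplus> G.part y n else \<zero>)"
  using x y by (intro G.part_unique[OF fin]) (auto intro: G.piece_add)
 then show ?thesis by simp
qed

lemma part_smult:
 assumes "c \<in> carrier K" "x \<in> carrier A"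
 shows "G.part (c \<odot> x) n = c \<odot> G.part x n"
proof -
 have "G.part (c \<odot> x) (n + 0) = c \<odot> G.part x n"
  by (rule part_hom[OF G.decomposed_axioms G.decomposed_axioms])
   (use assms G.piece_smult in \<open>auto simp: smult_r_distr\<close>)
 then show ?thesis by simp
qed

lemma finite_degrees:
 assumes Z: "frame Z"
 obtains F where "finite F" "\<And>n x. [|x \<in> \<pi> n; n \<notin> F|] ==> x = \<zero>"
proof
 let ?F = "\<Union>b\<in>Mon. {i. G.part (Z b) i \<noteq> \<zero>}"
 show "finite ?F" using Z G.part_spec(2) by auto
 fix n x assume x: "x \<in> \<pi> n" and n: "n \<notin> ?F"
 have xc: "x \<in> carrier A" using x by (rule G.piece_closed)
 have "x = G.part x n" using G.part_homogeneous[OF x] by simp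
 also have "\<dots> = G.part (\<Oplus>b\<in>Mon. coord Z x b \<odot> Z b) n"
  using coord_spec(2)[OF Z xc] by (simp add: comb_def)
 also have "\<dots> = (\<Oplus>b\<in>Mon. G.part (coord Z x b \<odot> Z b) n)"
  using Z xc
  by (intro finsum_additive[where h = "\<lambda>z. G.part z n"] abelian_monoid_axioms) (auto simp: part_add)
 also have "\<dots> = \<zero>"
  using Z xc n by (intro add.finprod_one_eqI) (auto simp: part_smult)
 finally show "x = \<zero>" .
qed

lemma K_pow_zero: "[|c \<in> carrier K; c [^]\<^bsub>K\<^esub> (m :: nat) = K0|] ==> c = K0"
 by (induction m) (auto dest: K.integral)

text \<open>
The powers of a homogeneous element of nonzero degree run through infinitely many degrees, so it is
nilpotent and the characters of the vertices vanish on it.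
\<close>

lemma degree_nonzero_character:
 assumes Z: "frame Z" and x: "x \<in> \<pi> n" and n: "n \<noteq> 0" and v: "v \<in> {1, 2, 3}"
 shows "coord Z x (Vertex v) = K0"
proof -
 have xc: "x \<in> carrier A" using x by (rule G.piece_closed)
 obtain F where F: "finite F" "\<And>n x. [|x \<in> \<pi> n; n \<notin> F|] ==> x = \<zero>"
  using finite_degrees[OF Z] by blast
 have "\<exists>m. int m * n \<notin> F"
 proof (rule ccontr)
  assume "\<not> ?thesis"
  then have "range (\<lambda>m. int m * n) \<subseteq> F" by auto
  then have "finite (range (\<lambda>m. int m * n))" using F(1) finite_subset by blast
  moreover have "inj (\<lambda>m. int m * n)" using n by (auto intro: injI)
  ultimately show False using finite_imageD[of "\<lambda>m. int m * n" UNIV] by simp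
 qed
 then obtain m where "int m * n \<notin> F" by blast
 then have "x [^] m = \<zero>" using F(2) piece_pow[OF x] by blast
 then have "coord Z x (Vertex v) [^]\<^bsub>K\<^esub> m = K0"
  using coord_pow_Vertex[OF Z xc v, of m] Z v by simp
 then show ?thesis using K_pow_zero[of "coord Z x (Vertex v)" m] Z xc v by simp
qed

lemma exists_part_coord:
 assumes Z: "frame Z" and x: "x \<in> carrier A" and b: "b \<in> Mon"
  and nz: "coord Z x b \<noteq> K0"
 obtains n where "coord Z (G.part x n) b \<noteq> K0"
proof -
 have "\<exists>n. coord Z (G.part x n) b \<noteq> K0"
 proof (rule ccontr)
  assume "\<not> ?thesis"
  then have all0: "coord Z (G.part x n) b = K0" for n by blast
  have "coord Z x b = coord Z (\<Oplus>i\<in>{i. G.part x i \<noteq> \<zero>}. G.part x i) b"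
   using G.part_spec(3)[OF x] by simp
  also have "\<dots> = (\<Oplus>\<^bsub>K\<^esub>i\<in>{i. G.part x i \<noteq> \<zero>}. coord Z (G.part x i) b)"
   using x b by (intro coord_finsum[OF Z]) auto
  also have "\<dots> = K0" using all0 by (intro K.add.finprod_one_eqI) auto
  finally show False using nz by simp
 qed
 with that show thesis by blast
qed

lemma coord_part_zero_Vertex:
 assumes Z: "frame Z" and x: "x \<in> carrier A" and v: "v \<in> {1, 2, 3}"
 shows "coord Z (G.part x 0) (Vertex v) = coord Z x (Vertex v)"
proof -
 let ?S = "insert 0 {i. G.part x i \<noteq> \<zero>}"
 have fin: "finite ?S" using G.part_spec(2)[OF x] by simp
 have b: "Vertex v \<in> Mon" using v by simp
 have "coord Z x (Vertex v) = coord Z (\<Oplus>i\<in>?S. G.part x i) (Vertex v)"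
  by (subst G.part_sum[OF x fin], blast, rule refl)
 also have "\<dots> = (\<Oplus>\<^bsub>K\<^esub>i\<in>?S. coord Z (G.part x i) (Vertex v))"
  using x b by (intro coord_finsum[OF Z]) auto
 also have "\<dots> = (\<Oplus>\<^bsub>K\<^esub>i\<in>{0}. coord Z (G.part x i) (Vertex v))"
  using fin Z x b degree_nonzero_character[OF Z G.part_in[OF x] _ v]
  by (intro K.add.finprod_mono_neutral_cong_right) auto
 finally show ?thesis using Z x b by simp
qed

text \<open>
The degree 0 part of a vertex has the same characters as the vertex, hence is idempotent modulo the
radical. A big power of the first part is an idempotent \<open>e1\<close>; cutting the second part with the complement of
\<open>e1\<close> before taking the power makes the second idempotent orthogonal to the first.
\<close>

lemma degree_zero_idempotents:
 assumes Z: "frame Z"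
 obtains e where "\<And>v. v \<in> {1, 2, 3} ==> e v \<in> \<pi> 0"
  "\<And>v w. [|v \<in> {1, 2, 3}; w \<in> {1, 2, 3}|] ==> e v \<otimes> e w = (if v = w then e v else \<zero>)"
  "\<And>v w. [|v \<in> {1, 2, 3}; w \<in> {1, 2, 3}|] ==>
   coord Z (e v) (Vertex w) = (if v = w then K1 else K0)"
  "e 1 \<oplus> e 2 \<oplus> e 3 = \<one>"
proof -
 define y where "y = (\<lambda>v. G.part (Z (Vertex v)) 0)"
 have y: "y v \<in> \<pi> 0" "y v \<in> carrier A" if "v \<in> {1, 2, 3}" for v
  using that Z by (auto simp: y_def)
 have y_char: "coord Z (y v) (Vertex w) = (if v = w then K1 else K0)"
  if "v \<in> {1, 2, 3}" "w \<in> {1, 2, 3}" for v w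
  using that Z coord_part_zero_Vertex[OF Z, of "Z (Vertex v)" w]
   coord_basis[OF Z, of "Vertex v" "Vertex w"] by (simp add: y_def)
 define e1 where "e1 = y 1 [^] big"
 define f1 where "f1 = \<one> \<oplus> e1"
 define z where "z = f1 \<otimes> (y 2 \<otimes> f1)"
 define e2 where "e2 = z [^] big"
 define e3 where "e3 = \<one> \<oplus> e1 \<oplus> e2"
 have Kpow: "K1 [^]\<^bsub>K\<^esub> big = K1" "K0 [^]\<^bsub>K\<^esub> big = K0"
  using big_ge(2) by (simp_all add: K.nat_pow_zero)
 have p0: "a \<otimes> b \<in> \<pi> 0" if "a \<in> \<pi> 0" "b \<in> \<pi> 0" for a b using piece_mult[OF that] by simp
 have pw: "a [^] big \<in> \<pi> 0" if "a \<in> \<pi> 0" for a using piece_pow[OF that, of big] by simp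
 have e1: "e1 \<in> \<pi> 0" unfolding e1_def using y by (intro pw) auto
 have f1: "f1 \<in> \<pi> 0" unfolding f1_def using e1 piece_one by (intro G.piece_add)
 have z: "z \<in> \<pi> 0" unfolding z_def using f1 y by (intro p0) auto
 have e2: "e2 \<in> \<pi> 0" unfolding e2_def using z by (rule pw)
 have e3: "e3 \<in> \<pi> 0" unfolding e3_def using e1 e2 piece_one by (intro G.piece_add)
 note c [simp] = G.piece_closed[OF e1] G.piece_closed[OF f1] G.piece_closed[OF z]
  G.piece_closed[OF e2] G.piece_closed[OF e3] y(2)
 have e1_char: "coord Z e1 (Vertex w) = (if w = 1 then K1 else K0)" if "w \<in> {1, 2, 3}" for w
  using that y_char[of 1 w] Kpow coord_pow_Vertex[OF Z, of "y 1" w big] by (auto simp: e1_def)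
 have f1_char: "coord Z f1 (Vertex w) = (if w = 1 then K0 else K1)" if "w \<in> {1, 2, 3}" for w
  using that e1_char[of w] Z by (auto simp: f1_def coord_add coord_one_Vertex char_two)
 have z_char: "coord Z z (Vertex w) = (if w = 2 then K1 else K0)" if "w \<in> {1, 2, 3}" for w
  using that f1_char[of w] y_char[of 2 w] Z by (auto simp: z_def coord_mult_Vertex)
 have e2_char: "coord Z e2 (Vertex w) = (if w = 2 then K1 else K0)" if "w \<in> {1, 2, 3}" for w
  using that z_char[of w] Kpow coord_pow_Vertex[OF Z, of z w big] by (auto simp: e2_def)
 have e3_char: "coord Z e3 (Vertex w) = (if w = 3 then K1 else K0)" if "w \<in> {1, 2, 3}" for w
  using that e1_char[of w] e2_char[of w] Z by (auto simp: e3_def coord_add coord_one_Vertex char_two)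
 have e1e1: "e1 \<otimes> e1 = e1" unfolding e1_def
  using y_char[of 1] by (intro big_power_idempotent[OF Z]) auto
 have e2e2: "e2 \<otimes> e2 = e2" unfolding e2_def
  using z_char by (intro big_power_idempotent[OF Z]) auto
 have ef: "e1 \<otimes> f1 = \<zero>" "f1 \<otimes> e1 = \<zero>"
  using e1e1 by (simp_all add: f1_def l_distr r_distr)
 have e1z: "e1 \<otimes> z = \<zero>"
  unfolding z_def using ef(1) m_assoc[of e1 f1 "y 2 \<otimes> f1"] by simp
 have ze1: "z \<otimes> e1 = \<zero>"
  unfolding z_def using ef(2) by (simp add: m_assoc)
 obtain k where k: "big = Suc k" using big_ge(2) by (cases big) auto
 have e2_left: "e2 = z \<otimes> z [^] k"
  unfolding e2_def k using nat_pow_Suc2[of z k] by simp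
 have e1e2: "e1 \<otimes> e2 = \<zero>"
  unfolding e2_left using e1z m_assoc[of e1 z "z [^] k"] by simp
 have e2e1: "e2 \<otimes> e1 = \<zero>"
  unfolding e2_def k using ze1 by (simp add: m_assoc)
 have e3m: "e3 \<otimes> e1 = \<zero>" "e1 \<otimes> e3 = \<zero>" "e3 \<otimes> e2 = \<zero>" "e2 \<otimes> e3 = \<zero>" "e3 \<otimes> e3 = e3"
 proof -
  show "e3 \<otimes> e1 = \<zero>" "e1 \<otimes> e3 = \<zero>" "e3 \<otimes> e2 = \<zero>" "e2 \<otimes> e3 = \<zero>"
   using e1e1 e2e2 e1e2 e2e1 by (simp_all add: e3_def l_distr r_distr)
  then have "e3 \<otimes> (\<one> \<oplus> e1 \<oplus> e2) = e3" by (simp add: r_distr)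
  then show "e3 \<otimes> e3 = e3" by (simp add: e3_def)
 qed
 have sum: "e1 \<oplus> e2 \<oplus> e3 = \<one>"
  unfolding e3_def by (simp add: a_ac)
 define e where "e = (\<lambda>v :: nat. if v = 1 then e1 else if v = 2 then e2 else e3)"
 show thesis
 proof (rule that)
  show "e v \<in> \<pi> 0" if "v \<in> {1, 2, 3}" for v using e1 e2 e3 by (simp add: e_def)
  show "e v \<otimes> e w = (if v = w then e v else \<zero>)" if "v \<in> {1, 2, 3}" "w \<in> {1, 2, 3}" for v w
   using that e1e1 e2e2 e1e2 e2e1 e3m by (auto simp: e_def)
  show "coord Z (e v) (Vertex w) = (if v = w then K1 else K0)"
   if "v \<in> {1, 2, 3}" "w \<in> {1, 2, 3}" for v w
   using that e1_char[of w] e2_char[of w] e3_char[of w] by (auto simp: e_def)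
  show "e 1 \<oplus> e 2 \<oplus> e 3 = \<one>" using sum by (simp add: e_def)
 qed
qed

text \<open>
Two complete systems of orthogonal idempotents with the same characters are conjugate: with vertices
\<open>\<epsilon>\<^sub>v\<close> and idempotents \<open>e\<^sub>v\<close>, the element \<open>u = \<epsilon>\<^sub>1 e\<^sub>1 + \<epsilon>\<^sub>2 e\<^sub>2 + \<epsilon>\<^sub>3 e\<^sub>3\<close> is invertible and \<open>\<epsilon>\<^sub>v u = u e\<^sub>v\<close>. Conjugating the
frame with \<open>u\<close> makes its vertices homogeneous.
\<close>

lemma frame_with_homogeneous_vertices:
 assumes Z: "frame Z"
 obtains Z' where "frame Z'" "\<And>v. v \<in> {1, 2, 3} ==> Z' (Vertex v) \<in> \<pi> 0"
proof -
 obtain e :: "nat => 'a" where e: "\<And>v. v \<in> {1, 2, 3} ==> e v \<in> \<pi> 0"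
  and em: "\<And>v w. [|v \<in> {1, 2, 3}; w \<in> {1, 2, 3}|] ==> e v \<otimes> e w = (if v = w then e v else \<zero>)"
  and ec: "\<And>v w. [|v \<in> {1, 2, 3}; w \<in> {1, 2, 3}|] ==>
   coord Z (e v) (Vertex w) = (if v = w then K1 else K0)"
  by (rule degree_zero_idempotents[OF Z]) (rule that)
 define \<epsilon> where "\<epsilon> = (\<lambda>v. Z (Vertex v))"
 have c [simp]: "e v \<in> carrier A" "\<epsilon> v \<in> carrier A" if "v \<in> {1, 2, 3}" for v
  using e[OF that] G.piece_closed Z that by (auto simp: \<epsilon>_def)
 have \<epsilon>m: "\<epsilon> v \<otimes> \<epsilon> w = (if v = w then \<epsilon> v else \<zero>)" if "v \<in> {1, 2, 3}" "w \<in> {1, 2, 3}" for v w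
  using that Z frame_mult[OF Z, of "Vertex v" "Vertex w"] by (simp add: \<epsilon>_def)
 have \<epsilon>c: "coord Z (\<epsilon> v) (Vertex w) = (if v = w then K1 else K0)"
  if "v \<in> {1, 2, 3}" "w \<in> {1, 2, 3}" for v w
  using that coord_basis[OF Z, of "Vertex v" "Vertex w"] by (simp add: \<epsilon>_def)
 define u where "u = \<epsilon> 1 \<otimes> e 1 \<oplus> \<epsilon> 2 \<otimes> e 2 \<oplus> \<epsilon> 3 \<otimes> e 3"
 have u: "u \<in> carrier A" by (simp add: u_def)
 have u1: "coord Z u (Vertex v) = K1" if v: "v \<in> {1, 2, 3}" for v
  using v Z ec[of _ v] \<epsilon>c[of _ v] by (auto simp: u_def coord_add coord_mult_Vertex)
 define u' where "u' = u [^] (big - 1)"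
 have u': "u' \<in> carrier A" "u' \<otimes> u = \<one>" "u \<otimes> u' = \<one>"
  using unipotent_inverse[OF Z u u1] u by (simp_all add: u'_def)
 have ue: "\<epsilon> v \<otimes> u = u \<otimes> e v" if v: "v \<in> {1, 2, 3}" for v
 proof -
  have "\<epsilon> v \<otimes> u = \<epsilon> v \<otimes> e v"
   using v \<epsilon>m by (auto simp: u_def r_distr m_assoc[symmetric])
  moreover have "u \<otimes> e v = \<epsilon> v \<otimes> e v"
   using v em by (auto simp: u_def l_distr m_assoc)
  ultimately show ?thesis by simp
 qed
 have "u' \<otimes> (\<epsilon> v \<otimes> u) = e v" if v: "v \<in> {1, 2, 3}" for v
  using ue[OF v] u u' v by (simp add: m_assoc[symmetric])
 then show thesis
  using that[OF frame_conjugate[OF Z u u'(1,3,2)]] e by (simp add: \<epsilon>_def)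
qed

end

section \<open>Homogeneous monomial bases\<close>

declare One_nat_def [simp del]

context C_type_algebra
begin

lemma two_term_mult:
 assumes Z: "frame Z" and st: "s \<in> Mon" "t \<in> Mon" "s' \<in> Mon" "t' \<in> Mon"
  and k: "k \<in> carrier K" "l \<in> carrier K"
 shows "(Z s \<oplus> k \<odot> Z t) \<otimes> (Z s' \<oplus> l \<odot> Z t') =
  Z (mm r s s') \<oplus> l \<odot> Z (mm r s t') \<oplus> (k \<odot> Z (mm r t s') \<oplus> (k \<otimes>\<^bsub>K\<^esub> l) \<odot> Z (mm r t t'))"
proof -
 have "(Z s \<oplus> k \<odot> Z t) \<otimes> (Z s' \<oplus> l \<odot> Z t') =
  Z s \<otimes> Z s' \<oplus> l \<odot> (Z s \<otimes> Z t') \<oplus> (k \<odot> (Z t \<otimes> Z s') \<oplus> (k \<otimes>\<^bsub>K\<^esub> l) \<odot> (Z t \<otimes> Z t'))"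
 proof -
  have lk: "l \<odot> (k \<odot> z) = (k \<otimes>\<^bsub>K\<^esub> l) \<odot> z" if "z \<in> carrier A" for z
   using that k by (simp add: smult_assoc1[symmetric] K.m_comm)
  show ?thesis
   using Z st k by (simp add: l_distr r_distr smult_mult_left smult_mult_right smult_r_distr lk a_ac)
 qed
 then show ?thesis using Z st by (simp add: frame_mult)
qed

lemma two_term_mult_right:
 assumes Z: "frame Z" and st: "s \<in> Mon" "t \<in> Mon" "s' \<in> Mon"
  and k: "k \<in> carrier K"
 shows "(Z s \<oplus> k \<odot> Z t) \<otimes> Z s' = Z (mm r s s') \<oplus> k \<odot> Z (mm r t s')"
 using Z st k by (simp add: l_distr smult_mult_left frame_mult)

lemma two_term_eq:
 assumes Z: "frame Z" and x: "x \<in> carrier A" and st: "s \<in> Mon" "t \<in> Mon" "s \<noteq> t"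
  and supp: "\<And>b. [|b \<in> Mon; coord Z x b \<noteq> K0|] ==> b = s \<or> b = t"
  and 1: "coord Z x s = K1"
 shows "x = Z s \<oplus> coord Z x t \<odot> Z t"
proof (rule coord_eqI[OF Z x])
 show "Z s \<oplus> coord Z x t \<odot> Z t \<in> carrier A" using Z x st by simp
 fix b assume b: "b \<in> Mon"
 have "coord Z (Z s \<oplus> coord Z x t \<odot> Z t) b =
   (if s = b then K1 else K0) \<oplus>\<^bsub>K\<^esub> coord Z x t \<otimes>\<^bsub>K\<^esub> (if t = b then K1 else K0)"
  using Z x st b by (simp add: coord_add coord_smult coord_basis)
 moreover have "coord Z x b = K0" if "b \<noteq> s" "b \<noteq> t" using supp[OF b] that by blast
 ultimately show "coord Z x b = coord Z (Z s \<oplus> coord Z x t \<odot> Z t) b"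
  using 1 st Z x b by (cases "b = s"; cases "b = t") simp_all
qed

definition loop_power :: "nat => C_monomial" where
 "loop_power i = (if i < r then Loop i else Socle 3)"

lemma loop_power_in [simp]: "1 \<le> i ==> loop_power i \<in> Mon"
 by (simp add: loop_power_def)

lemma mm_loop_power:
 "[|1 \<le> i; i \<le> r; 1 \<le> j; j \<le> r|] ==>
  mm r (loop_power i) (loop_power j) = (if i + j \<le> r then loop_power (i + j) else Null)"
 by (auto simp: loop_power_def)

lemma loop_power_inj: "[|loop_power i = loop_power j; i \<le> r; j \<le> r|] ==> i = j"
 by (auto simp: loop_power_def split: if_splits)

lemma loop_element_power:
 assumes Z: "frame Z" and c: "c \<in> carrier A" and c1: "coord Z c (Loop 1) = K1"
  and supp: "\<And>b. [|b \<in> Mon; coord Z c b \<noteq> K0|] ==> \<exists>j\<ge>1. j \<le> r \<and> b = loop_power j"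
  and i: "1 \<le> i" "i \<le> r"
 shows "coord Z (c [^] i) (loop_power i) = K1"
  and "\<And>b. [|b \<in> Mon; coord Z (c [^] i) b \<noteq> K0|] ==> \<exists>j\<ge>i. j \<le> r \<and> b = loop_power j"
proof -
 have lp1: "loop_power 1 = Loop 1" using r by (simp add: loop_power_def)
 have "coord Z (c [^] i) (loop_power i) = K1 \<and>
  (\<forall>b\<in>Mon. coord Z (c [^] i) b \<noteq> K0 \<longrightarrow> (\<exists>j\<ge>i. j \<le> r \<and> b = loop_power j))"
  using i
 proof (induction i rule: nat_induct_at_least)
  case base
  then show ?case using c c1 supp lp1 by simp
 next
  case (Suc i)
  have ci: "c [^] i \<in> carrier A" using c by simp
  have IH1: "coord Z (c [^] i) (loop_power i) = K1"
   and IH2: "\<And>b. [|b \<in> Mon; coord Z (c [^] i) b \<noteq> K0|] ==> \<exists>j\<ge>i. j \<le> r \<and> b = loop_power j"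
   using Suc by auto
  have key: "\<exists>k k'. i \<le> k \<and> 1 \<le> k' \<and> k + k' \<le> r \<and> s = loop_power k \<and> t = loop_power k' \<and> mm r s t = loop_power (k + k')"
   if st: "s \<in> Mon" "t \<in> Mon" "coord Z (c [^] i) s \<noteq> K0" "coord Z c t \<noteq> K0"
    "mm r s t \<noteq> Null" for s t
  proof -
   obtain k where k: "i \<le> k" "k \<le> r" "s = loop_power k" using IH2[OF st(1,3)] by blast
   obtain k' where k': "1 \<le> k'" "k' \<le> r" "t = loop_power k'" using supp[OF st(2,4)] by blast
   have "1 \<le> k" using k Suc.hyps by simp
   from mm_loop_power[OF this k(2) k'(1,2)] st(5) k k' show ?thesis
    by (intro exI[of _ k] exI[of _ k']) (auto split: if_splits)
  qed
  have m: "mm r (loop_power i) (loop_power 1) = loop_power (Suc i)"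
   using mm_loop_power[of i 1] Suc by (simp add: Suc_eq_plus1)
  have "coord Z (c [^] i \<otimes> c) (mm r (loop_power i) (loop_power 1)) =
    coord Z (c [^] i) (loop_power i) \<otimes>\<^bsub>K\<^esub> coord Z c (loop_power 1)"
  proof (rule coord_mult_single[OF Z ci c])
   fix s t assume st: "s \<in> Mon" "t \<in> Mon"
    "mm r s t = mm r (loop_power i) (loop_power 1)"
    "coord Z (c [^] i) s \<noteq> K0" "coord Z c t \<noteq> K0"
   have "mm r s t \<noteq> Null" using st(3) m by (simp add: loop_power_def)
   from key[OF st(1,2,4,5) this] obtain k k' where k: "i \<le> k" "1 \<le> k'" "k + k' \<le> r"
    "s = loop_power k" "t = loop_power k'" "mm r s t = loop_power (k + k')" by blast
   have "k + k' = Suc i"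
    by (rule loop_power_inj) (use k st(3) m Suc.prems in auto)
   then have "k = i" "k' = 1" using k by auto
   with k show "s = loop_power i \<and> t = loop_power 1" by simp
  qed (use Suc m in auto)
  then have A: "coord Z (c [^] Suc i) (loop_power (Suc i)) = K1"
   using IH1 lp1 c1 m by simp
  have B: "\<exists>j\<ge>Suc i. j \<le> r \<and> b = loop_power j"
   if b: "b \<in> Mon" and nz: "coord Z (c [^] Suc i) b \<noteq> K0" for b
  proof -
   have nz': "coord Z (c [^] i \<otimes> c) b \<noteq> K0" using nz by simp
   obtain s t where st: "s \<in> Mon" "t \<in> Mon" "mm r s t = b"
    "coord Z (c [^] i) s \<noteq> K0" "coord Z c t \<noteq> K0"
    using coord_mult_support[OF Z ci c b nz'] by blast
   have "mm r s t \<noteq> Null" using st(3) b by auto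
   from key[OF st(1,2,4,5) this] obtain k k' where "i \<le> k" "1 \<le> k'" "k + k' \<le> r"
    "mm r s t = loop_power (k + k')" by blast
   then show ?thesis using st(3) by (intro exI[of _ "k + k'"]) auto
  qed
  from A B show ?case by blast
 qed
 then show "coord Z (c [^] i) (loop_power i) = K1"
  and "\<And>b. [|b \<in> Mon; coord Z (c [^] i) b \<noteq> K0|] ==> \<exists>j\<ge>i. j \<le> r \<and> b = loop_power j"
  by blast+
qed

text \<open>
The only other monomial with the source and target of the arrow number \<open>p\<close>.
\<close>

definition opposite_arc :: "nat => C_monomial" where
 "opposite_arc p = Arc ((3 * p) mod 4) 3"

lemma opposite_arc_simps [simp]:
 "opposite_arc 0 = Arc 0 3" "opposite_arc 1 = Arc 3 3" "opposite_arc (Suc 0) = Arc 3 3"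
 "opposite_arc 2 = Arc 2 3" "opposite_arc 3 = Arc 1 3"
 by (simp_all add: opposite_arc_def)

lemma opposite_arc_in [simp]: "opposite_arc p \<in> Mon"
 by (simp add: opposite_arc_def)

lemma less_four_cases: "p < 4 ==> p = 0 \<or> p = 1 \<or> p = 2 \<or> p = (3 :: nat)"
 by linarith

lemma parallel_to_arrow:
 assumes p: "p < 4" and b: "b \<in> Mon"
  and src: "monomial_source b = vertex_at p" and tgt: "monomial_target b = vertex_at (p + 1)"
 shows "b = Arc p 1 \<or> b = opposite_arc p"
proof (cases b)
 case (Arc q l)
 then have q: "q = 0 \<or> q = 1 \<or> q = 2 \<or> q = 3" and l: "l = 1 \<or> l = 2 \<or> l = 3"
  using b by auto
 have e: "vertex_at q = vertex_at p" "vertex_at (q + l) = vertex_at (p + 1)"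
  using src tgt Arc by auto
 from less_four_cases[OF p] show ?thesis
  using q l e unfolding Arc by (elim disjE) (simp_all add: vertex_at_def)
qed (use src tgt less_four_cases[OF p] in \<open>auto simp: vertex_at_def\<close>)

text \<open>
Adding to the arrows multiples of their opposites keeps all relations if the multiples agree on the two
pairs of arrows with zero product, because in characteristic 2 the two socle terms of such a product then
cancel. A loop with leading coefficient 1 keeps them as well, since its \<open>r\<close>-th power is unchanged.
\<close>

lemma modified_frame:
 assumes Z: "frame Z" and t: "\<And>p. t p \<in> carrier K" "t 3 = t 0" "t 2 = t 1"
  and c: "c \<in> carrier A" and c1: "coord Z c (Loop 1) = K1"
  and supp: "\<And>b. [|b \<in> Mon; coord Z c b \<noteq> K0|] ==> \<exists>j\<ge>1. j \<le> r \<and> b = loop_power j"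
 obtains Z' where "frame Z'" "\<And>v. Z' (Vertex v) = Z (Vertex v)"
  "\<And>p. p < 4 ==> Z' (Arc p 1) = Z (Arc p 1) \<oplus> t p \<odot> Z (opposite_arc p)"
  "Z' (Loop 1) = c"
proof -
 define e where "e = (\<lambda>v. Z (Vertex v))"
 define g where "g = (\<lambda>p. Z (Arc p 1) \<oplus> t p \<odot> Z (opposite_arc p))"
 have g_closed: "g p \<in> carrier A" if "p < 4" for p using that Z t by (simp add: g_def)
 have gg: "g p \<otimes> g q = Z (mm r (Arc p 1) (Arc q 1)) \<oplus> t q \<odot> Z (mm r (Arc p 1) (opposite_arc q)) \<oplus>
   (t p \<odot> Z (mm r (opposite_arc p) (Arc q 1)) \<oplus>
    (t p \<otimes>\<^bsub>K\<^esub> t q) \<odot> Z (mm r (opposite_arc p) (opposite_arc q)))" if "p < 4" "q < 4" for p q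
  unfolding g_def using that t(1) by (intro two_term_mult[OF Z]) auto
 have gb: "g p \<otimes> Z m = Z (mm r (Arc p 1) m) \<oplus> t p \<odot> Z (mm r (opposite_arc p) m)"
  if "p < 4" "m \<in> Mon" for p m
  unfolding g_def using that t(1) by (intro two_term_mult_right[OF Z]) auto
 have bin: "Z (Arc p l) \<in> carrier A" "Z (Socle v) \<in> carrier A"
  if "p < 4" "1 \<le> l" "l \<le> 3" "v \<in> {1, 2, 3}" for p l v using that Z by auto
 have gg2: "g p \<otimes> g ((p + 1) mod 4) = Z (Arc p 2)" if "p < 4" for p
  using less_four_cases[OF that] t Z gg[of 0 1] gg[of 1 2] gg[of 2 3] gg[of 3 0]
  by (elim disjE) (simp_all add: a_assoc)
 have gg3: "g p \<otimes> Z (Arc ((p + 1) mod 4) 2) = Z (Arc p 3)" if "p < 4" for p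
  using less_four_cases[OF that] t Z gb[of 0 "Arc 1 2"] gb[of 1 "Arc 2 2"] gb[of 2 "Arc 3 2"] gb[of 3 "Arc 0 2"]
  by (elim disjE) simp_all
 have gg4: "g p \<otimes> Z (Arc ((p + 1) mod 4) 3) = Z (Socle (vertex_at p))" if "p < 4" for p
  using less_four_cases[OF that] t Z gb[of 0 "Arc 1 3"] gb[of 1 "Arc 2 3"] gb[of 2 "Arc 3 3"] gb[of 3 "Arc 0 3"]
  by (elim disjE) simp_all
 have c_source: "e 3 \<otimes> c = c" and c_target: "c \<otimes> e 3 = c"
 proof -
  have st: "coord Z c b = K0"
   if "b \<in> Mon" "monomial_source b \<noteq> 3 \<or> monomial_target b \<noteq> 3" for b
  proof (rule ccontr)
   assume "coord Z c b \<noteq> K0"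
   from supp[OF that(1) this] that(2) show False by (auto simp: loop_power_def split: if_splits)
  qed
  show "e 3 \<otimes> c = c"
   by (rule coord_eqI[OF Z]) (use Z c st in \<open>auto simp: e_def coord_Vertex_mult\<close>)
  show "c \<otimes> e 3 = c"
   by (rule coord_eqI[OF Z]) (use Z c st in \<open>auto simp: e_def coord_mult_Vertex_right\<close>)
 qed
 have c_ann: "Z (Arc p l) \<otimes> c = \<zero>" "c \<otimes> Z (Arc p l) = \<zero>" if pl: "p < 4" "1 \<le> l" "l \<le> 3" for p l
 proof -
  have al: "Arc p l \<in> Mon" using pl by simp
  have a: "Z (Arc p l) \<in> carrier A" using Z al by simp
  have only: "s = Arc p l" if "s \<in> Mon" "coord Z (Z (Arc p l)) s \<noteq> K0" for s
   using that coord_basis[OF Z, of "Arc p l" s] al by (auto split: if_splits)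
  show "Z (Arc p l) \<otimes> c = \<zero>"
  proof (rule coord_eqI[OF Z])
   fix b assume b: "b \<in> Mon"
   have "coord Z (Z (Arc p l) \<otimes> c) b = K0"
   proof (rule ccontr)
    assume "coord Z (Z (Arc p l) \<otimes> c) b \<noteq> K0"
    from coord_mult_support[OF Z a c b this] obtain s t where "s \<in> Mon" "t \<in> Mon"
     "mm r s t = b" "coord Z (Z (Arc p l)) s \<noteq> K0" "coord Z c t \<noteq> K0" by blast
    with only supp b show False by (fastforce simp: loop_power_def split: if_splits)
   qed
   then show "coord Z (Z (Arc p l) \<otimes> c) b = coord Z \<zero> b" using b Z by simp
  qed (use a c in auto)
  show "c \<otimes> Z (Arc p l) = \<zero>"
  proof (rule coord_eqI[OF Z])
   fix b assume b: "b \<in> Mon"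
   have "coord Z (c \<otimes> Z (Arc p l)) b = K0"
   proof (rule ccontr)
    assume "coord Z (c \<otimes> Z (Arc p l)) b \<noteq> K0"
    from coord_mult_support[OF Z c a b this] obtain s t where "s \<in> Mon" "t \<in> Mon"
     "mm r s t = b" "coord Z c s \<noteq> K0" "coord Z (Z (Arc p l)) t \<noteq> K0" by blast
    with only supp b show False by (fastforce simp: loop_power_def split: if_splits)
   qed
   then show "coord Z (c \<otimes> Z (Arc p l)) b = coord Z \<zero> b" using b Z by simp
  qed (use a c in auto)
 qed
 have lpr: "loop_power r = Socle 3" by (simp add: loop_power_def)
 note cpow = loop_element_power[OF Z c c1 supp]
 have c_pow_r: "c [^] r = Z (Socle 3)"
 proof (rule coord_eqI[OF Z])
  fix b assume b: "b \<in> Mon"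
  have "coord Z (c [^] r) b = (if b = Socle 3 then K1 else K0)"
  proof (cases "b = Socle 3")
   case True
   then show ?thesis using cpow(1)[of r] r lpr by simp
  next
   case False
   have "coord Z (c [^] r) b = K0"
   proof (rule ccontr)
    assume "coord Z (c [^] r) b \<noteq> K0"
    then obtain j where "r \<le> j" "j \<le> r" "b = loop_power j" using cpow(2)[of r b] b r by auto
    with False lpr show False by simp
   qed
   with False show ?thesis by simp
  qed
  then show "coord Z (c [^] r) b = coord Z (Z (Socle 3)) b"
   using b Z coord_basis[OF Z, of "Socle 3" b] by auto
 qed (use c Z in auto)
 have arc01: "Arc 0 1 \<in> Mon" "Arc 1 1 \<in> Mon" "Arc 2 1 \<in> Mon" "Arc 3 1 \<in> Mon"
  by auto
 interpret gen: C_generators K A r e g c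
 proof (unfold_locales)
  show "e v \<otimes> e w = (if v = w then e v else \<zero>)" if "v \<in> {1, 2, 3}" "w \<in> {1, 2, 3}" for v w
   using that Z frame_mult[OF Z, of "Vertex v" "Vertex w"] by (simp add: e_def)
  show "e (vertex_at p) \<otimes> g p = g p" if "p < 4" for p
  proof -
   have "vertex_at (3 * p mod 4) = vertex_at p"
    using less_four_cases[OF that] by (auto simp: vertex_at_def)
   then show ?thesis
    using that vertex_at_in[of p] Z t(1) frame_mult[OF Z, of "Vertex (vertex_at p)"]
    by (simp add: e_def g_def r_distr smult_mult_right opposite_arc_def)
  qed
  show "g p \<otimes> e (vertex_at (p + 1)) = g p" if "p < 4" for p
  proof -
   have "vertex_at (3 * p + 3) = vertex_at (p + 1)"
    using less_four_cases[OF that] by (auto simp: vertex_at_def)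
   then show ?thesis
    using that vertex_at_in[of "p + 1"] Z gb[OF that, of "Vertex (vertex_at (p + 1))"]
    by (simp add: e_def g_def mm_Vertex_right opposite_arc_def)
  qed
  show "g 0 \<otimes> g 3 = \<zero>" using gg[of 0 3] Z t by simp
  show "g 2 \<otimes> g 1 = \<zero>" using gg[of 2 1] Z t by simp
  show "g 1 \<otimes> c = \<zero>"
   unfolding g_def using c_ann(1)[of 1 1] c_ann(1)[of 3 3] Z t(1) c by (simp add: l_distr smult_mult_left)
  show "c \<otimes> g 2 = \<zero>"
   unfolding g_def using c_ann(2)[of 2 1] c_ann(2)[of 2 3] Z t(1) c by (simp add: r_distr smult_mult_right)
  show "c [^] r = g 2 \<otimes> (g 3 \<otimes> (g 0 \<otimes> g 1))"
   using gg2[of 0] gg3[of 3] gg4[of 2] c_pow_r by simp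
  show "g 1 \<otimes> (g 2 \<otimes> (g 3 \<otimes> g 0)) = g 3 \<otimes> (g 0 \<otimes> (g 1 \<otimes> g 2))"
   using gg2[of 3] gg3[of 2] gg4[of 1] gg2[of 1] gg3[of 0] gg4[of 3] by simp
 qed (use g_closed c c_source c_target Z in \<open>auto simp: e_def\<close>)
 have gen_arc1: "gen.generated (Arc p 1) = g p" if "p < 4" for p
  using gen.cycle_path_one[of p] that by (simp add: gen.generated_def del: gen.cycle_path.simps One_nat_def)
 have gen_arc2: "gen.generated (Arc p 2) = Z (Arc p 2)" if "p < 4" for p
  using gen.cycle_path_add[of p 1 1] gen.cycle_path_one[of p] gen.cycle_path_one[of "p + 1"] gg2[OF that] that
  by (simp add: gen.generated_def del: gen.cycle_path.simps One_nat_def)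
 have gen_arc3: "gen.generated (Arc p 3) = Z (Arc p 3)" if "p < 4" for p
 proof -
  have "gen.cycle_path (p + 1) 2 = Z (Arc ((p + 1) mod 4) 2)"
   using gen_arc2[of "(p + 1) mod 4"] gen.cycle_path_mod[of "p + 1" 2]
   by (simp add: gen.generated_def del: gen.cycle_path.simps One_nat_def)
  then show ?thesis
   using gen.cycle_path_add[of p 1 2] gen.cycle_path_one[of p] gg3[OF that] that
   by (simp add: gen.generated_def del: gen.cycle_path.simps One_nat_def)
 qed
 have gen_socle: "gen.generated (Socle v) = Z (Socle v)" if v: "v \<in> {1, 2, 3}" for v
 proof -
  obtain p where p: "p < 4" "vertex_at p = v" using v by (auto intro: that[of 0] that[of 1] that[of 2])
  have "gen.cycle_path (p + 1) 3 = Z (Arc ((p + 1) mod 4) 3)"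
   using gen_arc3[of "(p + 1) mod 4"] gen.cycle_path_mod[of "p + 1" 3]
   by (simp add: gen.generated_def del: gen.cycle_path.simps One_nat_def)
  then have "gen.cycle_path p 4 = Z (Socle (vertex_at p))"
   using gen.cycle_path_add[of p 1 3] gen.cycle_path_one[of p] gg4[OF p(1)] p(1)
   by (simp del: gen.cycle_path.simps One_nat_def)
  then show ?thesis using gen.generated_Socle[OF p(1)] p(2) by simp
 qed
 have gen_loop: "gen.generated (Loop i) = c [^] i" for i by (simp add: gen.generated_def)
 have gen_vertex: "gen.generated (Vertex v) = Z (Vertex v)" for v
 proof -
  have "gen.generated (Vertex v) = e v" by (simp add: gen.generated_def)
  also have "\<dots> = Z (Vertex v)" by (simp add: e_def)
  finally show ?thesis .
 qed
 have cg: "coord Z (g p) b = (if b = Arc p 1 then K1 else K0) \<oplus>\<^bsub>K\<^esub>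
   t p \<otimes>\<^bsub>K\<^esub> (if b = opposite_arc p then K1 else K0)"
  if "p < 4" "b \<in> Mon" for p b
  unfolding g_def using that Z t(1) coord_basis[OF Z, of "Arc p 1" b] coord_basis[OF Z, of "opposite_arc p" b]
  by (auto simp: coord_add coord_smult)
 have cases_b: "(\<exists>p<4. b = Arc p 1) \<or> (\<exists>i. b = Loop i) \<or> gen.generated b = Z b"
  if b: "b \<in> Mon" for b
 proof (cases b)
  case (Arc p l)
  then have "p < 4" "l = 1 \<or> l = 2 \<or> l = 3" using b by auto
  then show ?thesis using Arc gen_arc2 gen_arc3 by auto
 qed (use b gen_vertex gen_socle in auto)
 have frame': "frame gen.generated"
 proof (rule frame_triangular[OF Z])
  fix b assume b: "b \<in> Mon"
  from cases_b[OF b] show "coord Z (gen.generated b) b = K1"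
  proof (elim disjE exE conjE)
   fix p assume "p < 4" "b = Arc p 1"
   then show ?thesis using cg[of p b] b gen_arc1[of p] t(1) by (simp add: opposite_arc_def)
  next
   fix i assume i: "b = Loop i"
   then show ?thesis using cpow(1)[of i] b by (simp add: gen_loop loop_power_def)
  next
   assume "gen.generated b = Z b"
   then show ?thesis using coord_basis[OF Z, of b b] b by simp
  qed
 next
  fix m b assume m: "m \<in> Mon" and b: "b \<in> Mon" and mb: "m \<noteq> b"
   and nz: "coord Z (gen.generated m) b \<noteq> K0"
  from cases_b[OF m] show "depth r m < depth r b"
  proof (elim disjE exE conjE)
   fix p assume p: "p < 4" "m = Arc p 1"
   then have "b = opposite_arc p" using cg[of p b] b gen_arc1[of p] t(1) nz mb by (auto split: if_splits)
   then show ?thesis using p by (simp add: opposite_arc_def)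
  next
   fix i assume i: "m = Loop i"
   then have "\<exists>j\<ge>i. j \<le> r \<and> b = loop_power j" using cpow(2)[of i b] m b nz by (simp add: gen_loop)
   then show ?thesis using i mb m by (auto simp: loop_power_def split: if_splits)
  next
   assume "gen.generated m = Z m"
   then show ?thesis using coord_basis[OF Z, of m b] m b mb nz by simp
  qed
 next
  show "gen.generated Null = \<zero>" by (simp add: gen.generated_def)
  show "gen.generated (Vertex 1) \<oplus> gen.generated (Vertex 2) \<oplus> gen.generated (Vertex 3) = \<one>"
   using frame_one[OF Z] by (simp only: gen_vertex)
 qed (use gen.generated_mult in auto)
 show thesis
 proof (rule that[OF frame' gen_vertex])
  show "gen.generated (Arc p 1) = Z (Arc p 1) \<oplus> t p \<odot> Z (opposite_arc p)" if "p < 4" for p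
   using gen_arc1[OF that] by (simp add: g_def)
  show "gen.generated (Loop 1) = c" using c by (simp add: gen_loop)
 qed
qed

end

context graded_C_type_algebra
begin

lemma homogeneous_arrow:
 assumes Z: "frame Z" and V: "\<And>v. v \<in> {1, 2, 3} ==> Z (Vertex v) \<in> \<pi> 0"
  and b: "b \<in> Mon"
 obtains n y where "y \<in> \<pi> n" "coord Z y b = K1"
  "\<And>m. [|m \<in> Mon; coord Z y m \<noteq> K0|] ==>
   monomial_source m = monomial_source b \<and> monomial_target m = monomial_target b"
proof -
 have "coord Z (Z b) b \<noteq> K0" using coord_basis[OF Z, of b b] b by simp
 then obtain n where n: "coord Z (G.part (Z b) n) b \<noteq> K0"
  using exists_part_coord[OF Z _ b, of "Z b"] Z b by auto
 define z where "z = G.part (Z b) n"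
 have z: "z \<in> \<pi> n" "z \<in> carrier A" using Z b by (auto simp: z_def)
 define k where "k = inv\<^bsub>K\<^esub> (coord Z z b)"
 have k: "k \<in> carrier K" "k \<otimes>\<^bsub>K\<^esub> coord Z z b = K1"
  using n Z b z K.field_Units K.Units_l_inv K.Units_inv_closed unfolding k_def z_def[symmetric] by auto
 let ?s = "monomial_source b" and ?t = "monomial_target b"
 have st: "?s \<in> {1, 2, 3}" "?t \<in> {1, 2, 3}" using b monomial_source_in monomial_target_in by auto
 define y where "y = k \<odot> (Z (Vertex ?s) \<otimes> (z \<otimes> Z (Vertex ?t)))"
 have cl: "Z (Vertex ?s) \<in> carrier A" "Z (Vertex ?t) \<in> carrier A" using V st G.piece_closed by blast+
 have "Z (Vertex ?s) \<otimes> (z \<otimes> Z (Vertex ?t)) \<in> \<pi> (0 + (n + 0))"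
  using V st z by (intro piece_mult) auto
 then have y: "y \<in> \<pi> n" unfolding y_def using k G.piece_smult by simp
 have cy: "coord Z y m = (if monomial_source m = ?s \<and> monomial_target m = ?t then k \<otimes>\<^bsub>K\<^esub> coord Z z m else K0)"
  if m: "m \<in> Mon" for m
  unfolding y_def using m k z cl st Z
  by (simp add: coord_smult[OF Z] coord_Vertex_mult[OF Z] coord_mult_Vertex_right[OF Z])
 show thesis
 proof (rule that[OF y])
  show "coord Z y b = K1" using cy[OF b] k by simp
  show "monomial_source m = ?s \<and> monomial_target m = ?t"
   if "m \<in> Mon" "coord Z y m \<noteq> K0" for m
   using cy[OF that(1)] that(2) by (auto split: if_splits)
 qed
qed

lemma homogeneous_cycle_arrow:
 assumes Z: "frame Z" and V: "\<And>v. v \<in> {1, 2, 3} ==> Z (Vertex v) \<in> \<pi> 0" and p: "p < 4"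
 shows "\<exists>n. \<exists>k\<in>carrier K. Z (Arc p 1) \<oplus> k \<odot> Z (opposite_arc p) \<in> \<pi> n"
proof -
 have b: "Arc p 1 \<in> Mon" using p by simp
 obtain n y where y: "y \<in> \<pi> n" "coord Z y (Arc p 1) = K1"
  "\<And>m. [|m \<in> Mon; coord Z y m \<noteq> K0|] ==>
   monomial_source m = monomial_source (Arc p 1) \<and> monomial_target m = monomial_target (Arc p 1)"
  using homogeneous_arrow[OF Z V b] by blast
 have yc: "y \<in> carrier A" using y(1) by (rule G.piece_closed)
 have "y = Z (Arc p 1) \<oplus> coord Z y (opposite_arc p) \<odot> Z (opposite_arc p)"
 proof (rule two_term_eq[OF Z yc b _ _ _ y(2)])
  fix m assume "m \<in> Mon" "coord Z y m \<noteq> K0"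
  with y(3) show "m = Arc p 1 \<or> m = opposite_arc p"
   by (intro parallel_to_arrow[OF p]) auto
 qed (auto simp: opposite_arc_def)
 with y(1) have "Z (Arc p 1) \<oplus> coord Z y (opposite_arc p) \<odot> Z (opposite_arc p) \<in> \<pi> n" by simp
 then show ?thesis using coord_closed[OF Z yc opposite_arc_in] by blast
qed

lemma homogeneous_loop:
 assumes Z: "frame Z" and V: "\<And>v. v \<in> {1, 2, 3} ==> Z (Vertex v) \<in> \<pi> 0"
 obtains n c where "c \<in> \<pi> n" "coord Z c (Loop 1) = K1"
  "\<And>b. [|b \<in> Mon; coord Z c b \<noteq> K0|] ==> \<exists>j\<ge>1. j \<le> r \<and> b = loop_power j"
proof -
 have b: "Loop 1 \<in> Mon" using r by simp
 obtain n y where y: "y \<in> \<pi> n" "coord Z y (Loop 1) = K1"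
  "\<And>m. [|m \<in> Mon; coord Z y m \<noteq> K0|] ==>
   monomial_source m = monomial_source (Loop 1) \<and> monomial_target m = monomial_target (Loop 1)"
  using homogeneous_arrow[OF Z V b] by blast
 have yc: "y \<in> carrier A" using y(1) by (rule G.piece_closed)
 define k where "k = coord Z y (Vertex 3)"
 have k: "k \<in> carrier K" using Z yc by (simp add: k_def)
 define c where "c = y \<oplus> k \<odot> Z (Vertex 3)"
 have c: "c \<in> \<pi> n"
 proof (cases "n = 0")
  case True
  then show ?thesis unfolding c_def using y(1) V[of 3] k by (intro G.piece_add G.piece_smult) auto
 next
  case False
  then have "k = K0" unfolding k_def using degree_nonzero_character[OF Z y(1)] by simp
  then show ?thesis unfolding c_def using y(1) yc Z by simp
 qed
 have cc: "coord Z c m = coord Z y m \<oplus>\<^bsub>K\<^esub> (if m = Vertex 3 then k else K0)"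
  if "m \<in> Mon" for m
  unfolding c_def using that Z yc k coord_basis[OF Z, of "Vertex 3" m]
  by (auto simp: coord_add coord_smult)
 show thesis
 proof (rule that[OF c])
  show "coord Z c (Loop 1) = K1" using cc[OF b] y(2) by simp
  fix m assume m: "m \<in> Mon" and nz: "coord Z c m \<noteq> K0"
  have nv: "m \<noteq> Vertex 3" using cc[OF m] nz k by (auto simp: k_def)
  then have "coord Z y m \<noteq> K0" using cc[OF m] nz Z yc m by auto
  from y(3)[OF m this] have st: "monomial_source m = 3" "monomial_target m = 3" by auto
  show "\<exists>j\<ge>1. j \<le> r \<and> m = loop_power j"
  proof (cases m)
   case (Arc q l)
   then have "q = 0 \<or> q = 1 \<or> q = 2 \<or> q = 3" "l = 1 \<or> l = 2 \<or> l = 3" using m by auto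
   then show ?thesis using st Arc by (elim disjE) (simp_all add: vertex_at_def)
  next
   case (Socle v)
   then show ?thesis using st r by (intro exI[of _ r]) (simp add: loop_power_def)
  next
   case (Loop i)
   then show ?thesis using m by (intro exI[of _ i]) (simp add: loop_power_def)
  qed (use nv st m in auto)
 qed
qed

text \<open>The vertices and the arrows generate the algebra, and products of homogeneous elements are homogeneous.\<close>

lemma homogeneous_if_arrows_homogeneous:
 assumes Z: "frame Z" and V: "\<And>v. v \<in> {1, 2, 3} ==> Z (Vertex v) \<in> \<pi> 0"
  and arrows: "\<And>b. b \<in> arrow_monomials ==> \<exists>n. Z b \<in> \<pi> n" and b: "b \<in> Mon"
 shows "\<exists>n. Z b \<in> \<pi> n"
 using b
proof (induction "depth r b" arbitrary: b rule: less_induct)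
 case less
 show ?case
 proof (cases "b \<in> arrow_monomials \<or> (\<exists>v. b = Vertex v)")
  case True
  then show ?thesis
  proof
   assume "\<exists>v. b = Vertex v"
   then obtain v where "b = Vertex v" "v \<in> {1, 2, 3}" using less.prems by auto
   then show ?thesis using V by blast
  qed (rule arrows)
 next
  case False
  then obtain s t where st: "s \<in> Mon" "t \<in> Mon" "depth r s > 0" "depth r t > 0"
   "mm r s t = b" using monomial_factorisation[OF less.prems _ _ r] by metis
  have "mm r s t \<noteq> Null" using st(5) less.prems by auto
  from depth_mm[OF this] st have "depth r s < depth r b" "depth r t < depth r b" by auto
  then obtain m n where "Z s \<in> \<pi> m" "Z t \<in> \<pi> n" using less.hyps st(1,2) by blast
  then have "Z s \<otimes> Z t \<in> \<pi> (m + n)" by (rule piece_mult)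
  then show ?thesis using frame_mult[OF Z st(1,2)] st(5) by auto
 qed
qed

text \<open>
If \<open>k0\<close> and \<open>k3\<close> differ, the product of the modified arrows 0 and 3 is a nonzero multiple of the socle element
at 1, which is also the product of all four modified arrows. Hence \<open>n1 + n2 = 0\<close>, the opposite path of arrow 0
has degree \<open>n0\<close>, and its coefficient can be changed at will. The pair of arrows 1 and 2 behaves in
the same way.
\<close>

lemma opposite_coefficients:
 assumes Z: "frame Z"
  and k: "k0 \<in> carrier K" "k1 \<in> carrier K" "k2 \<in> carrier K" "k3 \<in> carrier K"
  and a: "Z (Arc 0 1) \<oplus> k0 \<odot> Z (Arc 0 3) \<in> \<pi> n0" (is "?g0 \<in> _")
   "Z (Arc 1 1) \<oplus> k1 \<odot> Z (Arc 3 3) \<in> \<pi> n1" (is "?g1 \<in> _")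
   "Z (Arc 2 1) \<oplus> k2 \<odot> Z (Arc 2 3) \<in> \<pi> n2" (is "?g2 \<in> _")
   "Z (Arc 3 1) \<oplus> k3 \<odot> Z (Arc 1 3) \<in> \<pi> n3" (is "?g3 \<in> _")
 shows "Z (Arc 0 1) \<oplus> k3 \<odot> Z (Arc 0 3) \<in> \<pi> n0" "Z (Arc 1 1) \<oplus> k2 \<odot> Z (Arc 3 3) \<in> \<pi> n1"
proof -
 note g = G.piece_closed[OF a(1)] G.piece_closed[OF a(2)] G.piece_closed[OF a(3)] G.piece_closed[OF a(4)]
 have m3: "Arc 0 1 \<in> Mon" "Arc 1 1 \<in> Mon" "Arc 2 1 \<in> Mon" "Arc 3 1 \<in> Mon"
   "Arc 0 3 \<in> Mon" "Arc 1 3 \<in> Mon" "Arc 2 3 \<in> Mon" "Arc 3 3 \<in> Mon" by auto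
 have nz: "Z (Socle v) \<noteq> \<zero>" if "v \<in> {1, 2, 3}" for v
  using coord_basis[OF Z, of "Socle v" "Socle v"] Z that K.one_not_zero by (metis Socle_in_monomials coord_zero insertI2)
 have g03: "?g0 \<otimes> ?g3 = (k3 \<oplus>\<^bsub>K\<^esub> k0) \<odot> Z (Socle 1)"
  using two_term_mult[OF Z m3(1,5,4,6) k(1,4)] Z k by (simp add: smult_l_distr)
 have g21: "?g2 \<otimes> ?g1 = (k1 \<oplus>\<^bsub>K\<^esub> k2) \<odot> Z (Socle 3)"
  using two_term_mult[OF Z m3(3,7,2,8) k(3,2)] Z k by (simp add: smult_l_distr)
 have g01: "?g0 \<otimes> ?g1 = Z (Arc 0 2)"
  using two_term_mult[OF Z m3(1,5,2,8) k(1,2)] Z k by simp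
 have g012: "(?g0 \<otimes> ?g1) \<otimes> ?g2 = Z (Arc 0 3)"
 proof -
  have "Z (Arc 0 2) \<otimes> ?g2 = Z (Arc 0 3)"
   using Z k frame_mult[OF Z, of "Arc 0 2" "Arc 2 1"] frame_mult[OF Z, of "Arc 0 2" "Arc 2 3"]
   by (simp add: r_distr smult_mult_right)
  then show ?thesis using g01 by simp
 qed
 have g0123: "((?g0 \<otimes> ?g1) \<otimes> ?g2) \<otimes> ?g3 = Z (Socle 1)"
  unfolding g012 using Z k frame_mult[OF Z, of "Arc 0 3" "Arc 3 1"] frame_mult[OF Z, of "Arc 0 3" "Arc 1 3"]
  by (simp add: r_distr smult_mult_right)
 have g30: "(?g3 \<otimes> ?g0) \<otimes> ?g1 = Z (Arc 3 3)"
 proof -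
  have "(?g3 \<otimes> ?g0) \<otimes> ?g1 = ?g3 \<otimes> Z (Arc 0 2)" using g m_assoc[OF g(4,1,2)] g01 by simp
  then show ?thesis using two_term_mult_right[OF Z m3(4,6) _ k(4), of "Arc 0 2"] Z k by simp
 qed
 have g2301: "?g2 \<otimes> ((?g3 \<otimes> ?g0) \<otimes> ?g1) = Z (Socle 3)"
  unfolding g30 using two_term_mult_right[OF Z m3(3,7,8) k(3)] Z k by simp
 have deg012: "Z (Arc 0 3) \<in> \<pi> (n0 + n1 + n2)" using piece_mult[OF piece_mult[OF a(1,2)] a(3)] unfolding g012 .
 have deg0123: "Z (Socle 1) \<in> \<pi> (n0 + n1 + n2 + n3)" using piece_mult[OF piece_mult[OF piece_mult[OF a(1,2)] a(3)] a(4)] unfolding g0123 .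
 have deg301: "Z (Arc 3 3) \<in> \<pi> (n3 + n0 + n1)" using piece_mult[OF piece_mult[OF a(4,1)] a(2)] unfolding g30 .
 have deg2301: "Z (Socle 3) \<in> \<pi> (n2 + (n3 + n0 + n1))" using piece_mult[OF a(3) piece_mult[OF piece_mult[OF a(4,1)] a(2)]] unfolding g2301 .
 have unscale: "x \<in> \<pi> n" if "l \<odot> x \<in> \<pi> n" "l \<in> carrier K" "l \<noteq> K0" "x \<in> carrier A" for l x n
 proof -
  have "inv\<^bsub>K\<^esub> l \<in> carrier K" "inv\<^bsub>K\<^esub> l \<otimes>\<^bsub>K\<^esub> l = K1"
   using that K.field_Units K.Units_l_inv K.Units_inv_closed by auto
  then have "inv\<^bsub>K\<^esub> l \<odot> (l \<odot> x) = x" using that by (simp add: smult_assoc1[symmetric])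
  then show ?thesis using G.piece_smult[OF \<open>inv\<^bsub>K\<^esub> l \<in> carrier K\<close> that(1)] by simp
 qed
 have adjust: "x \<oplus> l' \<odot> y \<in> \<pi> n"
  if "x \<oplus> l \<odot> y \<in> \<pi> n" "y \<in> \<pi> n" "l \<in> carrier K" "l' \<in> carrier K" "x \<in> carrier A" for x y l l' n
 proof -
  have y: "y \<in> carrier A" using that(2) by (rule G.piece_closed)
  have "(x \<oplus> l \<odot> y) \<oplus> (l \<odot> y \<oplus> l' \<odot> y) = x \<oplus> l' \<odot> y"
   using that y by (simp add: a_assoc)
  moreover have "(x \<oplus> l \<odot> y) \<oplus> (l \<odot> y \<oplus> l' \<odot> y) \<in> \<pi> n"
   by (rule G.piece_add[OF that(1) G.piece_add[OF G.piece_smult[OF that(3,2)] G.piece_smult[OF that(4,2)]]])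
  ultimately show ?thesis by (simp only:)
 qed
 show "Z (Arc 0 1) \<oplus> k3 \<odot> Z (Arc 0 3) \<in> \<pi> n0"
 proof (cases "k0 = k3")
  case False
  then have ne: "k3 \<oplus>\<^bsub>K\<^esub> k0 \<noteq> K0" using K_add_eq_zero[OF k(4,1)] by auto
  have sc: "(k3 \<oplus>\<^bsub>K\<^esub> k0) \<odot> Z (Socle 1) \<in> \<pi> (n0 + n3)"
   using piece_mult[OF a(1,4)] unfolding g03 .
  have "Z (Socle 1) \<in> \<pi> (n0 + n3)"
   by (rule unscale[OF sc K.a_closed[OF k(4,1)] ne frame_closed[OF Z]]) simp
  then have "n0 + n3 = n0 + n1 + n2 + n3" by (rule G.piece_disjoint[OF _ deg0123]) (simp add: nz)
  then have "n0 + n1 + n2 = n0" by linarith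
  then have "Z (Arc 0 3) \<in> \<pi> n0" using deg012 by (simp only:)
  then show ?thesis using frame_closed[OF Z m3(1)] by (intro adjust[OF a(1) _ k(1,4)])
 qed (use a in simp)
 show "Z (Arc 1 1) \<oplus> k2 \<odot> Z (Arc 3 3) \<in> \<pi> n1"
 proof (cases "k1 = k2")
  case False
  then have ne: "k1 \<oplus>\<^bsub>K\<^esub> k2 \<noteq> K0" using K_add_eq_zero[OF k(2,3)] by auto
  have sc: "(k1 \<oplus>\<^bsub>K\<^esub> k2) \<odot> Z (Socle 3) \<in> \<pi> (n2 + n1)"
   using piece_mult[OF a(3,2)] unfolding g21 .
  have "Z (Socle 3) \<in> \<pi> (n2 + n1)"
   by (rule unscale[OF sc K.a_closed[OF k(2,3)] ne frame_closed[OF Z]]) simp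
  then have "n2 + n1 = n2 + (n3 + n0 + n1)" by (rule G.piece_disjoint[OF _ deg2301]) (simp add: nz)
  then have "n3 + n0 + n1 = n1" by linarith
  then have "Z (Arc 3 3) \<in> \<pi> n1" using deg301 by (simp only:)
  then show ?thesis using frame_closed[OF Z m3(2)] by (intro adjust[OF a(2) _ k(2,3)])
 qed (use a in simp)
qed

theorem homogeneous_frame:
 assumes Z: "frame Z"
 obtains Z' where "frame Z'" "\<And>b. b \<in> Mon ==> \<exists>n. Z' b \<in> \<pi> n"
proof -
 obtain \<gamma> where \<gamma>: "frame \<gamma>" and V: "\<And>v. v \<in> {1, 2, 3} ==> \<gamma> (Vertex v) \<in> \<pi> 0"
  using frame_with_homogeneous_vertices[OF Z] by blast
 obtain k0 n0 where 0: "k0 \<in> carrier K" "\<gamma> (Arc 0 1) \<oplus> k0 \<odot> \<gamma> (Arc 0 3) \<in> \<pi> n0"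
  using homogeneous_cycle_arrow[OF \<gamma> V, of 0] by auto
 obtain k1 n1 where 1: "k1 \<in> carrier K" "\<gamma> (Arc 1 1) \<oplus> k1 \<odot> \<gamma> (Arc 3 3) \<in> \<pi> n1"
  using homogeneous_cycle_arrow[OF \<gamma> V, of 1] by auto
 obtain k2 n2 where 2: "k2 \<in> carrier K" "\<gamma> (Arc 2 1) \<oplus> k2 \<odot> \<gamma> (Arc 2 3) \<in> \<pi> n2"
  using homogeneous_cycle_arrow[OF \<gamma> V, of 2] by auto
 obtain k3 n3 where 3: "k3 \<in> carrier K" "\<gamma> (Arc 3 1) \<oplus> k3 \<odot> \<gamma> (Arc 1 3) \<in> \<pi> n3"
  using homogeneous_cycle_arrow[OF \<gamma> V, of 3] by auto
 note opp = opposite_coefficients[OF \<gamma> 0(1) 1(1) 2(1) 3(1) 0(2) 1(2) 2(2) 3(2)]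
 obtain n c where c: "c \<in> \<pi> n" "coord \<gamma> c (Loop 1) = K1"
  "\<And>b. [|b \<in> Mon; coord \<gamma> c b \<noteq> K0|] ==> \<exists>j\<ge>1. j \<le> r \<and> b = loop_power j"
  using homogeneous_loop[OF \<gamma> V] by metis
 define t where "t = (\<lambda>p :: nat. if p = 0 \<or> p = 3 then k3 else k2)"
 obtain \<delta> where \<delta>: "frame \<delta>" "\<And>v. \<delta> (Vertex v) = \<gamma> (Vertex v)"
  "\<And>p. p < 4 ==> \<delta> (Arc p 1) = \<gamma> (Arc p 1) \<oplus> t p \<odot> \<gamma> (opposite_arc p)" "\<delta> (Loop 1) = c"
 proof (rule modified_frame[OF \<gamma>, of t c])
  show "c \<in> carrier A" using c(1) by (rule G.piece_closed)
  show "coord \<gamma> c (Loop 1) = K1" by (rule c(2))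
  show "\<exists>j\<ge>1. j \<le> r \<and> b = loop_power j"
   if "b \<in> Mon" "coord \<gamma> c b \<noteq> K0" for b by (rule c(3)[OF that])
  show "t p \<in> carrier K" for p using 2(1) 3(1) by (simp add: t_def)
  show "t 3 = t 0" "t 2 = t 1" by (simp_all add: t_def)
 qed (rule that)
 have "\<exists>n. \<delta> b \<in> \<pi> n" if "b \<in> Mon" for b
 proof (rule homogeneous_if_arrows_homogeneous[OF \<delta>(1) _ _ that])
  show "\<delta> (Vertex v) \<in> \<pi> 0" if "v \<in> {1, 2, 3}" for v using V[OF that] \<delta>(2) by simp
  fix b assume "b \<in> arrow_monomials"
  moreover have "\<exists>n. \<delta> (Arc 0 1) \<in> \<pi> n" using \<delta>(3)[of 0] opp(1) by (auto simp: t_def)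
  moreover have "\<exists>n. \<delta> (Arc 1 1) \<in> \<pi> n" using \<delta>(3)[of 1] opp(2) by (auto simp: t_def)
  moreover have "\<exists>n. \<delta> (Arc 2 1) \<in> \<pi> n" using \<delta>(3)[of 2] 2(2) by (auto simp: t_def)
  moreover have "\<exists>n. \<delta> (Arc 3 1) \<in> \<pi> n" using \<delta>(3)[of 3] 3(2) by (auto simp: t_def)
  moreover have "\<exists>n. \<delta> (Loop 1) \<in> \<pi> n" using \<delta>(4) c(1) by auto
  ultimately show "\<exists>n. \<delta> b \<in> \<pi> n" by (auto simp: arrow_monomials_def)
 qed
 then show thesis using that \<delta>(1) by blast
qed

end

declare One_nat_def [simp]

section \<open>Standard gradings\<close>

lemma (in decomposed) piece_finsum:
 "(\<And>i. i \<in> I ==> f i \<in> \<gamma> n) ==> (\<Oplus>i\<in>I. f i) \<in> \<gamma> n"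
proof (induction I rule: infinite_finite_induct)
 case (insert i I)
 then have "f \<in> I \<rightarrow> carrier V" "f i \<in> carrier V" using piece_closed by auto
 then show ?case using insert by (simp add: piece_add)
qed auto

context C_type_algebra
begin

definition standard_grading :: "(C_monomial => 'a) => (C_monomial => int) => int => 'a set" where
 "standard_grading Z d = (\<lambda>n. {x \<in> carrier A. \<forall>b\<in>Mon. coord Z x b \<noteq> K0 \<longrightarrow> d b = n})"

lemma standard_grading_cong:
 "(\<And>b. b \<in> Mon ==> d b = d' b) ==> standard_grading Z d = standard_grading Z d'"
 by (simp add: standard_grading_def)

lemma standard_grading_basis:
 "[|frame Z; b \<in> Mon|] ==> Z b \<in> standard_grading Z d (d b)"
 by (auto simp: standard_grading_def coord_basis split: if_splits)

lemma standard_grading_decomposition: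
 assumes Z: "frame Z"
 shows "direct_decomposition K A (standard_grading Z d)"
 unfolding standard_grading_def
proof (rule direct_decomposition_by_basis[OF vectorspace finite_monomials])
 fix f assume f: "\<And>b. b \<in> Mon ==> f b \<in> carrier K"
 then show "\<exists>x\<in>carrier A. \<forall>b\<in>Mon. coord Z x b = f b"
  using coord_comb[OF Z, of f] comb_closed[of Z f] Z by (intro bexI[of _ "comb Z f"]) auto
qed (use Z coord_eqI[OF Z] in \<open>auto simp: coord_add coord_smult\<close>)

lemma standard_grading_in_gradings:
 assumes Z: "frame Z" and d: "degree_function r d"
 shows "standard_grading Z d \<in> gradings K A"
 unfolding gradings_def
proof (intro CollectI conjI allI ballI)
 show "direct_decomposition K A (standard_grading Z d)" by (rule standard_grading_decomposition[OF Z])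
 fix i j x y assume x: "x \<in> standard_grading Z d i" and y: "y \<in> standard_grading Z d j"
 have xy: "x \<in> carrier A" "y \<in> carrier A" using x y by (auto simp: standard_grading_def)
 have "d b = i + j" if b: "b \<in> Mon" and nz: "coord Z (x \<otimes> y) b \<noteq> K0" for b
 proof -
  obtain s t where st: "s \<in> Mon" "t \<in> Mon" "mm r s t = b"
   "coord Z x s \<noteq> K0" "coord Z y t \<noteq> K0"
   using coord_mult_support[OF Z xy b nz] by blast
  have "mm r s t \<noteq> Null" using st(3) b by auto
  from degree_functionD[OF d st(1,2) this] st x y show ?thesis by (simp add: standard_grading_def)
 qed
 then show "x \<otimes> y \<in> standard_grading Z d (i + j)" using xy by (simp add: standard_grading_def)
qed

lemma basis_nonzero: "[|frame Z; b \<in> Mon|] ==> Z b \<noteq> \<zero>"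
 using coord_basis[of Z b b] coord_zero[of Z b] by (metis K.one_not_zero insertI2)

lemma gradings_are_standard:
 assumes Z0: "frame Z0" and \<pi>: "\<pi> \<in> gradings K A"
 obtains Z d where "frame Z" "degree_function r d" "\<pi> = standard_grading Z d"
proof -
 interpret gr: graded_C_type_algebra K A r \<pi> by unfold_locales fact
 obtain Z where Z: "frame Z" and hom: "\<And>b. b \<in> Mon ==> \<exists>n. Z b \<in> \<pi> n"
  using gr.homogeneous_frame[OF Z0] by blast
 obtain d where d: "\<And>b. b \<in> Mon ==> Z b \<in> \<pi> (d b)" using hom by metis
 have deg: "degree_function r d"
  unfolding degree_function_def
 proof (intro ballI impI)
  fix s t assume st: "s \<in> Mon" "t \<in> Mon" and nz: "mm r s t \<noteq> Null"
  have m: "mm r s t \<in> Mon" using mm_closed[OF st] nz by simp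
  have "Z (mm r s t) \<in> \<pi> (d s + d t)"
   using gr.piece_mult[OF d[OF st(1)] d[OF st(2)]] frame_mult[OF Z st] by simp
  from gr.G.piece_disjoint[OF d[OF m] this basis_nonzero[OF Z m]] show "d (mm r s t) = d s + d t" .
 qed
 have "\<pi> = standard_grading Z d"
 proof (rule decomposition_eqI[OF gr.G.decomposed_axioms])
  show "decomposed K A (standard_grading Z d)"
   using standard_grading_decomposition[OF Z] by (simp add: decomposed_def)
  fix n show "standard_grading Z d n \<subseteq> \<pi> n"
  proof
   fix x assume x: "x \<in> standard_grading Z d n"
   then have xc: "x \<in> carrier A" and xn: "\<And>b. b \<in> Mon ==> coord Z x b \<noteq> K0 ==> d b = n"
    by (auto simp: standard_grading_def)
   have "(\<Oplus>b\<in>Mon. coord Z x b \<odot> Z b) \<in> \<pi> n"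
   proof (rule gr.G.piece_finsum)
    fix b assume b: "b \<in> Mon"
    show "coord Z x b \<odot> Z b \<in> \<pi> n"
    proof (cases "coord Z x b = K0")
     case True
     then show ?thesis using b Z by simp
    next
     case False
     with xn[OF b] d[OF b] have "Z b \<in> \<pi> n" by simp
     then show ?thesis using coord_closed[OF Z xc b] by (intro gr.G.piece_smult)
    qed
   qed
   then show "x \<in> \<pi> n" using coord_spec(2)[OF Z xc] by (simp add: comb_def)
  qed
 qed
 with Z deg that show thesis by blast
qed

subsection \<open>Change of frame as an automorphism\<close>

lemma frame_isomorphism:
 assumes Z: "frame Z" and Z': "frame Z'"
 shows "graded_algebras_isomorphic K A (standard_grading Z' d) A (standard_grading Z d)"
proof -
 define \<phi> where "\<phi> = (\<lambda>x. comb Z (coord Z' x))"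
 have \<phi>_closed: "\<phi> x \<in> carrier A" if "x \<in> carrier A" for x
  unfolding \<phi>_def using that Z Z' by (intro comb_closed) auto
 have co: "coord Z (\<phi> x) b = coord Z' x b" if "x \<in> carrier A" "b \<in> Mon" for x b
  unfolding \<phi>_def using that Z Z' by (intro coord_comb) auto
 have inj: "inj_on \<phi> (carrier A)"
  by (rule inj_onI, rule coord_eqI[OF Z']) (auto simp: co[symmetric])
 have surj: "\<exists>x\<in>carrier A. \<phi> x = y" if y: "y \<in> carrier A" for y
 proof -
  let ?x = "comb Z' (coord Z y)"
  have x: "?x \<in> carrier A" using y Z Z' by (intro comb_closed) auto
  have "\<phi> ?x = y"
  proof (rule coord_eqI[OF Z \<phi>_closed[OF x] y])
   fix b assume b: "b \<in> Mon"
   show "coord Z (\<phi> ?x) b = coord Z y b"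
    unfolding co[OF x b] by (rule coord_comb[OF Z' coord_closed[OF Z y] b])
  qed
  with x show ?thesis by blast
 qed
 have \<phi>_add: "\<phi> (x \<oplus> y) = \<phi> x \<oplus> \<phi> y" if "x \<in> carrier A" "y \<in> carrier A" for x y
  using that \<phi>_closed co Z Z' by (intro coord_eqI[OF Z]) (auto simp: coord_add)
 have \<phi>_smult: "\<phi> (c \<odot> x) = c \<odot> \<phi> x" if "x \<in> carrier A" "c \<in> carrier K" for c x
  using that \<phi>_closed co Z Z' by (intro coord_eqI[OF Z]) (auto simp: coord_smult)
 have \<phi>_mult: "\<phi> (x \<otimes> y) = \<phi> x \<otimes> \<phi> y" if x: "x \<in> carrier A" and y: "y \<in> carrier A" for x y
 proof (rule coord_eqI[OF Z])
  fix b assume b: "b \<in> Mon"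
  have "coord Z (\<phi> (x \<otimes> y)) b = coord Z' (x \<otimes> y) b" using x y b by (intro co) auto
  also have "\<dots> = coord Z (\<phi> x \<otimes> \<phi> y) b"
   unfolding coord_mult[OF Z' x y b] coord_mult[OF Z \<phi>_closed[OF x] \<phi>_closed[OF y] b]
   by (intro K.finsum_cong' refl)
    (auto simp: co[OF x] co[OF y] coord_closed[OF Z' x] coord_closed[OF Z' y] intro!: K.finsum_closed)
  finally show "coord Z (\<phi> (x \<otimes> y)) b = coord Z (\<phi> x \<otimes> \<phi> y) b" .
 qed (use x y \<phi>_closed in auto)
 have \<phi>_basis: "\<phi> (Z' m) = Z m" if m: "m \<in> Mon" for m
  using m \<phi>_closed co Z Z' by (intro coord_eqI[OF Z]) (auto simp: coord_basis)
 have \<phi>_one: "\<phi> \<one> = \<one>"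
 proof -
  have "\<phi> \<one> = \<phi> (Z' (Vertex 1)) \<oplus> \<phi> (Z' (Vertex 2)) \<oplus> \<phi> (Z' (Vertex 3))"
   unfolding frame_one[OF Z', symmetric] using Z' by (simp add: \<phi>_add)
  then show ?thesis using frame_one[OF Z] by (simp add: \<phi>_basis)
 qed
 have iso: "\<phi> \<in> ring_iso A A"
 proof (rule ring_iso_memI)
  show "bij_betw \<phi> (carrier A) (carrier A)"
   unfolding bij_betw_def using inj surj \<phi>_closed by blast
 qed (use \<phi>_closed \<phi>_mult \<phi>_add \<phi>_one in auto)
 have pieces: "\<phi> ` standard_grading Z' d i = standard_grading Z d i" for i
 proof
  show "\<phi> ` standard_grading Z' d i \<subseteq> standard_grading Z d i"
   using \<phi>_closed co by (auto simp: standard_grading_def)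
  show "standard_grading Z d i \<subseteq> \<phi> ` standard_grading Z' d i"
  proof
   fix y assume y: "y \<in> standard_grading Z d i"
   then obtain x where "x \<in> carrier A" "\<phi> x = y" using surj by (auto simp: standard_grading_def)
   with y co show "y \<in> \<phi> ` standard_grading Z' d i"
    by (intro image_eqI[of _ _ x]) (auto simp: standard_grading_def)
  qed
 qed
 show ?thesis unfolding graded_algebras_isomorphic_def using iso \<phi>_smult pieces by blast
qed

text \<open>
An isomorphism carries a frame to a frame.
\<close>

lemma isomorphic_grading_standard:
 assumes Z: "frame Z" and iso: "graded_algebras_isomorphic K A (standard_grading Z d) A \<pi>"
 obtains Z' where "frame Z'" "\<pi> = standard_grading Z' d"
proof -
 obtain \<phi> where \<phi>: "\<phi> \<in> ring_iso A A"
  and sm: "\<And>c x. [|c \<in> carrier K; x \<in> carrier A|] ==> \<phi> (c \<odot> x) = c \<odot> \<phi> x"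
  and pieces: "\<And>i. \<phi> ` standard_grading Z d i = \<pi> i"
  using iso unfolding graded_algebras_isomorphic_def by blast
 have h: "\<phi> \<in> ring_hom A A" and bij: "bij_betw \<phi> (carrier A) (carrier A)"
  using \<phi> by (auto simp: ring_iso_def)
 have closed: "\<phi> x \<in> carrier A" if "x \<in> carrier A" for x using ring_hom_closed[OF h that] .
 have zero: "\<phi> \<zero> = \<zero>" using sm[of "K0" \<zero>] closed[of \<zero>] by simp
 have comb: "comb (\<lambda>b. \<phi> (Z b)) f = \<phi> (comb Z f)" if f: "\<And>b. b \<in> Mon ==> f b \<in> carrier K" for f
 proof -
  have "\<phi> (comb Z f) = (\<Oplus>b\<in>Mon. \<phi> (f b \<odot> Z b))"
   unfolding comb_def using Z f closed ring_hom_add[OF h] zero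
   by (intro finsum_additive abelian_monoid_axioms) auto
  also have "\<dots> = comb (\<lambda>b. \<phi> (Z b)) f"
   unfolding comb_def using Z f closed sm by (intro finsum_cong') auto
  finally show ?thesis by simp
 qed
 have Z': "frame (\<lambda>b. \<phi> (Z b))"
 proof (rule frame_combI)
  show "\<phi> (Z s) \<otimes> \<phi> (Z t) = \<phi> (Z (mm r s t))" if "s \<in> Mon" "t \<in> Mon" for s t
   using that Z ring_hom_mult[OF h, of "Z s" "Z t"] by (simp add: frame_mult)
  have "\<phi> (Z (Vertex 1) \<oplus> Z (Vertex 2) \<oplus> Z (Vertex 3)) = \<one>"
   using frame_one[OF Z] ring_hom_one[OF h] by simp
  then show "\<phi> (Z (Vertex 1)) \<oplus> \<phi> (Z (Vertex 2)) \<oplus> \<phi> (Z (Vertex 3)) = \<one>"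
   using Z by (simp add: ring_hom_add[OF h])
  show "\<exists>f\<in>Mon \<rightarrow> carrier K. comb (\<lambda>b. \<phi> (Z b)) f = x" if x: "x \<in> carrier A" for x
  proof -
   have "x \<in> \<phi> ` carrier A" using bij x by (simp add: bij_betw_def)
   then obtain y where y: "y \<in> carrier A" "\<phi> y = x" by blast
   have "comb (\<lambda>b. \<phi> (Z b)) (coord Z y) = x"
    using comb[of "coord Z y"] y coord_spec(2)[OF Z y(1)] coord_closed[OF Z y(1)] by simp
   then show ?thesis using coord_closed[OF Z y(1)] by blast
  qed
  fix f b assume f: "f \<in> Mon \<rightarrow> carrier K" and 0: "comb (\<lambda>b. \<phi> (Z b)) f = \<zero>"
   and b: "b \<in> Mon"
  have fc: "\<And>b. b \<in> Mon ==> f b \<in> carrier K" using f by auto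
  have cb: "comb Z f \<in> carrier A" using Z fc by (intro comb_closed) auto
  have "\<phi> (comb Z f) = \<phi> \<zero>" using comb[OF fc] 0 zero by simp
  then have "comb Z f = \<zero>"
   using bij cb unfolding bij_betw_def inj_on_def by blast
  moreover have "coord Z (comb Z f) b = f b" by (rule coord_comb[OF Z fc b])
  ultimately show "f b = K0" using Z b by simp
 qed (use Z closed zero in auto)
 have co: "coord (\<lambda>b. \<phi> (Z b)) (\<phi> x) b = coord Z x b" if x: "x \<in> carrier A" and b: "b \<in> Mon" for x b
 proof -
  have "\<phi> x = comb (\<lambda>b. \<phi> (Z b)) (coord Z x)"
   using comb[of "coord Z x"] coord_closed[OF Z x] coord_spec(2)[OF Z x] by simp
  then show ?thesis using coord_comb[OF Z', of "coord Z x" b] coord_closed[OF Z x] b by simp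
 qed
 have "\<pi> i = standard_grading (\<lambda>b. \<phi> (Z b)) d i" for i
 proof -
  have "y \<in> \<pi> i \<longleftrightarrow> y \<in> standard_grading (\<lambda>b. \<phi> (Z b)) d i" for y
  proof
   assume "y \<in> \<pi> i"
   then obtain x where "x \<in> standard_grading Z d i" "y = \<phi> x" using pieces by blast
   then show "y \<in> standard_grading (\<lambda>b. \<phi> (Z b)) d i"
    using closed co by (auto simp: standard_grading_def)
  next
   assume y: "y \<in> standard_grading (\<lambda>b. \<phi> (Z b)) d i"
   then have "y \<in> \<phi> ` carrier A" using bij by (simp add: bij_betw_def standard_grading_def)
   then obtain x where x: "x \<in> carrier A" "y = \<phi> x" by blast
   then have "x \<in> standard_grading Z d i" using y co by (auto simp: standard_grading_def)
   then show "y \<in> \<pi> i" using x pieces by blast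
  qed
  then show ?thesis by blast
 qed
 then show thesis using that[OF Z'] by blast
qed

subsection \<open>Degrees of the arrows are invariants\<close>

lemma coord_arrow_left:
 assumes Z: "frame Z" and x: "x \<in> carrier A" and y: "y \<in> carrier A" and m: "m \<in> arrow_monomials"
  and y0: "\<And>v. v \<in> {1, 2, 3} ==> coord Z y (Vertex v) = K0"
 shows "coord Z (x \<otimes> y) m = coord Z x (Vertex (monomial_source m)) \<otimes>\<^bsub>K\<^esub> coord Z y m"
proof -
 note mm = arrow_in_monomials[OF r m]
 have eq: "mm r (Vertex (monomial_source m)) m = m" by simp
 have "coord Z (x \<otimes> y) (mm r (Vertex (monomial_source m)) m) =
   coord Z x (Vertex (monomial_source m)) \<otimes>\<^bsub>K\<^esub> coord Z y m"
 proof (rule coord_mult_single[OF Z x y])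
  fix s t assume st: "s \<in> Mon" "t \<in> Mon" "mm r s t = mm r (Vertex (monomial_source m)) m"
   "coord Z y t \<noteq> K0"
  then show "s = Vertex (monomial_source m) \<and> t = m"
   using mm_eq_arrow[OF st(1,2) m r] y0[OF monomial_target_in[OF mm]] eq by auto
 qed (use mm monomial_source_in[OF mm] in auto)
 then show ?thesis using eq by simp
qed

lemma coord_arrow_right:
 assumes Z: "frame Z" and x: "x \<in> carrier A" and y: "y \<in> carrier A" and m: "m \<in> arrow_monomials"
  and x0: "\<And>v. v \<in> {1, 2, 3} ==> coord Z x (Vertex v) = K0"
 shows "coord Z (x \<otimes> y) m = coord Z x m \<otimes>\<^bsub>K\<^esub> coord Z y (Vertex (monomial_target m))"
proof -
 note mm = arrow_in_monomials[OF r m]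
 have eq: "mm r m (Vertex (monomial_target m)) = m" by (simp add: mm_Vertex_right)
 have "coord Z (x \<otimes> y) (mm r m (Vertex (monomial_target m))) =
   coord Z x m \<otimes>\<^bsub>K\<^esub> coord Z y (Vertex (monomial_target m))"
 proof (rule coord_mult_single[OF Z x y])
  fix s t assume st: "s \<in> Mon" "t \<in> Mon" "mm r s t = mm r m (Vertex (monomial_target m))"
   "coord Z x s \<noteq> K0"
  then show "s = m \<and> t = Vertex (monomial_target m)"
   using mm_eq_arrow[OF st(1,2) m r] x0[OF monomial_source_in[OF mm]] eq by auto
 qed (use mm monomial_target_in[OF mm] eq in auto)
 then show ?thesis using eq by simp
qed

lemma K_power_zero: "[|c \<in> carrier K; c [^]\<^bsub>K\<^esub> (m :: nat) = K0|] ==> c = K0"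
 by (induction m) (auto dest: K.integral)

text \<open>The radical does not depend on the frame: it consists of nilpotent elements.\<close>

lemma deep_frame_independent:
 assumes Z: "frame Z" and Z': "frame Z'" and x: "deep Z 1 x" and v: "v \<in> {1, 2, 3}"
 shows "coord Z' x (Vertex v) = K0"
proof -
 have xc: "x \<in> carrier A" using x by (simp add: deep_def)
 have "x [^] (r + 5) = \<zero>" using deep_nilpotent[OF Z x] by simp
 then have "coord Z' x (Vertex v) [^]\<^bsub>K\<^esub> (r + 5) = K0"
  using coord_pow_Vertex[OF Z' xc v, of "r + 5"] Z' v by simp
 then show ?thesis using K_power_zero[of _ "r + 5"] Z' xc v by simp
qed

lemma deep_basis: "[|frame Z; b \<in> Mon; depth r b > 0|] ==> deep Z 1 (Z b)"
 by (auto simp: deep_def coord_basis split: if_splits)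

text \<open>
All monomials other than vertices and arrows are products of two elements of the radical. Without an
arrow among its monomials, the element would lie in the square of the radical, whose elements have no
arrows with respect to any frame.
\<close>

lemma arrow_survives:
 assumes Z: "frame Z" and Z': "frame Z'" and b: "b \<in> arrow_monomials"
 obtains m where "m \<in> arrow_monomials" "coord Z (Z' b) m \<noteq> K0"
proof -
 note bm = arrow_in_monomials[OF r b]
 have dpos: "depth r b > 0" using b by (auto simp: arrow_monomials_def)
 let ?y = "Z' b"
 have y: "?y \<in> carrier A" using Z' bm by simp
 have "\<exists>m\<in>arrow_monomials. coord Z ?y m \<noteq> K0"
 proof (rule ccontr)
  assume neg: "\<not> ?thesis"
  have term0: "coord Z' (coord Z ?y m \<odot> Z m) b = K0" if m: "m \<in> Mon" for m
  proof (cases "coord Z ?y m = K0")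
   case True
   then show ?thesis using Z Z' m bm by simp
  next
   case False
   have ma: "m \<notin> arrow_monomials" using neg False by blast
   have mv: "m \<noteq> Vertex v" for v
   proof
    assume "m = Vertex v"
    moreover from this have "v \<in> {1, 2, 3}" using m by simp
    ultimately show False
     using False deep_frame_independent[OF Z' Z deep_basis[OF Z' bm dpos]] by simp
   qed
   obtain s t where st: "s \<in> Mon" "t \<in> Mon" "depth r s > 0" "depth r t > 0"
    "mm r s t = m" using monomial_factorisation[OF m ma mv r] by blast
   have "coord Z' (Z s \<otimes> Z t) b = K0"
    using st Z deep_frame_independent[OF Z Z' deep_basis[OF Z]]
    by (intro coord_mult_arrow[OF Z' _ _ b]) auto
   then have "coord Z' (Z m) b = K0" using frame_mult[OF Z st(1,2)] st(5) by simp
   then show ?thesis using Z Z' m bm y by (simp add: coord_smult)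
  qed
  have "coord Z' ?y b = coord Z' (\<Oplus>m\<in>Mon. coord Z ?y m \<odot> Z m) b"
   using coord_spec(2)[OF Z y] by (simp add: comb_def)
  also have "\<dots> = (\<Oplus>\<^bsub>K\<^esub>m\<in>Mon. coord Z' (coord Z ?y m \<odot> Z m) b)"
   using Z y bm by (intro coord_finsum[OF Z']) auto
  also have "\<dots> = K0" using term0 by (rule K.add.finprod_one_eqI)
  finally show False using coord_basis[OF Z', of b b] bm by simp
 qed
 with that show thesis by blast
qed

lemma vertices_permuted:
 assumes Z: "frame Z" and Z': "frame Z'"
 obtains \<sigma> where "inj_on \<sigma> {1, 2, 3 :: nat}" "\<And>w. w \<in> {1, 2, 3} ==> \<sigma> w \<in> {1, 2, 3}"
  "\<And>v w. [|v \<in> {1, 2, 3}; w \<in> {1, 2, 3}|] ==>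
   coord Z (Z' (Vertex w)) (Vertex v) = (if v = \<sigma> w then K1 else K0)"
proof -
 define f where "f = (\<lambda>w. Z' (Vertex w))"
 have fc: "f w \<in> carrier A" if "w \<in> {1, 2, 3}" for w using that Z' by (simp add: f_def)
 have ff: "f w \<otimes> f w' = (if w = w' then f w else \<zero>)" if "w \<in> {1, 2, 3}" "w' \<in> {1, 2, 3}" for w w'
  using that Z' frame_mult[OF Z', of "Vertex w" "Vertex w'"] by (simp add: f_def)
 have ex: "\<exists>v\<in>{1, 2, 3}. coord Z (f w) (Vertex v) = K1" if w: "w \<in> {1, 2, 3}" for w
 proof (rule ccontr)
  assume neg: "\<not> ?thesis"
  have "coord Z (f w) (Vertex v) = K0" if v: "v \<in> {1, 2, 3}" for v
  proof (rule ccontr)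
   let ?c = "coord Z (f w) (Vertex v)"
   assume nz: "?c \<noteq> K0"
   have c: "?c \<in> carrier K" using Z fc[OF w] v by simp
   have "?c \<otimes>\<^bsub>K\<^esub> ?c = ?c \<otimes>\<^bsub>K\<^esub> K1"
    using coord_mult_Vertex[OF Z fc[OF w] fc[OF w] v] ff[OF w w] c by simp
   then have "?c = K1" using K.m_lcancel[OF nz c c K.one_closed] by simp
   with neg v show False by blast
  qed
  then have "deep Z 1 (f w)" using fc[OF w] by (intro deep_oneI) auto
  from deep_frame_independent[OF Z Z' this w] show False
   using coord_basis[OF Z', of "Vertex w" "Vertex w"] w by (simp add: f_def)
 qed
 obtain \<sigma> where \<sigma>: "\<And>w. w \<in> {1, 2, 3} ==> \<sigma> w \<in> {1, 2, 3}"
  "\<And>w. w \<in> {1, 2, 3} ==> coord Z (f w) (Vertex (\<sigma> w)) = K1" using ex by metis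
 have other: "coord Z (f w) (Vertex (\<sigma> w')) = K0"
  if w: "w \<in> {1, 2, 3}" "w' \<in> {1, 2, 3}" "w \<noteq> w'" for w w'
 proof -
  have "coord Z (f w \<otimes> f w') (Vertex (\<sigma> w')) = K0" using ff[OF w(1,2)] w(3) Z \<sigma>(1)[OF w(2)] by simp
  then show ?thesis
   using coord_mult_Vertex[OF Z fc[OF w(1)] fc[OF w(2)] \<sigma>(1)[OF w(2)]] \<sigma>(2)[OF w(2)]
    Z fc[OF w(1)] \<sigma>(1)[OF w(2)] by simp
 qed
 have inj: "inj_on \<sigma> {1, 2, 3}"
 proof (rule inj_onI, rule ccontr)
  fix w w' assume w: "w \<in> {1, 2, 3}" "w' \<in> {1, 2, 3}" "\<sigma> w = \<sigma> w'" "w \<noteq> w'"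
  then show False using other[OF w(1,2,4)] \<sigma>(2)[OF w(1)] by simp
 qed
 have surj: "\<sigma> ` {1, 2, 3} = {1, 2, 3}"
  using \<sigma>(1) inj by (intro card_subset_eq) (auto simp: card_image)
 show thesis
 proof (rule that[OF inj \<sigma>(1)])
  fix v w assume v: "v \<in> {1, 2, 3 :: nat}" and w: "w \<in> {1, 2, 3 :: nat}"
  from v surj obtain w' where w': "w' \<in> {1, 2, 3}" "v = \<sigma> w'" by blast
  show "coord Z (Z' (Vertex w)) (Vertex v) = (if v = \<sigma> w then K1 else K0)"
  proof (cases "w = w'")
   case True
   then show ?thesis using \<sigma>(2)[OF w] w' by (simp add: f_def)
  next
   case False
   then have "v \<noteq> \<sigma> w" using inj w w' by (auto simp: inj_on_def)
   then show ?thesis using other[OF w w'(1) False] w' by (simp add: f_def)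
  qed
 qed
qed

text \<open>
Comparing two frames modulo the square of the radical permutes the vertices and sends each arrow to an
arrow between the permuted vertices. The permutation fixes 3, where the only loop is, hence also 2, the only
other vertex with an arrow to 3, and hence 1. An arrow is determined by its source and target.
\<close>

theorem arrow_degrees_invariant:
 assumes Z: "frame Z" and Z': "frame Z'"
  and eq: "standard_grading Z d = standard_grading Z' d'" and b: "b \<in> arrow_monomials"
 shows "d b = d' b"
proof -
 obtain \<sigma> where inj: "inj_on \<sigma> {1, 2, 3 :: nat}" and \<sigma>: "\<And>w. w \<in> {1, 2, 3} ==> \<sigma> w \<in> {1, 2, 3}"
  "\<And>v w. [|v \<in> {1, 2, 3}; w \<in> {1, 2, 3}|] ==>
   coord Z (Z' (Vertex w)) (Vertex v) = (if v = \<sigma> w then K1 else K0)"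
  by (rule vertices_permuted[OF Z Z']) (rule that)
 have key: "\<exists>m\<in>arrow_monomials. monomial_source m = \<sigma> (monomial_source b) \<and>
   monomial_target m = \<sigma> (monomial_target b) \<and> d m = d' b" if b: "b \<in> arrow_monomials" for b
 proof -
  note bm = arrow_in_monomials[OF r b]
  note st = monomial_source_in[OF bm] monomial_target_in[OF bm]
  have dpos: "depth r b > 0" using b by (auto simp: arrow_monomials_def)
  obtain m where m: "m \<in> arrow_monomials" "coord Z (Z' b) m \<noteq> K0"
   using arrow_survives[OF Z Z' b] by blast
  note mm = arrow_in_monomials[OF r m(1)]
  let ?e = "Z' (Vertex (monomial_source b))" and ?f = "Z' (Vertex (monomial_target b))"
  have cl: "Z' b \<in> carrier A" "?e \<in> carrier A" "?f \<in> carrier A" using Z' bm st by auto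
  have y0: "coord Z (Z' b) (Vertex v) = K0" if "v \<in> {1, 2, 3}" for v
   using deep_frame_independent[OF Z' Z deep_basis[OF Z' bm dpos] that] .
  have "?e \<otimes> Z' b = Z' b" "Z' b \<otimes> ?f = Z' b"
   using frame_mult[OF Z', of "Vertex (monomial_source b)" b] frame_mult[OF Z', of b "Vertex (monomial_target b)"]
    bm st by (simp_all add: mm_Vertex_right)
  then have "coord Z ?e (Vertex (monomial_source m)) \<otimes>\<^bsub>K\<^esub> coord Z (Z' b) m = coord Z (Z' b) m"
   "coord Z (Z' b) m \<otimes>\<^bsub>K\<^esub> coord Z ?f (Vertex (monomial_target m)) = coord Z (Z' b) m"
   using coord_arrow_left[OF Z cl(2,1) m(1) y0] coord_arrow_right[OF Z cl(1,3) m(1) y0] by simp_all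
  then have "monomial_source m = \<sigma> (monomial_source b)" "monomial_target m = \<sigma> (monomial_target b)"
   using \<sigma>(2)[OF monomial_source_in[OF mm] st(1)] \<sigma>(2)[OF monomial_target_in[OF mm] st(2)]
    m(2) Z cl(1) mm by (auto split: if_splits)
  moreover have "Z' b \<in> standard_grading Z d (d' b)"
   unfolding eq by (rule standard_grading_basis[OF Z' bm])
  then have "d m = d' b" using m(2) mm by (simp add: standard_grading_def)
  ultimately show ?thesis using m(1) by blast
 qed
 have arrow_cases: "m = Arc 0 1 \<or> m = Arc 1 1 \<or> m = Arc 2 1 \<or> m = Arc 3 1 \<or> m = Loop 1"
  if "m \<in> arrow_monomials" for m using that by (simp add: arrow_monomials_def)
 have unique: "m = m'" if "m \<in> arrow_monomials" "m' \<in> arrow_monomials"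
  "monomial_source m = monomial_source m'" "monomial_target m = monomial_target m'" for m m'
  using arrow_cases[OF that(1)] arrow_cases[OF that(2)] that(3,4)
  by (elim disjE) (simp_all add: vertex_at_def)
 have mem: "Loop 1 \<in> arrow_monomials" "Arc 1 1 \<in> arrow_monomials"
  by (simp_all add: arrow_monomials_def)
 have ends: "monomial_source (Loop 1) = 3" "monomial_target (Loop 1) = 3"
  "monomial_source (Arc 1 1) = 2" "monomial_target (Arc 1 1) = 3" by (simp_all add: vertex_at_def)
 obtain m where m: "m \<in> arrow_monomials" "monomial_source m = \<sigma> 3" "monomial_target m = \<sigma> 3"
  using key[OF mem(1)] unfolding ends by blast
 have "m = Loop 1"
  using arrow_cases[OF m(1)] m(2,3) by (elim disjE) (simp_all add: vertex_at_def)
 then have s3: "\<sigma> 3 = 3" using m(2) by simp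
 have ne: "\<sigma> 1 \<noteq> 3" "\<sigma> 2 \<noteq> 3" "\<sigma> 1 \<noteq> \<sigma> 2"
  using inj s3 by (auto simp: inj_on_def)
 obtain m1 where m1: "m1 \<in> arrow_monomials" "monomial_source m1 = \<sigma> 2" "monomial_target m1 = 3"
  using key[OF mem(2)] unfolding ends s3 by blast
 have "m1 = Arc 1 1"
  using arrow_cases[OF m1(1)] m1(2,3) ne(2) by (elim disjE) (simp_all add: vertex_at_def)
 then have s2: "\<sigma> 2 = 2" using m1(2) by simp
 have s1: "\<sigma> 1 = 1" using \<sigma>(1)[of 1] ne s2 by auto
 have id: "\<sigma> v = v" if "v \<in> {1, 2, 3}" for v using that s1 s2 s3 by auto
 note bm = arrow_in_monomials[OF r b]
 obtain m2 where m2: "m2 \<in> arrow_monomials" "monomial_source m2 = \<sigma> (monomial_source b)"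
  "monomial_target m2 = \<sigma> (monomial_target b)" "d m2 = d' b" using key[OF b] by blast
 have "m2 = b"
  using m2(2,3) unfolding id[OF monomial_source_in[OF bm]] id[OF monomial_target_in[OF bm]]
  by (rule unique[OF m2(1) b])
 then show ?thesis using m2(4) by simp
qed

corollary cycle_degrees_invariant:
 assumes Z: "frame Z" and Z': "frame Z'" and d: "degree_function r d" and d': "degree_function r d'"
  and eq: "standard_grading Z d = standard_grading Z' d'"
 shows "cycle_degrees d = cycle_degrees d'"
 using degree_function_eqI[OF d d' r arrow_degrees_invariant[OF Z Z' eq]] r
 by (simp add: cycle_degrees_def)

end

section \<open>Modules\<close>

lemma left_module_smult_zero:
 assumes "left_module A M" "a \<in> carrier A"
 shows "a \<odot>\<^bsub>M\<^esub> \<zero>\<^bsub>M\<^esub> = \<zero>\<^bsub>M\<^esub>"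
proof -
 interpret M: left_module A M by fact
 have "a \<odot>\<^bsub>M\<^esub> \<zero>\<^bsub>M\<^esub> \<oplus>\<^bsub>M\<^esub> a \<odot>\<^bsub>M\<^esub> \<zero>\<^bsub>M\<^esub> = a \<odot>\<^bsub>M\<^esub> \<zero>\<^bsub>M\<^esub> \<oplus>\<^bsub>M\<^esub> \<zero>\<^bsub>M\<^esub>"
  using M.act_r_distr[of a "\<zero>\<^bsub>M\<^esub>" "\<zero>\<^bsub>M\<^esub>"] assms(2) M.act_closed by simp
 then show ?thesis using M.M.add.l_cancel M.act_closed assms(2) by simp
qed

lemma left_module_zero_smult:
 assumes "left_module A M" "x \<in> carrier M"
 shows "\<zero>\<^bsub>A\<^esub> \<odot>\<^bsub>M\<^esub> x = \<zero>\<^bsub>M\<^esub>"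
proof -
 interpret M: left_module A M by fact
 have "\<zero>\<^bsub>A\<^esub> \<odot>\<^bsub>M\<^esub> x \<oplus>\<^bsub>M\<^esub> \<zero>\<^bsub>A\<^esub> \<odot>\<^bsub>M\<^esub> x = \<zero>\<^bsub>A\<^esub> \<odot>\<^bsub>M\<^esub> x \<oplus>\<^bsub>M\<^esub> \<zero>\<^bsub>M\<^esub>"
  using M.act_l_distr[of "\<zero>\<^bsub>A\<^esub>" "\<zero>\<^bsub>A\<^esub>" x] assms(2) M.act_closed by simp
 then show ?thesis using M.M.add.l_cancel M.act_closed assms(2) by simp
qed

lemma left_module_minus:
 assumes "left_module A M" "x \<in> carrier M"
 shows "(\<ominus>\<^bsub>A\<^esub> \<one>\<^bsub>A\<^esub>) \<odot>\<^bsub>M\<^esub> x = \<ominus>\<^bsub>M\<^esub> x"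
proof -
 interpret M: left_module A M by fact
 have "(\<ominus>\<^bsub>A\<^esub> \<one>\<^bsub>A\<^esub>) \<odot>\<^bsub>M\<^esub> x \<oplus>\<^bsub>M\<^esub> x = \<zero>\<^bsub>M\<^esub>"
  using M.act_l_distr[of "\<ominus>\<^bsub>A\<^esub> \<one>\<^bsub>A\<^esub>" "\<one>\<^bsub>A\<^esub>" x] assms left_module_zero_smult[OF assms]
  by (simp add: M.act_one M.l_neg)
 then show ?thesis using M.M.minus_equality assms(2) M.act_closed by simp
qed

lemma submodule_of_leftI:
 assumes M: "left_module A M" and sub: "N \<subseteq> carrier M" "\<zero>\<^bsub>M\<^esub> \<in> N"
  "\<And>x y. [|x \<in> N; y \<in> N|] ==> x \<oplus>\<^bsub>M\<^esub> y \<in> N" "\<And>a x. [|a \<in> carrier A; x \<in> N|] ==> a \<odot>\<^bsub>M\<^esub> x \<in> N"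
 shows "Module.submodule N A M"
proof -
 interpret M: left_module A M by fact
 have "\<ominus>\<^bsub>M\<^esub> x \<in> N" if "x \<in> N" for x
  using left_module_minus[OF M, of x] sub(4)[of "\<ominus>\<^bsub>A\<^esub> \<one>\<^bsub>A\<^esub>" x] sub(1) that by auto
 then show ?thesis
  using sub by (intro Module.submodule.intro subgroup.intro Module.submodule_axioms.intro)
   (auto simp: a_inv_def)
qed

lemma submodule_of_leftD:
 assumes "Module.submodule N A M"
 shows "N \<subseteq> carrier M" "\<zero>\<^bsub>M\<^esub> \<in> N" "\<And>x y. [|x \<in> N; y \<in> N|] ==> x \<oplus>\<^bsub>M\<^esub> y \<in> N"
  "\<And>a x. [|a \<in> carrier A; x \<in> N|] ==> a \<odot>\<^bsub>M\<^esub> x \<in> N"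
proof -
 have s: "subgroup N (add_monoid M)" using assms by (simp add: Module.submodule_def)
 show "N \<subseteq> carrier M" using subgroup.subset[OF s] by simp
 show "\<zero>\<^bsub>M\<^esub> \<in> N" using subgroup.one_closed[OF s] by simp
 show "\<And>x y. [|x \<in> N; y \<in> N|] ==> x \<oplus>\<^bsub>M\<^esub> y \<in> N" using subgroup.m_closed[OF s] by simp
 show "\<And>a x. [|a \<in> carrier A; x \<in> N|] ==> a \<odot>\<^bsub>M\<^esub> x \<in> N" using Module.submodule.smult_closed[OF assms] .
qed

lemma module_hom_zero:
 assumes M: "left_module A M" and N: "left_module A N" and f: "f \<in> module_hom A M N"
 shows "f \<zero>\<^bsub>M\<^esub> = \<zero>\<^bsub>N\<^esub>"
proof -
 interpret M: left_module A M by fact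
 interpret N: left_module A N by fact
 have "f (\<zero>\<^bsub>A\<^esub> \<odot>\<^bsub>M\<^esub> \<zero>\<^bsub>M\<^esub>) = \<zero>\<^bsub>A\<^esub> \<odot>\<^bsub>N\<^esub> f \<zero>\<^bsub>M\<^esub>"
  using f by (intro module_hom_smult[OF f]) auto
 moreover have "f \<zero>\<^bsub>M\<^esub> \<in> carrier N" using f by (auto simp: module_hom_def)
 ultimately show ?thesis using left_module_zero_smult[OF M] left_module_zero_smult[OF N] by simp
qed

subsection \<open>Transport of structure\<close>

text \<open>
This realises modules on functions of a natural number, the type over which graded Morita
equivalence quantifies.
\<close>

definition transport_module :: "('m => 'n) => ('a, 'm) module => ('a, 'n) module" where
 "transport_module h M =
   \<lparr>carrier = h ` carrier M, monoid.mult = undefined, one = undefined, zero = h \<zero>\<^bsub>M\<^esub>,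
   add = \<lambda>x y. h (inv_into (carrier M) h x \<oplus>\<^bsub>M\<^esub> inv_into (carrier M) h y),
   smult = \<lambda>a x. h (a \<odot>\<^bsub>M\<^esub> inv_into (carrier M) h x)\<rparr>"

context
 fixes A :: "('a, 'y) ring_scheme" and M :: "('a, 'm) module" and h :: "'m => 'n"
 assumes M: "left_module A M" and h: "inj_on h (carrier M)"
begin

interpretation M: left_module A M
 by (rule M)

lemma transport_carrier [simp]: "carrier (transport_module h M) = h ` carrier M"
 by (simp add: transport_module_def)

lemma transport_zero [simp]: "\<zero>\<^bsub>transport_module h M\<^esub> = h \<zero>\<^bsub>M\<^esub>"
 by (simp add: transport_module_def)

lemma transport_add [simp]: "[|x \<in> carrier M; y \<in> carrier M|] ==>
 h x \<oplus>\<^bsub>transport_module h M\<^esub> h y = h (x \<oplus>\<^bsub>M\<^esub> y)"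
 by (simp add: transport_module_def inv_into_f_f[OF h])

lemma transport_smult [simp]: "x \<in> carrier M ==> a \<odot>\<^bsub>transport_module h M\<^esub> h x = h (a \<odot>\<^bsub>M\<^esub> x)"
 by (simp add: transport_module_def inv_into_f_f[OF h])

lemma transport_left_module: "left_module A (transport_module h M)"
proof (intro left_module.intro left_module_axioms.intro)
 show "abelian_group (transport_module h M)"
 proof (rule abelian_groupI)
  fix x assume "x \<in> carrier (transport_module h M)"
  then obtain x' where "x' \<in> carrier M" "x = h x'" by auto
  then show "\<exists>y\<in>carrier (transport_module h M). y \<oplus>\<^bsub>transport_module h M\<^esub> x = \<zero>\<^bsub>transport_module h M\<^esub>"
   by (intro bexI[of _ "h (\<ominus>\<^bsub>M\<^esub> x')"]) (auto simp: M.M.l_neg)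
 qed (auto simp: M.M.a_ac)
qed (auto simp: M.act_closed M.act_l_distr M.act_r_distr M.act_assoc M.act_one M.ring_axioms)

end

context kalgebra
begin

lemma scalar_action: "c \<in> carrier K ==> x \<in> carrier A ==> (c \<odot> \<one>) \<otimes> x = c \<odot> x"
 by (simp add: smult_mult_left)

lemma scalar_closed [simp]: "c \<in> carrier K ==> c \<odot> \<one> \<in> carrier A"
 by simp

lemma restrict_scalars_vectorspace:
 assumes "left_module A M"
 shows "vectorspace K (restrict_scalars A M)"
proof -
 interpret M: left_module A M by fact
 have ag: "abelian_group (restrict_scalars A M)"
  by (rule abelian_groupI)
   (auto simp: restrict_scalars_def M.M.a_ac intro: M.M.l_neg bexI[of _ "\<ominus>\<^bsub>M\<^esub> _"])
 show ?thesis
 proof (intro vectorspace.intro module.intro module_axioms.intro K.cring_axioms K.field_axioms ag)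
  fix c d x y assume cd: "c \<in> carrier K" "d \<in> carrier K"
   and xy: "x \<in> carrier (restrict_scalars A M)" "y \<in> carrier (restrict_scalars A M)"
  have "(c \<odot> \<one>) \<otimes> (d \<odot> \<one>) = (c \<otimes>\<^bsub>K\<^esub> d) \<odot> \<one>"
   using cd by (simp add: smult_mult_left smult_assoc1)
  then show "(c \<otimes>\<^bsub>K\<^esub> d) \<odot>\<^bsub>restrict_scalars A M\<^esub> x =
    c \<odot>\<^bsub>restrict_scalars A M\<^esub> (d \<odot>\<^bsub>restrict_scalars A M\<^esub> x)"
   using cd xy M.act_assoc[of "c \<odot> \<one>" "d \<odot> \<one>" x] by (simp add: restrict_scalars_def)
 qed (auto simp: restrict_scalars_def M.act_closed M.act_r_distr M.act_l_distr M.act_one smult_l_distr)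
qed

definition cyclic_ideal :: "'a => ('a, 'a) module" where
 "cyclic_ideal e = \<lparr>carrier = {x \<in> carrier A. x \<otimes> e = x}, monoid.mult = undefined, one = undefined,
   zero = \<zero>, add = add A, smult = monoid.mult A\<rparr>"

lemma cyclic_ideal_left_module:
 assumes e: "e \<in> carrier A"
 shows "left_module A (cyclic_ideal e)"
proof (intro left_module.intro left_module_axioms.intro ring_axioms)
 show "abelian_group (cyclic_ideal e)"
 proof (rule abelian_groupI)
  fix x assume x: "x \<in> carrier (cyclic_ideal e)"
  then have "\<ominus> x \<in> carrier (cyclic_ideal e)" using e by (simp add: cyclic_ideal_def l_minus)
  then show "\<exists>y\<in>carrier (cyclic_ideal e). y \<oplus>\<^bsub>cyclic_ideal e\<^esub> x = \<zero>\<^bsub>cyclic_ideal e\<^esub>"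
   using x by (intro bexI[of _ "\<ominus> x"]) (auto simp: cyclic_ideal_def l_neg)
 qed (use e in \<open>auto simp: cyclic_ideal_def l_distr a_ac\<close>)
qed (use e in \<open>auto simp: cyclic_ideal_def l_distr r_distr m_assoc\<close>)

text \<open>\<open>P\<close> is isomorphic to \<open>A e\<close>, with \<open>p\<close> corresponding to \<open>e\<close>.\<close>

definition free_generator :: "'a => ('a, 'm) module => 'm => bool" where
 "free_generator e P p \<longleftrightarrow> left_module A P \<and> e \<in> carrier A \<and> e \<otimes> e = e \<and> p \<in> carrier P \<and>
   e \<odot>\<^bsub>P\<^esub> p = p \<and> (\<forall>q\<in>carrier P. \<exists>x\<in>carrier A. x \<otimes> e = x \<and> q = x \<odot>\<^bsub>P\<^esub> p) \<and>
   (\<forall>x\<in>carrier A. x \<otimes> e = x \<and> x \<odot>\<^bsub>P\<^esub> p = \<zero>\<^bsub>P\<^esub> \<longrightarrow> x = \<zero>)"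

lemma free_generator_eq:
 assumes p: "free_generator e P p" and x: "x \<in> carrier A" "x \<otimes> e = x" and y: "y \<in> carrier A" "y \<otimes> e = y"
  and eq: "x \<odot>\<^bsub>P\<^esub> p = y \<odot>\<^bsub>P\<^esub> p"
 shows "x = y"
proof -
 interpret P: left_module A P using p by (simp add: free_generator_def)
 have e: "e \<in> carrier A" and pP: "p \<in> carrier P" using p by (auto simp: free_generator_def)
 have "\<ominus> \<one> \<otimes> y = \<ominus> y" using y by (simp add: l_minus)
 then have my: "(\<ominus> y) \<odot>\<^bsub>P\<^esub> p = \<ominus>\<^bsub>P\<^esub> (y \<odot>\<^bsub>P\<^esub> p)"
  using left_module_minus[OF P.left_module_axioms, of "y \<odot>\<^bsub>P\<^esub> p"] P.act_assoc[of "\<ominus> \<one>" y p] y pP P.act_closed by simp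
 have "(x \<oplus> \<ominus> y) \<odot>\<^bsub>P\<^esub> p = \<zero>\<^bsub>P\<^esub>"
  using x y pP my eq P.act_closed by (simp add: P.act_l_distr P.M.r_neg)
 moreover have "(x \<oplus> \<ominus> y) \<otimes> e = x \<oplus> \<ominus> y" using x y e by (simp add: l_distr l_minus)
 ultimately have "x \<oplus> \<ominus> y = \<zero>" using p x y by (simp add: free_generator_def)
 then show ?thesis using x y by (metis a_minus_def r_right_minus_eq)
qed

lemma free_generator_projective:
 fixes P :: "('a, 'm) module"
 assumes p: "free_generator e P p"
 shows "projective_module A P"
 unfolding projective_module_def
proof (intro conjI allI impI)
 have P: "left_module A P" using p by (simp add: free_generator_def)
 then show "left_module A P" .
 interpret P: left_module A P by fact
 have e: "e \<in> carrier A" "e \<otimes> e = e" and pP: "p \<in> carrier P" "e \<odot>\<^bsub>P\<^esub> p = p"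
  and gen: "\<And>q. q \<in> carrier P ==> \<exists>x\<in>carrier A. x \<otimes> e = x \<and> q = x \<odot>\<^bsub>P\<^esub> p"
  using p by (auto simp: free_generator_def)
 fix M N :: "('a, 'm) module" and g f
 assume a: "left_module A M \<and> left_module A N \<and> g \<in> module_hom A M N \<and>
  g ` carrier M = carrier N \<and> f \<in> module_hom A P N"
 then have g: "g \<in> module_hom A M N" "g ` carrier M = carrier N" and f: "f \<in> module_hom A P N" by auto
 interpret M: left_module A M using a by simp
 interpret N: left_module A N using a by simp
 define co where "co = (\<lambda>q. SOME x. x \<in> carrier A \<and> x \<otimes> e = x \<and> q = x \<odot>\<^bsub>P\<^esub> p)"
 have co: "co q \<in> carrier A" "co q \<otimes> e = co q" "co q \<odot>\<^bsub>P\<^esub> p = q" if "q \<in> carrier P" for q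
 proof -
  have "\<exists>x. x \<in> carrier A \<and> x \<otimes> e = x \<and> q = x \<odot>\<^bsub>P\<^esub> p" using gen[OF that] by blast
  from someI_ex[OF this] show "co q \<in> carrier A" "co q \<otimes> e = co q" "co q \<odot>\<^bsub>P\<^esub> p = q"
   by (simp_all only: co_def)
 qed
 have co_eq: "co (x \<odot>\<^bsub>P\<^esub> p) = x" if "x \<in> carrier A" "x \<otimes> e = x" for x
 proof -
  have q: "x \<odot>\<^bsub>P\<^esub> p \<in> carrier P" using that pP P.act_closed by simp
  show ?thesis by (rule free_generator_eq[OF p co(1,2)[OF q] that co(3)[OF q]])
 qed
 have "f p \<in> g ` carrier M" using f pP g(2) by (auto simp: module_hom_def)
 then obtain m where m: "m \<in> carrier M" "g m = f p" by (metis imageE)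
 define f' where "f' = (\<lambda>q. co q \<odot>\<^bsub>M\<^esub> m)"
 have co_add: "co (q \<oplus>\<^bsub>P\<^esub> q') = co q \<oplus> co q'" if "q \<in> carrier P" "q' \<in> carrier P" for q q'
 proof -
  have "q \<oplus>\<^bsub>P\<^esub> q' = (co q \<oplus> co q') \<odot>\<^bsub>P\<^esub> p" using co that pP by (simp add: P.act_l_distr)
  then show ?thesis using co_eq[of "co q \<oplus> co q'"] co that e by (simp add: l_distr)
 qed
 have co_smult: "co (a \<odot>\<^bsub>P\<^esub> q) = a \<otimes> co q" if "q \<in> carrier P" "a \<in> carrier A" for q a
 proof -
  have "a \<odot>\<^bsub>P\<^esub> q = (a \<otimes> co q) \<odot>\<^bsub>P\<^esub> p" using co that pP by (simp add: P.act_assoc)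
  then show ?thesis using co_eq[of "a \<otimes> co q"] co that e by (simp add: m_assoc)
 qed
 have "f' \<in> module_hom A P M"
  unfolding module_hom_def f'_def using co co_add co_smult m
  by (auto simp: M.act_closed M.act_l_distr M.act_assoc)
 moreover have "g (f' q) = f q" if q: "q \<in> carrier P" for q
 proof -
  have "g (f' q) = co q \<odot>\<^bsub>N\<^esub> g m" unfolding f'_def using co[OF q] m by (intro module_hom_smult[OF g(1)]) auto
  also have "\<dots> = f (co q \<odot>\<^bsub>P\<^esub> p)"
   unfolding m(2) by (rule module_hom_smult[OF f co(1)[OF q] pP(1), symmetric])
  finally show ?thesis using co[OF q] by simp
 qed
 ultimately show "\<exists>h'\<in>module_hom A P M. \<forall>x\<in>carrier P. g (h' x) = f x" by blast
qed

end

context C_type_algebra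
begin

text \<open>Coordinates indexed by numbers, so that the ideals \<open>A e\<close> live on functions \<open>nat => 'k\<close>.\<close>

definition index :: "C_monomial => nat" where
 "index = (SOME f. inj_on f (Mon))"

lemma index_inj: "inj_on index (Mon)"
 unfolding index_def using finite_imp_inj_to_nat_seg[OF finite_monomials] by (metis (mono_tags, lifting) someI_ex)

definition to_fun :: "(C_monomial => 'a) => 'a => nat => 'k" where
 "to_fun Z x = (\<lambda>n. if n \<in> index ` Mon then coord Z x (inv_into (Mon) index n) else K0)"

lemma to_fun_index: "b \<in> Mon ==> to_fun Z x (index b) = coord Z x b"
 by (simp add: to_fun_def inv_into_f_f[OF index_inj])

lemma to_fun_inj: "frame Z ==> inj_on (to_fun Z) (carrier A)"
 by (rule inj_onI, rule coord_eqI) (auto simp: to_fun_index[symmetric])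

context
 fixes Z assumes Z: "frame Z"
begin

definition vtx :: "nat => 'a" where "vtx v = Z (Vertex v)"

lemma vtx_closed [simp]: "v \<in> {1, 2, 3} ==> vtx v \<in> carrier A"
 using Z by (simp add: vtx_def)

lemma vtx_mult: "[|v \<in> {1, 2, 3}; w \<in> {1, 2, 3}|] ==> vtx v \<otimes> vtx w = (if v = w then vtx v else \<zero>)"
 using Z frame_mult[OF Z, of "Vertex v" "Vertex w"] by (simp add: vtx_def)

lemma vtx_sum: "vtx 1 \<oplus> vtx 2 \<oplus> vtx 3 = \<one>"
 using frame_one[OF Z] by (simp add: vtx_def)

definition chr :: "nat => 'a => 'k" where "chr v x = coord Z x (Vertex v)"

lemma chr_vtx: "[|v \<in> {1, 2, 3}; w \<in> {1, 2, 3}|] ==> chr v (vtx w) = (if v = w then K1 else K0)"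
 using coord_basis[OF Z, of "Vertex w" "Vertex v"] by (auto simp: chr_def vtx_def)

lemma chr_closed [simp]: "[|v \<in> {1, 2, 3}; x \<in> carrier A|] ==> chr v x \<in> carrier K"
 using Z by (simp add: chr_def)

lemma chr_mult: "[|v \<in> {1, 2, 3}; x \<in> carrier A; y \<in> carrier A|] ==> chr v (x \<otimes> y) = chr v x \<otimes>\<^bsub>K\<^esub> chr v y"
 by (simp add: chr_def coord_mult_Vertex[OF Z])

lemma chr_add: "[|v \<in> {1, 2, 3}; x \<in> carrier A; y \<in> carrier A|] ==> chr v (x \<oplus> y) = chr v x \<oplus>\<^bsub>K\<^esub> chr v y"
 by (simp add: chr_def coord_add[OF Z])

lemma chr_smult: "[|v \<in> {1, 2, 3}; c \<in> carrier K; x \<in> carrier A|] ==> chr v (c \<odot> x) = c \<otimes>\<^bsub>K\<^esub> chr v x"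
 by (simp add: chr_def coord_smult[OF Z])

lemma chr_one: "v \<in> {1, 2, 3} ==> chr v \<one> = K1"
 by (simp add: chr_def coord_one_Vertex[OF Z])

text \<open>After scaling, \<open>u\<close> plus the other two vertices is unipotent, and a power of it is its inverse.\<close>

lemma corner_unit:
 assumes v: "v \<in> {1, 2, 3}" and u: "u \<in> carrier A" "vtx v \<otimes> u = u" "u \<otimes> vtx v = u"
  and nz: "chr v u \<noteq> K0"
 obtains u' where "u' \<in> carrier A" "u' \<otimes> u = vtx v" "u \<otimes> u' = vtx v"
proof -
 define k where "k = inv\<^bsub>K\<^esub> (chr v u)"
 have k: "k \<in> carrier K" "k \<otimes>\<^bsub>K\<^esub> chr v u = K1"
  using nz u(1) v K.field_Units K.Units_l_inv K.Units_inv_closed unfolding k_def by auto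
 have other: "chr w u = K0" if "w \<in> {1, 2, 3}" "w \<noteq> v" for w
  using chr_mult[OF that(1) vtx_closed[OF v] u(1)] u that v chr_vtx[OF that(1) v] by simp
 define z where "z = k \<odot> u \<oplus> (\<one> \<oplus> vtx v)"
 have z: "z \<in> carrier A" using k u v by (simp add: z_def)
 have "chr w z = K1" if w: "w \<in> {1, 2, 3}" for w
  using w v k u other[OF w] chr_vtx[OF w v] chr_one[OF w]
  by (cases "w = v") (simp_all add: z_def chr_add chr_smult)
 then have 1: "\<And>w. w \<in> {1, 2, 3} ==> coord Z z (Vertex w) = K1" by (simp add: chr_def)
 define z' where "z' = z [^] (big - 1)"
 have z': "z' \<in> carrier A" "z' \<otimes> z = \<one>" "z \<otimes> z' = \<one>"
  using unipotent_inverse[OF Z z 1] z by (simp_all add: z'_def)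
 have vv: "vtx v \<otimes> vtx v = vtx v" using vtx_mult[OF v v] by simp
 have zv: "z \<otimes> vtx v = k \<odot> u" "vtx v \<otimes> z = k \<odot> u"
  using v k u vv by (simp_all add: z_def l_distr r_distr smult_mult_left smult_mult_right)
 show thesis
 proof (rule that[of "vtx v \<otimes> (k \<odot> (z' \<otimes> vtx v))"])
  show "vtx v \<otimes> (k \<odot> (z' \<otimes> vtx v)) \<in> carrier A" using v k z' by simp
  have "z' \<otimes> (k \<odot> u) = vtx v"
   unfolding zv(1)[symmetric] using z' z v m_assoc[of z' z "vtx v"] by simp
  then have a: "z' \<otimes> u = k' \<odot> vtx v" if "k' = chr v u" for k'
  proof -
   have "k' \<odot> (z' \<otimes> (k \<odot> u)) = (k \<otimes>\<^bsub>K\<^esub> chr v u) \<odot> (z' \<otimes> u)"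
    using that k z' u v by (simp add: smult_mult_right smult_assoc1[symmetric] K.m_comm)
   with \<open>z' \<otimes> (k \<odot> u) = vtx v\<close> show ?thesis using k z' u by simp
  qed
  have "(k \<odot> u) \<otimes> z' = vtx v"
   unfolding zv(2)[symmetric] using z' z v m_assoc[of "vtx v" z z'] by simp
  then have b: "u \<otimes> z' = chr v u \<odot> vtx v"
  proof -
   have "chr v u \<odot> ((k \<odot> u) \<otimes> z') = (k \<otimes>\<^bsub>K\<^esub> chr v u) \<odot> (u \<otimes> z')"
    using k z' u v by (simp add: smult_mult_left smult_assoc1[symmetric] K.m_comm)
   with \<open>(k \<odot> u) \<otimes> z' = vtx v\<close> show ?thesis using k z' u by simp
  qed
  have "(vtx v \<otimes> (k \<odot> (z' \<otimes> vtx v))) \<otimes> u = k \<odot> (vtx v \<otimes> (z' \<otimes> (vtx v \<otimes> u)))"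
   using v k z' u(1) by (simp add: smult_mult_left smult_mult_right m_assoc)
  also have "\<dots> = (k \<otimes>\<^bsub>K\<^esub> chr v u) \<odot> vtx v"
   using u a[OF refl] v k(1) vv by (simp add: smult_mult_right smult_assoc1)
  finally show "(vtx v \<otimes> (k \<odot> (z' \<otimes> vtx v))) \<otimes> u = vtx v" using k v by simp
  have "u \<otimes> (vtx v \<otimes> (k \<odot> (z' \<otimes> vtx v))) = k \<odot> (((u \<otimes> vtx v) \<otimes> z') \<otimes> vtx v)"
   using v k z' u(1) by (simp add: smult_mult_left smult_mult_right m_assoc)
  also have "\<dots> = (k \<otimes>\<^bsub>K\<^esub> chr v u) \<odot> vtx v"
   using u b v k(1) vv by (simp add: smult_mult_left smult_assoc1)
  finally show "u \<otimes> (vtx v \<otimes> (k \<odot> (z' \<otimes> vtx v))) = vtx v" using k v by simp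
 qed
qed

text \<open>A one-dimensional module on which \<open>A\<close> acts by the character of the vertex \<open>v\<close>. Every simple module
 has this form.\<close>

definition simple_at :: "nat => ('a, 'm) module => 'm => bool" where
 "simple_at v S s \<longleftrightarrow> left_module A S \<and> v \<in> {1, 2, 3} \<and> s \<in> carrier S \<and> s \<noteq> \<zero>\<^bsub>S\<^esub> \<and>
   (\<forall>a\<in>carrier A. a \<odot>\<^bsub>S\<^esub> s = (chr v a \<odot> \<one>) \<odot>\<^bsub>S\<^esub> s) \<and>
   (\<forall>t\<in>carrier S. \<exists>c\<in>carrier K. t = (c \<odot> \<one>) \<odot>\<^bsub>S\<^esub> s)"

lemma simple_at_span:
 "[|simple_at v S s; t \<in> carrier S|] ==> \<exists>c\<in>carrier K. t = (c \<odot> \<one>) \<odot>\<^bsub>S\<^esub> s"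
 unfolding simple_at_def by blast

lemma simple_at_act:
 "[|simple_at v S s; a \<in> carrier A|] ==> a \<odot>\<^bsub>S\<^esub> s = (chr v a \<odot> \<one>) \<odot>\<^bsub>S\<^esub> s"
 unfolding simple_at_def by blast

lemma simple_module_character:
 assumes S: "simple_module A S"
 obtains v s where "simple_at v S s"
proof -
 have L: "left_module A S" and ne: "carrier S \<noteq> {\<zero>\<^bsub>S\<^esub>}"
  and sub: "\<And>N. Module.submodule N A S ==> N = {\<zero>\<^bsub>S\<^esub>} \<or> N = carrier S"
  using S by (auto simp: simple_module_def)
 interpret S: left_module A S by fact
 obtain t where t: "t \<in> carrier S" "t \<noteq> \<zero>\<^bsub>S\<^esub>" using ne S.M.zero_closed by blast
 define D where "D = {n. \<exists>x. deep Z n x \<and> x \<odot>\<^bsub>S\<^esub> t \<noteq> \<zero>\<^bsub>S\<^esub>}"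
 have "deep Z 0 \<one>" by (simp add: deep_def)
 then have D0: "0 \<in> D" using t by (auto simp: D_def S.act_one)
 have Dle: "n < r + 5" if n: "n \<in> D" for n
 proof (rule ccontr)
  assume ge: "\<not> n < r + 5"
  obtain x where x: "deep Z n x" "x \<odot>\<^bsub>S\<^esub> t \<noteq> \<zero>\<^bsub>S\<^esub>" using n by (auto simp: D_def)
  have "x = \<zero>" using ge by (intro deep_zero[OF Z x(1)]) simp
  then show False using x(2) left_module_zero_smult[OF L t(1)] by simp
 qed
 have "finite D" using Dle by (intro finite_subset[of D "{..<r + 5}"]) auto
 then obtain n where n: "n \<in> D" "Suc n \<notin> D"
  using D0 by (metis Max_in Max_ge Suc_n_not_le_n empty_iff)
 then obtain x where x: "deep Z n x" "x \<odot>\<^bsub>S\<^esub> t \<noteq> \<zero>\<^bsub>S\<^esub>" by (auto simp: D_def)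
 have xc: "x \<in> carrier A" using x(1) by (simp add: deep_def)
 define t' where "t' = x \<odot>\<^bsub>S\<^esub> t"
 have t': "t' \<in> carrier S" "t' \<noteq> \<zero>\<^bsub>S\<^esub>" using x xc t S.act_closed by (auto simp: t'_def)
 have kill: "j \<odot>\<^bsub>S\<^esub> t' = \<zero>\<^bsub>S\<^esub>" if j: "deep Z 1 j" for j
 proof (rule ccontr)
  assume nz: "j \<odot>\<^bsub>S\<^esub> t' \<noteq> \<zero>\<^bsub>S\<^esub>"
  have jc: "j \<in> carrier A" using j by (simp add: deep_def)
  have "(j \<otimes> x) \<odot>\<^bsub>S\<^esub> t \<noteq> \<zero>\<^bsub>S\<^esub>" using nz jc xc t by (simp add: S.act_assoc t'_def)
  moreover have "deep Z (Suc n) (j \<otimes> x)" using deep_mult[OF Z j x(1)] by simp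
  ultimately show False using n(2) by (auto simp: D_def)
 qed
 have "\<exists>v\<in>{1, 2, 3}. vtx v \<odot>\<^bsub>S\<^esub> t' \<noteq> \<zero>\<^bsub>S\<^esub>"
 proof (rule ccontr)
  assume "\<not> ?thesis"
  then have "\<one> \<odot>\<^bsub>S\<^esub> t' = \<zero>\<^bsub>S\<^esub>"
   unfolding vtx_sum[symmetric] using t' by (simp add: S.act_l_distr)
  then show False using t' by (simp add: S.act_one)
 qed
 then obtain v where v: "v \<in> {1, 2, 3}" and s0: "vtx v \<odot>\<^bsub>S\<^esub> t' \<noteq> \<zero>\<^bsub>S\<^esub>" by blast
 define s where "s = vtx v \<odot>\<^bsub>S\<^esub> t'"
 have s: "s \<in> carrier S" "s \<noteq> \<zero>\<^bsub>S\<^esub>" using s0 t' v S.act_closed by (auto simp: s_def)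
 have act: "a \<odot>\<^bsub>S\<^esub> s = (chr v a \<odot> \<one>) \<odot>\<^bsub>S\<^esub> s" if a: "a \<in> carrier A" for a
 proof -
  let ?y = "a \<otimes> vtx v" and ?z = "chr v a \<odot> vtx v"
  have yz: "?y \<in> carrier A" "?z \<in> carrier A" using a v by auto
  have "deep Z 1 (?y \<oplus> ?z)"
  proof (rule deep_oneI)
   fix w assume w: "w \<in> {1, 2, 3 :: nat}"
   have "chr w (?y \<oplus> ?z) = K0"
    using w v a yz chr_vtx[OF w v] by (cases "w = v") (simp_all add: chr_add chr_mult chr_smult)
   then show "coord Z (?y \<oplus> ?z) (Vertex w) = K0" by (simp add: chr_def)
  qed (use yz in simp)
  then have 0: "?y \<odot>\<^bsub>S\<^esub> t' \<oplus>\<^bsub>S\<^esub> ?z \<odot>\<^bsub>S\<^esub> t' = \<zero>\<^bsub>S\<^esub>"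
   using kill yz t' by (simp add: S.act_l_distr[symmetric])
  have "?z \<odot>\<^bsub>S\<^esub> t' \<oplus>\<^bsub>S\<^esub> ?z \<odot>\<^bsub>S\<^esub> t' = \<zero>\<^bsub>S\<^esub>"
   using yz t' left_module_zero_smult[OF L t'(1)] by (simp add: S.act_l_distr[symmetric])
  with 0 have "?y \<odot>\<^bsub>S\<^esub> t' = ?z \<odot>\<^bsub>S\<^esub> t'"
   using yz t' S.act_closed S.M.add.r_cancel by metis
  moreover have "?y \<odot>\<^bsub>S\<^esub> t' = a \<odot>\<^bsub>S\<^esub> s" using a v t' by (simp add: s_def S.act_assoc)
  moreover have "?z \<odot>\<^bsub>S\<^esub> t' = (chr v a \<odot> \<one>) \<odot>\<^bsub>S\<^esub> s"
   using a v t' S.act_assoc[of "chr v a \<odot> \<one>" "vtx v" t'] by (simp add: s_def scalar_action)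
  ultimately show ?thesis by simp
 qed
 let ?N = "(\<lambda>a. a \<odot>\<^bsub>S\<^esub> s) ` carrier A"
 have "Module.submodule ?N A S"
 proof (rule submodule_of_leftI[OF L])
  show "?N \<subseteq> carrier S" using s S.act_closed by auto
  show "\<zero>\<^bsub>S\<^esub> \<in> ?N" using left_module_zero_smult[OF L s(1)] by (metis imageI zero_closed)
  show "y \<oplus>\<^bsub>S\<^esub> z \<in> ?N" if "y \<in> ?N" "z \<in> ?N" for y z
  proof -
   obtain a b where "a \<in> carrier A" "b \<in> carrier A" "y = a \<odot>\<^bsub>S\<^esub> s" "z = b \<odot>\<^bsub>S\<^esub> s" using \<open>y \<in> ?N\<close> \<open>z \<in> ?N\<close> by blast
   then show ?thesis using s by (intro image_eqI[of _ _ "a \<oplus> b"]) (auto simp: S.act_l_distr)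
  qed
  show "a \<odot>\<^bsub>S\<^esub> y \<in> ?N" if a: "a \<in> carrier A" and y: "y \<in> ?N" for a y
  proof -
   obtain b where "b \<in> carrier A" "y = b \<odot>\<^bsub>S\<^esub> s" using y by blast
   then show ?thesis using a s by (intro image_eqI[of _ _ "a \<otimes> b"]) (auto simp: S.act_assoc)
  qed
 qed
 moreover have "s \<in> ?N" using s by (intro image_eqI[of _ _ \<one>]) (auto simp: S.act_one)
 ultimately have N: "?N = carrier S" using sub[of ?N] s by blast
 have "simple_at v S s"
  unfolding simple_at_def
 proof (intro conjI ballI)
  fix t assume "t \<in> carrier S"
  then obtain a where a: "a \<in> carrier A" "t = a \<odot>\<^bsub>S\<^esub> s" using N by blast
  then show "\<exists>c\<in>carrier K. t = (c \<odot> \<one>) \<odot>\<^bsub>S\<^esub> s" using act[OF a(1)] v by (intro bexI[of _ "chr v a"]) auto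
 qed (rule L v s act | assumption)+
 then show thesis by (rule that)
qed

lemma simple_at_scalar_zero:
 assumes S: "simple_at v S s" and c: "c \<in> carrier K" "(c \<odot> \<one>) \<odot>\<^bsub>S\<^esub> s = \<zero>\<^bsub>S\<^esub>"
 shows "c = K0"
proof (rule ccontr)
 assume nz: "c \<noteq> K0"
 interpret S: left_module A S using S by (simp add: simple_at_def)
 have s: "s \<in> carrier S" "s \<noteq> \<zero>\<^bsub>S\<^esub>" using S by (auto simp: simple_at_def)
 have k: "inv\<^bsub>K\<^esub> c \<in> carrier K" "inv\<^bsub>K\<^esub> c \<otimes>\<^bsub>K\<^esub> c = K1"
  using nz c K.field_Units K.Units_l_inv K.Units_inv_closed by auto
 have "((inv\<^bsub>K\<^esub> c \<odot> \<one>) \<otimes> (c \<odot> \<one>)) \<odot>\<^bsub>S\<^esub> s = \<zero>\<^bsub>S\<^esub>"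
  using S.act_assoc[of "inv\<^bsub>K\<^esub> c \<odot> \<one>" "c \<odot> \<one>" s] k c s left_module_smult_zero[OF S.left_module_axioms, of "inv\<^bsub>K\<^esub> c \<odot> \<one>"] by simp
 moreover have "(inv\<^bsub>K\<^esub> c \<odot> \<one>) \<otimes> (c \<odot> \<one>) = \<one>"
  using k c by (simp add: scalar_action smult_assoc1[symmetric])
 ultimately show False using s by (simp add: S.act_one)
qed

lemma simple_at_dim:
 assumes S: "simple_at v S s"
 shows "vectorspace.dim K (restrict_scalars A S) = 1"
proof -
 have L: "left_module A S" using S by (simp add: simple_at_def)
 interpret S: left_module A S by fact
 interpret V: vectorspace K "restrict_scalars A S" by (rule restrict_scalars_vectorspace[OF L])
 have s: "s \<in> carrier S" "s \<noteq> \<zero>\<^bsub>S\<^esub>" using S by (auto simp: simple_at_def)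
 have "V.span {s} = carrier (restrict_scalars A S)"
 proof
  show "V.span {s} \<subseteq> carrier (restrict_scalars A S)"
   by (rule V.span_is_subset2) (use s in \<open>simp add: restrict_scalars_def\<close>)
  show "carrier (restrict_scalars A S) \<subseteq> V.span {s}"
  proof
   fix t assume "t \<in> carrier (restrict_scalars A S)"
   then have "t \<in> carrier S" by (simp add: restrict_scalars_def)
   from simple_at_span[OF S this] obtain c where c: "c \<in> carrier K" "t = (c \<odot> \<one>) \<odot>\<^bsub>S\<^esub> s" by blast
   have "s \<in> V.span {s}" using s by (intro V.in_own_span[THEN subsetD]) (auto simp: restrict_scalars_def)
   then have "c \<odot>\<^bsub>restrict_scalars A S\<^esub> s \<in> V.span {s}"
    using c(1) s by (intro LinearCombinations.submodule.smult_closed[OF V.span_is_submodule])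
     (auto simp: restrict_scalars_def)
   then show "t \<in> V.span {s}" using c by (simp add: restrict_scalars_def)
  qed
 qed
 then show ?thesis using s by (intro V.dim1I[of s]) (auto simp: restrict_scalars_def)
qed

lemma simple_at_isomorphic:
 assumes S: "simple_at v S s" and T: "simple_at v T t"
 shows "isomorphic_modules A S T"
proof -
 have LS: "left_module A S" and LT: "left_module A T" using S T by (auto simp: simple_at_def)
 interpret S: left_module A S by fact
 interpret T: left_module A T by fact
 have s: "s \<in> carrier S" and t: "t \<in> carrier T" and v: "v \<in> {1, 2, 3}" using S T by (auto simp: simple_at_def)
 define co where "co = (\<lambda>x. SOME c. c \<in> carrier K \<and> x = (c \<odot> \<one>) \<odot>\<^bsub>S\<^esub> s)"
 have co: "co x \<in> carrier K" "x = (co x \<odot> \<one>) \<odot>\<^bsub>S\<^esub> s" if "x \<in> carrier S" for x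
 proof -
  have "\<exists>c. c \<in> carrier K \<and> x = (c \<odot> \<one>) \<odot>\<^bsub>S\<^esub> s" using simple_at_span[OF S that] by blast
  from someI_ex[OF this] show "co x \<in> carrier K" "x = (co x \<odot> \<one>) \<odot>\<^bsub>S\<^esub> s" unfolding co_def by blast+
 qed
 have sc: "((c \<oplus>\<^bsub>K\<^esub> d) \<odot> \<one>) \<odot>\<^bsub>S\<^esub> s = (c \<odot> \<one>) \<odot>\<^bsub>S\<^esub> s \<oplus>\<^bsub>S\<^esub> (d \<odot> \<one>) \<odot>\<^bsub>S\<^esub> s"
  if "c \<in> carrier K" "d \<in> carrier K" for c d
  using that s by (simp add: smult_l_distr S.act_l_distr)
 have uniq: "c = d" if cd: "c \<in> carrier K" "d \<in> carrier K" "(c \<odot> \<one>) \<odot>\<^bsub>S\<^esub> s = (d \<odot> \<one>) \<odot>\<^bsub>S\<^esub> s" for c d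
 proof -
  have "((c \<oplus>\<^bsub>K\<^esub> d) \<odot> \<one>) \<odot>\<^bsub>S\<^esub> s = ((d \<oplus>\<^bsub>K\<^esub> d) \<odot> \<one>) \<odot>\<^bsub>S\<^esub> s"
   unfolding sc[OF cd(1,2)] sc[OF cd(2,2)] using cd(3) by simp
  then have "((c \<oplus>\<^bsub>K\<^esub> d) \<odot> \<one>) \<odot>\<^bsub>S\<^esub> s = \<zero>\<^bsub>S\<^esub>"
   using cd left_module_zero_smult[OF LS s] by simp
  then have "c \<oplus>\<^bsub>K\<^esub> d = K0"
   by (rule simple_at_scalar_zero[OF S K.a_closed[OF cd(1,2)]])
  then show ?thesis by (rule K_add_eq_zero[OF cd(1,2)])
 qed
 have co_eq: "co ((c \<odot> \<one>) \<odot>\<^bsub>S\<^esub> s) = c" if "c \<in> carrier K" for c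
 proof -
  have "(c \<odot> \<one>) \<odot>\<^bsub>S\<^esub> s \<in> carrier S" using that s S.act_closed by simp
  from co[OF this] that show ?thesis by (intro uniq) auto
 qed
 define f where "f = (\<lambda>x. (co x \<odot> \<one>) \<odot>\<^bsub>T\<^esub> t)"
 have f_add: "f (x \<oplus>\<^bsub>S\<^esub> y) = f x \<oplus>\<^bsub>T\<^esub> f y" if x: "x \<in> carrier S" and y: "y \<in> carrier S" for x y
 proof -
  have "x \<oplus>\<^bsub>S\<^esub> y = ((co x \<oplus>\<^bsub>K\<^esub> co y) \<odot> \<one>) \<odot>\<^bsub>S\<^esub> s"
   using sc[OF co(1)[OF x] co(1)[OF y]] co(2)[OF x] co(2)[OF y] by simp
  then have "co (x \<oplus>\<^bsub>S\<^esub> y) = co x \<oplus>\<^bsub>K\<^esub> co y" using co_eq co(1)[OF x] co(1)[OF y] by simp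
  then show ?thesis
   using co(1)[OF x] co(1)[OF y] t by (simp add: f_def smult_l_distr T.act_l_distr)
 qed
 have scal: "a \<odot>\<^bsub>U\<^esub> ((c \<odot> \<one>) \<odot>\<^bsub>U\<^esub> u) = ((c \<otimes>\<^bsub>K\<^esub> chr v a) \<odot> \<one>) \<odot>\<^bsub>U\<^esub> u"
  if U: "simple_at v U u" and a: "a \<in> carrier A" and c: "c \<in> carrier K" for U :: "('a, 'u) module" and u a c
 proof -
  interpret U: left_module A U using U by (simp add: simple_at_def)
  have u: "u \<in> carrier U" using U by (simp add: simple_at_def)
  have "a \<odot>\<^bsub>U\<^esub> ((c \<odot> \<one>) \<odot>\<^bsub>U\<^esub> u) = (a \<otimes> (c \<odot> \<one>)) \<odot>\<^bsub>U\<^esub> u" using a c u by (simp add: U.act_assoc)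
  also have "a \<otimes> (c \<odot> \<one>) = (c \<odot> \<one>) \<otimes> a" using a c by (simp add: smult_mult_left smult_mult_right)
  also have "((c \<odot> \<one>) \<otimes> a) \<odot>\<^bsub>U\<^esub> u = (c \<odot> \<one>) \<odot>\<^bsub>U\<^esub> ((chr v a \<odot> \<one>) \<odot>\<^bsub>U\<^esub> u)"
   using a c u simple_at_act[OF U a] by (simp add: U.act_assoc)
  also have "\<dots> = ((c \<odot> \<one>) \<otimes> (chr v a \<odot> \<one>)) \<odot>\<^bsub>U\<^esub> u" using a c u v by (simp add: U.act_assoc)
  also have "(c \<odot> \<one>) \<otimes> (chr v a \<odot> \<one>) = (c \<otimes>\<^bsub>K\<^esub> chr v a) \<odot> \<one>"
   using a c v by (simp add: scalar_action smult_assoc1)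
  finally show ?thesis .
 qed
 have f_smult: "f (a \<odot>\<^bsub>S\<^esub> x) = a \<odot>\<^bsub>T\<^esub> f x" if a: "a \<in> carrier A" and x: "x \<in> carrier S" for a x
 proof -
  have "co (a \<odot>\<^bsub>S\<^esub> x) = co x \<otimes>\<^bsub>K\<^esub> chr v a"
   using scal[OF S a co(1)[OF x]] co(2)[OF x] co_eq[of "co x \<otimes>\<^bsub>K\<^esub> chr v a"] co(1)[OF x] a v by simp
  then show ?thesis using scal[OF T a co(1)[OF x]] by (simp add: f_def)
 qed
 have f_closed: "f x \<in> carrier T" if "x \<in> carrier S" for x
  using co(1)[OF that] t T.act_closed by (simp add: f_def)
 have "bij_betw f (carrier S) (carrier T)"
  unfolding bij_betw_def
 proof
  show "inj_on f (carrier S)"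
  proof (rule inj_onI)
   fix x y assume x: "x \<in> carrier S" and y: "y \<in> carrier S" and eq: "f x = f y"
   have "((co x \<oplus>\<^bsub>K\<^esub> co y) \<odot> \<one>) \<odot>\<^bsub>T\<^esub> t = f x \<oplus>\<^bsub>T\<^esub> f y"
    using co(1)[OF x] co(1)[OF y] t by (simp add: f_def smult_l_distr T.act_l_distr)
   also have "\<dots> = ((co y \<oplus>\<^bsub>K\<^esub> co y) \<odot> \<one>) \<odot>\<^bsub>T\<^esub> t"
    unfolding eq using co(1)[OF y] t T.act_l_distr[of "co y \<odot> \<one>" "co y \<odot> \<one>" t]
    by (simp add: f_def smult_l_distr del: K_double A_double)
   also have "\<dots> = \<zero>\<^bsub>T\<^esub>" using co(1)[OF y] left_module_zero_smult[OF LT t] by simp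
   finally have "co x \<oplus>\<^bsub>K\<^esub> co y = K0"
    by (rule simple_at_scalar_zero[OF T K.a_closed[OF co(1)[OF x] co(1)[OF y]]])
   then have "co x = co y" by (rule K_add_eq_zero[OF co(1)[OF x] co(1)[OF y]])
   then show "x = y" using co(2)[OF x] co(2)[OF y] by simp
  qed
  show "f ` carrier S = carrier T"
  proof
   show "f ` carrier S \<subseteq> carrier T" using f_closed by auto
   show "carrier T \<subseteq> f ` carrier S"
   proof
    fix y assume "y \<in> carrier T"
    from simple_at_span[OF T this] obtain c where c: "c \<in> carrier K" "y = (c \<odot> \<one>) \<odot>\<^bsub>T\<^esub> t" by blast
    then show "y \<in> f ` carrier S"
     using co_eq[OF c(1)] s S.act_closed by (intro image_eqI[of _ _ "(c \<odot> \<one>) \<odot>\<^bsub>S\<^esub> s"]) (auto simp: f_def)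
   qed
  qed
 qed
 moreover have "f \<in> module_hom A S T"
  unfolding module_hom_def using f_closed f_add f_smult by auto
 ultimately show ?thesis unfolding isomorphic_modules_def by blast
qed

lemma isomorphic_simple_at:
 assumes S: "simple_at v S s" and T: "simple_at w T t" and iso: "isomorphic_modules A S T"
 shows "v = w"
proof (rule ccontr)
 assume ne: "v \<noteq> w"
 have LS: "left_module A S" and LT: "left_module A T" and v: "v \<in> {1, 2, 3}" and w: "w \<in> {1, 2, 3}"
  using S T by (auto simp: simple_at_def)
 interpret S: left_module A S by fact
 interpret T: left_module A T by fact
 have s: "s \<in> carrier S" "s \<noteq> \<zero>\<^bsub>S\<^esub>" and t: "t \<in> carrier T" using S T by (auto simp: simple_at_def)
 obtain f where f: "f \<in> module_hom A S T" "bij_betw f (carrier S) (carrier T)"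
  using iso by (auto simp: isomorphic_modules_def)
 have fs: "f s \<in> carrier T" using f s by (auto simp: module_hom_def)
 from simple_at_span[OF T this] obtain c where c: "c \<in> carrier K" "f s = (c \<odot> \<one>) \<odot>\<^bsub>T\<^esub> t" by blast
 have "vtx v \<odot>\<^bsub>S\<^esub> s = s"
  using simple_at_act[OF S vtx_closed[OF v]] chr_vtx[OF v v] s by (simp add: S.act_one)
 then have "f s = vtx v \<odot>\<^bsub>T\<^esub> f s" using module_hom_smult[OF f(1), of "vtx v" s] v s by simp
 also have "\<dots> = ((c \<odot> \<one>) \<otimes> vtx v) \<odot>\<^bsub>T\<^esub> t"
  using c v t T.act_assoc[of "vtx v" "c \<odot> \<one>" t] by (simp add: smult_mult_left smult_mult_right)
 also have "\<dots> = (c \<odot> \<one>) \<odot>\<^bsub>T\<^esub> ((chr w (vtx v) \<odot> \<one>) \<odot>\<^bsub>T\<^esub> t)"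
  using c v t simple_at_act[OF T vtx_closed[OF v]] by (simp add: T.act_assoc)
 also have "\<dots> = \<zero>\<^bsub>T\<^esub>"
  using ne chr_vtx[OF w v] left_module_zero_smult[OF LT t] left_module_smult_zero[OF LT] c by simp
 finally have "f s = f \<zero>\<^bsub>S\<^esub>" using module_hom_zero[OF LS LT f(1)] by simp
 then show False using f(2) s unfolding bij_betw_def inj_on_def by blast
qed

end

end

section \<open>Graded projective covers\<close>

lemma (in C_type_algebra) standard_grading_mem:
 "x \<in> standard_grading Z d n \<longleftrightarrow> x \<in> carrier A \<and> (\<forall>b\<in>Mon. coord Z x b \<noteq> K0 \<longrightarrow> d b = n)"
 by (simp add: standard_grading_def)

context C_type_algebra
begin

context
 fixes Z assumes Z: "frame Z"
begin

lemma vtx_in: "v \<in> {1, 2, 3} ==> vtx Z v \<in> carrier A"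
 using vtx_closed[OF Z] .

lemma vtx_idem: "v \<in> {1, 2, 3} ==> vtx Z v \<otimes> vtx Z v = vtx Z v"
 using vtx_mult[OF Z, of v v] by simp

lemma submodule_generated:
 assumes P: "left_module A P" and q: "q \<in> carrier P"
 shows "Module.submodule ((\<lambda>x. x \<odot>\<^bsub>P\<^esub> q) ` carrier A) A P"
proof (rule submodule_of_leftI[OF P])
 interpret P: left_module A P by fact
 let ?N = "(\<lambda>x. x \<odot>\<^bsub>P\<^esub> q) ` carrier A"
 show "?N \<subseteq> carrier P" using q P.act_closed by auto
 show "\<zero>\<^bsub>P\<^esub> \<in> ?N" using left_module_zero_smult[OF P q] by (metis imageI zero_closed)
 show "y \<oplus>\<^bsub>P\<^esub> z \<in> ?N" if yz: "y \<in> ?N" "z \<in> ?N" for y z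
 proof -
  obtain a b where "a \<in> carrier A" "b \<in> carrier A" "y = a \<odot>\<^bsub>P\<^esub> q" "z = b \<odot>\<^bsub>P\<^esub> q" using yz by blast
  then show ?thesis using q by (intro image_eqI[of _ _ "a \<oplus> b"]) (simp_all add: P.act_l_distr)
 qed
 show "a \<odot>\<^bsub>P\<^esub> y \<in> ?N" if a: "a \<in> carrier A" and y: "y \<in> ?N" for a y
 proof -
  obtain b where "b \<in> carrier A" "y = b \<odot>\<^bsub>P\<^esub> q" using y by blast
  then show ?thesis using a q by (intro image_eqI[of _ _ "a \<otimes> b"]) (simp_all add: P.act_assoc)
 qed
qed

text \<open>
Elements of the cover that map to a nonzero vector generate, since the kernel is superfluous. The map from
the left ideal onto the cover has a section, since the cover is projective. The section sends the generator to a
unit of the corner of the vertex, so the map is injective.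
\<close>

lemma projective_cover_generator:
 fixes P S :: "('a, nat => 'k) module"
 assumes cover: "projective_cover A P S" and simple: "simple_module A S" and S: "simple_at Z v S s"
 obtains f where "f \<in> module_hom A P S" "f ` carrier P = carrier S"
  "\<And>q. [|q \<in> carrier P; vtx Z v \<odot>\<^bsub>P\<^esub> q = q; f q \<noteq> \<zero>\<^bsub>S\<^esub>|] ==> free_generator (vtx Z v) P q"
proof -
 obtain f where f: "f \<in> module_hom A P S" "f ` carrier P = carrier S"
  and small: "\<And>N. [|Module.submodule N A P; N <+>\<^bsub>P\<^esub> {x \<in> carrier P. f x = \<zero>\<^bsub>S\<^esub>} = carrier P|] ==> N = carrier P"
  using cover unfolding projective_cover_def by blast
 have proj: "projective_module A P" using cover by (simp add: projective_cover_def)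
 then have LP: "left_module A P" by (simp add: projective_module_def)
 have LS: "left_module A S" using simple by (simp add: simple_module_def)
 have v: "v \<in> {1, 2, 3}" using S by (simp add: simple_at_def[OF Z])
 interpret P: left_module A P by fact
 interpret S: left_module A S by fact
 let ?e = "vtx Z v"
 have e: "?e \<in> carrier A" "?e \<otimes> ?e = ?e" using vtx_in[OF v] vtx_idem[OF v] by auto
 have f_closed: "f x \<in> carrier S" if "x \<in> carrier P" for x using f(1) that by (auto simp: module_hom_def)
 have gen: "free_generator ?e P q" if q: "q \<in> carrier P" "?e \<odot>\<^bsub>P\<^esub> q = q" "f q \<noteq> \<zero>\<^bsub>S\<^esub>" for q
 proof -
  let ?N = "(\<lambda>x. x \<odot>\<^bsub>P\<^esub> q) ` carrier A"
  have N: "Module.submodule ?N A P" by (rule submodule_generated[OF LP q(1)])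
  have fN: "f ` ?N = (\<lambda>x. x \<odot>\<^bsub>S\<^esub> f q) ` carrier A"
   using module_hom_smult[OF f(1) _ q(1)] by (auto simp: image_image)
  have "f ` ?N = {\<zero>\<^bsub>S\<^esub>} \<or> f ` ?N = carrier S"
   unfolding fN using simple submodule_generated[OF LS f_closed[OF q(1)]] by (simp add: simple_module_def)
  moreover have "f q \<in> f ` ?N"
   using q(1) by (intro imageI image_eqI[of _ _ \<one>]) (simp_all add: P.act_one)
  ultimately have fN': "f ` ?N = carrier S" using q(3) by blast
  have "?N <+>\<^bsub>P\<^esub> {x \<in> carrier P. f x = \<zero>\<^bsub>S\<^esub>} = carrier P"
  proof
   show "?N <+>\<^bsub>P\<^esub> {x \<in> carrier P. f x = \<zero>\<^bsub>S\<^esub>} \<subseteq> carrier P"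
    using submodule_of_leftD(1)[OF N] by (auto simp: set_add_def')
   show "carrier P \<subseteq> ?N <+>\<^bsub>P\<^esub> {x \<in> carrier P. f x = \<zero>\<^bsub>S\<^esub>}"
   proof
    fix y assume y: "y \<in> carrier P"
    have "f y \<in> f ` ?N" unfolding fN' by (rule f_closed[OF y])
    then obtain n where n: "n \<in> ?N" "f y = f n" by blast
    have nP: "n \<in> carrier P" using n(1) submodule_of_leftD(1)[OF N] by blast
    \<comment> \<open>In characteristic 2 this is the difference of the two elements.\<close>
    define k where "k = y \<oplus>\<^bsub>P\<^esub> n"
    have "n \<oplus>\<^bsub>P\<^esub> n = (\<one> \<oplus> \<one>) \<odot>\<^bsub>P\<^esub> n" using nP by (simp only: P.act_l_distr[OF one_closed one_closed nP] P.act_one[OF nP])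
    then have nn: "n \<oplus>\<^bsub>P\<^esub> n = \<zero>\<^bsub>P\<^esub>" using left_module_zero_smult[OF LP nP] by simp
    have "f k = f n \<oplus>\<^bsub>S\<^esub> f n"
     unfolding k_def using module_hom_add[OF f(1) y nP] n(2) by simp
    also have "\<dots> = f (n \<oplus>\<^bsub>P\<^esub> n)" using module_hom_add[OF f(1) nP nP] by simp
    also have "\<dots> = \<zero>\<^bsub>S\<^esub>" unfolding nn by (rule module_hom_zero[OF LP LS f(1)])
    finally have fk: "f k = \<zero>\<^bsub>S\<^esub>" .
    have kP: "k \<in> carrier P" using y nP by (simp add: k_def)
    have "y = n \<oplus>\<^bsub>P\<^esub> k"
     using y nP nn P.M.a_lcomm[OF nP y nP] by (simp add: k_def)
    then show "y \<in> ?N <+>\<^bsub>P\<^esub> {x \<in> carrier P. f x = \<zero>\<^bsub>S\<^esub>}"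
     unfolding set_add_def' using n(1) kP fk by blast
   qed
  qed
  from small[OF N this] have NP: "?N = carrier P" .
  have onto: "\<exists>x\<in>carrier A. x \<otimes> ?e = x \<and> y = x \<odot>\<^bsub>P\<^esub> q" if y: "y \<in> carrier P" for y
  proof -
   have "y \<in> ?N" unfolding NP by (rule y)
   then obtain x where x: "x \<in> carrier A" "y = x \<odot>\<^bsub>P\<^esub> q" by blast
   have "y = (x \<otimes> ?e) \<odot>\<^bsub>P\<^esub> q" using x q e by (simp add: P.act_assoc)
   moreover have "(x \<otimes> ?e) \<otimes> ?e = x \<otimes> ?e" using x e by (simp add: m_assoc)
   ultimately show ?thesis using x(1) e(1) by blast
  qed
  let ?C = "cyclic_ideal ?e"
  let ?h = "to_fun Z"
  let ?T = "transport_module ?h ?C"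
  have LC: "left_module A ?C" by (rule cyclic_ideal_left_module[OF e(1)])
  have cc: "carrier ?C = {x \<in> carrier A. x \<otimes> ?e = x}" by (simp add: cyclic_ideal_def)
  have hinj: "inj_on ?h (carrier ?C)"
   by (rule inj_on_subset[OF to_fun_inj[OF Z]]) (auto simp: cc)
  have LT: "left_module A ?T" by (rule transport_left_module[OF LC hinj])
  have Tc: "carrier ?T = ?h ` carrier ?C" by (rule transport_carrier[OF LC hinj])
  have Ta: "?h x \<oplus>\<^bsub>?T\<^esub> ?h y = ?h (x \<oplus> y)" if "x \<in> carrier ?C" "y \<in> carrier ?C" for x y
   using transport_add[OF LC hinj that] by (simp add: cyclic_ideal_def)
  have Ts: "a \<odot>\<^bsub>?T\<^esub> ?h x = ?h (a \<otimes> x)" if "x \<in> carrier ?C" for a x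
   using transport_smult[OF LC hinj that] by (simp add: cyclic_ideal_def)
  define g where "g = (\<lambda>y. inv_into (carrier ?C) ?h y \<odot>\<^bsub>P\<^esub> q)"
  have g: "g (?h x) = x \<odot>\<^bsub>P\<^esub> q" if "x \<in> carrier ?C" for x
   unfolding g_def inv_into_f_f[OF hinj that] ..
  have ca: "x \<oplus> y \<in> carrier ?C" if "x \<in> carrier ?C" "y \<in> carrier ?C" for x y
   using that e by (simp add: cc l_distr)
  have cm: "a \<otimes> x \<in> carrier ?C" if "a \<in> carrier A" "x \<in> carrier ?C" for a x
   using that e by (simp add: cc m_assoc)
  have g_hom: "g \<in> module_hom A ?T P"
   unfolding module_hom_def
  proof (intro CollectI conjI allI impI funcsetI; (elim conjE)?)
   fix y assume "y \<in> carrier ?T"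
   then obtain x where x: "x \<in> carrier ?C" "y = ?h x" unfolding Tc by blast
   then show "g y \<in> carrier P" using g[OF x(1)] q P.act_closed by (simp add: cc)
  next
   fix y z assume "y \<in> carrier ?T" "z \<in> carrier ?T"
   then obtain x x' where x: "x \<in> carrier ?C" "y = ?h x" "x' \<in> carrier ?C" "z = ?h x'" unfolding Tc by blast
   then show "g (y \<oplus>\<^bsub>?T\<^esub> z) = g y \<oplus>\<^bsub>P\<^esub> g z"
    using g[OF x(1)] g[OF x(3)] g[OF ca[OF x(1,3)]] Ta[OF x(1,3)] q by (simp add: cc P.act_l_distr)
  next
   fix a y assume a: "a \<in> carrier A" and "y \<in> carrier ?T"
   then obtain x where x: "x \<in> carrier ?C" "y = ?h x" unfolding Tc by blast
   then show "g (a \<odot>\<^bsub>?T\<^esub> y) = a \<odot>\<^bsub>P\<^esub> g y"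
    using g[OF x(1)] g[OF cm[OF a x(1)]] Ts[OF x(1)] q a by (simp add: cc P.act_assoc)
  qed
  have g_onto: "g ` carrier ?T = carrier P"
  proof
   show "g ` carrier ?T \<subseteq> carrier P" using g_hom by (auto simp: module_hom_def)
   show "carrier P \<subseteq> g ` carrier ?T"
   proof
    fix y assume "y \<in> carrier P"
    from onto[OF this] obtain x where x: "x \<in> carrier A" "x \<otimes> ?e = x" "y = x \<odot>\<^bsub>P\<^esub> q" by blast
    then have xC: "x \<in> carrier ?C" by (simp add: cc)
    show "y \<in> g ` carrier ?T"
     unfolding Tc using g[OF xC] x(3) xC by (intro image_eqI[of _ _ "?h x"]) auto
   qed
  qed
  have idh: "(\<lambda>x. x) \<in> module_hom A P P" by (simp add: module_hom_def)
  obtain h' where h': "h' \<in> module_hom A P ?T" "\<And>x. x \<in> carrier P ==> g (h' x) = x"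
   using proj[unfolded projective_module_def, THEN conjunct2, rule_format, of ?T P g "\<lambda>x. x"]
    LT LP g_hom g_onto idh by auto
  have "h' q \<in> carrier ?T" using h'(1) q(1) by (auto simp: module_hom_def)
  then obtain u where u: "u \<in> carrier ?C" "h' q = ?h u" unfolding Tc by blast
  have uA: "u \<in> carrier A" "u \<otimes> ?e = u" using u(1) by (auto simp: cc)
  have uq: "u \<odot>\<^bsub>P\<^esub> q = q" using h'(2)[OF q(1)] g[OF u(1)] u(2) by simp
  have h'x: "h' (x \<odot>\<^bsub>P\<^esub> q) = ?h (x \<otimes> u)" if x: "x \<in> carrier A" for x
   using module_hom_smult[OF h'(1) x q(1)] Ts[OF u(1)] u(2) by simp
  have eu: "?e \<otimes> u = u"
  proof -
   have "?h (?e \<otimes> u) = ?h u" using h'x[OF e(1)] q(2) u(2) by simp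
   then show ?thesis using inj_onD[OF hinj _ cm[OF e(1) u(1)] u(1)] by blast
  qed
  have q0: "q \<noteq> \<zero>\<^bsub>P\<^esub>" using q(3) module_hom_zero[OF LP LS f(1)] by auto
  have chr_u: "chr Z v u \<noteq> K0"
  proof
   assume 0: "chr Z v u = K0"
   have "deep Z 1 u"
   proof (rule deep_oneI[OF uA(1)])
    fix w assume w: "w \<in> {1, 2, 3 :: nat}"
    show "coord Z u (Vertex w) = K0"
    proof (cases "w = v")
     case True
     then show ?thesis using 0 by (simp add: chr_def[OF Z])
    next
     case False
     have "chr Z w u = chr Z w ?e \<otimes>\<^bsub>K\<^esub> chr Z w u"
      using chr_mult[OF Z w e(1) uA(1)] eu by simp
     then show ?thesis
      using False chr_vtx[OF Z w v] chr_closed[OF Z w uA(1)] by (simp add: chr_def[OF Z])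
    qed
   qed
   then have "u [^] (r + 5) = \<zero>" by (rule deep_nilpotent[OF Z]) simp
   moreover have "u [^] n \<odot>\<^bsub>P\<^esub> q = q" for n :: nat
    by (induction n) (use uA uq q(1) in \<open>simp_all add: P.act_one P.act_assoc\<close>)
   ultimately have "\<zero> \<odot>\<^bsub>P\<^esub> q = q" by metis
   then show False using q0 left_module_zero_smult[OF LP q(1)] by simp
  qed
  obtain u' where u': "u' \<in> carrier A" "u \<otimes> u' = ?e"
   using corner_unit[OF Z v uA(1) eu uA(2) chr_u] by blast
  have inj0: "x = \<zero>" if x: "x \<in> carrier A" "x \<otimes> ?e = x" "x \<odot>\<^bsub>P\<^esub> q = \<zero>\<^bsub>P\<^esub>" for x
  proof -
   have "?h (x \<otimes> u) = ?h \<zero>"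
    using h'x[OF x(1)] x(3) module_hom_zero[OF LP LT h'(1)] transport_zero[OF LC hinj]
    by (simp add: cyclic_ideal_def)
   moreover have "\<zero> \<in> carrier ?C" using e by (simp add: cc)
   ultimately have "x \<otimes> u = \<zero>" using inj_onD[OF hinj _ cm[OF x(1) u(1)]] by blast
   then have "x \<otimes> (u \<otimes> u') = \<zero>" using m_assoc[OF x(1) uA(1) u'(1)] u'(1) by simp
   then show ?thesis using x(2) u'(2) by simp
  qed
  show ?thesis
   unfolding free_generator_def using LP e q(1,2) onto inj0 by blast
 qed
 show thesis by (rule that[OF f gen])
qed

text \<open>
Of the homogeneous parts of a preimage of a nonzero vector, one has nonzero image.
\<close>

lemma graded_cover_generator:
 fixes P S :: "('a, nat => 'k) module"
 assumes cover: "projective_cover A P S" and simple: "simple_module A S" and S: "simple_at Z v S s"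
  and graded: "graded_module K A \<pi> P \<gamma>" and v0: "vtx Z v \<in> \<pi> 0"
 obtains p m where "p \<in> \<gamma> m" "free_generator (vtx Z v) P p"
proof -
 obtain f where f: "f \<in> module_hom A P S" "f ` carrier P = carrier S"
  and gen: "\<And>q. [|q \<in> carrier P; vtx Z v \<odot>\<^bsub>P\<^esub> q = q; f q \<noteq> \<zero>\<^bsub>S\<^esub>|] ==> free_generator (vtx Z v) P q"
  by (rule projective_cover_generator[OF cover simple S]) (rule that)
 have LP: "left_module A P" and dec: "direct_decomposition K (restrict_scalars A P) \<gamma>"
  and act: "\<And>i j a x. [|a \<in> \<pi> i; x \<in> \<gamma> j|] ==> a \<odot>\<^bsub>P\<^esub> x \<in> \<gamma> (i + j)"
  using graded by (auto simp: graded_module_def)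
 have LS: "left_module A S" using simple by (simp add: simple_module_def)
 have v: "v \<in> {1, 2, 3}" and s: "s \<in> carrier S" "s \<noteq> \<zero>\<^bsub>S\<^esub>" using S by (auto simp: simple_at_def[OF Z])
 interpret P: left_module A P by fact
 interpret S: left_module A S by fact
 have decP: "decomposed K (restrict_scalars A P) \<gamma>" using dec by (simp add: decomposed_def)
 interpret D: decomposed K "restrict_scalars A P" \<gamma> by fact
 have cP: "carrier (restrict_scalars A P) = carrier P" "\<zero>\<^bsub>restrict_scalars A P\<^esub> = \<zero>\<^bsub>P\<^esub>"
  "add (restrict_scalars A P) = add P" by (simp_all add: restrict_scalars_def)
 let ?e = "vtx Z v"
 have e: "?e \<in> carrier A" "?e \<otimes> ?e = ?e" using vtx_in[OF v] vtx_idem[OF v] by auto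
 have es: "?e \<odot>\<^bsub>S\<^esub> s = s"
  using simple_at_act[OF Z S e(1)] chr_vtx[OF Z v v] s by (simp add: S.act_one)
 have "s \<in> f ` carrier P" using f(2) s(1) by simp
 then obtain q0 where q0: "q0 \<in> carrier P" "f q0 = s" by blast
 define q where "q = ?e \<odot>\<^bsub>P\<^esub> q0"
 have q: "q \<in> carrier P" using e q0 P.act_closed by (simp add: q_def)
 have eq: "?e \<odot>\<^bsub>P\<^esub> q = q" unfolding q_def using P.act_assoc[OF e(1) e(1) q0(1)] e(2) by simp
 have fq: "f q = s" unfolding q_def using module_hom_smult[OF f(1) e(1) q0(1)] q0(2) es by simp
 have qR: "q \<in> carrier (restrict_scalars A P)" using q cP by simp
 have "\<exists>n. f (D.part q n) \<noteq> \<zero>\<^bsub>S\<^esub>"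
 proof (rule ccontr)
  assume neg: "\<not> ?thesis"
  let ?J = "{i. D.part q i \<noteq> \<zero>\<^bsub>restrict_scalars A P\<^esub>}"
  have "f q = f (\<Oplus>\<^bsub>restrict_scalars A P\<^esub>i\<in>?J. D.part q i)"
   using D.part_spec(3)[OF qR] by simp
  also have "\<dots> = (\<Oplus>\<^bsub>S\<^esub>i\<in>?J. f (D.part q i))"
  proof (rule finsum_additive[OF D.V.abelian_monoid_axioms S.M.abelian_monoid_axioms])
   show "f \<in> carrier (restrict_scalars A P) \<rightarrow> carrier S" using f(1) cP by (simp add: module_hom_def)
   show "f \<zero>\<^bsub>restrict_scalars A P\<^esub> = \<zero>\<^bsub>S\<^esub>" using module_hom_zero[OF LP LS f(1)] cP by simp
   show "f (x \<oplus>\<^bsub>restrict_scalars A P\<^esub> y) = f x \<oplus>\<^bsub>S\<^esub> f y"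
    if "x \<in> carrier (restrict_scalars A P)" "y \<in> carrier (restrict_scalars A P)" for x y
    using module_hom_add[OF f(1)] that cP by simp
   show "D.part q i \<in> carrier (restrict_scalars A P)" for i using qR by simp
  qed
  also have "\<dots> = \<zero>\<^bsub>S\<^esub>" using neg by (intro S.M.add.finprod_one_eqI) blast
  finally show False using fq s(2) by simp
 qed
 then obtain n where n: "f (D.part q n) \<noteq> \<zero>\<^bsub>S\<^esub>" by blast
 let ?p = "D.part q n"
 have p: "?p \<in> \<gamma> n" "?p \<in> carrier P" using qR D.part_in[OF qR] D.part_closed[OF qR] cP by auto
 have "D.part (?e \<odot>\<^bsub>P\<^esub> q) (n + 0) = ?e \<odot>\<^bsub>P\<^esub> ?p"
 proof (rule part_hom[OF decP decP])
  show "?e \<odot>\<^bsub>P\<^esub> x \<in> carrier (restrict_scalars A P)" if "x \<in> carrier (restrict_scalars A P)" for x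
   using that e P.act_closed cP by simp
  show "?e \<odot>\<^bsub>P\<^esub> (x \<oplus>\<^bsub>restrict_scalars A P\<^esub> y) = ?e \<odot>\<^bsub>P\<^esub> x \<oplus>\<^bsub>restrict_scalars A P\<^esub> ?e \<odot>\<^bsub>P\<^esub> y"
   if "x \<in> carrier (restrict_scalars A P)" "y \<in> carrier (restrict_scalars A P)" for x y
   using that e P.act_r_distr cP by simp
  show "?e \<odot>\<^bsub>P\<^esub> \<zero>\<^bsub>restrict_scalars A P\<^esub> = \<zero>\<^bsub>restrict_scalars A P\<^esub>"
   using left_module_smult_zero[OF LP e(1)] cP by simp
  show "?e \<odot>\<^bsub>P\<^esub> x \<in> \<gamma> (i + 0)" if "x \<in> \<gamma> i" for i x using act[OF v0 that] by simp
 qed (rule qR)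
 then have ep: "?e \<odot>\<^bsub>P\<^esub> ?p = ?p" using eq by simp
 show thesis by (rule that[OF p(1) gen[OF p(2) ep n]])
qed

text \<open>A homogeneous generator identifies the module with a shift of \<open>A e\<close>: the homogeneous parts of \<open>x p\<close>
 are the products of those of \<open>x\<close> with \<open>p\<close>.\<close>

lemma free_generator_degree:
 fixes P :: "('a, 'm) module"
 assumes \<pi>: "\<pi> \<in> gradings K A" and graded: "graded_module K A \<pi> P \<gamma>" and p: "p \<in> \<gamma> m" "free_generator e P p"
  and e0: "e \<in> \<pi> 0" and x: "x \<in> carrier A" "x \<otimes> e = x"
 shows "x \<odot>\<^bsub>P\<^esub> p \<in> \<gamma> (n + m) \<longleftrightarrow> x \<in> \<pi> n"
proof
 have act: "\<And>i j a x. [|a \<in> \<pi> i; x \<in> \<gamma> j|] ==> a \<odot>\<^bsub>P\<^esub> x \<in> \<gamma> (i + j)"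
  and LP: "left_module A P" and dec: "direct_decomposition K (restrict_scalars A P) \<gamma>"
  using graded by (auto simp: graded_module_def)
 show "x \<odot>\<^bsub>P\<^esub> p \<in> \<gamma> (n + m)" if "x \<in> \<pi> n" using act[OF that p(1)] .
 assume xp: "x \<odot>\<^bsub>P\<^esub> p \<in> \<gamma> (n + m)"
 interpret P: left_module A P by fact
 have decP: "decomposed K (restrict_scalars A P) \<gamma>" using dec by (simp add: decomposed_def)
 have decA: "decomposed K A \<pi>" using \<pi> by (simp add: decomposed_def gradings_def)
 interpret D: decomposed K "restrict_scalars A P" \<gamma> by fact
 interpret G: decomposed K A \<pi> by fact
 have cP: "carrier (restrict_scalars A P) = carrier P" "\<zero>\<^bsub>restrict_scalars A P\<^esub> = \<zero>\<^bsub>P\<^esub>"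
  "add (restrict_scalars A P) = add P" by (simp_all add: restrict_scalars_def)
 have e: "e \<in> carrier A" and pP: "p \<in> carrier P" using p by (auto simp: free_generator_def)
 have zero: "G.part x k = \<zero>" if k: "k \<noteq> n" for k
 proof -
  have xk: "G.part x k \<in> carrier A" using x by simp
  have "G.part (x \<otimes> e) (k + 0) = G.part x k \<otimes> e"
  proof (rule part_hom[OF decA decA])
   show "y \<otimes> e \<in> \<pi> (i + 0)" if "y \<in> \<pi> i" for i y
    using \<pi> that e0 unfolding gradings_def by blast
  qed (use x e in \<open>simp_all add: l_distr\<close>)
  then have xke: "G.part x k \<otimes> e = G.part x k" using x(2) by simp
  have "D.part (x \<odot>\<^bsub>P\<^esub> p) (k + m) = G.part x k \<odot>\<^bsub>P\<^esub> p"
  proof (rule part_hom[OF decA decP])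
   show "y \<odot>\<^bsub>P\<^esub> p \<in> carrier (restrict_scalars A P)" if "y \<in> carrier A" for y
    using that pP P.act_closed cP by simp
   show "(y \<oplus> z) \<odot>\<^bsub>P\<^esub> p = y \<odot>\<^bsub>P\<^esub> p \<oplus>\<^bsub>restrict_scalars A P\<^esub> z \<odot>\<^bsub>P\<^esub> p"
    if "y \<in> carrier A" "z \<in> carrier A" for y z using that pP P.act_l_distr cP by simp
   show "\<zero> \<odot>\<^bsub>P\<^esub> p = \<zero>\<^bsub>restrict_scalars A P\<^esub>" using left_module_zero_smult[OF LP pP] cP by simp
   show "y \<odot>\<^bsub>P\<^esub> p \<in> \<gamma> (i + m)" if "y \<in> \<pi> i" for i y using act[OF that p(1)] .
  qed (rule x(1))
  moreover have "D.part (x \<odot>\<^bsub>P\<^esub> p) (k + m) = \<zero>\<^bsub>P\<^esub>"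
   using D.part_homogeneous[OF xp, of "k + m"] k cP by simp
  ultimately have "G.part x k \<odot>\<^bsub>P\<^esub> p = \<zero>\<^bsub>P\<^esub>" by simp
  then show ?thesis using p(2) xk xke unfolding free_generator_def by blast
 qed
 have "(\<Oplus>i\<in>{n}. G.part x i) = x" by (rule G.part_sum[OF x(1)]) (use zero in blast)+
 then have "G.part x n = x" using x by simp
 then show "x \<in> \<pi> n" using G.part_in[OF x(1), of n] by simp
qed

end

section \<open>Endomorphisms of a free module of rank one\<close>

lemma endomorphisms_abelian:
 assumes M: "left_module A M"
 shows "abelian_group (endomorphism_algebra A M)"
proof -
 interpret M: left_module A M by fact
 let ?E = "endomorphism_algebra A M"
 have cE: "f \<in> carrier ?E \<longleftrightarrow> f \<in> carrier M \<rightarrow> carrier M \<and>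
   (\<forall>x\<in>carrier M. \<forall>y\<in>carrier M. f (x \<oplus>\<^bsub>M\<^esub> y) = f x \<oplus>\<^bsub>M\<^esub> f y) \<and>
   (\<forall>a\<in>carrier A. \<forall>x\<in>carrier M. f (a \<odot>\<^bsub>M\<^esub> x) = a \<odot>\<^bsub>M\<^esub> f x) \<and> f \<in> extensional (carrier M)" for f
  by (auto simp: endomorphism_algebra_def module_hom_def)
 have fc: "f x \<in> carrier M" if "f \<in> carrier ?E" "x \<in> carrier M" for f x using that unfolding cE by blast
 have fadd: "f (x \<oplus>\<^bsub>M\<^esub> y) = f x \<oplus>\<^bsub>M\<^esub> f y" if "f \<in> carrier ?E" "x \<in> carrier M" "y \<in> carrier M" for f x y
  using that unfolding cE by blast
 have fsm: "f (a \<odot>\<^bsub>M\<^esub> x) = a \<odot>\<^bsub>M\<^esub> f x" if "f \<in> carrier ?E" "a \<in> carrier A" "x \<in> carrier M" for f a x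
  using that unfolding cE by blast
 have fext: "f \<in> extensional (carrier M)" if "f \<in> carrier ?E" for f using that unfolding cE by blast
 have E_add: "f \<oplus>\<^bsub>?E\<^esub> g = (\<lambda>x\<in>carrier M. f x \<oplus>\<^bsub>M\<^esub> g x)" for f g by (simp add: endomorphism_algebra_def)
 have E_zero: "\<zero>\<^bsub>?E\<^esub> = (\<lambda>x\<in>carrier M. \<zero>\<^bsub>M\<^esub>)" by (simp add: endomorphism_algebra_def)
 have z: "\<zero>\<^bsub>?E\<^esub> \<in> carrier ?E"
  unfolding cE E_zero using left_module_smult_zero[OF M] M.act_closed by auto
 have pl: "f \<oplus>\<^bsub>?E\<^esub> g \<in> carrier ?E" if f: "f \<in> carrier ?E" and g: "g \<in> carrier ?E" for f g
  unfolding cE E_add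
 proof (intro conjI ballI)
  show "(\<lambda>x\<in>carrier M. f x \<oplus>\<^bsub>M\<^esub> g x) \<in> carrier M \<rightarrow> carrier M" using fc[OF f] fc[OF g] by simp
  fix x y assume xy: "x \<in> carrier M" "y \<in> carrier M"
  show "(\<lambda>x\<in>carrier M. f x \<oplus>\<^bsub>M\<^esub> g x) (x \<oplus>\<^bsub>M\<^esub> y) =
    (\<lambda>x\<in>carrier M. f x \<oplus>\<^bsub>M\<^esub> g x) x \<oplus>\<^bsub>M\<^esub> (\<lambda>x\<in>carrier M. f x \<oplus>\<^bsub>M\<^esub> g x) y"
   using xy fadd[OF f xy] fadd[OF g xy] fc[OF f xy(1)] fc[OF f xy(2)] fc[OF g xy(1)] fc[OF g xy(2)]
   by (simp add: M.M.a_ac)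
 next
  fix a x assume ax: "a \<in> carrier A" "x \<in> carrier M"
  show "(\<lambda>x\<in>carrier M. f x \<oplus>\<^bsub>M\<^esub> g x) (a \<odot>\<^bsub>M\<^esub> x) = a \<odot>\<^bsub>M\<^esub> (\<lambda>x\<in>carrier M. f x \<oplus>\<^bsub>M\<^esub> g x) x"
   using ax fsm[OF f ax] fsm[OF g ax] fc[OF f ax(2)] fc[OF g ax(2)] M.act_closed[OF ax]
   by (simp add: M.act_r_distr)
 qed simp
 show ?thesis
 proof (rule abelian_groupI)
  fix f g assume f: "f \<in> carrier ?E" and g: "g \<in> carrier ?E"
  show "f \<oplus>\<^bsub>?E\<^esub> g \<in> carrier ?E" by (rule pl[OF f g])
  show "f \<oplus>\<^bsub>?E\<^esub> g = g \<oplus>\<^bsub>?E\<^esub> f"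
   unfolding E_add by (rule restrict_ext) (simp add: M.M.a_comm fc[OF f] fc[OF g])
 next
  fix f g k assume f: "f \<in> carrier ?E" and g: "g \<in> carrier ?E" and k: "k \<in> carrier ?E"
  show "(f \<oplus>\<^bsub>?E\<^esub> g) \<oplus>\<^bsub>?E\<^esub> k = f \<oplus>\<^bsub>?E\<^esub> (g \<oplus>\<^bsub>?E\<^esub> k)"
   unfolding E_add by (rule restrict_ext) (simp add: M.M.a_assoc fc[OF f] fc[OF g] fc[OF k])
 next
  fix f assume f: "f \<in> carrier ?E"
  show "\<zero>\<^bsub>?E\<^esub> \<oplus>\<^bsub>?E\<^esub> f = f"
   unfolding E_add E_zero by (rule extensionalityI[OF _ fext[OF f]]) (simp_all add: fc[OF f])
  have "f x \<oplus>\<^bsub>M\<^esub> f x = \<zero>\<^bsub>M\<^esub>" if x: "x \<in> carrier M" for x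
  proof -
   have "f x \<oplus>\<^bsub>M\<^esub> f x = (\<one> \<oplus> \<one>) \<odot>\<^bsub>M\<^esub> f x"
    by (simp only: M.act_l_distr[OF one_closed one_closed fc[OF f x]] M.act_one[OF fc[OF f x]])
   then show ?thesis using left_module_zero_smult[OF M fc[OF f x]] by simp
  qed
  then have "f \<oplus>\<^bsub>?E\<^esub> f = \<zero>\<^bsub>?E\<^esub>" unfolding E_add E_zero by (intro restrict_ext)
  then show "\<exists>g\<in>carrier ?E. g \<oplus>\<^bsub>?E\<^esub> f = \<zero>\<^bsub>?E\<^esub>" using f by blast
 qed (rule z)
qed

text \<open>
An endomorphism of a free module of rank one is right multiplication by an element of the algebra;
composition reverses the order of the factors, hence the opposite algebra. The hypothesis on degrees says that
right multiplication by \<open>x\<close> raises degrees by \<open>n\<close> exactly when \<open>x\<close> is homogeneous of degree \<open>n\<close>. The decomposition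
into homogeneous elements shows that every endomorphism is a sum of graded ones.
\<close>

theorem endomorphisms_of_free_module:
 fixes M :: "('a, 'm) module"
 assumes M: "left_module A M" and m0: "m0 \<in> carrier M"
  and bij: "bij_betw (\<lambda>y. y \<odot>\<^bsub>M\<^esub> m0) (carrier A) (carrier M)"
  and \<rho>: "direct_decomposition K A \<rho>" and \<delta>: "\<And>t. \<delta> t \<subseteq> carrier M"
  and deg: "\<And>x n. x \<in> carrier A ==>
   x \<in> \<rho> n \<longleftrightarrow> (\<forall>t. \<forall>y\<in>carrier A. y \<odot>\<^bsub>M\<^esub> m0 \<in> \<delta> t \<longrightarrow> (y \<otimes> x) \<odot>\<^bsub>M\<^esub> m0 \<in> \<delta> (n + t))"
 shows "graded_algebras_isomorphic K A \<rho> (opposite_algebra (Endgr A M \<delta>)) (Endgr_component A M \<delta>)"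
proof -
 interpret M: left_module A M by fact
 interpret R: decomposed K A \<rho> using \<rho> by (simp add: decomposed_def)
 let ?E = "endomorphism_algebra A M"
 interpret E: abelian_group ?E by (rule endomorphisms_abelian[OF M])
 define T where "T = inv_into (carrier A) (\<lambda>y. y \<odot>\<^bsub>M\<^esub> m0)"
 have T: "T (y \<odot>\<^bsub>M\<^esub> m0) = y" if "y \<in> carrier A" for y
  unfolding T_def using inv_into_f_f[OF bij_betw_imp_inj_on[OF bij] that] .
 have Tm: "T m \<in> carrier A" "T m \<odot>\<^bsub>M\<^esub> m0 = m" if m: "m \<in> carrier M" for m
 proof -
  have "m \<in> (\<lambda>y. y \<odot>\<^bsub>M\<^esub> m0) ` carrier A" using m bij_betw_imp_surj_on[OF bij] by simp
  then show "T m \<in> carrier A" "T m \<odot>\<^bsub>M\<^esub> m0 = m" unfolding T_def by (rule inv_into_into, rule f_inv_into_f)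
 qed
 have inj: "y = z" if "y \<in> carrier A" "z \<in> carrier A" "y \<odot>\<^bsub>M\<^esub> m0 = z \<odot>\<^bsub>M\<^esub> m0" for y z
  using inj_onD[OF bij_betw_imp_inj_on[OF bij] that(3,1,2)] .
 have m_closed: "y \<odot>\<^bsub>M\<^esub> m0 \<in> carrier M" if "y \<in> carrier A" for y using M.act_closed[OF that m0] .
 define \<Psi> where "\<Psi> = (\<lambda>x. \<lambda>m\<in>carrier M. (T m \<otimes> x) \<odot>\<^bsub>M\<^esub> m0)"
 have \<Psi>_at: "\<Psi> x (y \<odot>\<^bsub>M\<^esub> m0) = (y \<otimes> x) \<odot>\<^bsub>M\<^esub> m0" if "y \<in> carrier A" for x y
  unfolding \<Psi>_def using m_closed[OF that] T[OF that] by simp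
 have ext_eq: "f = g" if "f \<in> extensional (carrier M)" "g \<in> extensional (carrier M)"
  "\<And>y. y \<in> carrier A ==> f (y \<odot>\<^bsub>M\<^esub> m0) = g (y \<odot>\<^bsub>M\<^esub> m0)" for f g :: "'m => 'm"
 proof (rule extensionalityI[OF that(1,2)])
  fix m assume m: "m \<in> carrier M"
  show "f m = g m" using that(3)[OF Tm(1)[OF m]] Tm(2)[OF m] by simp
 qed
 have \<Psi>_ext: "\<Psi> x \<in> extensional (carrier M)" for x by (simp add: \<Psi>_def)
 have cE: "carrier ?E = module_hom A M M \<inter> extensional (carrier M)" by (simp add: endomorphism_algebra_def)
 have \<Psi>_hom: "\<Psi> x \<in> module_hom A M M" if x: "x \<in> carrier A" for x
  unfolding module_hom_def
 proof (intro CollectI conjI allI impI funcsetI; (elim conjE)?)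
  fix m assume "m \<in> carrier M"
  then show "\<Psi> x m \<in> carrier M" unfolding \<Psi>_def using Tm m_closed x by simp
 next
  fix m n assume m: "m \<in> carrier M" and n: "n \<in> carrier M"
  have mn: "m \<oplus>\<^bsub>M\<^esub> n = (T m \<oplus> T n) \<odot>\<^bsub>M\<^esub> m0"
   using Tm[OF m] Tm[OF n] M.act_l_distr[OF Tm(1)[OF m] Tm(1)[OF n] m0] by simp
  have "\<Psi> x (m \<oplus>\<^bsub>M\<^esub> n) = ((T m \<oplus> T n) \<otimes> x) \<odot>\<^bsub>M\<^esub> m0"
   unfolding mn using Tm(1)[OF m] Tm(1)[OF n] by (intro \<Psi>_at) simp
  also have "\<dots> = (T m \<otimes> x) \<odot>\<^bsub>M\<^esub> m0 \<oplus>\<^bsub>M\<^esub> (T n \<otimes> x) \<odot>\<^bsub>M\<^esub> m0"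
   using Tm(1)[OF m] Tm(1)[OF n] x m0 by (simp add: l_distr M.act_l_distr)
  finally show "\<Psi> x (m \<oplus>\<^bsub>M\<^esub> n) = \<Psi> x m \<oplus>\<^bsub>M\<^esub> \<Psi> x n" using m n by (simp add: \<Psi>_def)
 next
  fix a m assume a: "a \<in> carrier A" and m: "m \<in> carrier M"
  have am: "a \<odot>\<^bsub>M\<^esub> m = (a \<otimes> T m) \<odot>\<^bsub>M\<^esub> m0"
   using Tm[OF m] M.act_assoc[OF a Tm(1)[OF m] m0] by simp
  have "\<Psi> x (a \<odot>\<^bsub>M\<^esub> m) = ((a \<otimes> T m) \<otimes> x) \<odot>\<^bsub>M\<^esub> m0"
   unfolding am using a Tm(1)[OF m] by (intro \<Psi>_at) simp
  also have "\<dots> = a \<odot>\<^bsub>M\<^esub> ((T m \<otimes> x) \<odot>\<^bsub>M\<^esub> m0)"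
   using a Tm(1)[OF m] x m0 by (simp add: m_assoc M.act_assoc)
  finally show "\<Psi> x (a \<odot>\<^bsub>M\<^esub> m) = a \<odot>\<^bsub>M\<^esub> \<Psi> x m" using m by (simp add: \<Psi>_def)
 qed
 have \<Psi>_E: "\<Psi> x \<in> carrier ?E" if "x \<in> carrier A" for x unfolding cE using \<Psi>_hom[OF that] \<Psi>_ext by blast
 have \<Psi>_surj: "\<exists>x\<in>carrier A. f = \<Psi> x" if f: "f \<in> carrier ?E" for f
 proof -
  have fh: "f \<in> module_hom A M M" "f \<in> extensional (carrier M)" using f unfolding cE by auto
  have fm: "f m0 \<in> carrier M" using fh(1) m0 by (auto simp: module_hom_def)
  let ?x = "T (f m0)"
  have x: "?x \<in> carrier A" "?x \<odot>\<^bsub>M\<^esub> m0 = f m0" using Tm[OF fm] by auto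
  have "f = \<Psi> ?x"
  proof (rule ext_eq[OF fh(2) \<Psi>_ext])
   fix y assume y: "y \<in> carrier A"
   have "f (y \<odot>\<^bsub>M\<^esub> m0) = y \<odot>\<^bsub>M\<^esub> (?x \<odot>\<^bsub>M\<^esub> m0)" using module_hom_smult[OF fh(1) y m0] x(2) by simp
   also have "\<dots> = \<Psi> ?x (y \<odot>\<^bsub>M\<^esub> m0)" unfolding \<Psi>_at[OF y] using y x(1) m0 by (simp add: M.act_assoc)
   finally show "f (y \<odot>\<^bsub>M\<^esub> m0) = \<Psi> ?x (y \<odot>\<^bsub>M\<^esub> m0)" .
  qed
  with x(1) show ?thesis by blast
 qed
 have \<Psi>_inj: "x = y" if x: "x \<in> carrier A" and y: "y \<in> carrier A" and eq: "\<Psi> x = \<Psi> y" for x y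
 proof -
  have "(\<one> \<otimes> x) \<odot>\<^bsub>M\<^esub> m0 = (\<one> \<otimes> y) \<odot>\<^bsub>M\<^esub> m0"
   using \<Psi>_at[OF one_closed, of x] \<Psi>_at[OF one_closed, of y] eq by simp
  then show ?thesis using inj[OF x y] x y by simp
 qed
 have \<Psi>_add: "\<Psi> (x \<oplus> y) = \<Psi> x \<oplus>\<^bsub>?E\<^esub> \<Psi> y" if x: "x \<in> carrier A" and y: "y \<in> carrier A" for x y
 proof (rule ext_eq[OF \<Psi>_ext])
  show "\<Psi> x \<oplus>\<^bsub>?E\<^esub> \<Psi> y \<in> extensional (carrier M)" by (simp add: endomorphism_algebra_def)
  fix z assume z: "z \<in> carrier A"
  show "\<Psi> (x \<oplus> y) (z \<odot>\<^bsub>M\<^esub> m0) = (\<Psi> x \<oplus>\<^bsub>?E\<^esub> \<Psi> y) (z \<odot>\<^bsub>M\<^esub> m0)"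
   using \<Psi>_at[OF z] m_closed[OF z] x y z m0
   by (simp add: endomorphism_algebra_def r_distr M.act_l_distr)
 qed
 have \<Psi>_zero: "\<Psi> \<zero> = \<zero>\<^bsub>?E\<^esub>"
 proof (rule ext_eq[OF \<Psi>_ext])
  show "\<zero>\<^bsub>?E\<^esub> \<in> extensional (carrier M)" by (simp add: endomorphism_algebra_def)
  fix z assume z: "z \<in> carrier A"
  show "\<Psi> \<zero> (z \<odot>\<^bsub>M\<^esub> m0) = \<zero>\<^bsub>?E\<^esub> (z \<odot>\<^bsub>M\<^esub> m0)"
   using \<Psi>_at[OF z] m_closed[OF z] z left_module_zero_smult[OF M m0] by (simp add: endomorphism_algebra_def)
 qed
 have comp: "\<Psi> x \<in> Endgr_component A M \<delta> n \<longleftrightarrow> x \<in> \<rho> n" if x: "x \<in> carrier A" for x n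
 proof -
  have "\<Psi> x \<in> Endgr_component A M \<delta> n \<longleftrightarrow> (\<forall>t. \<Psi> x ` \<delta> t \<subseteq> \<delta> (n + t))"
   using \<Psi>_hom[OF x] \<Psi>_ext by (simp add: Endgr_component_def graded_hom_def shift_def)
  also have "\<dots> \<longleftrightarrow> (\<forall>t. \<forall>y\<in>carrier A. y \<odot>\<^bsub>M\<^esub> m0 \<in> \<delta> t \<longrightarrow> (y \<otimes> x) \<odot>\<^bsub>M\<^esub> m0 \<in> \<delta> (n + t))"
  proof (intro iff_allI iffI ballI impI)
   fix t y assume "\<Psi> x ` \<delta> t \<subseteq> \<delta> (n + t)" "y \<in> carrier A" "y \<odot>\<^bsub>M\<^esub> m0 \<in> \<delta> t"
   then show "(y \<otimes> x) \<odot>\<^bsub>M\<^esub> m0 \<in> \<delta> (n + t)" using \<Psi>_at[of y x] by auto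
  next
   fix t assume a: "\<forall>y\<in>carrier A. y \<odot>\<^bsub>M\<^esub> m0 \<in> \<delta> t \<longrightarrow> (y \<otimes> x) \<odot>\<^bsub>M\<^esub> m0 \<in> \<delta> (n + t)"
   show "\<Psi> x ` \<delta> t \<subseteq> \<delta> (n + t)"
   proof
    fix z assume "z \<in> \<Psi> x ` \<delta> t"
    then obtain m where m: "m \<in> \<delta> t" "z = \<Psi> x m" by blast
    have mM: "m \<in> carrier M" using m(1) \<delta> by blast
    have "(T m \<otimes> x) \<odot>\<^bsub>M\<^esub> m0 \<in> \<delta> (n + t)" using a Tm[OF mM] m(1) by simp
    then show "z \<in> \<delta> (n + t)" using m(2) mM by (simp add: \<Psi>_def)
   qed
  qed
  finally show ?thesis using deg[OF x] by simp
 qed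
 have comp_sub: "Endgr_component A M \<delta> n \<subseteq> carrier ?E" for n
  unfolding cE Endgr_component_def graded_hom_def by blast
 have cEnd: "carrier (Endgr A M \<delta>) = carrier ?E"
 proof
  show "carrier (Endgr A M \<delta>) \<subseteq> carrier ?E"
  proof
   fix g assume "g \<in> carrier (Endgr A M \<delta>)"
   then obtain f J where "finite J" "\<forall>i\<in>J. f i \<in> Endgr_component A M \<delta> i" "g = (\<Oplus>\<^bsub>?E\<^esub>i\<in>J. f i)"
    unfolding Endgr_def by auto
   then show "g \<in> carrier ?E" using comp_sub by (auto intro!: E.finsum_closed)
  qed
  show "carrier ?E \<subseteq> carrier (Endgr A M \<delta>)"
  proof
   fix g assume "g \<in> carrier ?E"
   from \<Psi>_surj[OF this] obtain x where x: "x \<in> carrier A" "g = \<Psi> x" by blast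
   let ?J = "{i. R.part x i \<noteq> \<zero>}"
   have "\<Psi> x = \<Psi> (\<Oplus>i\<in>?J. R.part x i)" using R.part_spec(3)[OF x(1)] by simp
   also have "\<dots> = (\<Oplus>\<^bsub>?E\<^esub>i\<in>?J. \<Psi> (R.part x i))"
    using x(1) \<Psi>_E \<Psi>_add \<Psi>_zero
    by (intro finsum_additive abelian_monoid_axioms E.abelian_monoid_axioms) auto
   finally have "g = (\<Oplus>\<^bsub>?E\<^esub>i\<in>?J. \<Psi> (R.part x i))" using x(2) by simp
   moreover have "\<forall>i\<in>?J. \<Psi> (R.part x i) \<in> Endgr_component A M \<delta> i"
    using comp[OF R.part_closed[OF x(1)]] R.part_in[OF x(1)] by blast
   moreover have "finite ?J" by (rule R.part_spec(2)[OF x(1)])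
   ultimately show "g \<in> carrier (Endgr A M \<delta>)"
    unfolding Endgr_def by (simp, intro exI[of _ "\<lambda>i. \<Psi> (R.part x i)"] exI[of _ ?J]) simp
  qed
 qed
 let ?O = "opposite_algebra (Endgr A M \<delta>)"
 have O: "carrier ?O = carrier ?E" "add ?O = add ?E" "one ?O = one ?E" "smult ?O = smult ?E"
  "\<And>f g. f \<otimes>\<^bsub>?O\<^esub> g = compose (carrier M) g f"
  using cEnd by (simp_all add: opposite_algebra_def Endgr_def endomorphism_algebra_def)
 have iso: "\<Psi> \<in> ring_iso A ?O"
 proof (rule ring_iso_memI)
  show "\<Psi> x \<in> carrier ?O" if "x \<in> carrier A" for x unfolding O by (rule \<Psi>_E[OF that])
  show "\<Psi> (x \<oplus> y) = \<Psi> x \<oplus>\<^bsub>?O\<^esub> \<Psi> y" if "x \<in> carrier A" "y \<in> carrier A" for x y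
   unfolding O by (rule \<Psi>_add[OF that])
  show "\<Psi> \<one> = \<one>\<^bsub>?O\<^esub>"
  proof (rule ext_eq[OF \<Psi>_ext])
   show "\<one>\<^bsub>?O\<^esub> \<in> extensional (carrier M)" unfolding O by (simp add: endomorphism_algebra_def)
   fix z assume z: "z \<in> carrier A"
   show "\<Psi> \<one> (z \<odot>\<^bsub>M\<^esub> m0) = \<one>\<^bsub>?O\<^esub> (z \<odot>\<^bsub>M\<^esub> m0)"
    unfolding O using \<Psi>_at[OF z] m_closed[OF z] z by (simp add: endomorphism_algebra_def)
  qed
  show "\<Psi> (x \<otimes> y) = \<Psi> x \<otimes>\<^bsub>?O\<^esub> \<Psi> y" if x: "x \<in> carrier A" and y: "y \<in> carrier A" for x y
   unfolding O
  proof (rule ext_eq[OF \<Psi>_ext])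
   show "compose (carrier M) (\<Psi> y) (\<Psi> x) \<in> extensional (carrier M)" by (simp add: compose_def)
   fix z assume z: "z \<in> carrier A"
   show "\<Psi> (x \<otimes> y) (z \<odot>\<^bsub>M\<^esub> m0) = compose (carrier M) (\<Psi> y) (\<Psi> x) (z \<odot>\<^bsub>M\<^esub> m0)"
    using \<Psi>_at[OF z] \<Psi>_at[of "z \<otimes> x" y] m_closed[OF z] x y z by (simp add: compose_def m_assoc)
  qed
  show "bij_betw \<Psi> (carrier A) (carrier ?O)"
   unfolding O bij_betw_def inj_on_def using \<Psi>_inj \<Psi>_E \<Psi>_surj by blast
 qed
 have sm: "\<Psi> (c \<odot> x) = c \<odot>\<^bsub>?O\<^esub> \<Psi> x" if c: "c \<in> carrier K" and x: "x \<in> carrier A" for c x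
  unfolding O
 proof (rule ext_eq[OF \<Psi>_ext])
  show "c \<odot>\<^bsub>?E\<^esub> \<Psi> x \<in> extensional (carrier M)" by (simp add: endomorphism_algebra_def)
  fix z assume z: "z \<in> carrier A"
  have "(z \<otimes> (c \<odot> x)) \<odot>\<^bsub>M\<^esub> m0 = ((c \<odot> \<one>) \<otimes> (z \<otimes> x)) \<odot>\<^bsub>M\<^esub> m0"
   using c x z by (simp add: smult_mult_right scalar_action)
  also have "\<dots> = (c \<odot> \<one>) \<odot>\<^bsub>M\<^esub> ((z \<otimes> x) \<odot>\<^bsub>M\<^esub> m0)" using c x z m0 by (intro M.act_assoc) auto
  finally show "\<Psi> (c \<odot> x) (z \<odot>\<^bsub>M\<^esub> m0) = (c \<odot>\<^bsub>?E\<^esub> \<Psi> x) (z \<odot>\<^bsub>M\<^esub> m0)"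
   using \<Psi>_at[OF z] m_closed[OF z] by (simp add: endomorphism_algebra_def)
 qed
 have pieces: "\<Psi> ` \<rho> n = Endgr_component A M \<delta> n" for n
 proof
  show "\<Psi> ` \<rho> n \<subseteq> Endgr_component A M \<delta> n"
   using comp[OF R.piece_closed] by blast
  show "Endgr_component A M \<delta> n \<subseteq> \<Psi> ` \<rho> n"
  proof
   fix f assume f: "f \<in> Endgr_component A M \<delta> n"
   then have "f \<in> carrier ?E" using comp_sub by blast
   from \<Psi>_surj[OF this] obtain x where "x \<in> carrier A" "f = \<Psi> x" by blast
   then show "f \<in> \<Psi> ` \<rho> n" using f comp by blast
  qed
 qed
 show ?thesis unfolding graded_algebras_isomorphic_def using iso sm pieces by blast
qed

end

section \<open>Shifted sums of projective covers\<close>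

lemma direct_sum_left_module:
 assumes "ring A" and M: "\<And>i. i \<in> I ==> left_module A (M i)"
 shows "left_module A (direct_sum_module I M)"
proof -
 let ?D = "direct_sum_module I M"
 have D: "carrier ?D = (\<Pi>\<^sub>E i\<in>I. carrier (M i))" "\<zero>\<^bsub>?D\<^esub> = (\<lambda>i\<in>I. \<zero>\<^bsub>M i\<^esub>)"
  "\<And>x y. x \<oplus>\<^bsub>?D\<^esub> y = (\<lambda>i\<in>I. x i \<oplus>\<^bsub>M i\<^esub> y i)" "\<And>a x. a \<odot>\<^bsub>?D\<^esub> x = (\<lambda>i\<in>I. a \<odot>\<^bsub>M i\<^esub> x i)"
  by (simp_all add: direct_sum_module_def)
 have ag: "abelian_group (M i)" if "i \<in> I" for i using M[OF that] by (simp add: left_module_def)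
 have mem: "x i \<in> carrier (M i)" if "x \<in> carrier ?D" "i \<in> I" for x i using that unfolding D by (rule PiE_mem)
 have ext: "x = y" if "x \<in> carrier ?D" "y \<in> carrier ?D" "\<And>i. i \<in> I ==> x i = y i" for x y
  using that(1,2) unfolding D by (rule PiE_ext) (rule that(3))
 have pl: "x \<oplus>\<^bsub>?D\<^esub> y \<in> carrier ?D" if x: "x \<in> carrier ?D" and y: "y \<in> carrier ?D" for x y
  unfolding D restrict_PiE_iff using abelian_monoid.a_closed[OF abelian_group.axioms(1)[OF ag]] mem[OF x] mem[OF y] by blast
 have z: "\<zero>\<^bsub>?D\<^esub> \<in> carrier ?D"
  unfolding D restrict_PiE_iff using abelian_monoid.zero_closed[OF abelian_group.axioms(1)[OF ag]] by blast
 have sm: "a \<odot>\<^bsub>?D\<^esub> x \<in> carrier ?D" if a: "a \<in> carrier A" and x: "x \<in> carrier ?D" for a x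
  unfolding D restrict_PiE_iff using left_module.act_closed[OF M a mem[OF x]] by blast
 have ap: "(x \<oplus>\<^bsub>?D\<^esub> y) i = x i \<oplus>\<^bsub>M i\<^esub> y i" "(a \<odot>\<^bsub>?D\<^esub> x) i = a \<odot>\<^bsub>M i\<^esub> x i" "\<zero>\<^bsub>?D\<^esub> i = \<zero>\<^bsub>M i\<^esub>"
  if "i \<in> I" for x y a i using that by (simp_all add: D)
 show ?thesis
 proof (intro left_module.intro left_module_axioms.intro \<open>ring A\<close>)
  show "abelian_group ?D"
  proof (rule abelian_groupI)
   fix x y w assume x: "x \<in> carrier ?D" and y: "y \<in> carrier ?D" and w: "w \<in> carrier ?D"
   show "x \<oplus>\<^bsub>?D\<^esub> y \<oplus>\<^bsub>?D\<^esub> w = x \<oplus>\<^bsub>?D\<^esub> (y \<oplus>\<^bsub>?D\<^esub> w)"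
    by (rule ext[OF pl[OF pl[OF x y] w] pl[OF x pl[OF y w]]])
     (simp add: ap abelian_monoid.a_assoc[OF abelian_group.axioms(1)[OF ag]] mem[OF x] mem[OF y] mem[OF w])
  next
   fix x y assume x: "x \<in> carrier ?D" and y: "y \<in> carrier ?D"
   show "x \<oplus>\<^bsub>?D\<^esub> y \<in> carrier ?D" by (rule pl[OF x y])
   show "x \<oplus>\<^bsub>?D\<^esub> y = y \<oplus>\<^bsub>?D\<^esub> x"
    by (rule ext[OF pl[OF x y] pl[OF y x]])
     (simp add: ap abelian_monoid.a_comm[OF abelian_group.axioms(1)[OF ag]] mem[OF x] mem[OF y])
  next
   fix x assume x: "x \<in> carrier ?D"
   show "\<zero>\<^bsub>?D\<^esub> \<oplus>\<^bsub>?D\<^esub> x = x"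
    by (rule ext[OF pl[OF z x] x]) (simp add: ap abelian_monoid.l_zero[OF abelian_group.axioms(1)[OF ag]] mem[OF x])
   have nx: "(\<lambda>i\<in>I. \<ominus>\<^bsub>M i\<^esub> x i) \<in> carrier ?D"
    unfolding D restrict_PiE_iff using abelian_group.a_inv_closed[OF ag mem[OF x]] by blast
   have "(\<lambda>i\<in>I. \<ominus>\<^bsub>M i\<^esub> x i) \<oplus>\<^bsub>?D\<^esub> x = \<zero>\<^bsub>?D\<^esub>"
    by (rule ext[OF pl[OF nx x] z]) (simp add: ap abelian_group.l_neg[OF ag] mem[OF x])
   with nx show "\<exists>y\<in>carrier ?D. y \<oplus>\<^bsub>?D\<^esub> x = \<zero>\<^bsub>?D\<^esub>" by blast
  qed (rule z)
  fix a x assume a: "a \<in> carrier A" and x: "x \<in> carrier ?D"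
  show "a \<odot>\<^bsub>?D\<^esub> x \<in> carrier ?D" by (rule sm[OF a x])
 next
  fix a b x assume a: "a \<in> carrier A" and b: "b \<in> carrier A" and x: "x \<in> carrier ?D"
  have ab: "a \<oplus>\<^bsub>A\<^esub> b \<in> carrier A" "a \<otimes>\<^bsub>A\<^esub> b \<in> carrier A"
   using a b \<open>ring A\<close> by (simp_all add: ring.ring_simprules)
  show "(a \<oplus>\<^bsub>A\<^esub> b) \<odot>\<^bsub>?D\<^esub> x = a \<odot>\<^bsub>?D\<^esub> x \<oplus>\<^bsub>?D\<^esub> b \<odot>\<^bsub>?D\<^esub> x"
   by (rule ext[OF sm[OF ab(1) x] pl[OF sm[OF a x] sm[OF b x]]])
    (simp add: ap left_module.act_l_distr[OF M a b mem[OF x]])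
  show "(a \<otimes>\<^bsub>A\<^esub> b) \<odot>\<^bsub>?D\<^esub> x = a \<odot>\<^bsub>?D\<^esub> (b \<odot>\<^bsub>?D\<^esub> x)"
   by (rule ext[OF sm[OF ab(2) x] sm[OF a sm[OF b x]]])
    (simp add: ap left_module.act_assoc[OF M a b mem[OF x]])
 next
  fix a x y assume a: "a \<in> carrier A" and x: "x \<in> carrier ?D" and y: "y \<in> carrier ?D"
  show "a \<odot>\<^bsub>?D\<^esub> (x \<oplus>\<^bsub>?D\<^esub> y) = a \<odot>\<^bsub>?D\<^esub> x \<oplus>\<^bsub>?D\<^esub> a \<odot>\<^bsub>?D\<^esub> y"
   by (rule ext[OF sm[OF a pl[OF x y]] pl[OF sm[OF a x] sm[OF a y]]])
    (simp add: ap left_module.act_r_distr[OF M a mem[OF x] mem[OF y]])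
 next
  fix x assume x: "x \<in> carrier ?D"
  have o: "\<one>\<^bsub>A\<^esub> \<in> carrier A" using \<open>ring A\<close> by (simp add: ring.ring_simprules)
  show "\<one>\<^bsub>A\<^esub> \<odot>\<^bsub>?D\<^esub> x = x"
   by (rule ext[OF sm[OF o x] x]) (simp add: ap left_module.act_one[OF M mem[OF x]])
 qed
qed

lemma graded_isomorphic_trans:
 assumes AB: "graded_algebras_isomorphic K A \<alpha> B Z" and BC: "graded_algebras_isomorphic K B Z C \<gamma>"
 shows "graded_algebras_isomorphic K A \<alpha> C \<gamma>"
proof -
 obtain f where f: "f \<in> ring_iso A B" "\<And>c x. [|c \<in> carrier K; x \<in> carrier A|] ==> f (c \<odot>\<^bsub>A\<^esub> x) = c \<odot>\<^bsub>B\<^esub> f x"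
  "\<And>i. f ` \<alpha> i = Z i" using AB unfolding graded_algebras_isomorphic_def by blast
 obtain g where g: "g \<in> ring_iso B C" "\<And>c x. [|c \<in> carrier K; x \<in> carrier B|] ==> g (c \<odot>\<^bsub>B\<^esub> x) = c \<odot>\<^bsub>C\<^esub> g x"
  "\<And>i. g ` Z i = \<gamma> i" using BC unfolding graded_algebras_isomorphic_def by blast
 have fc: "f x \<in> carrier B" if "x \<in> carrier A" for x using ring_iso_memE(1)[OF f(1) that] .
 have "g \<circ> f \<in> ring_iso A C" by (rule ring_iso_set_trans[OF f(1) g(1)])
 moreover have "(g \<circ> f) (c \<odot>\<^bsub>A\<^esub> x) = c \<odot>\<^bsub>C\<^esub> (g \<circ> f) x" if "c \<in> carrier K" "x \<in> carrier A" for c x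
  using f(2)[OF that] g(2)[OF that(1) fc[OF that(2)]] by simp
 moreover have "(g \<circ> f) ` \<alpha> i = \<gamma> i" for i
  by (simp only: image_comp[symmetric] f(3) g(3))
 ultimately show ?thesis unfolding graded_algebras_isomorphic_def by blast
qed

lemma graded_isomorphic_sym:
 assumes A: "kalgebra K A" and sub: "\<And>i. \<alpha> i \<subseteq> carrier A"
  and AB: "graded_algebras_isomorphic K A \<alpha> B Z"
 shows "graded_algebras_isomorphic K B Z A \<alpha>"
proof -
 interpret kalgebra K A by fact
 obtain f where f: "f \<in> ring_iso A B" and fs: "\<And>c x. [|c \<in> carrier K; x \<in> carrier A|] ==> f (c \<odot>\<^bsub>A\<^esub> x) = c \<odot>\<^bsub>B\<^esub> f x"
  and fi: "\<And>i. f ` \<alpha> i = Z i" using AB unfolding graded_algebras_isomorphic_def by blast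
 let ?g = "inv_into (carrier A) f"
 have g: "?g \<in> ring_iso B A" by (rule ring_iso_set_sym[OF ring_axioms f])
 have inj: "inj_on f (carrier A)" and img: "f ` carrier A = carrier B"
  using ring_iso_memE(5)[OF f] by (simp_all add: bij_betw_def)
 have gs: "?g (c \<odot>\<^bsub>B\<^esub> y) = c \<odot>\<^bsub>A\<^esub> ?g y" if c: "c \<in> carrier K" and y: "y \<in> carrier B" for c y
 proof -
  obtain x where x: "x \<in> carrier A" "y = f x" using y img by blast
  have "?g (c \<odot>\<^bsub>B\<^esub> y) = ?g (f (c \<odot>\<^bsub>A\<^esub> x))" using fs[OF c x(1)] x(2) by simp
  also have "\<dots> = c \<odot>\<^bsub>A\<^esub> x" using c x(1) by (intro inv_into_f_f[OF inj]) simp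
  finally show ?thesis using inv_into_f_f[OF inj x(1)] x(2) by simp
 qed
 have gi: "?g ` Z i = \<alpha> i" for i
  unfolding fi[symmetric] by (rule inv_into_image_cancel[OF inj sub])
 show ?thesis unfolding graded_algebras_isomorphic_def using g gs gi by blast
qed

context C_type_algebra
begin

context
 fixes Z assumes Z: "frame Z"
begin

definition character_module :: "nat => ('a, nat => 'k) module" where
 "character_module v = transport_module (\<lambda>c n. if n = 0 then c else K0)
   \<lparr>carrier = carrier K, monoid.mult = undefined, one = undefined, zero = K0, add = add K,
   smult = \<lambda>a c. chr Z v a \<otimes>\<^bsub>K\<^esub> c\<rparr>"

definition character_vector :: "'k => nat => 'k" where
 "character_vector c = (\<lambda>n. if n = 0 then c else K0)"

lemma character_vector_inj: "character_vector c = character_vector d ==> c = d"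
 by (auto simp: character_vector_def dest: fun_cong[of _ _ 0])

lemma character_module:
 assumes v: "v \<in> {1, 2, 3}"
 shows character_left_module: "left_module A (character_module v)"
  and character_carrier: "carrier (character_module v) = character_vector ` carrier K"
  and character_zero: "\<zero>\<^bsub>character_module v\<^esub> = character_vector K0"
  and character_add: "\<And>c d. [|c \<in> carrier K; d \<in> carrier K|] ==>
   character_vector c \<oplus>\<^bsub>character_module v\<^esub> character_vector d = character_vector (c \<oplus>\<^bsub>K\<^esub> d)"
  and character_smult: "\<And>a c. c \<in> carrier K ==>
   a \<odot>\<^bsub>character_module v\<^esub> character_vector c = character_vector (chr Z v a \<otimes>\<^bsub>K\<^esub> c)"
proof -
 let ?C = "\<lparr>carrier = carrier K, monoid.mult = undefined, one = undefined, zero = K0, add = add K,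
   smult = \<lambda>a c. chr Z v a \<otimes>\<^bsub>K\<^esub> c\<rparr> :: ('a, 'k) module"
 have T: "character_module v = transport_module character_vector ?C"
  by (simp add: character_module_def character_vector_def[abs_def])
 have L: "left_module A ?C"
 proof (intro left_module.intro left_module_axioms.intro ring_axioms)
  show "abelian_group ?C"
  proof (rule abelian_groupI)
   fix x assume "x \<in> carrier ?C"
   then show "\<exists>y\<in>carrier ?C. y \<oplus>\<^bsub>?C\<^esub> x = \<zero>\<^bsub>?C\<^esub>"
    by (intro bexI[of _ "\<ominus>\<^bsub>K\<^esub> x"]) (simp_all add: K.l_neg)
  qed (simp_all add: K.a_ac)
 qed (simp_all add: chr_closed[OF Z v] chr_add[OF Z v] chr_mult[OF Z v] chr_one[OF Z v] K.l_distr K.r_distr K.m_assoc)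
 have inj: "inj_on character_vector (carrier ?C)" by (rule inj_onI) (rule character_vector_inj)
 show "left_module A (character_module v)" unfolding T by (rule transport_left_module[OF L inj])
 show "carrier (character_module v) = character_vector ` carrier K"
  unfolding T using transport_carrier[OF L inj] by simp
 show "\<zero>\<^bsub>character_module v\<^esub> = character_vector K0" unfolding T using transport_zero[OF L inj] by simp
 show "character_vector c \<oplus>\<^bsub>character_module v\<^esub> character_vector d = character_vector (c \<oplus>\<^bsub>K\<^esub> d)"
  if "c \<in> carrier K" "d \<in> carrier K" for c d unfolding T using transport_add[OF L inj] that by simp
 show "a \<odot>\<^bsub>character_module v\<^esub> character_vector c = character_vector (chr Z v a \<otimes>\<^bsub>K\<^esub> c)"
  if "c \<in> carrier K" for a c unfolding T using transport_smult[OF L inj] that by simp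
qed

lemma chr_scalar: "v \<in> {1, 2, 3} ==> c \<in> carrier K ==> chr Z v (c \<odot> \<one>) = c"
 using chr_smult[OF Z, of v c \<one>] chr_one[OF Z, of v] by simp

lemma character_module_simple_at:
 assumes v: "v \<in> {1, 2, 3}"
 shows "simple_at Z v (character_module v) (character_vector K1)"
 unfolding simple_at_def[OF Z]
proof (intro conjI ballI)
 show "left_module A (character_module v)" by (rule character_left_module[OF v])
 show "v \<in> {1, 2, 3}" by (rule v)
 show "character_vector K1 \<in> carrier (character_module v)" unfolding character_carrier[OF v] by simp
 show "character_vector K1 \<noteq> \<zero>\<^bsub>character_module v\<^esub>"
  unfolding character_zero[OF v] using character_vector_inj[of "K1" "K0"] K.one_not_zero by blast
 fix a assume a: "a \<in> carrier A"
 show "a \<odot>\<^bsub>character_module v\<^esub> character_vector K1 =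
   (chr Z v a \<odot> \<one>) \<odot>\<^bsub>character_module v\<^esub> character_vector K1"
  using character_smult[OF v K.one_closed] chr_scalar[OF v chr_closed[OF Z v a]] by simp
next
 fix t assume "t \<in> carrier (character_module v)"
 then obtain c where c: "c \<in> carrier K" "t = character_vector c" unfolding character_carrier[OF v] by blast
 then show "\<exists>c\<in>carrier K. t = (c \<odot> \<one>) \<odot>\<^bsub>character_module v\<^esub> character_vector K1"
  using character_smult[OF v K.one_closed] chr_scalar[OF v c(1)] by (intro bexI[of _ c]) simp_all
qed

lemma character_module_simple:
 assumes v: "v \<in> {1, 2, 3}"
 shows "simple_module A (character_module v)"
 unfolding simple_module_def
proof (intro conjI allI impI)
 let ?S = "character_module v" and ?s = "character_vector K1"
 note S = character_module_simple_at[OF v]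
 show L: "left_module A ?S" by (rule character_left_module[OF v])
 interpret S: left_module A ?S by fact
 have s: "?s \<in> carrier ?S" "?s \<noteq> \<zero>\<^bsub>?S\<^esub>" using S by (simp_all add: simple_at_def[OF Z])
 show "carrier ?S \<noteq> {\<zero>\<^bsub>?S\<^esub>}" using s by blast
 fix N assume N: "Module.submodule N A ?S"
 note Nd = submodule_of_leftD[OF N]
 show "N = {\<zero>\<^bsub>?S\<^esub>} \<or> N = carrier ?S"
 proof (rule disjCI)
  assume "N \<noteq> carrier ?S"
  have "t = \<zero>\<^bsub>?S\<^esub>" if t: "t \<in> N" for t
  proof (rule ccontr)
   assume t0: "t \<noteq> \<zero>\<^bsub>?S\<^esub>"
   have "t \<in> carrier ?S" using t Nd(1) by blast
   then obtain c where c: "c \<in> carrier K" "t = character_vector c" unfolding character_carrier[OF v] by blast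
   have "c \<noteq> K0" using t0 c(2) character_zero[OF v] by auto
   then have ic: "inv\<^bsub>K\<^esub> c \<in> carrier K" "inv\<^bsub>K\<^esub> c \<otimes>\<^bsub>K\<^esub> c = K1"
    using c(1) K.field_Units K.Units_l_inv K.Units_inv_closed by auto
   have "carrier ?S \<subseteq> N"
   proof
    fix u assume "u \<in> carrier ?S"
    then obtain k where k: "k \<in> carrier K" "u = character_vector k" unfolding character_carrier[OF v] by blast
    have "((k \<otimes>\<^bsub>K\<^esub> inv\<^bsub>K\<^esub> c) \<odot> \<one>) \<odot>\<^bsub>?S\<^esub> t = character_vector ((k \<otimes>\<^bsub>K\<^esub> inv\<^bsub>K\<^esub> c) \<otimes>\<^bsub>K\<^esub> c)"
     unfolding c(2) character_smult[OF v c(1)] using chr_scalar[OF v, of "k \<otimes>\<^bsub>K\<^esub> inv\<^bsub>K\<^esub> c"] k(1) ic(1) by simp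
    also have "\<dots> = u" using k ic c(1) by (simp add: K.m_assoc)
    finally show "u \<in> N" using Nd(4)[OF _ t, of "(k \<otimes>\<^bsub>K\<^esub> inv\<^bsub>K\<^esub> c) \<odot> \<one>"] k(1) ic(1) by simp
   qed
   with Nd(1) \<open>N \<noteq> carrier ?S\<close> show False by blast
  qed
  then show "N = {\<zero>\<^bsub>?S\<^esub>}" using Nd(2) by blast
 qed
qed

text \<open>
Simple modules correspond to their characters, and each of the three characters occurs.
\<close>

lemma simple_modules_classified:
 assumes S: "simple_representatives A s (S :: nat => ('a, nat => 'k) module)"
 obtains v t where "bij_betw v {1..s} {1, 2, 3}" "\<And>i. i \<in> {1..s} ==> simple_at Z (v i) (S i) (t i)"
proof -
 have simple: "simple_module A (S i)" if "i \<in> {1..s}" for i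
  using S that unfolding simple_representatives_def by blast
 have distinct: "i = j" if "i \<in> {1..s}" "j \<in> {1..s}" "isomorphic_modules A (S i) (S j)" for i j
  using S that unfolding simple_representatives_def by blast
 have all: "\<exists>i\<in>{1..s}. isomorphic_modules A T (S i)" if "simple_module A T" for T :: "('a, nat => 'k) module"
  using S that unfolding simple_representatives_def by blast
 have "\<exists>v t. simple_at Z v (S i) t" if i: "i \<in> {1..s}" for i
  by (rule simple_module_character[OF Z simple[OF i]]) blast
 then obtain v t where vt: "\<And>i. i \<in> {1..s} ==> simple_at Z (v i) (S i) (t i)" by metis
 have "bij_betw v {1..s} {1, 2, 3}"
  unfolding bij_betw_def
 proof
  show "inj_on v {1..s}"
  proof (rule inj_onI)
   fix i j assume ij: "i \<in> {1..s}" "j \<in> {1..s}" "v i = v j"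
   have "simple_at Z (v i) (S j) (t j)" using vt[OF ij(2)] ij(3) by simp
   from simple_at_isomorphic[OF Z vt[OF ij(1)] this] show "i = j" by (rule distinct[OF ij(1,2)])
  qed
  show "v ` {1..s} = {1, 2, 3}"
  proof
   show "v ` {1..s} \<subseteq> {1, 2, 3}"
   proof
    fix w assume "w \<in> v ` {1..s}"
    then obtain i where i: "i \<in> {1..s}" "w = v i" by blast
    show "w \<in> {1, 2, 3}" using vt[OF i(1)] i(2) by (simp add: simple_at_def[OF Z])
   qed
   show "{1, 2, 3} \<subseteq> v ` {1..s}"
   proof
    fix w :: nat assume w: "w \<in> {1, 2, 3}"
    obtain i where i: "i \<in> {1..s}" "isomorphic_modules A (character_module w) (S i)"
     using all[OF character_module_simple[OF w]] by blast
    have "w = v i" by (rule isomorphic_simple_at[OF Z character_module_simple_at[OF w] vt[OF i(1)] i(2)])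
    with i(1) show "w \<in> v ` {1..s}" by blast
   qed
  qed
 qed
 then show thesis using vt by (rule that)
qed

lemma mult_vtx_sum:
 assumes x: "x \<in> carrier A"
 shows "x \<otimes> vtx Z 1 \<oplus> x \<otimes> vtx Z 2 \<oplus> x \<otimes> vtx Z 3 = x"
proof -
 have "x \<otimes> (vtx Z 1 \<oplus> vtx Z 2 \<oplus> vtx Z 3) = x" using vtx_sum[OF Z] x by simp
 then show ?thesis using x vtx_in[OF Z] by (simp add: r_distr)
qed

text \<open>Homogeneous generators of the covers combine to a free generator of their sum, because the vertices add
 up to 1. Right multiplication by a monomial leads from the component of its source to that of its target,
 so its degree is corrected by the shifts of these two components.\<close>

theorem shifted_endomorphism_algebra:
 fixes S P :: "nat => ('a, nat => 'k) module" and \<gamma> :: "nat => int => (nat => 'k) set"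
 assumes d: "degree_function r d"
  and S: "simple_representatives A s S"
  and cov: "\<forall>i\<in>{1..s}. projective_cover A (P i) (S i) \<and>
   graded_module K A (standard_grading Z d) (P i) (\<gamma> i)"
 shows "\<exists>v m. bij_betw v {1..s} {1, 2, 3 :: nat} \<and>
  (\<forall>D dd. (\<forall>i\<in>{1..s}. D (v i) = dd i 1 - m i) \<longrightarrow>
   (let I = (SIGMA i:{1..s}. {1..vectorspace.dim K (restrict_scalars A (S i))});
      M = direct_sum_module I (\<lambda>(i, j). P i);
      \<delta> = direct_sum_grading I (\<lambda>(i, j). shift (dd i j) (\<gamma> i))
    in graded_algebras_isomorphic K A (standard_grading Z (regrade D d))
      (opposite_algebra (Endgr A M \<delta>)) (Endgr_component A M \<delta>)))"
proof -
 have P: "projective_cover A (P i) (S i)" and graded: "graded_module K A (standard_grading Z d) (P i) (\<gamma> i)"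
  if "i \<in> {1..s}" for i using bspec[OF cov that] by blast+
 let ?\<pi> = "standard_grading Z d"
 have \<pi>: "?\<pi> \<in> gradings K A" by (rule standard_grading_in_gradings[OF Z d])
 obtain v t where v: "bij_betw v {1..s} {1, 2, 3 :: nat}" and t: "\<And>i. i \<in> {1..s} ==> simple_at Z (v i) (S i) (t i)"
  by (rule simple_modules_classified[OF S]) (rule that)
 have vi: "v i \<in> {1, 2, 3}" if "i \<in> {1..s}" for i using v that by (auto simp: bij_betw_def)
 have vtx0: "vtx Z w \<in> ?\<pi> 0" if w: "w \<in> {1, 2, 3}" for w
  using standard_grading_basis[OF Z, of "Vertex w" d] degree_Vertex[OF d w] w by (simp add: vtx_def[OF Z])
 have "\<exists>p m. p \<in> \<gamma> i m \<and> free_generator (vtx Z (v i)) (P i) p" if i: "i \<in> {1..s}" for i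
 proof -
  have simple: "simple_module A (S i)" using S i unfolding simple_representatives_def by blast
  show ?thesis
   by (rule graded_cover_generator[OF Z P[OF i] simple t[OF i] graded[OF i] vtx0[OF vi[OF i]]]) blast
 qed
 then obtain p m where p: "\<And>i. i \<in> {1..s} ==> p i \<in> \<gamma> i (m i)"
  "\<And>i. i \<in> {1..s} ==> free_generator (vtx Z (v i)) (P i) (p i)" by metis
 have main: "let I = (SIGMA i:{1..s}. {1..vectorspace.dim K (restrict_scalars A (S i))});
      M = direct_sum_module I (\<lambda>(i, j). P i);
      \<delta> = direct_sum_grading I (\<lambda>(i, j). shift (dd i j) (\<gamma> i))
    in graded_algebras_isomorphic K A (standard_grading Z (regrade D d))
      (opposite_algebra (Endgr A M \<delta>)) (Endgr_component A M \<delta>)"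
  if D: "\<And>i. i \<in> {1..s} ==> D (v i) = dd i 1 - m i" for D :: "nat => int" and dd :: "nat => nat => int"
 proof -
  define I where "I = (SIGMA i:{1..s}. {1..vectorspace.dim K (restrict_scalars A (S i))})"
  define M where "M = direct_sum_module I (\<lambda>(i, j). P i)"
  define \<delta> where "\<delta> = direct_sum_grading I (\<lambda>(i, j). shift (dd i j) (\<gamma> i))"
  have dim: "vectorspace.dim K (restrict_scalars A (S i)) = 1" if "i \<in> {1..s}" for i
   by (rule simple_at_dim[OF Z t[OF that]])
  have I: "I = (\<lambda>i. (i, 1)) ` {1..s}"
  proof (rule Set.set_eqI)
   fix z :: "nat \<times> nat"
   obtain i j where z: "z = (i, j)" by (cases z)
   show "z \<in> I \<longleftrightarrow> z \<in> (\<lambda>i. (i, 1)) ` {1..s}"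
   proof (cases "i \<in> {1..s}")
    case True
    have "z \<in> I \<longleftrightarrow> j \<in> {1..1}" unfolding I_def z mem_Sigma_iff dim[OF True] using True by blast
    moreover have "z \<in> (\<lambda>i. (i, 1)) ` {1..s} \<longleftrightarrow> j = 1" unfolding z using True by blast
    ultimately show ?thesis by simp
   next
    case False
    then show ?thesis unfolding I_def z by blast
   qed
  qed
  have LP: "left_module A (P i)" if "i \<in> {1..s}" for i using p(2)[OF that] by (simp add: free_generator_def)
  have pP: "p i \<in> carrier (P i)" if "i \<in> {1..s}" for i using p(2)[OF that] by (simp add: free_generator_def)
  have ep: "vtx Z (v i) \<odot>\<^bsub>P i\<^esub> p i = p i" if "i \<in> {1..s}" for i using p(2)[OF that] by (simp add: free_generator_def)
  have M: "left_module A M"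
   unfolding M_def by (rule direct_sum_left_module[OF ring_axioms]) (use LP I in auto)
  define m0 where "m0 = (\<lambda>(i, j)\<in>I. p i)"
  have Mc: "carrier M = (\<Pi>\<^sub>E z\<in>I. carrier (P (fst z)))"
   by (simp add: M_def direct_sum_module_def case_prod_unfold)
  have m0: "m0 \<in> carrier M" unfolding Mc m0_def using pP I by auto
  have ym0: "y \<odot>\<^bsub>M\<^esub> m0 = (\<lambda>z\<in>I. y \<odot>\<^bsub>P (fst z)\<^esub> p (fst z))" for y
   by (rule ext) (simp add: M_def direct_sum_module_def m0_def case_prod_unfold)
  have yp: "y \<odot>\<^bsub>P i\<^esub> p i = (y \<otimes> vtx Z (v i)) \<odot>\<^bsub>P i\<^esub> p i" if y: "y \<in> carrier A" and i: "i \<in> {1..s}" for y i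
   using left_module.act_assoc[OF LP[OF i] y vtx_in[OF Z vi[OF i]] pP[OF i]] ep[OF i] by simp
  have yee: "(y \<otimes> vtx Z w) \<otimes> vtx Z w = y \<otimes> vtx Z w" if "y \<in> carrier A" "w \<in> {1, 2, 3}" for y w
   using m_assoc[OF that(1) vtx_in[OF Z that(2)] vtx_in[OF Z that(2)]] vtx_idem[OF Z that(2)] by simp
  have iI: "(i, 1) \<in> I" if "i \<in> {1..s}" for i using that unfolding I by blast
  have at: "(y \<odot>\<^bsub>M\<^esub> m0) (i, 1) = y \<odot>\<^bsub>P i\<^esub> p i" if "i \<in> {1..s}" for y i
   unfolding ym0 using iI[OF that] by simp
  have surj_v: "\<exists>i\<in>{1..s}. v i = w" if "w \<in> {1, 2, 3}" for w
   using v that unfolding bij_betw_def by (metis imageE)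
  have bij: "bij_betw (\<lambda>y. y \<odot>\<^bsub>M\<^esub> m0) (carrier A) (carrier M)"
   unfolding bij_betw_def
  proof
   show "inj_on (\<lambda>y. y \<odot>\<^bsub>M\<^esub> m0) (carrier A)"
   proof (rule inj_onI)
    fix y z assume y: "y \<in> carrier A" and z: "z \<in> carrier A" and eq: "y \<odot>\<^bsub>M\<^esub> m0 = z \<odot>\<^bsub>M\<^esub> m0"
    have e: "y \<otimes> vtx Z w = z \<otimes> vtx Z w" if w: "w \<in> {1, 2, 3}" for w
    proof -
     obtain i where i: "i \<in> {1..s}" "v i = w" using surj_v[OF w] by blast
     have "y \<odot>\<^bsub>P i\<^esub> p i = z \<odot>\<^bsub>P i\<^esub> p i" using at[OF i(1), of y] at[OF i(1), of z] eq by simp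
     then have "(y \<otimes> vtx Z w) \<odot>\<^bsub>P i\<^esub> p i = (z \<otimes> vtx Z w) \<odot>\<^bsub>P i\<^esub> p i"
      using yp[OF y i(1)] yp[OF z i(1)] i(2) by simp
     moreover have "free_generator (vtx Z w) (P i) (p i)" using p(2)[OF i(1)] i(2) by simp
     ultimately show ?thesis
      using free_generator_eq[of "vtx Z w" "P i" "p i" "y \<otimes> vtx Z w" "z \<otimes> vtx Z w"]
       yee[OF y w] yee[OF z w] y z vtx_in[OF Z w] by simp
    qed
    have e3: "y \<otimes> vtx Z 1 = z \<otimes> vtx Z 1" "y \<otimes> vtx Z 2 = z \<otimes> vtx Z 2" "y \<otimes> vtx Z 3 = z \<otimes> vtx Z 3"
     by (rule e, simp)+
    show "y = z" using mult_vtx_sum[OF y] unfolding e3 mult_vtx_sum[OF z] by (rule sym)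
   qed
   show "(\<lambda>y. y \<odot>\<^bsub>M\<^esub> m0) ` carrier A = carrier M"
   proof
    show "(\<lambda>y. y \<odot>\<^bsub>M\<^esub> m0) ` carrier A \<subseteq> carrier M" using left_module.act_closed[OF M _ m0] by blast
    show "carrier M \<subseteq> (\<lambda>y. y \<odot>\<^bsub>M\<^esub> m0) ` carrier A"
    proof
     fix q assume q: "q \<in> carrier M"
     have "\<exists>x. x \<in> carrier A \<and> x \<otimes> vtx Z w = x \<and> (\<forall>i\<in>{1..s}. v i = w \<longrightarrow> q (i, 1) = x \<odot>\<^bsub>P i\<^esub> p i)"
      if w: "w \<in> {1, 2, 3}" for w
     proof -
      obtain i where i: "i \<in> {1..s}" "v i = w" using surj_v[OF w] by blast
      have "q (i, 1) \<in> carrier (P i)" using q iI[OF i(1)] unfolding Mc by (metis PiE_mem fst_conv)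
      then obtain x where x: "x \<in> carrier A" "x \<otimes> vtx Z w = x" "q (i, 1) = x \<odot>\<^bsub>P i\<^esub> p i"
       using p(2)[OF i(1)] i(2) unfolding free_generator_def by blast
      have "j = i" if "j \<in> {1..s}" "v j = w" for j
       using v i that unfolding bij_betw_def inj_on_def by blast
      with x show ?thesis by blast
     qed
     then obtain x where x: "\<And>w. w \<in> {1, 2, 3} ==> x w \<in> carrier A"
      "\<And>w. w \<in> {1, 2, 3} ==> x w \<otimes> vtx Z w = x w"
      "\<And>w i. [|w \<in> {1, 2, 3}; i \<in> {1..s}; v i = w|] ==> q (i, 1) = x w \<odot>\<^bsub>P i\<^esub> p i" by metis
     define y where "y = x 1 \<oplus> x 2 \<oplus> x 3"
     have y: "y \<in> carrier A" unfolding y_def using x(1) by simp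
     have xw: "x u \<otimes> vtx Z w = (if u = w then x u else \<zero>)" if u: "u \<in> {1, 2, 3}" and w: "w \<in> {1, 2, 3}" for u w
     proof -
      have "x u \<otimes> vtx Z w = (x u \<otimes> vtx Z u) \<otimes> vtx Z w" unfolding x(2)[OF u] ..
      also have "\<dots> = x u \<otimes> (vtx Z u \<otimes> vtx Z w)"
       by (rule m_assoc[OF x(1)[OF u] vtx_in[OF Z u] vtx_in[OF Z w]])
      also have "\<dots> = (if u = w then x u else \<zero>)"
       unfolding vtx_mult[OF Z u w] using x(1)[OF u] x(2)[OF u] by (cases "u = w") simp_all
      finally show ?thesis .
     qed
     have yw: "y \<otimes> vtx Z w = x w" if w: "w \<in> {1, 2, 3}" for w
     proof -
      have "y \<otimes> vtx Z w = x 1 \<otimes> vtx Z w \<oplus> x 2 \<otimes> vtx Z w \<oplus> x 3 \<otimes> vtx Z w"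
       unfolding y_def using x(1) vtx_in[OF Z w] by (simp add: l_distr)
      then show ?thesis using xw[of 1 w] xw[of 2 w] xw[of 3 w] x(1)[OF w] w by auto
     qed
     have "q = y \<odot>\<^bsub>M\<^esub> m0"
     proof (rule PiE_ext)
      show "q \<in> (\<Pi>\<^sub>E z\<in>I. carrier (P (fst z)))" using q unfolding Mc .
      show "y \<odot>\<^bsub>M\<^esub> m0 \<in> (\<Pi>\<^sub>E z\<in>I. carrier (P (fst z)))" using left_module.act_closed[OF M y m0] unfolding Mc .
      fix z assume "z \<in> I"
      then obtain i where i: "i \<in> {1..s}" "z = (i, 1)" unfolding I by blast
      show "q z = (y \<odot>\<^bsub>M\<^esub> m0) z"
       using x(3)[OF vi[OF i(1)] i(1) refl] at[OF i(1)] yp[OF y i(1)] yw[OF vi[OF i(1)]] i(2) by simp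
     qed
     with y show "q \<in> (\<lambda>y. y \<odot>\<^bsub>M\<^esub> m0) ` carrier A" by blast
    qed
   qed
  qed
  have \<gamma>sub: "\<gamma> i n \<subseteq> carrier (P i)" if i: "i \<in> {1..s}" for i n
  proof -
   interpret D: decomposed K "restrict_scalars A (P i)" "\<gamma> i"
    using graded[OF i] by (simp add: decomposed_def graded_module_def)
   show ?thesis using D.piece_subset[of n] by (simp add: restrict_scalars_def)
  qed
  have \<delta>: "\<delta> n = (\<Pi>\<^sub>E z\<in>I. \<gamma> (fst z) (dd (fst z) (snd z) + n))" for n
   by (simp add: \<delta>_def direct_sum_grading_def shift_def case_prod_unfold)
  have \<delta>sub: "\<delta> n \<subseteq> carrier M" for n
   unfolding \<delta> Mc
  proof (rule PiE_mono)
   fix z assume "z \<in> I"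
   then obtain i where i: "i \<in> {1..s}" "z = (i, 1)" unfolding I by blast
   show "\<gamma> (fst z) (dd (fst z) (snd z) + n) \<subseteq> carrier (P (fst z))"
    unfolding i(2) fst_conv by (rule \<gamma>sub[OF i(1)])
  qed
  have Y: "y \<odot>\<^bsub>M\<^esub> m0 \<in> \<delta> n \<longleftrightarrow> (\<forall>b\<in>Mon. coord Z y b \<noteq> K0 \<longrightarrow> d b = n + D (monomial_target b))"
   if y: "y \<in> carrier A" for y n
  proof -
   have piece: "y \<odot>\<^bsub>P i\<^esub> p i \<in> \<gamma> i (dd i 1 + n) \<longleftrightarrow>
     (\<forall>b\<in>Mon. monomial_target b = v i \<longrightarrow> coord Z y b \<noteq> K0 \<longrightarrow> d b = n + D (v i))"
    if i: "i \<in> {1..s}" for i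
   proof -
    have ye: "y \<otimes> vtx Z (v i) \<in> carrier A" using y vtx_in[OF Z vi[OF i]] by simp
    have sum: "dd i 1 + n = (n + D (v i)) + m i" using D[OF i] by simp
    have "y \<odot>\<^bsub>P i\<^esub> p i \<in> \<gamma> i (dd i 1 + n) \<longleftrightarrow> (y \<otimes> vtx Z (v i)) \<odot>\<^bsub>P i\<^esub> p i \<in> \<gamma> i ((n + D (v i)) + m i)"
     unfolding sum yp[OF y i, symmetric] ..
    also have "\<dots> \<longleftrightarrow> y \<otimes> vtx Z (v i) \<in> ?\<pi> (n + D (v i))"
     by (rule free_generator_degree[OF Z \<pi> graded[OF i] p(1)[OF i] p(2)[OF i] vtx0[OF vi[OF i]] ye yee[OF y vi[OF i]]])
    also have "\<dots> \<longleftrightarrow> (\<forall>b\<in>Mon. coord Z (y \<otimes> vtx Z (v i)) b \<noteq> K0 \<longrightarrow> d b = n + D (v i))"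
     using ye by (simp add: standard_grading_mem)
    also have "\<dots> \<longleftrightarrow> (\<forall>b\<in>Mon. monomial_target b = v i \<longrightarrow> coord Z y b \<noteq> K0 \<longrightarrow> d b = n + D (v i))"
     unfolding vtx_def[OF Z] using coord_mult_Vertex_right[OF Z y vi[OF i]] by (intro ball_cong refl) auto
    finally show ?thesis .
   qed
   have "y \<odot>\<^bsub>M\<^esub> m0 \<in> \<delta> n \<longleftrightarrow> (\<forall>i\<in>{1..s}. y \<odot>\<^bsub>P i\<^esub> p i \<in> \<gamma> i (dd i 1 + n))"
    unfolding \<delta> ym0 restrict_PiE_iff I by simp
   also have "\<dots> \<longleftrightarrow> (\<forall>b\<in>Mon. coord Z y b \<noteq> K0 \<longrightarrow> d b = n + D (monomial_target b))"
   proof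
    assume a: "\<forall>i\<in>{1..s}. y \<odot>\<^bsub>P i\<^esub> p i \<in> \<gamma> i (dd i 1 + n)"
    show "\<forall>b\<in>Mon. coord Z y b \<noteq> K0 \<longrightarrow> d b = n + D (monomial_target b)"
    proof (intro ballI impI)
     fix b assume b: "b \<in> Mon" "coord Z y b \<noteq> K0"
     obtain i where i: "i \<in> {1..s}" "v i = monomial_target b" using surj_v[OF monomial_target_in[OF b(1)]] by blast
     show "d b = n + D (monomial_target b)" using a i b piece[OF i(1)] by auto
    qed
   next
    assume a: "\<forall>b\<in>Mon. coord Z y b \<noteq> K0 \<longrightarrow> d b = n + D (monomial_target b)"
    show "\<forall>i\<in>{1..s}. y \<odot>\<^bsub>P i\<^esub> p i \<in> \<gamma> i (dd i 1 + n)"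
    proof
     fix i assume i: "i \<in> {1..s}"
     show "y \<odot>\<^bsub>P i\<^esub> p i \<in> \<gamma> i (dd i 1 + n)" unfolding piece[OF i] using a by auto
    qed
   qed
   finally show ?thesis .
  qed
  have iso: "graded_algebras_isomorphic K A (standard_grading Z (regrade D d))
    (opposite_algebra (Endgr A M \<delta>)) (Endgr_component A M \<delta>)"
  proof (rule endomorphisms_of_free_module[OF M m0 bij standard_grading_decomposition[OF Z] \<delta>sub])
   fix x n assume x: "x \<in> carrier A"
   show "x \<in> standard_grading Z (regrade D d) n \<longleftrightarrow>
    (\<forall>t. \<forall>y\<in>carrier A. y \<odot>\<^bsub>M\<^esub> m0 \<in> \<delta> t \<longrightarrow> (y \<otimes> x) \<odot>\<^bsub>M\<^esub> m0 \<in> \<delta> (n + t))"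
   proof
    assume xn: "x \<in> standard_grading Z (regrade D d) n"
    show "\<forall>t. \<forall>y\<in>carrier A. y \<odot>\<^bsub>M\<^esub> m0 \<in> \<delta> t \<longrightarrow> (y \<otimes> x) \<odot>\<^bsub>M\<^esub> m0 \<in> \<delta> (n + t)"
    proof (intro allI ballI impI)
     fix t y assume y: "y \<in> carrier A" and yt: "y \<odot>\<^bsub>M\<^esub> m0 \<in> \<delta> t"
     have yx: "y \<otimes> x \<in> carrier A" using y x by simp
     show "(y \<otimes> x) \<odot>\<^bsub>M\<^esub> m0 \<in> \<delta> (n + t)"
      unfolding Y[OF yx]
     proof (intro ballI impI)
      fix b assume b: "b \<in> Mon" "coord Z (y \<otimes> x) b \<noteq> K0"
      obtain u w where uw: "u \<in> Mon" "w \<in> Mon" "mm r u w = b"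
       "coord Z y u \<noteq> K0" "coord Z x w \<noteq> K0"
       by (rule coord_mult_support[OF Z y x b]) (rule that)
      have nn: "mm r u w \<noteq> Null" using uw(3) b(1) by auto
      have "d u = t + D (monomial_target u)" using yt uw(1,4) unfolding Y[OF y] by blast
      moreover have "regrade D d w = n" using xn uw(2,5) unfolding standard_grading_mem by blast
      moreover have "d b = d u + d w" using degree_functionD[OF d uw(1,2) nn] uw(3) by simp
      moreover have "monomial_target u = monomial_source w" "monomial_target b = monomial_target w"
       using mm_source_target[OF uw(1,2) nn] uw(3) by simp_all
      ultimately show "d b = n + t + D (monomial_target b)" by (simp add: regrade_def)
     qed
    qed
   next
    assume a: "\<forall>t. \<forall>y\<in>carrier A. y \<odot>\<^bsub>M\<^esub> m0 \<in> \<delta> t \<longrightarrow> (y \<otimes> x) \<odot>\<^bsub>M\<^esub> m0 \<in> \<delta> (n + t)"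
    have "regrade D d b = n" if b: "b \<in> Mon" "coord Z x b \<noteq> K0" for b
    proof -
     let ?w = "monomial_source b"
     have w: "?w \<in> {1, 2, 3}" by (rule monomial_source_in[OF b(1)])
     have wM: "Vertex ?w \<in> Mon" using w by simp
     have e: "Z (Vertex ?w) \<in> carrier A" by (rule frame_closed[OF Z wM])
     have "Z (Vertex ?w) \<odot>\<^bsub>M\<^esub> m0 \<in> \<delta> (- D ?w)"
      unfolding Y[OF e]
     proof (intro ballI impI)
      fix c assume c: "c \<in> Mon" "coord Z (Z (Vertex ?w)) c \<noteq> K0"
      then have "c = Vertex ?w" using coord_basis[OF Z, of "Vertex ?w" c] wM by (auto split: if_splits)
      then show "d c = - D ?w + D (monomial_target c)" using degree_Vertex[OF d w] by simp
     qed
     then have "(Z (Vertex ?w) \<otimes> x) \<odot>\<^bsub>M\<^esub> m0 \<in> \<delta> (n + - D ?w)" using a e by blast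
     moreover have "Z (Vertex ?w) \<otimes> x \<in> carrier A" using e x by simp
     ultimately have "d b = n + - D ?w + D (monomial_target b)"
      using Y[of "Z (Vertex ?w) \<otimes> x" "n + - D ?w"] coord_Vertex_mult[OF Z x w b(1)] b by auto
     then show ?thesis by (simp add: regrade_def)
    qed
    then show "x \<in> standard_grading Z (regrade D d) n" unfolding standard_grading_mem using x by blast
   qed
  qed
  then show ?thesis unfolding Let_def M_def \<delta>_def I_def .
 qed
 show ?thesis
  by (intro exI[of _ v] exI[of _ m] conjI allI impI) (rule v, rule main, erule bspec, assumption)
qed

end

end

section \<open>The indecomposable projective modules\<close>

context C_type_algebra
begin

context
 fixes Z assumes Z: "frame Z"
begin

text \<open>
The left ideal \<open>A e\<^sub>v\<close>, spanned by the monomials with target \<open>v\<close>.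
\<close>

definition column :: "nat => ('a, nat => 'k) module" where
 "column v = transport_module (to_fun Z) (cyclic_ideal (vtx Z v))"

lemma column_module:
 assumes v: "v \<in> {1, 2, 3}"
 shows column_left_module: "left_module A (column v)"
  and column_carrier: "carrier (column v) = to_fun Z ` {x \<in> carrier A. x \<otimes> vtx Z v = x}"
  and column_zero: "\<zero>\<^bsub>column v\<^esub> = to_fun Z \<zero>"
  and column_add: "\<And>x y. [|x \<in> carrier A; x \<otimes> vtx Z v = x; y \<in> carrier A; y \<otimes> vtx Z v = y|] ==>
   to_fun Z x \<oplus>\<^bsub>column v\<^esub> to_fun Z y = to_fun Z (x \<oplus> y)"
  and column_smult: "\<And>a x. [|x \<in> carrier A; x \<otimes> vtx Z v = x|] ==>
   a \<odot>\<^bsub>column v\<^esub> to_fun Z x = to_fun Z (a \<otimes> x)"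
proof -
 let ?E = "cyclic_ideal (vtx Z v)"
 have L: "left_module A ?E" by (rule cyclic_ideal_left_module[OF vtx_closed[OF Z v]])
 have C: "carrier ?E = {x \<in> carrier A. x \<otimes> vtx Z v = x}" by (simp add: cyclic_ideal_def)
 have inj: "inj_on (to_fun Z) (carrier ?E)"
  by (rule inj_on_subset[OF to_fun_inj[OF Z]]) (use C in blast)
 note cd = column_def[of v]
 show "left_module A (column v)" unfolding cd by (rule transport_left_module[OF L inj])
 show "carrier (column v) = to_fun Z ` {x \<in> carrier A. x \<otimes> vtx Z v = x}"
  unfolding cd transport_carrier[OF L inj] C ..
 have z: "\<zero>\<^bsub>?E\<^esub> = \<zero>" by (simp add: cyclic_ideal_def)
 show "\<zero>\<^bsub>column v\<^esub> = to_fun Z \<zero>" unfolding cd transport_zero[OF L inj] z ..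
 fix x assume x: "x \<in> carrier A" "x \<otimes> vtx Z v = x"
 then have xE: "x \<in> carrier ?E" unfolding C by blast
 have sm: "a \<odot>\<^bsub>?E\<^esub> x = a \<otimes> x" for a by (simp add: cyclic_ideal_def)
 show "a \<odot>\<^bsub>column v\<^esub> to_fun Z x = to_fun Z (a \<otimes> x)" for a
  unfolding cd transport_smult[OF L inj xE] sm ..
 fix y assume y: "y \<in> carrier A" "y \<otimes> vtx Z v = y"
 then have yE: "y \<in> carrier ?E" unfolding C by blast
 have pl: "x \<oplus>\<^bsub>?E\<^esub> y = x \<oplus> y" by (simp add: cyclic_ideal_def)
 show "to_fun Z x \<oplus>\<^bsub>column v\<^esub> to_fun Z y = to_fun Z (x \<oplus> y)"
  unfolding cd transport_add[OF L inj xE yE] pl ..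
qed

lemma column_mem:
 assumes v: "v \<in> {1, 2, 3}" and q: "q \<in> carrier (column v)"
 obtains x where "x \<in> carrier A" "x \<otimes> vtx Z v = x" "q = to_fun Z x"
 using q unfolding column_carrier[OF v] by blast

lemma column_memI:
 "[|v \<in> {1, 2, 3}; x \<in> carrier A; x \<otimes> vtx Z v = x|] ==> to_fun Z x \<in> carrier (column v)"
 unfolding column_carrier by blast

lemma vtx_square: "v \<in> {1, 2, 3} ==> vtx Z v \<otimes> vtx Z v = vtx Z v"
 using vtx_mult[OF Z, of v v] by simp

lemma to_fun_eq: "[|x \<in> carrier A; y \<in> carrier A; to_fun Z x = to_fun Z y|] ==> x = y"
 using inj_onD[OF to_fun_inj[OF Z]] by blast

lemma column_generator:
 assumes v: "v \<in> {1, 2, 3}"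
 shows "free_generator (vtx Z v) (column v) (to_fun Z (vtx Z v))"
 unfolding free_generator_def
proof (intro conjI ballI impI)
 let ?e = "vtx Z v"
 note e = vtx_closed[OF Z v] vtx_square[OF v]
 show "left_module A (column v)" by (rule column_left_module[OF v])
 show "?e \<in> carrier A" "?e \<otimes> ?e = ?e" by (rule e)+
 show "to_fun Z ?e \<in> carrier (column v)" by (rule column_memI[OF v e])
 show "?e \<odot>\<^bsub>column v\<^esub> to_fun Z ?e = to_fun Z ?e" unfolding column_smult[OF v e] e(2) ..
 show "\<exists>x\<in>carrier A. x \<otimes> ?e = x \<and> q = x \<odot>\<^bsub>column v\<^esub> to_fun Z ?e" if "q \<in> carrier (column v)" for q
 proof (rule column_mem[OF v that])
  fix x assume x: "x \<in> carrier A" "x \<otimes> ?e = x" "q = to_fun Z x"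
  show ?thesis
   by (rule bexI[OF _ x(1)]) (simp only: x(2,3) column_smult[OF v e])
 qed
 show "x = \<zero>" if x: "x \<in> carrier A" "x \<otimes> ?e = x \<and> x \<odot>\<^bsub>column v\<^esub> to_fun Z ?e = \<zero>\<^bsub>column v\<^esub>" for x
 proof (rule to_fun_eq[OF x(1) zero_closed])
  have "to_fun Z x = x \<odot>\<^bsub>column v\<^esub> to_fun Z ?e" using x(2) column_smult[OF v e] by simp
  then show "to_fun Z x = to_fun Z \<zero>" using x(2) column_zero[OF v] by simp
 qed
qed

text \<open>
If a submodule together with the kernel of the character is everything, it contains an element \<open>x\<close> of
character 1. Then \<open>e\<^sub>v x\<close> is a unit of the corner \<open>e\<^sub>v A e\<^sub>v\<close>, so the submodule contains the generator \<open>e\<^sub>v\<close>.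
\<close>

lemma column_projective_cover:
 assumes v: "v \<in> {1, 2, 3}"
 shows "projective_cover A (column v) (character_module Z v)"
 unfolding projective_cover_def
proof (intro conjI bexI[of _ "\<lambda>q. character_vector (chr Z v (inv_into (carrier A) (to_fun Z) q))"] allI impI)
 let ?S = "character_module Z v" and ?e = "vtx Z v"
 let ?f = "\<lambda>q. character_vector (chr Z v (inv_into (carrier A) (to_fun Z) q))"
 note e = vtx_closed[OF Z v] vtx_square[OF v]
 show "projective_module A (column v)" by (rule free_generator_projective[OF column_generator[OF v]])
 have f: "?f (to_fun Z x) = character_vector (chr Z v x)" if "x \<in> carrier A" for x
  using inv_into_f_f[OF to_fun_inj[OF Z] that] by simp
 have ce: "chr Z v ?e = K1" using chr_vtx[OF Z v v] by simp
 have f_closed: "?f q \<in> carrier ?S" if q: "q \<in> carrier (column v)" for q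
 proof -
  obtain x where x: "x \<in> carrier A" "x \<otimes> ?e = x" "q = to_fun Z x" by (rule column_mem[OF v q])
  show ?thesis
   unfolding x(3) f[OF x(1)] character_carrier[OF Z v] by (rule imageI[OF chr_closed[OF Z v x(1)]])
 qed
 have f_smult: "?f (a \<odot>\<^bsub>column v\<^esub> q) = a \<odot>\<^bsub>?S\<^esub> ?f q" if a: "a \<in> carrier A" and q: "q \<in> carrier (column v)" for a q
 proof -
  obtain x where x: "x \<in> carrier A" "x \<otimes> ?e = x" "q = to_fun Z x" by (rule column_mem[OF v q])
  show ?thesis
   unfolding x(3) column_smult[OF v x(1,2)] f[OF x(1)] f[OF m_closed[OF a x(1)]]
    character_smult[OF Z v chr_closed[OF Z v x(1)]] chr_mult[OF Z v a x(1)] ..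
 qed
 have f_add: "?f (q \<oplus>\<^bsub>column v\<^esub> q') = ?f q \<oplus>\<^bsub>?S\<^esub> ?f q'"
  if q: "q \<in> carrier (column v)" and q': "q' \<in> carrier (column v)" for q q'
 proof -
  obtain x where x: "x \<in> carrier A" "x \<otimes> ?e = x" "q = to_fun Z x" by (rule column_mem[OF v q])
  obtain y where y: "y \<in> carrier A" "y \<otimes> ?e = y" "q' = to_fun Z y" by (rule column_mem[OF v q'])
  show ?thesis
   unfolding x(3) y(3) column_add[OF v x(1,2) y(1,2)] f[OF x(1)] f[OF y(1)] f[OF a_closed[OF x(1) y(1)]]
    character_add[OF Z v chr_closed[OF Z v x(1)] chr_closed[OF Z v y(1)]] chr_add[OF Z v x(1) y(1)] ..
 qed
 show "?f \<in> module_hom A (column v) ?S"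
  unfolding module_hom_def mem_Collect_eq
  by (intro conjI allI impI funcsetI) (assumption | erule conjE | rule f_closed f_smult f_add)+
 show "?f ` carrier (column v) = carrier ?S"
 proof (rule equalityI)
  show "?f ` carrier (column v) \<subseteq> carrier ?S"
   by (rule image_subsetI) (rule f_closed)
  show "carrier ?S \<subseteq> ?f ` carrier (column v)"
   unfolding character_carrier[OF Z v]
  proof (rule image_subsetI)
   fix k assume k: "k \<in> carrier K"
   have x: "k \<odot> ?e \<in> carrier A" "(k \<odot> ?e) \<otimes> ?e = k \<odot> ?e"
    using smult_closed[OF k e(1)] smult_mult_left[OF k e(1) e(1)] e(2) by simp_all
   have "?f (to_fun Z (k \<odot> ?e)) = character_vector k"
    unfolding f[OF x(1)] chr_smult[OF Z v k e(1)] ce using k by simp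
   then show "character_vector k \<in> ?f ` carrier (column v)"
    using column_memI[OF v x] by (metis image_eqI)
  qed
 qed
 fix N assume N: "Module.submodule N A (column v) \<and>
  N <+>\<^bsub>column v\<^esub> {x \<in> carrier (column v). ?f x = \<zero>\<^bsub>?S\<^esub>} = carrier (column v)"
 note Nd = submodule_of_leftD[OF N[THEN conjunct1]]
 have "to_fun Z ?e \<in> N <+>\<^bsub>column v\<^esub> {x \<in> carrier (column v). ?f x = \<zero>\<^bsub>?S\<^esub>}"
  using N column_memI[OF v e] by simp
 then obtain n k where n: "n \<in> N" and k: "k \<in> carrier (column v)" "?f k = \<zero>\<^bsub>?S\<^esub>"
  and eq: "to_fun Z ?e = n \<oplus>\<^bsub>column v\<^esub> k" unfolding set_add_def' by blast
 have "n \<in> carrier (column v)" using n Nd(1) by blast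
 then obtain x where x: "x \<in> carrier A" "x \<otimes> ?e = x" "n = to_fun Z x" by (rule column_mem[OF v])
 obtain y where y: "y \<in> carrier A" "y \<otimes> ?e = y" "k = to_fun Z y" by (rule column_mem[OF v k(1)])
 have exy: "?e = x \<oplus> y"
  using eq unfolding x(3) y(3) column_add[OF v x(1,2) y(1,2)] by (rule to_fun_eq[OF e(1) a_closed[OF x(1) y(1)]])
 have "chr Z v y = K0"
  using k(2) unfolding y(3) f[OF y(1)] character_zero[OF Z v] by (rule character_vector_inj[OF Z])
 then have cx: "chr Z v x = K1"
  using ce chr_add[OF Z v x(1) y(1)] chr_closed[OF Z v x(1)] unfolding exy[symmetric] by simp
 let ?u = "?e \<otimes> x"
 have u: "?u \<in> carrier A" "?e \<otimes> ?u = ?u" "?u \<otimes> ?e = ?u"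
  using e x m_assoc[OF e(1) e(1) x(1)] m_assoc[OF e(1) x(1) e(1)] by simp_all
 have "chr Z v ?u = K1" unfolding chr_mult[OF Z v e(1) x(1)] ce cx by simp
 then have "chr Z v ?u \<noteq> K0" by simp
 then obtain u' where u': "u' \<in> carrier A" "u' \<otimes> ?u = ?e" by (rule corner_unit[OF Z v u]) (rule that)
 have "u' \<odot>\<^bsub>column v\<^esub> (?e \<odot>\<^bsub>column v\<^esub> n) \<in> N" by (rule Nd(4)[OF u'(1) Nd(4)[OF e(1) n]])
 moreover have "u' \<odot>\<^bsub>column v\<^esub> (?e \<odot>\<^bsub>column v\<^esub> n) = to_fun Z ?e"
  unfolding x(3) column_smult[OF v x(1,2)] column_smult[OF v u(1,3)] u'(2) ..
 ultimately have p: "to_fun Z ?e \<in> N" by simp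
 show "N = carrier (column v)"
 proof (rule equalityI[OF Nd(1)], rule subsetI)
  fix q assume "q \<in> carrier (column v)"
  then obtain z where z: "z \<in> carrier A" "z \<otimes> ?e = z" "q = to_fun Z z" by (rule column_mem[OF v])
  show "q \<in> N" using Nd(4)[OF z(1) p] unfolding column_smult[OF v e] z(2,3) .
 qed
qed

definition column_grading :: "(C_monomial => int) => nat => int => (nat => 'k) set" where
 "column_grading d v = (\<lambda>n. {q \<in> carrier (restrict_scalars A (column v)).
   \<forall>b\<in>{b \<in> Mon. monomial_target b = v}. q (index b) \<noteq> K0 \<longrightarrow> d b = n})"

lemma column_graded:
 assumes d: "degree_function r d" and v: "v \<in> {1, 2, 3}"
 shows "graded_module K A (standard_grading Z d) (column v) (column_grading d v)"
 unfolding graded_module_def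
proof (intro conjI allI ballI)
 let ?B = "{b \<in> Mon. monomial_target b = v}" and ?e = "vtx Z v"
 let ?V = "restrict_scalars A (column v)"
 have ev: "?e = Z (Vertex v)" by (rule vtx_def[OF Z])
 show L: "left_module A (column v)" by (rule column_left_module[OF v])
 have C: "carrier ?V = carrier (column v)" by (simp add: restrict_scalars_def)
 have idx: "to_fun Z x (index b) = coord Z x b" if "b \<in> ?B" for x b
  using that by (intro to_fun_index) simp
 have off: "coord Z x b = K0" if "x \<in> carrier A" "x \<otimes> ?e = x" "b \<in> Mon" "b \<notin> ?B" for x b
  using coord_mult_Vertex_right[OF Z that(1) v that(3)] that unfolding ev by simp
 show "direct_decomposition K ?V (column_grading d v)"
  unfolding column_grading_def
 proof (rule direct_decomposition_by_basis[where coo = "\<lambda>q b. q (index b)"])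
  show "vectorspace K ?V" by (rule restrict_scalars_vectorspace[OF L])
  show "finite ?B" by simp
 next
  fix q b assume q: "q \<in> carrier ?V" and b: "b \<in> ?B"
  have bm: "b \<in> Mon" using b by blast
  obtain x where x: "x \<in> carrier A" "x \<otimes> ?e = x" "q = to_fun Z x" using q unfolding C by (rule column_mem[OF v])
  show "q (index b) \<in> carrier K" unfolding x(3) idx[OF b] by (rule coord_closed[OF Z x(1) bm])
  show "(c \<odot>\<^bsub>?V\<^esub> q) (index b) = c \<otimes>\<^bsub>K\<^esub> q (index b)" if c: "c \<in> carrier K" for c
  proof -
   have "c \<odot>\<^bsub>?V\<^esub> q = (c \<odot> \<one>) \<odot>\<^bsub>column v\<^esub> q" by (simp add: restrict_scalars_def)
   also have "\<dots> = to_fun Z (c \<odot> x)"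
    unfolding x(3) column_smult[OF v x(1,2)] scalar_action[OF c x(1)] ..
   finally show ?thesis unfolding x(3) by (simp only: idx[OF b] coord_smult[OF Z c x(1) bm])
  qed
  fix q' assume q': "q' \<in> carrier ?V"
  obtain y where y: "y \<in> carrier A" "y \<otimes> ?e = y" "q' = to_fun Z y" using q' unfolding C by (rule column_mem[OF v])
  have "q \<oplus>\<^bsub>?V\<^esub> q' = q \<oplus>\<^bsub>column v\<^esub> q'" by (simp add: restrict_scalars_def)
  also have "\<dots> = to_fun Z (x \<oplus> y)" unfolding x(3) y(3) column_add[OF v x(1,2) y(1,2)] ..
  finally show "(q \<oplus>\<^bsub>?V\<^esub> q') (index b) = q (index b) \<oplus>\<^bsub>K\<^esub> q' (index b)"
   unfolding x(3) y(3) by (simp only: idx[OF b] coord_add[OF Z x(1) y(1) bm])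
 next
  fix q q' assume q: "q \<in> carrier ?V" and q': "q' \<in> carrier ?V"
   and eq: "\<And>b. b \<in> ?B ==> q (index b) = q' (index b)"
  obtain x where x: "x \<in> carrier A" "x \<otimes> ?e = x" "q = to_fun Z x" using q unfolding C by (rule column_mem[OF v])
  obtain y where y: "y \<in> carrier A" "y \<otimes> ?e = y" "q' = to_fun Z y" using q' unfolding C by (rule column_mem[OF v])
  have "coord Z x b = coord Z y b" if b: "b \<in> Mon" for b
  proof (cases "b \<in> ?B")
   case True
   show ?thesis using eq[OF True] unfolding x(3) y(3) idx[OF True] .
  next
   case False
   show ?thesis unfolding off[OF x(1,2) b False] off[OF y(1,2) b False] ..
  qed
  then show "q = q'" unfolding x(3) y(3) using coord_eqI[OF Z x(1) y(1)] by simp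
 next
  fix f assume f: "\<And>b. b \<in> ?B ==> f b \<in> carrier K"
  let ?g = "\<lambda>b. if b \<in> ?B then f b else K0"
  define x where "x = comb Z ?g"
  have g: "?g b \<in> carrier K" for b using f by (cases "b \<in> ?B") auto
  have x: "x \<in> carrier A" unfolding x_def by (rule comb_closed) (use g frame_closed[OF Z] in blast)+
  have cx: "coord Z x b = ?g b" if "b \<in> Mon" for b
   unfolding x_def by (rule coord_comb[OF Z _ that]) (rule g)
  have xe: "x \<otimes> ?e = x"
  proof (rule coord_eqI[OF Z m_closed[OF x vtx_closed[OF Z v]] x])
   fix b assume b: "b \<in> Mon"
   show "coord Z (x \<otimes> ?e) b = coord Z x b"
    unfolding ev coord_mult_Vertex_right[OF Z x v b] cx[OF b] by simp
  qed
  show "\<exists>q\<in>carrier ?V. \<forall>b\<in>?B. q (index b) = f b"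
  proof (intro bexI ballI)
   show "to_fun Z x \<in> carrier ?V" unfolding C by (rule column_memI[OF v x xe])
   fix b assume b: "b \<in> ?B"
   then have bm: "b \<in> Mon" by blast
   show "to_fun Z x (index b) = f b" unfolding idx[OF b] cx[OF bm] using b by simp
  qed
 qed
 fix i j a q assume a: "a \<in> standard_grading Z d i" and q: "q \<in> column_grading d v j"
 have ac: "a \<in> carrier A" and ad: "\<And>b. [|b \<in> Mon; coord Z a b \<noteq> K0|] ==> d b = i"
  using a unfolding standard_grading_def by blast+
 have qc: "q \<in> carrier (column v)" and qd: "\<And>b. [|b \<in> ?B; q (index b) \<noteq> K0|] ==> d b = j"
  using q unfolding column_grading_def C by blast+
 obtain x where x: "x \<in> carrier A" "x \<otimes> ?e = x" "q = to_fun Z x" by (rule column_mem[OF v qc])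
 have ax: "a \<otimes> x \<in> carrier A" "(a \<otimes> x) \<otimes> ?e = a \<otimes> x"
  using ac x(1) m_assoc[OF ac x(1) vtx_closed[OF Z v]] x(2) by simp_all
 have "d b = i + j" if b: "b \<in> ?B" and nz: "coord Z (a \<otimes> x) b \<noteq> K0" for b
 proof -
  have bm: "b \<in> Mon" using b by blast
  obtain s t where st: "s \<in> Mon" "t \<in> Mon" "mm r s t = b"
   "coord Z a s \<noteq> K0" "coord Z x t \<noteq> K0"
   by (rule coord_mult_support[OF Z ac x(1) bm nz]) (rule that)
  have nN: "mm r s t \<noteq> Null" using st(3) bm by auto
  have tB: "t \<in> ?B" using mm_source_target(2)[OF st(1,2) nN] st(2,3) b by simp
  have "d t = j" using qd[OF tB] st(5) unfolding x(3) idx[OF tB] by blast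
  moreover have "d s = i" by (rule ad[OF st(1,4)])
  ultimately show ?thesis using degree_functionD[OF d st(1,2) nN] st(3) by simp
 qed
 then show "a \<odot>\<^bsub>column v\<^esub> q \<in> column_grading d v (i + j)"
  unfolding x(3) column_smult[OF v x(1,2)] column_grading_def C mem_Collect_eq
  using column_memI[OF v ax] idx by simp
qed

lemma character_modules_representatives: "simple_representatives A 3 (character_module Z)"
 unfolding simple_representatives_def
proof (intro conjI ballI allI impI)
 have three: "i \<in> {1..3} \<longleftrightarrow> i \<in> {1, 2, 3}" for i :: nat by auto
 note at = character_module_simple_at[OF Z]
 show "simple_module A (character_module Z i)" if "i \<in> {1..3}" for i
  by (rule character_module_simple[OF Z that[unfolded three]])
 show "i = j" if "i \<in> {1..3}" "j \<in> {1..3}" "isomorphic_modules A (character_module Z i) (character_module Z j)" for i j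
  by (rule isomorphic_simple_at[OF Z at[OF that(1)[unfolded three]] at[OF that(2)[unfolded three]] that(3)])
 fix T :: "('a, nat => 'k) module" assume T: "simple_module A T"
 obtain v s where vs: "simple_at Z v T s" by (rule simple_module_character[OF Z T]) (rule that)
 have v: "v \<in> {1, 2, 3}" using vs unfolding simple_at_def[OF Z] by blast
 show "\<exists>i\<in>{1..3}. isomorphic_modules A T (character_module Z i)"
  by (rule bexI[of _ v]) (rule simple_at_isomorphic[OF Z vs at[OF v]], rule v[folded three])
qed

end

section \<open>Classification by the degrees of two cycles\<close>

lemma standard_grading_subset: "standard_grading Z d i \<subseteq> carrier A"
 unfolding standard_grading_def by blast

text \<open>
Up to isomorphism an equivalence presents one grading as a regrading of the other, and regrading preserves the
degrees of cycles.
Conversely, gradings with equal degrees of cycles differ by a regrading, and the shifts of the left ideals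
can be chosen to realise it.
\<close>

theorem graded_Morita_iff:
 assumes Z: "frame Z" and d: "degree_function r d" and Z': "frame Z'" and d': "degree_function r d'"
 shows "graded_Morita_equivalent K A (standard_grading Z d) (standard_grading Z' d') \<longleftrightarrow>
  cycle_degrees d = cycle_degrees d'"
proof
 assume "graded_Morita_equivalent K A (standard_grading Z d) (standard_grading Z' d')"
 then obtain s and S P :: "nat => ('a, nat => 'k) module" and \<gamma> :: "nat => int => (nat => 'k) set"
  and dd :: "nat => nat => int"
  where S: "simple_representatives A s S"
   and cov: "\<forall>i\<in>{1..s}. projective_cover A (P i) (S i) \<and> graded_module K A (standard_grading Z d) (P i) (\<gamma> i)"
   and iso: "let I = (SIGMA i:{1..s}. {1..vectorspace.dim K (restrict_scalars A (S i))});
       M = direct_sum_module I (\<lambda>(i, j). P i);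
       \<delta> = direct_sum_grading I (\<lambda>(i, j). shift (dd i j) (\<gamma> i))
     in graded_algebras_isomorphic K A (standard_grading Z' d')
       (opposite_algebra (Endgr A M \<delta>)) (Endgr_component A M \<delta>)"
  unfolding graded_Morita_equivalent_def by (elim exE conjE)
 obtain v m where v: "bij_betw v {1..s} {1, 2, 3 :: nat}"
  and main: "\<forall>D dd. (\<forall>i\<in>{1..s}. D (v i) = dd i 1 - m i) \<longrightarrow>
   (let I = (SIGMA i:{1..s}. {1..vectorspace.dim K (restrict_scalars A (S i))});
      M = direct_sum_module I (\<lambda>(i, j). P i);
      \<delta> = direct_sum_grading I (\<lambda>(i, j). shift (dd i j) (\<gamma> i))
    in graded_algebras_isomorphic K A (standard_grading Z (regrade D d))
      (opposite_algebra (Endgr A M \<delta>)) (Endgr_component A M \<delta>))"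
  using shifted_endomorphism_algebra[OF Z d S cov] by (elim exE conjE) (rule that)
 define D where "D = (\<lambda>w. dd (inv_into {1..s} v w) 1 - m (inv_into {1..s} v w))"
 have "D (v i) = dd i 1 - m i" if "i \<in> {1..s}" for i
  unfolding D_def using inv_into_f_f[OF bij_betw_imp_inj_on[OF v] that] by simp
 note std = main[THEN spec[of _ D], THEN spec[of _ dd], THEN mp, OF ballI[OF this]]
 have "graded_algebras_isomorphic K A (standard_grading Z' d') A (standard_grading Z (regrade D d))"
  by (rule graded_isomorphic_trans[OF iso[unfolded Let_def]
     graded_isomorphic_sym[OF kalgebra_axioms standard_grading_subset std[unfolded Let_def]]])
 then obtain Z'' where Z'': "frame Z''" "standard_grading Z (regrade D d) = standard_grading Z'' d'"
  by (rule isomorphic_grading_standard[OF Z']) (rule that)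
 show "cycle_degrees d = cycle_degrees d'"
  using cycle_degrees_invariant[OF Z Z''(1) degree_function_regrade[OF d] d' Z''(2)] by simp
next
 assume eq: "cycle_degrees d = cycle_degrees d'"
 obtain D where D: "\<And>b. b \<in> Mon ==> d' b = regrade D d b"
  by (rule regrade_exists[OF d d' r eq]) (rule that)
 have three: "i \<in> {1..3} \<longleftrightarrow> i \<in> {1, 2, 3}" for i :: nat by auto
 note S = character_modules_representatives[OF Z]
 have cov: "\<forall>i\<in>{1..3}. projective_cover A (column Z i) (character_module Z i) \<and>
   graded_module K A (standard_grading Z d) (column Z i) (column_grading Z d i)"
  using column_projective_cover[OF Z] column_graded[OF Z d] three by blast
 obtain v m where v: "bij_betw v {1..3 :: nat} {1, 2, 3 :: nat}"
  and main: "\<forall>D dd. (\<forall>i\<in>{1..3}. D (v i) = dd i 1 - m i) \<longrightarrow>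
   (let I = (SIGMA i:{1..3}. {1..vectorspace.dim K (restrict_scalars A (character_module Z i))});
      M = direct_sum_module I (\<lambda>(i, j). column Z i);
      \<delta> = direct_sum_grading I (\<lambda>(i, j). shift (dd i j) (column_grading Z d i))
    in graded_algebras_isomorphic K A (standard_grading Z (regrade D d))
      (opposite_algebra (Endgr A M \<delta>)) (Endgr_component A M \<delta>))"
  using shifted_endomorphism_algebra[OF Z d S cov] by (elim exE conjE) (rule that)
 let ?dd = "\<lambda>i j :: nat. D (v i) + m i"
 have "standard_grading Z d' = standard_grading Z (regrade D d)" by (rule standard_grading_cong) (rule D)
 with frame_isomorphism[OF Z Z', of d']
 have iso: "graded_algebras_isomorphic K A (standard_grading Z' d') A (standard_grading Z (regrade D d))" by simp
 have "D (v i) = ?dd i 1 - m i" if "i \<in> {1..3}" for i by simp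
 note std = main[THEN spec[of _ D], THEN spec[of _ ?dd], THEN mp, OF ballI[OF this]]
 show "graded_Morita_equivalent K A (standard_grading Z d) (standard_grading Z' d')"
  unfolding graded_Morita_equivalent_def
 proof (intro exI conjI)
  show "simple_representatives A 3 (character_module Z)" by (rule S)
  show "\<forall>i\<in>{1..3}. projective_cover A (column Z i) (character_module Z i) \<and>
   graded_module K A (standard_grading Z d) (column Z i) (column_grading Z d i)" by (rule cov)
  show "let I = (SIGMA i:{1..3}. {1..vectorspace.dim K (restrict_scalars A (character_module Z i))});
      M = direct_sum_module I (\<lambda>(i, j). column Z i);
      \<delta> = direct_sum_grading I (\<lambda>(i, j). shift (?dd i j) (column_grading Z d i))
    in graded_algebras_isomorphic K A (standard_grading Z' d')
      (opposite_algebra (Endgr A M \<delta>)) (Endgr_component A M \<delta>)"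
   unfolding Let_def by (rule graded_isomorphic_trans[OF iso std[unfolded Let_def]])
 qed
qed

end

lemma classes_of_invariant:
 fixes f :: "'a => 'b"
 assumes R: "R = {(x, y). x \<in> G \<and> y \<in> G \<and> f x = f y}" and f: "f ` G = UNIV"
 shows "equiv G R" "\<exists>\<Phi>. bij_betw \<Phi> (G // R) (UNIV :: 'b set)"
proof -
 show "equiv G R"
  by (rule equivI) (auto simp: R refl_on_def sym_def trans_def)
 have "bij_betw (\<lambda>y. {x \<in> G. f x = y}) UNIV (G // R)"
  unfolding bij_betw_def
 proof
  show "inj (\<lambda>y. {x \<in> G. f x = y})"
  proof (rule injI)
   fix y z assume eq: "{x \<in> G. f x = y} = {x \<in> G. f x = z}"
   obtain x where "x \<in> G" "f x = y" using f by (metis UNIV_I imageE)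
   then show "y = z" using eq by blast
  qed
  have cls: "Image R {x} = {x' \<in> G. f x' = f x}" if "x \<in> G" for x using that unfolding R by auto
  show "range (\<lambda>y. {x \<in> G. f x = y}) = G // R"
  proof (rule equalityI)
   show "range (\<lambda>y. {x \<in> G. f x = y}) \<subseteq> G // R"
   proof (rule image_subsetI)
    fix y
    obtain x where x: "x \<in> G" "f x = y" using f by (metis UNIV_I imageE)
    show "{x \<in> G. f x = y} \<in> G // R" using quotientI[OF x(1), of R] unfolding cls[OF x(1)] x(2) .
   qed
   show "G // R \<subseteq> range (\<lambda>y. {x \<in> G. f x = y})"
   proof (rule subsetI)
    fix C assume "C \<in> G // R"
    then obtain x where x: "x \<in> G" "C = Image R {x}" by (rule quotientE)
    show "C \<in> range (\<lambda>y. {x \<in> G. f x = y})" unfolding x(2) cls[OF x(1)] by (rule rangeI)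
   qed
  qed
 qed
 then show "\<exists>\<Phi>. bij_betw \<Phi> (G // R) (UNIV :: 'b set)" by (rule bij_betw_inv)
qed

context C_type_algebra
begin

theorem gradings_classified:
 assumes Z0: "frame Z0"
 shows "equiv (gradings K A) (graded_Morita_rel K A)"
  and "\<exists>\<Phi>. bij_betw \<Phi> (gradings K A // graded_Morita_rel K A) (UNIV :: (int \<times> int) set)"
proof -
 define f where "f \<pi> = (SOME c. \<exists>Z d. frame Z \<and> degree_function r d \<and> \<pi> = standard_grading Z d
  \<and> c = cycle_degrees d)" for \<pi>
 have f: "f (standard_grading Z d) = cycle_degrees d" if Z: "frame Z" and d: "degree_function r d" for Z d
  unfolding f_def
 proof (rule some_equality)
  fix c assume "\<exists>Z' d'. frame Z' \<and> degree_function r d' \<and> standard_grading Z d = standard_grading Z' d'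
   \<and> c = cycle_degrees d'"
  then obtain Z' d' where a: "frame Z'" "degree_function r d'" "standard_grading Z d = standard_grading Z' d'"
   "c = cycle_degrees d'" by blast
  show "c = cycle_degrees d" using cycle_degrees_invariant[OF Z a(1) d a(2,3)] a(4) by simp
 qed (use Z d in blast)
 have rel: "graded_Morita_equivalent K A \<pi> \<pi>' \<longleftrightarrow> f \<pi> = f \<pi>'"
  if \<pi>: "\<pi> \<in> gradings K A" and \<pi>': "\<pi>' \<in> gradings K A" for \<pi> \<pi>'
 proof -
  obtain Z d where a: "frame Z" "degree_function r d" "\<pi> = standard_grading Z d"
   by (rule gradings_are_standard[OF Z0 \<pi>]) (rule that)
  obtain Z' d' where b: "frame Z'" "degree_function r d'" "\<pi>' = standard_grading Z' d'"
   by (rule gradings_are_standard[OF Z0 \<pi>']) (rule that)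
  show ?thesis unfolding a(3) b(3) f[OF a(1,2)] f[OF b(1,2)] by (rule graded_Morita_iff[OF a(1,2) b(1,2)])
 qed
 have R: "graded_Morita_rel K A = {(\<pi>, \<pi>'). \<pi> \<in> gradings K A \<and> \<pi>' \<in> gradings K A \<and> f \<pi> = f \<pi>'}"
  unfolding graded_Morita_rel_def using rel by blast
 have surj: "f ` gradings K A = UNIV"
 proof -
  have "(x, y) \<in> f ` gradings K A" for x y :: int
  proof (rule image_eqI)
   show "standard_grading Z0 (degree_with r x y) \<in> gradings K A"
    by (rule standard_grading_in_gradings[OF Z0 degree_function_degree_with])
   show "(x, y) = f (standard_grading Z0 (degree_with r x y))"
    unfolding f[OF Z0 degree_function_degree_with] cycle_degrees_degree_with ..
  qed
  then show ?thesis by auto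
 qed
 show "equiv (gradings K A) (graded_Morita_rel K A)" by (rule classes_of_invariant(1)[OF R surj])
 show "\<exists>\<Phi>. bij_betw \<Phi> (gradings K A // graded_Morita_rel K A) (UNIV :: (int \<times> int) set)"
  by (rule classes_of_invariant(2)[OF R surj])
qed

end

section \<open>Path algebras\<close>

locale quiver_algebra = K: field K + wf_digraph Q
 for K :: "('k, 'x) ring_scheme" and Q :: "('v, 'e) pre_digraph" +
 assumes finite_verts: "finite (verts Q)"
begin

abbreviation "K0 \<equiv> \<zero>\<^bsub>K\<^esub>"

abbreviation "K1 \<equiv> \<one>\<^bsub>K\<^esub>"

abbreviation "PA \<equiv> path_algebra K Q"

definition path_end :: "'v => 'e list => 'v" where
 "path_end u p = awlast u p"

lemma path_end_Nil [simp]: "path_end u [] = u"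
 by (simp add: path_end_def)

lemma path_end_Cons [simp]: "path_end u (a # p) = path_end (head Q a) p"
 by (cases p) (simp_all add: path_end_def)

lemma path_end_append: "path_end u (p @ q) = path_end (path_end u p) q"
 by (induction p arbitrary: u) simp_all

lemma paths_Nil [simp]: "(u, []) \<in> quiver_paths Q \<longleftrightarrow> u \<in> verts Q"
 by (auto simp: quiver_paths_def awalk_def)

lemma paths_Cons [simp]:
 "(u, a # p) \<in> quiver_paths Q \<longleftrightarrow> a \<in> arcs Q \<and> tail Q a = u \<and> (head Q a, p) \<in> quiver_paths Q"
 by (auto simp: quiver_paths_def awalk_def)

lemma paths_source: "(u, p) \<in> quiver_paths Q ==> u \<in> verts Q"
 by (auto simp: quiver_paths_def awalk_def)

lemma paths_append:
 "(u, p @ q) \<in> quiver_paths Q \<longleftrightarrow> (u, p) \<in> quiver_paths Q \<and> (path_end u p, q) \<in> quiver_paths Q"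
 by (induction p arbitrary: u) (use paths_source in auto)

lemma path_end_in: "(u, p) \<in> quiver_paths Q ==> path_end u p \<in> verts Q"
 using paths_append[of u p "[]"] by simp

abbreviation KF :: "('v \<times> 'e list => 'k) set" where
 "KF \<equiv> UNIV \<rightarrow> carrier K"

lemma KF_mem: "f \<in> KF ==> f x \<in> carrier K"
 by auto

definition conv :: "('v \<times> 'e list => 'k) => ('v \<times> 'e list => 'k) => 'v \<times> 'e list => 'k" where
 "conv f g = (\<lambda>(u, p). \<Oplus>\<^bsub>K\<^esub>n\<in>{..length p}.
   f (u, take n p) \<otimes>\<^bsub>K\<^esub> g (path_end u (take n p), drop n p))"

lemma conv_apply: "conv f g (u, p) = (\<Oplus>\<^bsub>K\<^esub>n\<in>{..length p}.
  f (u, take n p) \<otimes>\<^bsub>K\<^esub> g (path_end u (take n p), drop n p))"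
 by (simp add: conv_def)

lemma conv_closed: "[|f \<in> KF; g \<in> KF|] ==> conv f g \<in> KF"
 by (auto simp: conv_apply KF_mem intro!: K.finsum_closed)

lemma conv_Nil: "[|f \<in> KF; g \<in> KF|] ==> conv f g (u, []) = f (u, []) \<otimes>\<^bsub>K\<^esub> g (u, [])"
 by (simp add: conv_apply KF_mem)

text \<open>
The recursion on the first arrow of the path replaces reindexing of double sums: removing the arrow
turns the left factor into \<open>\<lambda>x. f (u, a # snd x)\<close>.
\<close>

lemma conv_Cons:
 assumes "f \<in> KF" "g \<in> KF"
 shows "conv f g (u, a # q) = f (u, []) \<otimes>\<^bsub>K\<^esub> g (u, a # q) \<oplus>\<^bsub>K\<^esub> conv (\<lambda>x. f (u, a # snd x)) g (head Q a, q)"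
proof -
 let ?F = "\<lambda>n. f (u, take n (a # q)) \<otimes>\<^bsub>K\<^esub> g (path_end u (take n (a # q)), drop n (a # q))"
 have c: "?F n \<in> carrier K" for n using assms by (simp add: KF_mem)
 have "conv f g (u, a # q) = finsum K ?F {..Suc (length q)}" by (simp add: conv_apply)
 also have "\<dots> = (\<Oplus>\<^bsub>K\<^esub>n\<in>{..length q}. ?F (Suc n)) \<oplus>\<^bsub>K\<^esub> ?F 0" using c by (intro K.finsum_Suc2) blast
 also have "\<dots> = ?F 0 \<oplus>\<^bsub>K\<^esub> (\<Oplus>\<^bsub>K\<^esub>n\<in>{..length q}. ?F (Suc n))"
  using c by (intro K.a_comm K.finsum_closed) blast+
 finally show ?thesis by (simp add: conv_apply)
qed

lemma conv_cong: "(\<And>q. f (u, q) = f' (u, q)) ==> conv f g (u, p) = conv f' g (u, p)"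
 by (simp add: conv_apply)

lemma conv_add_left:
 assumes "f \<in> KF" "f' \<in> KF" "g \<in> KF"
 shows "conv (\<lambda>x. f x \<oplus>\<^bsub>K\<^esub> f' x) g y = conv f g y \<oplus>\<^bsub>K\<^esub> conv f' g y"
proof (cases y)
 case (Pair u p)
 show ?thesis
  unfolding Pair conv_apply using assms
  by (subst K.finsum_addf[symmetric]) (auto simp: KF_mem K.l_distr)
qed

lemma conv_add_right:
 assumes "f \<in> KF" "g \<in> KF" "g' \<in> KF"
 shows "conv f (\<lambda>x. g x \<oplus>\<^bsub>K\<^esub> g' x) y = conv f g y \<oplus>\<^bsub>K\<^esub> conv f g' y"
proof (cases y)
 case (Pair u p)
 show ?thesis
  unfolding Pair conv_apply using assms
  by (subst K.finsum_addf[symmetric]) (auto simp: KF_mem K.r_distr)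
qed

lemma conv_smult_left:
 assumes "c \<in> carrier K" "f \<in> KF" "g \<in> KF"
 shows "conv (\<lambda>x. c \<otimes>\<^bsub>K\<^esub> f x) g y = c \<otimes>\<^bsub>K\<^esub> conv f g y"
proof (cases y)
 case (Pair u p)
 show ?thesis
  unfolding Pair conv_apply using assms
  by (subst K.finsum_rdistr) (auto simp: KF_mem K.m_assoc)
qed

lemma conv_smult_right:
 assumes "c \<in> carrier K" "f \<in> KF" "g \<in> KF"
 shows "conv f (\<lambda>x. c \<otimes>\<^bsub>K\<^esub> g x) y = c \<otimes>\<^bsub>K\<^esub> conv f g y"
proof (cases y)
 case (Pair u p)
 show ?thesis
  unfolding Pair conv_apply using assms
  by (subst K.finsum_rdistr) (auto simp: KF_mem K.m_lcomm)
qed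

lemma conv_zero_left: "g \<in> KF ==> conv (\<lambda>x. K0) g y = K0"
 using conv_smult_left[of "K0" "\<lambda>x. K0" g y] KF_mem[OF conv_closed, of "\<lambda>x. K0" g y] by simp

lemma conv_assoc:
 assumes "f \<in> KF" "g \<in> KF" and h: "h \<in> KF"
 shows "conv (conv f g) h (u, p) = conv f (conv g h) (u, p)"
 using assms(1,2)
proof (induction p arbitrary: u f g)
 case Nil
 then show ?case using h by (simp add: conv_Nil conv_closed KF_mem K.m_assoc)
next
 case (Cons a q)
 note f = Cons.prems(1) and g = Cons.prems(2)
 let ?w = "head Q a"
 define F where "F = (\<lambda>x :: 'v \<times> 'e list. f (u, a # snd x))"
 define G where "G = (\<lambda>x :: 'v \<times> 'e list. g (u, a # snd x))"
 have FG: "F \<in> KF" "G \<in> KF" using f g by (auto simp: F_def G_def)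
 have f0: "f (u, []) \<in> carrier K" and g0: "g (u, []) \<in> carrier K" and h1: "h (u, a # q) \<in> carrier K"
  using f g h by auto
 have fG: "(\<lambda>x. f (u, []) \<otimes>\<^bsub>K\<^esub> G x) \<in> KF" using f0 FG by auto
 have GH: "conv G h (?w, q) \<in> carrier K" by (rule KF_mem[OF conv_closed[OF FG(2) h]])
 have FGH: "conv F (conv g h) (?w, q) \<in> carrier K"
  by (rule KF_mem[OF conv_closed[OF FG(1) conv_closed[OF g h]]])
 have "conv (\<lambda>x. conv f g (u, a # snd x)) h (?w, q)
   = conv (\<lambda>x. f (u, []) \<otimes>\<^bsub>K\<^esub> G x \<oplus>\<^bsub>K\<^esub> conv F g x) h (?w, q)"
  by (rule conv_cong) (simp add: conv_Cons[OF f g] F_def G_def)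
 also have "\<dots> = f (u, []) \<otimes>\<^bsub>K\<^esub> conv G h (?w, q) \<oplus>\<^bsub>K\<^esub> conv (conv F g) h (?w, q)"
  unfolding conv_add_left[OF fG conv_closed[OF FG(1) g] h] conv_smult_left[OF f0 FG(2) h] ..
 also have "\<dots> = f (u, []) \<otimes>\<^bsub>K\<^esub> conv G h (?w, q) \<oplus>\<^bsub>K\<^esub> conv F (conv g h) (?w, q)"
  unfolding Cons.IH[OF FG(1) g] ..
 finally have "conv (conv f g) h (u, a # q) = f (u, []) \<otimes>\<^bsub>K\<^esub> g (u, []) \<otimes>\<^bsub>K\<^esub> h (u, a # q)
   \<oplus>\<^bsub>K\<^esub> (f (u, []) \<otimes>\<^bsub>K\<^esub> conv G h (?w, q) \<oplus>\<^bsub>K\<^esub> conv F (conv g h) (?w, q))"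
  unfolding conv_Cons[OF conv_closed[OF f g] h] conv_Nil[OF f g] by simp
 also have "\<dots> = f (u, []) \<otimes>\<^bsub>K\<^esub> (g (u, []) \<otimes>\<^bsub>K\<^esub> h (u, a # q) \<oplus>\<^bsub>K\<^esub> conv G h (?w, q)) \<oplus>\<^bsub>K\<^esub> conv F (conv g h) (?w, q)"
  using f0 g0 h1 GH FGH by (simp add: K.m_assoc K.r_distr K.a_assoc)
 also have "\<dots> = conv f (conv g h) (u, a # q)"
  unfolding conv_Cons[OF f conv_closed[OF g h]] conv_Cons[OF g h] F_def G_def ..
 finally show ?case .
qed

lemma conv_support:
 assumes nz: "conv f g (u, p) \<noteq> K0" and "f \<in> KF" "g \<in> KF"
 obtains n where "f (u, take n p) \<noteq> K0" "g (path_end u (take n p), drop n p) \<noteq> K0"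
proof -
 have "\<exists>n. f (u, take n p) \<noteq> K0 \<and> g (path_end u (take n p), drop n p) \<noteq> K0"
 proof (rule ccontr)
  assume "\<nexists>n. f (u, take n p) \<noteq> K0 \<and> g (path_end u (take n p), drop n p) \<noteq> K0"
  then have z: "f (u, take n p) = K0 \<or> g (path_end u (take n p), drop n p) = K0" for n by blast
  have "f (u, take n p) \<otimes>\<^bsub>K\<^esub> g (path_end u (take n p), drop n p) = K0" for n
   using z[of n] KF_mem[OF assms(2), of "(u, take n p)"] KF_mem[OF assms(3), of "(path_end u (take n p), drop n p)"]
   by (elim disjE) simp_all
  then have "conv f g (u, p) = K0" by (simp add: conv_apply K.finsum_zero)
  with nz show False ..
 qed
 then show thesis using that by blast
qed

definition unit_path :: "'v \<times> 'e list => 'k" where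
 "unit_path = (\<lambda>(u, p). if u \<in> verts Q \<and> p = [] then K1 else K0)"

lemma unit_path_KF: "unit_path \<in> KF"
 by (auto simp: unit_path_def)

lemma PA_carrier: "f \<in> carrier PA \<longleftrightarrow> f \<in> KF \<and> finite {x. f x \<noteq> K0} \<and> {x. f x \<noteq> K0} \<subseteq> quiver_paths Q"
 by (auto simp: path_algebra_def)

lemma PA_simps [simp]:
 "\<zero>\<^bsub>PA\<^esub> = (\<lambda>x. K0)" "\<one>\<^bsub>PA\<^esub> = unit_path" "f \<oplus>\<^bsub>PA\<^esub> g = (\<lambda>x. f x \<oplus>\<^bsub>K\<^esub> g x)"
 "f \<otimes>\<^bsub>PA\<^esub> g = conv f g" "c \<odot>\<^bsub>PA\<^esub> f = (\<lambda>x. c \<otimes>\<^bsub>K\<^esub> f x)"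
 by (simp_all add: path_algebra_def unit_path_def conv_def path_end_def)

lemma PA_KF: "f \<in> carrier PA ==> f \<in> KF"
 by (simp add: PA_carrier)

lemma PA_off: "[|f \<in> carrier PA; x \<notin> quiver_paths Q|] ==> f x = K0"
 unfolding PA_carrier by blast

lemma PA_mult_closed:
 assumes f: "f \<in> carrier PA" and g: "g \<in> carrier PA"
 shows "conv f g \<in> carrier PA"
 unfolding PA_carrier
proof (intro conjI)
 note fg = PA_KF[OF f] PA_KF[OF g]
 show "conv f g \<in> KF" by (rule conv_closed[OF fg])
 have sub: "x \<in> (\<lambda>((u, p), (w, q)). (u, p @ q)) ` ({x. f x \<noteq> K0} \<times> {x. g x \<noteq> K0}) \<and> x \<in> quiver_paths Q"
  if x: "conv f g x \<noteq> K0" for x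
 proof -
  obtain u p where up: "x = (u, p)" by (cases x)
  obtain n where n: "f (u, take n p) \<noteq> K0" "g (path_end u (take n p), drop n p) \<noteq> K0"
   by (rule conv_support[OF x[unfolded up] fg]) (rule that)
  have "(u, take n p) \<in> quiver_paths Q" "(path_end u (take n p), drop n p) \<in> quiver_paths Q"
   using n PA_off[OF f] PA_off[OF g] by blast+
  then have "(u, take n p @ drop n p) \<in> quiver_paths Q" by (simp only: paths_append simp_thms)
  moreover have "x = (\<lambda>((u, p), (w, q)). (u, p @ q)) ((u, take n p), (path_end u (take n p), drop n p))"
   by (simp add: up)
  ultimately show ?thesis using n up by (intro conjI image_eqI) auto
 qed
 have "finite ((\<lambda>((u, p), (w, q)). (u, p @ q)) ` ({x. f x \<noteq> K0} \<times> {x. g x \<noteq> K0}))"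
  using f g by (simp add: PA_carrier)
 then show "finite {x. conv f g x \<noteq> K0}" by (rule rev_finite_subset) (use sub in blast)
 show "{x. conv f g x \<noteq> K0} \<subseteq> quiver_paths Q" using sub by blast
qed

lemma PA_add_closed: "[|f \<in> carrier PA; g \<in> carrier PA|] ==> (\<lambda>x. f x \<oplus>\<^bsub>K\<^esub> g x) \<in> carrier PA"
proof -
 assume f: "f \<in> carrier PA" and g: "g \<in> carrier PA"
 have sub: "{x. f x \<oplus>\<^bsub>K\<^esub> g x \<noteq> K0} \<subseteq> {x. f x \<noteq> K0} \<union> {x. g x \<noteq> K0}"
  by auto
 show ?thesis
  unfolding PA_carrier
 proof (intro conjI)
  show "(\<lambda>x. f x \<oplus>\<^bsub>K\<^esub> g x) \<in> KF" using f g by (auto simp: PA_carrier)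
  show "finite {x. f x \<oplus>\<^bsub>K\<^esub> g x \<noteq> K0}"
   by (rule finite_subset[OF sub]) (use f g in \<open>simp add: PA_carrier\<close>)
  show "{x. f x \<oplus>\<^bsub>K\<^esub> g x \<noteq> K0} \<subseteq> quiver_paths Q"
   using sub f g unfolding PA_carrier by blast
 qed
qed

lemma PA_smult_closed: "[|c \<in> carrier K; f \<in> carrier PA|] ==> (\<lambda>x. c \<otimes>\<^bsub>K\<^esub> f x) \<in> carrier PA"
proof -
 assume c: "c \<in> carrier K" and f: "f \<in> carrier PA"
 have sub: "{x. c \<otimes>\<^bsub>K\<^esub> f x \<noteq> K0} \<subseteq> {x. f x \<noteq> K0}" using c by auto
 show ?thesis
  unfolding PA_carrier
 proof (intro conjI)
  show "(\<lambda>x. c \<otimes>\<^bsub>K\<^esub> f x) \<in> KF" using c f by (auto simp: PA_carrier)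
  show "finite {x. c \<otimes>\<^bsub>K\<^esub> f x \<noteq> K0}"
   by (rule finite_subset[OF sub]) (use f in \<open>simp add: PA_carrier\<close>)
  show "{x. c \<otimes>\<^bsub>K\<^esub> f x \<noteq> K0} \<subseteq> quiver_paths Q"
   using sub f unfolding PA_carrier by blast
 qed
qed

lemma PA_zero_closed: "(\<lambda>x. K0) \<in> carrier PA"
 by (simp add: PA_carrier)

lemma unit_path_closed: "unit_path \<in> carrier PA"
 unfolding PA_carrier
proof (intro conjI unit_path_KF)
 have "{x. unit_path x \<noteq> K0} = (\<lambda>u. (u, [])) ` verts Q"
  by (auto simp: unit_path_def split: if_splits)
 then show "finite {x. unit_path x \<noteq> K0}" "{x. unit_path x \<noteq> K0} \<subseteq> quiver_paths Q"
  using finite_verts by auto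
qed

lemma conv_unit_left:
 assumes f: "f \<in> carrier PA"
 shows "conv unit_path f = f"
proof
 fix x :: "'v \<times> 'e list"
 obtain u p where x: "x = (u, p)" by (cases x)
 note fK = PA_KF[OF f]
 have fx: "f x \<in> carrier K" by (rule KF_mem[OF fK])
 have off: "f x = K0" if "u \<notin> verts Q" using PA_off[OF f, of x] paths_source[of u p] that x by blast
 show "conv unit_path f x = f x"
 proof (cases p)
  case Nil
  show ?thesis using fx off unfolding x Nil conv_Nil[OF unit_path_KF fK] by (simp add: unit_path_def)
 next
  case (Cons a q)
  have "(\<lambda>y :: 'v \<times> 'e list. unit_path (u, a # snd y)) = (\<lambda>y. K0)" by (simp add: unit_path_def)
  then show ?thesis
   using fx off unfolding x Cons conv_Cons[OF unit_path_KF fK]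
   by (simp add: conv_zero_left[OF fK] unit_path_def)
 qed
qed

lemma conv_unit_right_apply:
 assumes "f \<in> KF"
 shows "conv f unit_path (u, p) = (if path_end u p \<in> verts Q then f (u, p) else K0)"
 using assms
proof (induction p arbitrary: u f)
 case Nil
 then show ?case using KF_mem[OF Nil] by (simp add: conv_Nil unit_path_KF) (simp add: unit_path_def)
next
 case (Cons a q)
 have "(\<lambda>x :: 'v \<times> 'e list. f (u, a # snd x)) \<in> KF" using Cons.prems by auto
 note IH = Cons.IH[OF this, of "head Q a"]
 show ?case
  using KF_mem[OF Cons.prems] unfolding conv_Cons[OF Cons.prems unit_path_KF] IH
  by (simp add: unit_path_def)
qed

lemma conv_unit_right:
 assumes f: "f \<in> carrier PA"
 shows "conv f unit_path = f"
proof
 fix x :: "'v \<times> 'e list"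
 obtain u p where x: "x = (u, p)" by (cases x)
 have "f x = K0" if "path_end u p \<notin> verts Q" using PA_off[OF f, of x] path_end_in[of u p] that x by blast
 then show "conv f unit_path x = f x" unfolding x conv_unit_right_apply[OF PA_KF[OF f]] by simp
qed

theorem path_algebra_kalgebra: "kalgebra K PA"
proof (intro kalgebra.intro kalgebra_axioms.intro K.field_axioms ringI abelian_groupI monoidI)
 fix f assume f: "f \<in> carrier PA"
 note fK = KF_mem[OF PA_KF[OF f]]
 show "\<exists>g\<in>carrier PA. g \<oplus>\<^bsub>PA\<^esub> f = \<zero>\<^bsub>PA\<^esub>"
 proof (rule bexI)
  show "(\<lambda>x. (\<ominus>\<^bsub>K\<^esub> K1) \<otimes>\<^bsub>K\<^esub> f x) \<in> carrier PA" using f by (intro PA_smult_closed) auto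
  show "(\<lambda>x. (\<ominus>\<^bsub>K\<^esub> K1) \<otimes>\<^bsub>K\<^esub> f x) \<oplus>\<^bsub>PA\<^esub> f = \<zero>\<^bsub>PA\<^esub>"
   using fK by (simp add: K.l_minus K.l_neg)
 qed
 show "\<one>\<^bsub>PA\<^esub> \<otimes>\<^bsub>PA\<^esub> f = f" "f \<otimes>\<^bsub>PA\<^esub> \<one>\<^bsub>PA\<^esub> = f"
  using conv_unit_left[OF f] conv_unit_right[OF f] by simp_all
 show "\<zero>\<^bsub>PA\<^esub> \<oplus>\<^bsub>PA\<^esub> f = f" "K1 \<odot>\<^bsub>PA\<^esub> f = f" using fK by simp_all
 fix g assume g: "g \<in> carrier PA"
 note gK = KF_mem[OF PA_KF[OF g]]
 show "f \<oplus>\<^bsub>PA\<^esub> g \<in> carrier PA" "f \<otimes>\<^bsub>PA\<^esub> g \<in> carrier PA"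
  using PA_add_closed[OF f g] PA_mult_closed[OF f g] by simp_all
 show "f \<oplus>\<^bsub>PA\<^esub> g = g \<oplus>\<^bsub>PA\<^esub> f" using fK gK by (simp add: K.a_comm)
 show "(c \<odot>\<^bsub>PA\<^esub> f) \<otimes>\<^bsub>PA\<^esub> g = c \<odot>\<^bsub>PA\<^esub> (f \<otimes>\<^bsub>PA\<^esub> g)" "f \<otimes>\<^bsub>PA\<^esub> (c \<odot>\<^bsub>PA\<^esub> g) = c \<odot>\<^bsub>PA\<^esub> (f \<otimes>\<^bsub>PA\<^esub> g)"
  "c \<odot>\<^bsub>PA\<^esub> (f \<oplus>\<^bsub>PA\<^esub> g) = c \<odot>\<^bsub>PA\<^esub> f \<oplus>\<^bsub>PA\<^esub> c \<odot>\<^bsub>PA\<^esub> g"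
  if c: "c \<in> carrier K" for c
  using fK gK c by (simp_all add: fun_eq_iff conv_smult_left[OF c PA_KF[OF f] PA_KF[OF g]]
    conv_smult_right[OF c PA_KF[OF f] PA_KF[OF g]] K.r_distr del: split_paired_All)
 fix h assume h: "h \<in> carrier PA"
 note hK = KF_mem[OF PA_KF[OF h]]
 show "f \<oplus>\<^bsub>PA\<^esub> g \<oplus>\<^bsub>PA\<^esub> h = f \<oplus>\<^bsub>PA\<^esub> (g \<oplus>\<^bsub>PA\<^esub> h)" using fK gK hK by (simp add: K.a_assoc)
 show "f \<otimes>\<^bsub>PA\<^esub> g \<otimes>\<^bsub>PA\<^esub> h = f \<otimes>\<^bsub>PA\<^esub> (g \<otimes>\<^bsub>PA\<^esub> h)"
  using conv_assoc[OF PA_KF[OF f] PA_KF[OF g] PA_KF[OF h]] by (simp add: fun_eq_iff)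
 show "(f \<oplus>\<^bsub>PA\<^esub> g) \<otimes>\<^bsub>PA\<^esub> h = f \<otimes>\<^bsub>PA\<^esub> h \<oplus>\<^bsub>PA\<^esub> g \<otimes>\<^bsub>PA\<^esub> h"
  using conv_add_left[OF PA_KF[OF f] PA_KF[OF g] PA_KF[OF h]] by (simp add: fun_eq_iff)
 show "h \<otimes>\<^bsub>PA\<^esub> (f \<oplus>\<^bsub>PA\<^esub> g) = h \<otimes>\<^bsub>PA\<^esub> f \<oplus>\<^bsub>PA\<^esub> h \<otimes>\<^bsub>PA\<^esub> g"
  using conv_add_right[OF PA_KF[OF h] PA_KF[OF f] PA_KF[OF g]] by (simp add: fun_eq_iff)
qed (auto simp: PA_zero_closed unit_path_closed PA_smult_closed K.l_distr K.m_assoc KF_mem PA_KF)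

lemma path_element_closed: "(u, p) \<in> quiver_paths Q ==> path_element K u p \<in> carrier PA"
 by (auto simp: PA_carrier path_element_def)

lemma path_element_KF: "path_element K u p \<in> KF"
 by (auto simp: path_element_def)

lemma path_element_mult:
 "conv (path_element K u p) (path_element K w q) =
  (if path_end u p = w then path_element K u (p @ q) else (\<lambda>x. K0))"
proof
 fix x :: "'v \<times> 'e list"
 obtain v s where x: "x = (v, s)" by (cases x)
 let ?c = "if v = u \<and> s = p @ q \<and> path_end u p = w then K1 else K0"
 have summand: "path_element K u p (v, take n s) \<otimes>\<^bsub>K\<^esub> path_element K w q (path_end v (take n s), drop n s)
   = (if length p = n then ?c else K0)" if n: "n \<le> length s" for n
 proof (cases "v = u \<and> take n s = p")
  case True
  have "length p = n" using True n by auto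
  moreover have "drop n s = q \<longleftrightarrow> s = p @ q" using True append_take_drop_id[of n s] by (metis same_append_eq)
  ultimately show ?thesis using True by (auto simp: path_element_def)
 next
  case False
  have "\<not> (length p = n \<and> v = u \<and> s = p @ q)" using False by auto
  moreover have "path_element K u p (v, take n s) = K0" using False by (auto simp: path_element_def)
  ultimately show ?thesis
   using KF_mem[OF path_element_KF, of w q "(path_end v (take n s), drop n s)"] by auto
 qed
 have "conv (path_element K u p) (path_element K w q) (v, s) = (\<Oplus>\<^bsub>K\<^esub>n\<in>{..length s}. if length p = n then ?c else K0)"
  unfolding conv_apply by (intro K.finsum_cong') (auto simp: summand)
 also have "\<dots> = ?c"
 proof (cases "length p \<le> length s")
  case True
  then show ?thesis by (intro K.add.finprod_singleton[of "length p" "{..length s}" "\<lambda>_. ?c"]) auto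
 next
  case False
  then have "?c = K0" by auto
  then show ?thesis by (simp add: K.finsum_zero)
 qed
 finally show "conv (path_element K u p) (path_element K w q) x =
   (if path_end u p = w then path_element K u (p @ q) else (\<lambda>x. K0)) x"
  unfolding x by (auto simp: path_element_def)
qed

text \<open>
Finitely supported functions are built from zero by adding multiples of paths, which reduces linear
statements to paths.
\<close>

lemma path_algebra_induct [consumes 1, case_names zero step]:
 assumes f: "f \<in> carrier PA" and zero: "R (\<lambda>x. K0)"
  and step: "\<And>c u p g. [|c \<in> carrier K; (u, p) \<in> quiver_paths Q; g \<in> carrier PA; R g|] ==>
   R (c \<odot>\<^bsub>PA\<^esub> path_element K u p \<oplus>\<^bsub>PA\<^esub> g)"
 shows "R f"
proof -
 have "\<forall>f\<in>carrier PA. {x. f x \<noteq> K0} \<subseteq> S \<longrightarrow> R f" if "finite S" for S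
  using that
 proof (induction S)
  case empty
  have "f = (\<lambda>x. K0)" if "{x. f x \<noteq> K0} \<subseteq> {}" for f using that by blast
  then show ?case using zero by blast
 next
  case (insert y S)
  show ?case
  proof (intro ballI impI)
   fix f assume f: "f \<in> carrier PA" and sub: "{x. f x \<noteq> K0} \<subseteq> insert y S"
   obtain u p where y: "y = (u, p)" by (cases y)
   show "R f"
   proof (cases "f y = K0")
    case True
    then have "{x. f x \<noteq> K0} \<subseteq> S" using sub by blast
    then show ?thesis using insert.IH f by blast
   next
    case False
    define g where "g = f(y := K0)"
    have gs: "{x. g x \<noteq> K0} = {x. f x \<noteq> K0} - {y}" by (auto simp: g_def)
    have g: "g \<in> carrier PA"
     unfolding PA_carrier gs using f by (auto simp: PA_carrier g_def)
    have "{x. g x \<noteq> K0} \<subseteq> S" unfolding gs using sub by blast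
    then have "R g" using insert.IH g by blast
    moreover have "y \<in> quiver_paths Q" using False PA_off[OF f] by blast
    moreover have fy: "f y \<in> carrier K" by (rule KF_mem[OF PA_KF[OF f]])
    ultimately have "R (f y \<odot>\<^bsub>PA\<^esub> path_element K u p \<oplus>\<^bsub>PA\<^esub> g)" using g y by (intro step) auto
    moreover have "f y \<odot>\<^bsub>PA\<^esub> path_element K u p \<oplus>\<^bsub>PA\<^esub> g = f"
     using fy KF_mem[OF PA_KF[OF f]] by (simp add: fun_eq_iff y path_element_def g_def del: split_paired_All)
    ultimately show ?thesis by simp
   qed
  qed
 qed
 from this[of "{x. f x \<noteq> K0}"] show ?thesis using f by (auto simp: PA_carrier)
qed

text \<open>The linear functional on the path algebra with prescribed values on the paths.\<close>

definition pairing :: "('v \<times> 'e list => 'k) => ('v \<times> 'e list => 'k) => 'k" where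
 "pairing f \<eta> = (\<Oplus>\<^bsub>K\<^esub>x\<in>{x. f x \<noteq> K0}. f x \<otimes>\<^bsub>K\<^esub> \<eta> x)"

lemma pairing_closed: "[|f \<in> carrier PA; \<eta> \<in> KF|] ==> pairing f \<eta> \<in> carrier K"
 unfolding pairing_def by (intro K.finsum_closed) (auto simp: PA_carrier)

lemma pairing_superset:
 assumes f: "f \<in> carrier PA" and \<eta>: "\<eta> \<in> KF" and S: "finite S" "{x. f x \<noteq> K0} \<subseteq> S"
 shows "pairing f \<eta> = (\<Oplus>\<^bsub>K\<^esub>x\<in>S. f x \<otimes>\<^bsub>K\<^esub> \<eta> x)"
 unfolding pairing_def using f \<eta>
 by (intro K.add.finprod_mono_neutral_cong_left[OF S]) (auto simp: KF_mem PA_KF)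

lemma pairing_zero: "pairing (\<lambda>x. K0) \<eta> = K0"
 by (simp add: pairing_def)

lemma pairing_add:
 assumes f: "f \<in> carrier PA" and g: "g \<in> carrier PA" and \<eta>: "\<eta> \<in> KF"
 shows "pairing (\<lambda>x. f x \<oplus>\<^bsub>K\<^esub> g x) \<eta> = pairing f \<eta> \<oplus>\<^bsub>K\<^esub> pairing g \<eta>"
proof -
 let ?S = "{x. f x \<noteq> K0} \<union> {x. g x \<noteq> K0}"
 have S: "finite ?S" using f g by (simp add: PA_carrier)
 have "pairing (\<lambda>x. f x \<oplus>\<^bsub>K\<^esub> g x) \<eta> = (\<Oplus>\<^bsub>K\<^esub>x\<in>?S. (f x \<oplus>\<^bsub>K\<^esub> g x) \<otimes>\<^bsub>K\<^esub> \<eta> x)"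
  by (rule pairing_superset[OF PA_add_closed[OF f g] \<eta> S]) auto
 also have "\<dots> = (\<Oplus>\<^bsub>K\<^esub>x\<in>?S. f x \<otimes>\<^bsub>K\<^esub> \<eta> x \<oplus>\<^bsub>K\<^esub> g x \<otimes>\<^bsub>K\<^esub> \<eta> x)"
  using KF_mem[OF PA_KF[OF f]] KF_mem[OF PA_KF[OF g]] KF_mem[OF \<eta>]
  by (intro K.finsum_cong') (auto simp: K.l_distr)
 also have "\<dots> = (\<Oplus>\<^bsub>K\<^esub>x\<in>?S. f x \<otimes>\<^bsub>K\<^esub> \<eta> x) \<oplus>\<^bsub>K\<^esub> (\<Oplus>\<^bsub>K\<^esub>x\<in>?S. g x \<otimes>\<^bsub>K\<^esub> \<eta> x)"
  using KF_mem[OF PA_KF[OF f]] KF_mem[OF PA_KF[OF g]] KF_mem[OF \<eta>] by (intro K.finsum_addf) auto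
 also have "\<dots> = pairing f \<eta> \<oplus>\<^bsub>K\<^esub> pairing g \<eta>"
  using pairing_superset[OF f \<eta> S] pairing_superset[OF g \<eta> S] by simp
 finally show ?thesis .
qed

lemma pairing_smult:
 assumes c: "c \<in> carrier K" and f: "f \<in> carrier PA" and \<eta>: "\<eta> \<in> KF"
 shows "pairing (\<lambda>x. c \<otimes>\<^bsub>K\<^esub> f x) \<eta> = c \<otimes>\<^bsub>K\<^esub> pairing f \<eta>"
proof -
 let ?S = "{x. f x \<noteq> K0}"
 have S: "finite ?S" using f by (simp add: PA_carrier)
 note fK = KF_mem[OF PA_KF[OF f]] and hK = KF_mem[OF \<eta>]
 have "pairing (\<lambda>x. c \<otimes>\<^bsub>K\<^esub> f x) \<eta> = (\<Oplus>\<^bsub>K\<^esub>x\<in>?S. (c \<otimes>\<^bsub>K\<^esub> f x) \<otimes>\<^bsub>K\<^esub> \<eta> x)"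
  by (rule pairing_superset[OF PA_smult_closed[OF c f] \<eta> S]) (use c in auto)
 also have "\<dots> = (\<Oplus>\<^bsub>K\<^esub>x\<in>?S. c \<otimes>\<^bsub>K\<^esub> (f x \<otimes>\<^bsub>K\<^esub> \<eta> x))"
  using fK hK c by (intro K.finsum_cong') (auto simp: K.m_assoc)
 also have "\<dots> = c \<otimes>\<^bsub>K\<^esub> pairing f \<eta>"
  unfolding pairing_def using fK hK c S by (intro K.finsum_rdistr[symmetric]) auto
 finally show ?thesis .
qed

lemma pairing_path_element: "\<eta> \<in> KF ==> pairing (path_element K u p) \<eta> = \<eta> (u, p)"
proof -
 assume \<eta>: "\<eta> \<in> KF"
 have "{x. path_element K u p x \<noteq> K0} = {(u, p)}" by (auto simp: path_element_def)
 then show ?thesis using KF_mem[OF \<eta>, of "(u, p)"] by (simp add: pairing_def path_element_def)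
qed

lemma pairing_linear:
 "[|c \<in> carrier K; (u, p) \<in> quiver_paths Q; g \<in> carrier PA; \<eta> \<in> KF|] ==>
  pairing (c \<odot>\<^bsub>PA\<^esub> path_element K u p \<oplus>\<^bsub>PA\<^esub> g) \<eta> = c \<otimes>\<^bsub>K\<^esub> \<eta> (u, p) \<oplus>\<^bsub>K\<^esub> pairing g \<eta>"
 using pairing_add[OF PA_smult_closed[OF _ path_element_closed], of c u p g \<eta>]
  pairing_smult[OF _ path_element_closed, of c u p \<eta>] pairing_path_element[of \<eta> u p]
 by simp

text \<open>
The adjoint of left multiplication by a path acts on functionals by composition.
\<close>

lemma pairing_path_mult_left:
 assumes up: "(u, p) \<in> quiver_paths Q" and f: "f \<in> carrier PA" and \<eta>: "\<eta> \<in> KF"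
 shows "pairing (conv (path_element K u p) f) \<eta> =
  pairing f (\<lambda>(w, q). if path_end u p = w then \<eta> (u, p @ q) else K0)"
  (is "_ = pairing f ?\<theta>")
proof -
 note pe = path_element_closed[OF up]
 have \<theta>: "?\<theta> \<in> KF" using \<eta> by auto
 show ?thesis using f
 proof (induction f rule: path_algebra_induct)
  case zero
  have "conv (path_element K u p) (\<lambda>x. K0) = (\<lambda>x. K0)"
   using conv_smult_right[OF K.zero_closed path_element_KF path_element_KF, of u p u p]
    KF_mem[OF conv_closed[OF path_element_KF path_element_KF], of u p u p] KF_mem[OF path_element_KF, of u p]
   by (simp add: fun_eq_iff)
  then show ?case by (simp add: pairing_zero)
 next
  case (step c w q g)
  note pw = path_element_closed[OF step(2)]
  let ?e = "path_element K u p"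
  have "conv ?e (c \<odot>\<^bsub>PA\<^esub> path_element K w q \<oplus>\<^bsub>PA\<^esub> g)
    = (\<lambda>x. c \<otimes>\<^bsub>K\<^esub> conv ?e (path_element K w q) x \<oplus>\<^bsub>K\<^esub> conv ?e g x)"
   using conv_add_right[OF path_element_KF PA_KF[OF PA_smult_closed[OF step(1) pw]] PA_KF[OF step(3)]]
    conv_smult_right[OF step(1) path_element_KF path_element_KF] by (simp add: fun_eq_iff)
  then have "pairing (conv ?e (c \<odot>\<^bsub>PA\<^esub> path_element K w q \<oplus>\<^bsub>PA\<^esub> g)) \<eta>
    = c \<otimes>\<^bsub>K\<^esub> pairing (conv ?e (path_element K w q)) \<eta> \<oplus>\<^bsub>K\<^esub> pairing (conv ?e g) \<eta>"
   using pairing_add[OF PA_smult_closed[OF step(1) PA_mult_closed[OF pe pw]] PA_mult_closed[OF pe step(3)] \<eta>]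
    pairing_smult[OF step(1) PA_mult_closed[OF pe pw] \<eta>] by simp
  also have "pairing (conv ?e (path_element K w q)) \<eta> = ?\<theta> (w, q)"
   unfolding path_element_mult using pairing_path_element[OF \<eta>] pairing_zero by simp
  also have "pairing (conv ?e g) \<eta> = pairing g ?\<theta>" by (rule step(4))
  finally show ?case unfolding pairing_linear[OF step(1-3) \<theta>] .
 qed
qed

lemma pairing_path_mult_right:
 assumes wq: "(w, q) \<in> quiver_paths Q" and f: "f \<in> carrier PA" and \<eta>: "\<eta> \<in> KF"
 shows "pairing (conv f (path_element K w q)) \<eta> =
  pairing f (\<lambda>(u, p). if path_end u p = w then \<eta> (u, p @ q) else K0)"
  (is "_ = pairing f ?\<theta>")
proof -
 note pe = path_element_closed[OF wq]
 have \<theta>: "?\<theta> \<in> KF" using \<eta> by auto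
 show ?thesis using f
 proof (induction f rule: path_algebra_induct)
  case zero
  have "conv (\<lambda>x. K0) (path_element K w q) = (\<lambda>x. K0)"
   using conv_zero_left[OF path_element_KF] by blast
  then show ?case by (simp add: pairing_zero)
 next
  case (step c u p g)
  note pu = path_element_closed[OF step(2)]
  let ?e = "path_element K w q"
  have "conv (c \<odot>\<^bsub>PA\<^esub> path_element K u p \<oplus>\<^bsub>PA\<^esub> g) ?e
    = (\<lambda>x. c \<otimes>\<^bsub>K\<^esub> conv (path_element K u p) ?e x \<oplus>\<^bsub>K\<^esub> conv g ?e x)"
   using conv_add_left[OF PA_KF[OF PA_smult_closed[OF step(1) pu]] PA_KF[OF step(3)] path_element_KF]
    conv_smult_left[OF step(1) path_element_KF path_element_KF] by (simp add: fun_eq_iff)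
  then have "pairing (conv (c \<odot>\<^bsub>PA\<^esub> path_element K u p \<oplus>\<^bsub>PA\<^esub> g) ?e) \<eta>
    = c \<otimes>\<^bsub>K\<^esub> pairing (conv (path_element K u p) ?e) \<eta> \<oplus>\<^bsub>K\<^esub> pairing (conv g ?e) \<eta>"
   using pairing_add[OF PA_smult_closed[OF step(1) PA_mult_closed[OF pu pe]] PA_mult_closed[OF step(3) pe] \<eta>]
    pairing_smult[OF step(1) PA_mult_closed[OF pu pe] \<eta>] by simp
  also have "pairing (conv (path_element K u p) ?e) \<eta> = ?\<theta> (u, p)"
   unfolding path_element_mult using pairing_path_element[OF \<eta>] pairing_zero by simp
  also have "pairing (conv g ?e) \<eta> = pairing g ?\<theta>" by (rule step(4))
  finally show ?case unfolding pairing_linear[OF step(1-3) \<theta>] .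
 qed
qed

end

section \<open>Quotients of algebras\<close>

context kalgebra
begin

context
 fixes I assumes I: "ideal I A"
begin

lemma quotient_carrier: "carrier (quotient_algebra A I) = (\<lambda>x. I +> x) ` carrier A"
 by (auto simp: quotient_algebra_def FactRing_def A_RCOSETS_def')

lemma quotient_mult: "[|x \<in> carrier A; y \<in> carrier A|] ==>
 (I +> x) \<otimes>\<^bsub>quotient_algebra A I\<^esub> (I +> y) = I +> (x \<otimes> y)"
 using ring_hom_mult[OF ideal.rcos_ring_hom[OF I], of x y] by (simp add: quotient_algebra_def)

lemma quotient_add: "[|x \<in> carrier A; y \<in> carrier A|] ==>
 (I +> x) \<oplus>\<^bsub>quotient_algebra A I\<^esub> (I +> y) = I +> (x \<oplus> y)"
 using ring_hom_add[OF ideal.rcos_ring_hom[OF I], of x y] by (simp add: quotient_algebra_def)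

lemma quotient_one: "\<one>\<^bsub>quotient_algebra A I\<^esub> = I +> \<one>"
 using ring_hom_one[OF ideal.rcos_ring_hom[OF I]] by (simp add: quotient_algebra_def)

lemma quotient_zero: "\<zero>\<^bsub>quotient_algebra A I\<^esub> = I"
 by (simp add: quotient_algebra_def FactRing_def)

lemma coset_eq_zero: "x \<in> carrier A ==> I +> x = \<zero>\<^bsub>quotient_algebra A I\<^esub> \<longleftrightarrow> x \<in> I"
 unfolding quotient_zero using a_rcos_zero[OF I] ideal.rcos_const_imp_mem[OF I] by blast

lemma coset_zero: "I +> \<zero> = \<zero>\<^bsub>quotient_algebra A I\<^esub>"
 using coset_eq_zero[OF zero_closed] additive_subgroup.zero_closed[OF ideal.axioms(1)[OF I]] by blast

lemma quotient_smult:
 assumes c: "c \<in> carrier K" and x: "x \<in> carrier A"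
 shows "c \<odot>\<^bsub>quotient_algebra A I\<^esub> (I +> x) = I +> (c \<odot> x)"
proof -
 interpret I: ideal I A by (rule I)
 have "I +> (c \<odot> y) = I +> (c \<odot> x)" if y: "y \<in> I +> x" for y
 proof -
  obtain i where i: "i \<in> I" "y = i \<oplus> x" using y unfolding a_r_coset_def' by blast
  have iA: "i \<in> carrier A" using i(1) I.a_subset by blast
  have "(c \<odot> \<one>) \<otimes> i \<in> I" using I.I_l_closed[OF i(1)] c by simp
  then have ci: "c \<odot> i \<in> I" using scalar_action[OF c iA] by simp
  have "I +> (c \<odot> y) = (I +> (c \<odot> i)) \<oplus>\<^bsub>quotient_algebra A I\<^esub> (I +> (c \<odot> x))"
   unfolding i(2) smult_r_distr[OF c iA x] using c iA x by (intro quotient_add[symmetric]) simp_all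
  also have "I +> (c \<odot> i) = I +> \<zero>"
   using a_rcos_zero[OF I ci] a_rcos_zero[OF I I.zero_closed] by simp
  also have "(I +> \<zero>) \<oplus>\<^bsub>quotient_algebra A I\<^esub> (I +> (c \<odot> x)) = I +> (c \<odot> x)"
   using c x quotient_add[of \<zero> "c \<odot> x"] by simp
  finally show ?thesis .
 qed
 moreover have "I +> x \<noteq> {}" using I.a_rcos_self[OF x] by blast
 ultimately have "(\<Union>y\<in>I +> x. I +> (c \<odot> y)) = I +> (c \<odot> x)" by (intro SUP_eq_const) blast+
 then show ?thesis by (simp only: quotient_algebra_def module.select_convs)
qed

lemma quotient_kalgebra: "kalgebra K (quotient_algebra A I)"
proof (intro kalgebra.intro kalgebra_axioms.intro K.field_axioms ringI abelian_groupI monoidI)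
 let ?Q = "quotient_algebra A I"
 note simps = quotient_mult quotient_add quotient_one coset_zero[symmetric] quotient_smult
 have cl: "I +> x \<in> carrier ?Q" if "x \<in> carrier A" for x using that unfolding quotient_carrier by blast
 show "\<zero>\<^bsub>?Q\<^esub> \<in> carrier ?Q" "\<one>\<^bsub>?Q\<^esub> \<in> carrier ?Q" by (simp_all add: simps cl)
 fix U assume "U \<in> carrier ?Q"
 then obtain x where x: "x \<in> carrier A" and U: "U = I +> x" unfolding quotient_carrier by blast
 show "\<exists>V\<in>carrier ?Q. V \<oplus>\<^bsub>?Q\<^esub> U = \<zero>\<^bsub>?Q\<^esub>"
  by (rule bexI[OF _ cl[of "\<ominus> x"]]) (simp_all add: U simps x l_neg)
 show "\<zero>\<^bsub>?Q\<^esub> \<oplus>\<^bsub>?Q\<^esub> U = U" "\<one>\<^bsub>?Q\<^esub> \<otimes>\<^bsub>?Q\<^esub> U = U" "U \<otimes>\<^bsub>?Q\<^esub> \<one>\<^bsub>?Q\<^esub> = U" "K1 \<odot>\<^bsub>?Q\<^esub> U = U"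
  by (simp_all add: U simps x)
 show "c \<odot>\<^bsub>?Q\<^esub> U \<in> carrier ?Q" if "c \<in> carrier K" for c
  using that by (simp add: U simps x cl)
 show "(c \<oplus>\<^bsub>K\<^esub> d) \<odot>\<^bsub>?Q\<^esub> U = c \<odot>\<^bsub>?Q\<^esub> U \<oplus>\<^bsub>?Q\<^esub> d \<odot>\<^bsub>?Q\<^esub> U" "(c \<otimes>\<^bsub>K\<^esub> d) \<odot>\<^bsub>?Q\<^esub> U = c \<odot>\<^bsub>?Q\<^esub> (d \<odot>\<^bsub>?Q\<^esub> U)"
  if "c \<in> carrier K" "d \<in> carrier K" for c d
  using that by (simp_all add: U simps x smult_l_distr smult_assoc1)
 fix V assume "V \<in> carrier ?Q"
 then obtain y where y: "y \<in> carrier A" and V: "V = I +> y" unfolding quotient_carrier by blast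
 show "U \<oplus>\<^bsub>?Q\<^esub> V \<in> carrier ?Q" "U \<otimes>\<^bsub>?Q\<^esub> V \<in> carrier ?Q" by (simp_all add: U V simps x y cl)
 show "U \<oplus>\<^bsub>?Q\<^esub> V = V \<oplus>\<^bsub>?Q\<^esub> U" by (simp add: U V simps x y a_comm)
 show "c \<odot>\<^bsub>?Q\<^esub> (U \<oplus>\<^bsub>?Q\<^esub> V) = c \<odot>\<^bsub>?Q\<^esub> U \<oplus>\<^bsub>?Q\<^esub> c \<odot>\<^bsub>?Q\<^esub> V"
  "(c \<odot>\<^bsub>?Q\<^esub> U) \<otimes>\<^bsub>?Q\<^esub> V = c \<odot>\<^bsub>?Q\<^esub> (U \<otimes>\<^bsub>?Q\<^esub> V)" "U \<otimes>\<^bsub>?Q\<^esub> (c \<odot>\<^bsub>?Q\<^esub> V) = c \<odot>\<^bsub>?Q\<^esub> (U \<otimes>\<^bsub>?Q\<^esub> V)"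
  if "c \<in> carrier K" for c
  using that by (simp_all add: U V simps x y smult_r_distr smult_mult_left smult_mult_right)
 fix W assume "W \<in> carrier ?Q"
 then obtain z where z: "z \<in> carrier A" and W: "W = I +> z" unfolding quotient_carrier by blast
 show "U \<oplus>\<^bsub>?Q\<^esub> V \<oplus>\<^bsub>?Q\<^esub> W = U \<oplus>\<^bsub>?Q\<^esub> (V \<oplus>\<^bsub>?Q\<^esub> W)" "U \<otimes>\<^bsub>?Q\<^esub> V \<otimes>\<^bsub>?Q\<^esub> W = U \<otimes>\<^bsub>?Q\<^esub> (V \<otimes>\<^bsub>?Q\<^esub> W)"
  "(U \<oplus>\<^bsub>?Q\<^esub> V) \<otimes>\<^bsub>?Q\<^esub> W = U \<otimes>\<^bsub>?Q\<^esub> W \<oplus>\<^bsub>?Q\<^esub> V \<otimes>\<^bsub>?Q\<^esub> W" "W \<otimes>\<^bsub>?Q\<^esub> (U \<oplus>\<^bsub>?Q\<^esub> V) = W \<otimes>\<^bsub>?Q\<^esub> U \<oplus>\<^bsub>?Q\<^esub> W \<otimes>\<^bsub>?Q\<^esub> V"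
  by (simp_all add: U V W simps x y z a_assoc m_assoc l_distr r_distr)
qed

end

end

section \<open>The monomial basis of \<open>C\<^sub>r\<close> by generators and relations\<close>

lemma mm_Null_ends:
 "[|s \<in> monomials r; t \<in> monomials r; monomial_target s \<noteq> monomial_source t|] ==> mm r s t = Null"
 using mm_source_target(3) by blast

lemma mm_Arc_assoc:
 assumes "1 \<le> l" "1 \<le> m"
 shows "mm r (mm r (Arc p (Suc 0)) (Arc q l)) (Arc k m) = mm r (Arc p (Suc 0)) (mm r (Arc q l) (Arc k m))"
proof (cases "q = (p + 1) mod 4")
 case False
 then show ?thesis by simp
next
 case True
 define x where "x = (q + l) mod 4"
 have x: "x = (p + Suc l) mod 4" by (simp add: x_def True mod_add_left_eq)
 have A: "mm r (Arc p (Suc 0)) (Arc q n) =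
   (if Suc n < 4 then Arc p (Suc n) else if Suc n = 4 then Socle (vertex_at p) else Null)" for n
  using True by simp
 have B: "mm r (Arc p (Suc l)) (Arc k' m) = (if k' = x then
   if Suc l + m < 4 then Arc p (Suc l + m) else if Suc l + m = 4 then Socle (vertex_at p) else Null else Null)" for k'
  by (simp only: mm.simps x)
 have C: "mm r (Arc q l) (Arc k' m) = (if k' = x then
   if l + m < 4 then Arc q (l + m) else if l + m = 4 then Socle (vertex_at q) else Null else Null)" for k'
  by (simp only: mm.simps x_def)
 have D: "mm r (Socle v) (Arc k' m) = Null" "mm r (Arc p (Suc 0)) (Socle v) = Null" for v k' by simp_all
 show ?thesis using assms by (auto simp add: A B C D simp del: mm.simps)
qed

lemma mm_arrow_assoc:
 assumes s: "s \<in> arrow_monomials" and t: "t \<in> monomials r" and w: "w \<in> monomials r" and r: "r \<ge> 2"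
 shows "mm r (mm r s t) w = mm r s (mm r t w)"
proof -
 have sm: "s \<in> monomials r" by (rule arrow_in_monomials[OF r s])
 consider (left) v where "t = Vertex v" | (right) v where "w = Vertex v"
  | (neither) "\<And>v. t \<noteq> Vertex v" "\<And>v. w \<noteq> Vertex v" by blast
 then show ?thesis
 proof cases
  case left
  then show ?thesis
   using mm_Null_ends[OF sm w] by (cases "monomial_target s = v") (auto simp: mm_Vertex_right)
 next
  case right
  then show ?thesis
   using mm_source_target(2)[OF sm t] by (cases "mm r s t = Null") (auto simp: mm_Vertex_right)
 next
  case neither
  from s have "(\<exists>p. s = Arc p (Suc 0)) \<or> s = Loop 1" by (auto simp: arrow_monomials_def)
  then show ?thesis
  proof (elim disjE exE)
   fix p assume sp: "s = Arc p (Suc 0)"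
   show ?thesis
   proof (cases t)
    case (Arc q l)
    show ?thesis
    proof (cases w)
     case (Arc k m)
     show ?thesis
      unfolding sp \<open>t = Arc q l\<close> Arc by (rule mm_Arc_assoc) (use t w \<open>t = Arc q l\<close> Arc in simp_all)
    qed (use neither sp Arc in auto)
   qed (use neither sp in \<open>cases w; auto\<close>)+
  next
   assume "s = Loop 1"
   then show ?thesis using t w neither by (cases t; cases w) auto
  qed
 qed
qed

lemma vertex_at_more [simp]: "vertex_at (Suc (Suc 0)) = 3" "vertex_at 4 = 1"
 unfolding numeral_2_eq_2[symmetric] by (rule vertex_at_small(4)) (simp add: vertex_at_def)

fun arrow_monomial :: "C_arrow => C_monomial" where
 "arrow_monomial arr_a1 = Arc 0 1"
| "arrow_monomial arr_a2 = Arc 1 1"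
| "arrow_monomial arr_b2 = Arc 2 1"
| "arrow_monomial arr_b1 = Arc 3 1"
| "arrow_monomial arr_c = Loop 1"

text \<open>
The monomial, or \<open>Null\<close>, to which the relations reduce the path.
\<close>

fun normal_form :: "nat => nat => C_arrow list => C_monomial" where
 "normal_form r u [] = Vertex u"
| "normal_form r u (a # p) = mm r (arrow_monomial a) (normal_form r (C_target a) p)"

lemma arrow_monomial_in: "arrow_monomial a \<in> arrow_monomials"
 by (cases a) (simp_all add: arrow_monomials_def)

lemma arrow_monomial_ends:
 "monomial_source (arrow_monomial a) = C_source a" "monomial_target (arrow_monomial a) = C_target a"
 by (cases a; simp add: vertex_at_def)+

lemma C_quiver_simps [simp]:
 "verts C_quiver = {1, 2, 3}" "arcs C_quiver = UNIV" "tail C_quiver = C_source" "head C_quiver = C_target"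
 by (simp_all add: C_quiver_def)

lemma C_ends_in: "C_source a \<in> {1, 2, 3}" "C_target a \<in> {1, 2, 3}"
 by (cases a; simp)+

locale C_presentation = field K
 for K :: "('k, 'x) ring_scheme" and r :: nat +
 assumes r: "r \<ge> 2" and char_two: "\<one>\<^bsub>K\<^esub> \<oplus>\<^bsub>K\<^esub> \<one>\<^bsub>K\<^esub> = \<zero>\<^bsub>K\<^esub>"

sublocale C_presentation \<subseteq> quiver_algebra K C_quiver
 by unfold_locales (use C_ends_in in auto)

context C_presentation
begin

interpretation PA: kalgebra K PA by (rule path_algebra_kalgebra)

lemma normal_form_in: "(u, p) \<in> quiver_paths C_quiver ==> normal_form r u p \<in> insert Null (monomials r)"
proof (induction p arbitrary: u)
 case (Cons a p)
 have "normal_form r (C_target a) p \<in> insert Null (monomials r)" using Cons by simp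
 then show ?case
  using mm_closed[OF arrow_in_monomials[OF r arrow_monomial_in], of "normal_form r (C_target a) p" a] by auto
qed auto

lemma normal_form_ends:
 assumes "(u, p) \<in> quiver_paths C_quiver" "normal_form r u p \<noteq> Null"
 shows "monomial_source (normal_form r u p) = u" "monomial_target (normal_form r u p) = path_end u p"
proof -
 have "monomial_source (normal_form r u p) = u \<and> monomial_target (normal_form r u p) = path_end u p"
  using assms
 proof (induction p arbitrary: u)
  case (Cons a p)
  have path: "(C_target a, p) \<in> quiver_paths C_quiver" "C_source a = u" using Cons.prems(1) by simp_all
  let ?t = "normal_form r (C_target a) p"
  have nz: "mm r (arrow_monomial a) ?t \<noteq> Null" using Cons.prems(2) by simp
  then have "?t \<noteq> Null" by auto
  then have t: "?t \<in> monomials r" "monomial_target ?t = path_end (C_target a) p"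
   using normal_form_in[OF path(1)] Cons.IH[OF path(1)] by auto
  show ?case
   using mm_source_target[OF arrow_in_monomials[OF r arrow_monomial_in] t(1) nz] t(2) path(2)
   by (simp add: arrow_monomial_ends)
 qed simp
 then show "monomial_source (normal_form r u p) = u" "monomial_target (normal_form r u p) = path_end u p" by auto
qed

lemma normal_form_append:
 assumes "(u, p) \<in> quiver_paths C_quiver" "(path_end u p, q) \<in> quiver_paths C_quiver"
 shows "normal_form r u (p @ q) = mm r (normal_form r u p) (normal_form r (path_end u p) q)"
 using assms
proof (induction p arbitrary: u)
 case Nil
 show ?case
 proof (cases "normal_form r u q = Null")
  case False
  have "(u, q) \<in> quiver_paths C_quiver" using Nil.prems(2) by simp
  then show ?thesis using normal_form_ends(1)[OF _ False] by simp
 qed simp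
next
 case (Cons a p)
 have path: "(C_target a, p) \<in> quiver_paths C_quiver" "(path_end (C_target a) p, q) \<in> quiver_paths C_quiver"
  using Cons.prems by simp_all
 let ?t = "normal_form r (C_target a) p" and ?w = "normal_form r (path_end (C_target a) p) q"
 have "mm r (arrow_monomial a) (mm r ?t ?w) = mm r (mm r (arrow_monomial a) ?t) ?w"
 proof (cases "?t = Null \<or> ?w = Null")
  case False
  then have "?t \<in> monomials r" "?w \<in> monomials r" using normal_form_in[OF path(1)] normal_form_in[OF path(2)] by auto
  then show ?thesis using mm_arrow_assoc[OF arrow_monomial_in _ _ r] by simp
 qed auto
 then show ?case using Cons.IH[OF path] by simp
qed

lemma path_mult_Null:
 assumes p: "(u, p) \<in> quiver_paths C_quiver" and q: "(w, q) \<in> quiver_paths C_quiver" and ne: "path_end u p \<noteq> w"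
 shows "mm r (normal_form r u p) (normal_form r w q) = Null"
proof (rule ccontr)
 assume nz: "mm r (normal_form r u p) (normal_form r w q) \<noteq> Null"
 then have nN: "normal_form r u p \<noteq> Null" "normal_form r w q \<noteq> Null" by auto
 then have m: "normal_form r u p \<in> monomials r" "normal_form r w q \<in> monomials r"
  using normal_form_in[OF p] normal_form_in[OF q] by auto
 show False
  using mm_source_target(3)[OF m nz] normal_form_ends(2)[OF p nN(1)] normal_form_ends(1)[OF q nN(2)] ne by simp
qed

lemma monomial_is_normal_form:
 assumes b: "b \<in> monomials r"
 shows "\<exists>u p. (u, p) \<in> quiver_paths C_quiver \<and> normal_form r u p = b"
proof -
 have loop: "(3, replicate i arr_c) \<in> quiver_paths C_quiver \<and>
   normal_form r 3 (replicate i arr_c) = (if i = 0 then Vertex 3 else if i < r then Loop i else Socle 3)"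
  if "i \<le> r" for i using that
 proof (induction i)
  case (Suc i)
  then show ?case using r by (cases i) auto
 qed simp
 show ?thesis
 proof (cases b)
  case (Vertex v)
  then show ?thesis using b by (intro exI[of _ v] exI[of _ "[]"]) simp
 next
  case (Loop i)
  then show ?thesis using b loop[of i] by (intro exI[of _ 3] exI[of _ "replicate i arr_c"]) simp
 next
  case (Socle v)
  then have "v = 1 \<or> v = 2 \<or> v = 3" using b by auto
  then show ?thesis
  proof (elim disjE)
   assume "v = 1"
   then show ?thesis using Socle
    by (intro exI[of _ 1] exI[of _ "[arr_a1, arr_a2, arr_b2, arr_b1]"]) simp
  next
   assume "v = 2"
   then show ?thesis using Socle
    by (intro exI[of _ 2] exI[of _ "[arr_a2, arr_b2, arr_b1, arr_a1]"]) simp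
  next
   assume "v = 3"
   then show ?thesis using Socle
    by (intro exI[of _ 3] exI[of _ "[arr_b2, arr_b1, arr_a1, arr_a2]"]) simp
  qed
 next
  case (Arc p l)
  define q where "q = take l (drop p [arr_a1, arr_a2, arr_b2, arr_b1, arr_a1, arr_a2, arr_b2])"
  have "(p = 0 \<or> p = 1 \<or> p = 2 \<or> p = 3) \<and> (l = 1 \<or> l = 2 \<or> l = 3)" using b Arc by auto
  then have "(vertex_at p, q) \<in> quiver_paths C_quiver \<and> normal_form r (vertex_at p) q = Arc p l"
   unfolding q_def by (elim conjE disjE) simp_all
  then show ?thesis using Arc by blast
 qed (use b in simp)
qed

abbreviation along_normal_form :: "(C_monomial => 'k) => nat \<times> C_arrow list => 'k" where
 "along_normal_form \<xi> \<equiv> (\<lambda>(u, p). \<xi> (normal_form r u p))"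

definition functionals :: "(C_monomial => 'k) set" where
 "functionals = {\<xi>. range \<xi> \<subseteq> carrier K \<and> \<xi> Null = K0}"

text \<open>
The elements of the path algebra whose image under the linear extension of \<open>normal_form\<close> is zero,
expressed by functionals on the monomials. Testing against all functionals makes the closure under products
immediate: a functional composed with multiplication by a monomial is again one.
\<close>

definition vanishing :: "(nat \<times> C_arrow list => 'k) set" where
 "vanishing = {f \<in> carrier PA. \<forall>\<xi>\<in>functionals. pairing f (along_normal_form \<xi>) = K0}"

lemma functional_KF: "\<xi> \<in> functionals ==> along_normal_form \<xi> \<in> KF"
 unfolding functionals_def by auto

lemma vanishing_closed: "f \<in> vanishing ==> f \<in> carrier PA"
 by (simp add: vanishing_def)

lemma vanishing_add: "[|f \<in> vanishing; g \<in> vanishing|] ==> (\<lambda>x. f x \<oplus>\<^bsub>K\<^esub> g x) \<in> vanishing"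
 using functional_KF by (simp add: vanishing_def PA_add_closed pairing_add)

lemma vanishing_smult: "[|c \<in> carrier K; f \<in> vanishing|] ==> (\<lambda>x. c \<otimes>\<^bsub>K\<^esub> f x) \<in> vanishing"
 using functional_KF by (simp add: vanishing_def PA_smult_closed pairing_smult)

lemma vanishing_zero: "(\<lambda>x. K0) \<in> vanishing"
 by (simp add: vanishing_def PA_zero_closed pairing_zero)

lemma pairing_cong:
 assumes f: "f \<in> carrier PA" and \<eta>: "\<eta> \<in> KF" and eq: "\<And>u p. (u, p) \<in> quiver_paths C_quiver ==> \<eta>' (u, p) = \<eta> (u, p)"
 shows "pairing f \<eta>' = pairing f \<eta>"
 unfolding pairing_def
proof (rule finsum_cong')
 show "(\<lambda>x. f x \<otimes>\<^bsub>K\<^esub> \<eta> x) \<in> {x. f x \<noteq> K0} \<rightarrow> carrier K"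
  using KF_mem[OF PA_KF[OF f]] KF_mem[OF \<eta>] by blast
 fix x assume "x \<in> {x. f x \<noteq> K0}"
 then have "x \<in> quiver_paths C_quiver" using f unfolding PA_carrier by blast
 then show "f x \<otimes>\<^bsub>K\<^esub> \<eta>' x = f x \<otimes>\<^bsub>K\<^esub> \<eta> x" using eq by (cases x) simp
qed simp

lemma vanishing_path_left:
 assumes p: "(u, p) \<in> quiver_paths C_quiver" and f: "f \<in> vanishing"
 shows "conv (path_element K u p) f \<in> vanishing"
 unfolding vanishing_def
proof (intro CollectI conjI ballI)
 note fc = vanishing_closed[OF f]
 show "conv (path_element K u p) f \<in> carrier PA" by (rule PA_mult_closed[OF path_element_closed[OF p] fc])
 fix \<xi> assume \<xi>: "\<xi> \<in> functionals"
 define \<xi>' where "\<xi>' = (\<lambda>m. \<xi> (mm r (normal_form r u p) m))"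
 have \<xi>': "\<xi>' \<in> functionals" using \<xi> unfolding functionals_def \<xi>'_def by auto
 have "pairing (conv (path_element K u p) f) (along_normal_form \<xi>) = pairing f (along_normal_form \<xi>')"
  unfolding pairing_path_mult_left[OF p fc functional_KF[OF \<xi>]]
 proof (rule pairing_cong[OF fc functional_KF[OF \<xi>']])
  fix w q assume q: "(w, q) \<in> quiver_paths C_quiver"
  show "(case (w, q) of (w, q) => if path_end u p = w then along_normal_form \<xi> (u, p @ q) else K0)
   = along_normal_form \<xi>' (w, q)"
   using normal_form_append[OF p, of q] path_mult_Null[OF p q] q \<xi>
   by (cases "path_end u p = w") (auto simp: \<xi>'_def functionals_def)
 qed
 then show "pairing (conv (path_element K u p) f) (along_normal_form \<xi>) = K0"
  using f \<xi>' unfolding vanishing_def by auto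
qed

lemma vanishing_path_right:
 assumes q: "(w, q) \<in> quiver_paths C_quiver" and f: "f \<in> vanishing"
 shows "conv f (path_element K w q) \<in> vanishing"
 unfolding vanishing_def
proof (intro CollectI conjI ballI)
 note fc = vanishing_closed[OF f]
 show "conv f (path_element K w q) \<in> carrier PA" by (rule PA_mult_closed[OF fc path_element_closed[OF q]])
 fix \<xi> assume \<xi>: "\<xi> \<in> functionals"
 define \<xi>' where "\<xi>' = (\<lambda>m. \<xi> (mm r m (normal_form r w q)))"
 have \<xi>': "\<xi>' \<in> functionals" using \<xi> unfolding functionals_def \<xi>'_def by auto
 have "pairing (conv f (path_element K w q)) (along_normal_form \<xi>) = pairing f (along_normal_form \<xi>')"
  unfolding pairing_path_mult_right[OF q fc functional_KF[OF \<xi>]]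
 proof (rule pairing_cong[OF fc functional_KF[OF \<xi>']])
  fix u p assume p: "(u, p) \<in> quiver_paths C_quiver"
  show "(case (u, p) of (u, p) => if path_end u p = w then along_normal_form \<xi> (u, p @ q) else K0)
   = along_normal_form \<xi>' (u, p)"
   using normal_form_append[OF p, of q] path_mult_Null[OF p q] q \<xi>
   by (cases "path_end u p = w") (auto simp: \<xi>'_def functionals_def)
 qed
 then show "pairing (conv f (path_element K w q)) (along_normal_form \<xi>) = K0"
  using f \<xi>' unfolding vanishing_def by auto
qed

lemma PA_minus: "f \<in> carrier PA ==> \<ominus>\<^bsub>PA\<^esub> f = (\<lambda>x. (\<ominus>\<^bsub>K\<^esub> K1) \<otimes>\<^bsub>K\<^esub> f x)"
proof -
 assume f: "f \<in> carrier PA"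
 have m: "(\<lambda>x. (\<ominus>\<^bsub>K\<^esub> K1) \<otimes>\<^bsub>K\<^esub> f x) \<in> carrier PA" using f by (intro PA_smult_closed) auto
 have "(\<lambda>x. (\<ominus>\<^bsub>K\<^esub> K1) \<otimes>\<^bsub>K\<^esub> f x) \<oplus>\<^bsub>PA\<^esub> f = \<zero>\<^bsub>PA\<^esub>"
  using KF_mem[OF PA_KF[OF f]] by (simp add: l_minus l_neg)
 then show ?thesis using PA.minus_equality[OF _ f m] by simp
qed

lemma vanishing_ideal: "ideal vanishing PA"
proof (rule idealI)
 show "ring PA" by (rule PA.ring_axioms)
 show "subgroup vanishing (add_monoid PA)"
 proof (rule PA.add.subgroupI)
  show "vanishing \<subseteq> carrier PA" using vanishing_closed by blast
  show "vanishing \<noteq> {}" using vanishing_zero by blast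
  show "\<ominus>\<^bsub>PA\<^esub> f \<in> vanishing" if "f \<in> vanishing" for f
   unfolding PA_minus[OF vanishing_closed[OF that]] using that by (intro vanishing_smult) auto
  show "f \<oplus>\<^bsub>PA\<^esub> g \<in> vanishing" if "f \<in> vanishing" "g \<in> vanishing" for f g
   using vanishing_add[OF that] by simp
 qed
 show "h \<otimes>\<^bsub>PA\<^esub> f \<in> vanishing" if f: "f \<in> vanishing" and h: "h \<in> carrier PA" for f h
  using h
 proof (induction h rule: path_algebra_induct)
  case zero
  then show ?case using vanishing_zero conv_zero_left[OF PA_KF[OF vanishing_closed[OF f]]] by simp
 next
  case (step c u p g)
  note pe = path_element_closed[OF step(2)] and fc = vanishing_closed[OF f]
  have "conv (c \<odot>\<^bsub>PA\<^esub> path_element K u p \<oplus>\<^bsub>PA\<^esub> g) f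
    = (\<lambda>x. c \<otimes>\<^bsub>K\<^esub> conv (path_element K u p) f x \<oplus>\<^bsub>K\<^esub> conv g f x)"
   using conv_add_left[OF PA_KF[OF PA_smult_closed[OF step(1) pe]] PA_KF[OF step(3)] PA_KF[OF fc]]
    conv_smult_left[OF step(1) path_element_KF PA_KF[OF fc]] by (simp add: fun_eq_iff)
  then show ?case
   using vanishing_add[OF vanishing_smult[OF step(1) vanishing_path_left[OF step(2) f]]] step(4) by simp
 qed
 show "f \<otimes>\<^bsub>PA\<^esub> h \<in> vanishing" if f: "f \<in> vanishing" and h: "h \<in> carrier PA" for f h
  using h
 proof (induction h rule: path_algebra_induct)
  case zero
  have "conv f (\<lambda>x. K0) = (\<lambda>x. K0)" using PA.r_null[OF vanishing_closed[OF f]] by simp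
  then show ?case using vanishing_zero by simp
 next
  case (step c u p g)
  note pe = path_element_closed[OF step(2)] and fc = vanishing_closed[OF f]
  have "conv f (c \<odot>\<^bsub>PA\<^esub> path_element K u p \<oplus>\<^bsub>PA\<^esub> g)
    = (\<lambda>x. c \<otimes>\<^bsub>K\<^esub> conv f (path_element K u p) x \<oplus>\<^bsub>K\<^esub> conv f g x)"
   using conv_add_right[OF PA_KF[OF fc] PA_KF[OF PA_smult_closed[OF step(1) pe]] PA_KF[OF step(3)]]
    conv_smult_right[OF step(1) PA_KF[OF fc] path_element_KF] by (simp add: fun_eq_iff)
  then show ?case
   using vanishing_add[OF vanishing_smult[OF step(1) vanishing_path_right[OF step(2) f]]] step(4) by simp
 qed
qed

lemma loop_path: "(3, replicate i arr_c) \<in> quiver_paths C_quiver"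
 by (induction i) simp_all

lemma normal_form_loop: "1 \<le> i ==> i \<le> r ==>
  normal_form r 3 (replicate i arr_c) = (if i < r then Loop i else Socle 3)"
proof (induction i rule: nat_induct_at_least)
 case base
 then show ?case using r by simp
next
 case (Suc i)
 then show ?case using r by simp
qed

lemma path_in_vanishing:
 "[|(u, p) \<in> quiver_paths C_quiver; normal_form r u p = Null|] ==> path_element K u p \<in> vanishing"
 unfolding vanishing_def using path_element_closed pairing_path_element[OF functional_KF]
 by (auto simp: functionals_def)

lemma difference_in_vanishing:
 assumes p: "(u, p) \<in> quiver_paths C_quiver" and q: "(w, q) \<in> quiver_paths C_quiver"
  and eq: "normal_form r u p = normal_form r w q"
 shows "path_element K u p \<ominus>\<^bsub>PA\<^esub> path_element K w q \<in> vanishing"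
proof -
 note pc = path_element_closed[OF p] and qc = path_element_closed[OF q]
 have mc: "\<ominus>\<^bsub>K\<^esub> K1 \<in> carrier K" by simp
 have e: "path_element K u p \<ominus>\<^bsub>PA\<^esub> path_element K w q
   = (\<lambda>x. path_element K u p x \<oplus>\<^bsub>K\<^esub> (\<ominus>\<^bsub>K\<^esub> K1) \<otimes>\<^bsub>K\<^esub> path_element K w q x)"
  by (simp add: a_minus_def PA_minus[OF qc])
 have "pairing (path_element K u p \<ominus>\<^bsub>PA\<^esub> path_element K w q) (along_normal_form \<xi>) = K0"
  if \<xi>: "\<xi> \<in> functionals" for \<xi>
 proof -
  note K = functional_KF[OF \<xi>]
  have "\<xi> (normal_form r w q) \<in> carrier K" using \<xi> by (auto simp: functionals_def)
  then show ?thesis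
   unfolding e pairing_add[OF pc PA_smult_closed[OF mc qc] K] pairing_smult[OF mc qc K]
    pairing_path_element[OF K] by (simp add: eq l_minus r_neg)
 qed
 moreover have "path_element K u p \<ominus>\<^bsub>PA\<^esub> path_element K w q \<in> carrier PA" using pc qc by (rule PA.minus_closed)
 ultimately show ?thesis unfolding vanishing_def by blast
qed

lemma relations_vanish: "C_relations K r \<subseteq> vanishing"
 unfolding C_relations_def
proof (intro insert_subsetI empty_subsetI)
 show "path_element K 1 [arr_a1, arr_b1] \<in> vanishing" by (rule path_in_vanishing) simp_all
 show "path_element K 3 [arr_b2, arr_a2] \<in> vanishing" by (rule path_in_vanishing) simp_all
 show "path_element K 2 [arr_a2, arr_c] \<in> vanishing" by (rule path_in_vanishing) simp_all
 show "path_element K 3 [arr_c, arr_b2] \<in> vanishing" by (rule path_in_vanishing) simp_all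
 show "path_element K 3 (replicate r arr_c) \<ominus>\<^bsub>PA\<^esub> path_element K 3 [arr_b2, arr_b1, arr_a1, arr_a2] \<in> vanishing"
  by (rule difference_in_vanishing[OF loop_path]) (use normal_form_loop[of r] r in simp_all)
 show "path_element K 2 [arr_a2, arr_b2, arr_b1, arr_a1] \<ominus>\<^bsub>PA\<^esub> path_element K 2 [arr_b1, arr_a1, arr_a2, arr_b2] \<in> vanishing"
  by (rule difference_in_vanishing) simp_all
qed

end

context C_presentation
begin

interpretation PA: kalgebra K PA by (rule path_algebra_kalgebra)

abbreviation "relation_ideal \<equiv> Idl\<^bsub>PA\<^esub> (C_relations K r)"

abbreviation "CA \<equiv> C_algebra K r"

lemma relations_closed: "C_relations K r \<subseteq> carrier PA"
 using relations_vanish vanishing_closed by blast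

lemma relation_ideal: "ideal relation_ideal PA"
 by (rule PA.genideal_ideal[OF relations_closed])

lemma relation_ideal_vanishes: "relation_ideal \<subseteq> vanishing"
 by (rule PA.genideal_minimal[OF vanishing_ideal relations_vanish])

lemma C_algebra_quotient: "CA = quotient_algebra PA relation_ideal"
 by (simp add: C_algebra_def)

definition coset :: "(nat \<times> C_arrow list => 'k) => (nat \<times> C_arrow list => 'k) set" where
 "coset f = relation_ideal +>\<^bsub>PA\<^esub> f"

lemma coset_simps:
 shows coset_carrier: "carrier CA = coset ` carrier PA"
  and coset_mult: "\<And>f g. [|f \<in> carrier PA; g \<in> carrier PA|] ==> coset f \<otimes>\<^bsub>CA\<^esub> coset g = coset (conv f g)"
  and coset_add: "\<And>f g. [|f \<in> carrier PA; g \<in> carrier PA|] ==> coset f \<oplus>\<^bsub>CA\<^esub> coset g = coset (\<lambda>x. f x \<oplus>\<^bsub>K\<^esub> g x)"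
  and coset_smult: "\<And>c f. [|c \<in> carrier K; f \<in> carrier PA|] ==> c \<odot>\<^bsub>CA\<^esub> coset f = coset (\<lambda>x. c \<otimes>\<^bsub>K\<^esub> f x)"
  and coset_one: "\<one>\<^bsub>CA\<^esub> = coset unit_path"
  and coset_zero: "coset (\<lambda>x. K0) = \<zero>\<^bsub>CA\<^esub>"
  and coset_eq_zero: "\<And>f. f \<in> carrier PA ==> coset f = \<zero>\<^bsub>CA\<^esub> \<longleftrightarrow> f \<in> relation_ideal"
proof -
 note unfold = C_algebra_quotient coset_def
 show "carrier CA = coset ` carrier PA"
  unfolding unfold by (rule PA.quotient_carrier[OF relation_ideal])
 show "coset f \<otimes>\<^bsub>CA\<^esub> coset g = coset (conv f g)" if "f \<in> carrier PA" "g \<in> carrier PA" for f g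
  unfolding unfold by (rule PA.quotient_mult[OF relation_ideal that, unfolded PA_simps])
 show "coset f \<oplus>\<^bsub>CA\<^esub> coset g = coset (\<lambda>x. f x \<oplus>\<^bsub>K\<^esub> g x)" if "f \<in> carrier PA" "g \<in> carrier PA" for f g
  unfolding unfold by (rule PA.quotient_add[OF relation_ideal that, unfolded PA_simps])
 show "c \<odot>\<^bsub>CA\<^esub> coset f = coset (\<lambda>x. c \<otimes>\<^bsub>K\<^esub> f x)" if "c \<in> carrier K" "f \<in> carrier PA" for c f
  unfolding unfold by (rule PA.quotient_smult[OF relation_ideal that, unfolded PA_simps])
 show "\<one>\<^bsub>CA\<^esub> = coset unit_path"
  unfolding unfold by (rule PA.quotient_one[OF relation_ideal, unfolded PA_simps])
 show "coset (\<lambda>x. K0) = \<zero>\<^bsub>CA\<^esub>"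
  unfolding unfold by (rule PA.coset_zero[OF relation_ideal, unfolded PA_simps])
 show "coset f = \<zero>\<^bsub>CA\<^esub> \<longleftrightarrow> f \<in> relation_ideal" if "f \<in> carrier PA" for f
  unfolding unfold by (rule PA.coset_eq_zero[OF relation_ideal that])
qed

lemma CA_kalgebra: "kalgebra K CA"
 unfolding C_algebra_quotient by (rule PA.quotient_kalgebra[OF relation_ideal])

lemma CA_type: "C_type_algebra K CA r"
 by (intro C_type_algebra.intro CA_kalgebra C_type_algebra_axioms.intro r char_two)

interpretation CA: C_type_algebra K CA r by (rule CA_type)

definition path_class :: "nat => C_arrow list => (nat \<times> C_arrow list => 'k) set" where
 "path_class u p = coset (path_element K u p)"

lemma path_class_closed: "(u, p) \<in> quiver_paths C_quiver ==> path_class u p \<in> carrier CA"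
 unfolding path_class_def coset_carrier using path_element_closed by blast

lemma path_class_mult:
 assumes "(u, p) \<in> quiver_paths C_quiver" "(w, q) \<in> quiver_paths C_quiver"
 shows "path_class u p \<otimes>\<^bsub>CA\<^esub> path_class w q = (if path_end u p = w then path_class u (p @ q) else \<zero>\<^bsub>CA\<^esub>)"
 unfolding path_class_def coset_mult[OF path_element_closed[OF assms(1)] path_element_closed[OF assms(2)]]
  path_element_mult using coset_zero by simp

lemma path_class_zero: "(u, p) \<in> quiver_paths C_quiver ==> path_element K u p \<in> C_relations K r ==> path_class u p = \<zero>\<^bsub>CA\<^esub>"
 unfolding path_class_def coset_eq_zero[OF path_element_closed] using PA.genideal_self[OF relations_closed] by blast

lemma path_class_eq:
 assumes p: "(u, p) \<in> quiver_paths C_quiver" and q: "(w, q) \<in> quiver_paths C_quiver"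
  and rel: "path_element K u p \<ominus>\<^bsub>PA\<^esub> path_element K w q \<in> C_relations K r"
 shows "path_class u p = path_class w q"
proof -
 note pc = path_element_closed[OF p] and qc = path_element_closed[OF q]
 let ?d = "path_element K u p \<ominus>\<^bsub>PA\<^esub> path_element K w q"
 have dc: "?d \<in> carrier PA" using rel relations_closed by blast
 have d: "coset ?d = \<zero>\<^bsub>CA\<^esub>"
  using rel PA.genideal_self[OF relations_closed] coset_eq_zero[OF dc] by blast
 have "path_element K u p = ?d \<oplus>\<^bsub>PA\<^esub> path_element K w q"
  using pc qc unfolding a_minus_def by (simp only: PA.a_assoc PA.a_inv_closed PA.l_neg PA.r_zero)
 then have "path_class u p = coset (?d \<oplus>\<^bsub>PA\<^esub> path_element K w q)" unfolding path_class_def by (rule arg_cong)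
 also have "\<dots> = coset ?d \<oplus>\<^bsub>CA\<^esub> path_class w q" unfolding path_class_def coset_add[OF dc qc] by simp
 also have "\<dots> = path_class w q" unfolding d using path_class_closed[OF q] by simp
 finally show ?thesis .
qed

definition cyclic_arrow :: "nat => C_arrow" where
 "cyclic_arrow p = [arr_a1, arr_a2, arr_b2, arr_b1] ! p"

lemma cyclic_arrow_simps [simp]:
 "cyclic_arrow 0 = arr_a1" "cyclic_arrow (Suc 0) = arr_a2" "cyclic_arrow 2 = arr_b2" "cyclic_arrow 3 = arr_b1"
 by (simp_all add: cyclic_arrow_def)

lemma cyclic_arrow_ends:
 assumes "p < 4"
 shows "C_source (cyclic_arrow p) = vertex_at p" "C_target (cyclic_arrow p) = vertex_at (p + 1)"
proof -
 have "p = 0 \<or> p = 1 \<or> p = 2 \<or> p = 3" using assms by linarith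
 then show "C_source (cyclic_arrow p) = vertex_at p" "C_target (cyclic_arrow p) = vertex_at (p + 1)" by auto
qed

abbreviation arrow_class :: "C_arrow => (nat \<times> C_arrow list => 'k) set" where
 "arrow_class a \<equiv> path_class (C_source a) [a]"

lemma arrow_path [simp]: "C_source a = u ==> (u, [a]) \<in> quiver_paths C_quiver"
 using C_ends_in(2)[of a] by simp

lemma loop_power_class: "path_class 3 [arr_c] [^]\<^bsub>CA\<^esub> (Suc n) = path_class 3 (replicate (Suc n) arr_c)"
proof (induction n)
 case 0
 then show ?case using path_class_closed[OF arrow_path, of arr_c 3] by simp
next
 case (Suc n)
 have e: "path_end 3 (replicate m arr_c) = 3" for m by (induction m) simp_all
 have c: "(3, [arr_c]) \<in> quiver_paths C_quiver" by simp
 have "path_class 3 [arr_c] [^]\<^bsub>CA\<^esub> Suc (Suc n) = path_class 3 (replicate (Suc n) arr_c) \<otimes>\<^bsub>CA\<^esub> path_class 3 [arr_c]"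
  using Suc by simp
 also have "\<dots> = path_class 3 (replicate (Suc n) arr_c @ [arr_c])"
  unfolding path_class_mult[OF loop_path c] e by (simp only: refl if_True)
 also have "replicate (Suc n) arr_c @ [arr_c] = replicate (Suc (Suc n)) arr_c"
  by (simp add: replicate_append_same)
 finally show ?case .
qed

lemma generators:
 "C_generators K CA r (\<lambda>v. path_class v []) (\<lambda>p. arrow_class (cyclic_arrow p)) (path_class 3 [arr_c])"
proof (intro C_generators.intro CA_type C_generators_axioms.intro)
 fix v :: nat assume v: "v \<in> {1, 2, 3}"
 then have vp: "(v, []) \<in> quiver_paths C_quiver" by simp
 show "path_class v [] \<in> carrier CA" by (rule path_class_closed[OF vp])
 fix w :: nat assume w: "w \<in> {1, 2, 3}"
 then have wp: "(w, []) \<in> quiver_paths C_quiver" by simp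
 show "path_class v [] \<otimes>\<^bsub>CA\<^esub> path_class w [] = (if v = w then path_class v [] else \<zero>\<^bsub>CA\<^esub>)"
  unfolding path_class_mult[OF vp wp] by simp
next
 fix p :: nat assume p: "p < 4"
 note ap = arrow_path[OF refl, of "cyclic_arrow p"]
 have vp: "(vertex_at q, []) \<in> quiver_paths C_quiver" for q using vertex_at_in by simp
 show "arrow_class (cyclic_arrow p) \<in> carrier CA" by (rule path_class_closed[OF ap])
 show "path_class (vertex_at p) [] \<otimes>\<^bsub>CA\<^esub> arrow_class (cyclic_arrow p) = arrow_class (cyclic_arrow p)"
  unfolding path_class_mult[OF vp ap] using cyclic_arrow_ends[OF p] by simp
 show "arrow_class (cyclic_arrow p) \<otimes>\<^bsub>CA\<^esub> path_class (vertex_at (p + 1)) [] = arrow_class (cyclic_arrow p)"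
  unfolding path_class_mult[OF ap vp] using cyclic_arrow_ends[OF p] by simp
next
 have c: "(3, [arr_c]) \<in> quiver_paths C_quiver" and e: "(3, []) \<in> quiver_paths C_quiver" by simp_all
 show "path_class 3 [arr_c] \<in> carrier CA" by (rule path_class_closed) simp
 show "path_class 3 [] \<otimes>\<^bsub>CA\<^esub> path_class 3 [arr_c] = path_class 3 [arr_c]" using path_class_mult[OF e c] by simp
 show "path_class 3 [arr_c] \<otimes>\<^bsub>CA\<^esub> path_class 3 [] = path_class 3 [arr_c]" using path_class_mult[OF c e] by simp
 have rel: "path_element K 1 [arr_a1, arr_b1] \<in> C_relations K r" "path_element K 3 [arr_b2, arr_a2] \<in> C_relations K r"
  "path_element K 2 [arr_a2, arr_c] \<in> C_relations K r" "path_element K 3 [arr_c, arr_b2] \<in> C_relations K r"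
  "path_element K 3 (replicate r arr_c) \<ominus>\<^bsub>PA\<^esub> path_element K 3 [arr_b2, arr_b1, arr_a1, arr_a2] \<in> C_relations K r"
  "path_element K 2 [arr_a2, arr_b2, arr_b1, arr_a1] \<ominus>\<^bsub>PA\<^esub> path_element K 2 [arr_b1, arr_a1, arr_a2, arr_b2] \<in> C_relations K r"
  unfolding C_relations_def by blast+
 have paths: "(1, [arr_a1]) \<in> quiver_paths C_quiver" "(2, [arr_a2]) \<in> quiver_paths C_quiver"
  "(3, [arr_b2]) \<in> quiver_paths C_quiver" "(2, [arr_b1]) \<in> quiver_paths C_quiver"
  "(1, [arr_a1, arr_b1]) \<in> quiver_paths C_quiver" "(3, [arr_b2, arr_a2]) \<in> quiver_paths C_quiver"
  "(2, [arr_a2, arr_c]) \<in> quiver_paths C_quiver" "(3, [arr_c, arr_b2]) \<in> quiver_paths C_quiver"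
  "(1, [arr_a1, arr_a2]) \<in> quiver_paths C_quiver" "(2, [arr_b1, arr_a1, arr_a2]) \<in> quiver_paths C_quiver"
  "(3, [arr_b2, arr_b1, arr_a1, arr_a2]) \<in> quiver_paths C_quiver"
  "(2, [arr_b1, arr_a1]) \<in> quiver_paths C_quiver" "(3, [arr_b2, arr_b1, arr_a1]) \<in> quiver_paths C_quiver"
  "(2, [arr_a2, arr_b2, arr_b1, arr_a1]) \<in> quiver_paths C_quiver"
  "(2, [arr_a2, arr_b2]) \<in> quiver_paths C_quiver" "(1, [arr_a1, arr_a2, arr_b2]) \<in> quiver_paths C_quiver"
  "(2, [arr_b1, arr_a1, arr_a2, arr_b2]) \<in> quiver_paths C_quiver" by simp_all
 note mult = path_class_mult[OF paths(1) paths(4)] path_class_mult[OF paths(3) paths(2)]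
  path_class_mult[OF paths(2) c] path_class_mult[OF c paths(3)]
  path_class_mult[OF paths(1) paths(2)] path_class_mult[OF paths(4) paths(9)] path_class_mult[OF paths(3) paths(10)]
  path_class_mult[OF paths(4) paths(1)] path_class_mult[OF paths(3) paths(12)] path_class_mult[OF paths(2) paths(13)]
  path_class_mult[OF paths(2) paths(3)] path_class_mult[OF paths(1) paths(15)] path_class_mult[OF paths(4) paths(16)]
 have ends: "path_end 1 [arr_a1] = 2" "path_end 2 [arr_a2] = 3" "path_end 3 [arr_b2] = 2" "path_end 2 [arr_b1] = 1"
  "path_end 3 [arr_c] = 3" by simp_all
 have cls: "arrow_class (cyclic_arrow 0) = path_class 1 [arr_a1]" "arrow_class (cyclic_arrow 1) = path_class 2 [arr_a2]"
  "arrow_class (cyclic_arrow 2) = path_class 3 [arr_b2]" "arrow_class (cyclic_arrow 3) = path_class 2 [arr_b1]"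
 by simp_all
 note compute = cls mult ends append.simps if_True refl simp_thms
 show "arrow_class (cyclic_arrow 0) \<otimes>\<^bsub>CA\<^esub> arrow_class (cyclic_arrow 3) = \<zero>\<^bsub>CA\<^esub>"
  by (simp only: compute path_class_zero[OF paths(5) rel(1)])
 show "arrow_class (cyclic_arrow 2) \<otimes>\<^bsub>CA\<^esub> arrow_class (cyclic_arrow 1) = \<zero>\<^bsub>CA\<^esub>"
  by (simp only: compute path_class_zero[OF paths(6) rel(2)])
 show "arrow_class (cyclic_arrow 1) \<otimes>\<^bsub>CA\<^esub> path_class 3 [arr_c] = \<zero>\<^bsub>CA\<^esub>"
  by (simp only: compute path_class_zero[OF paths(7) rel(3)])
 show "path_class 3 [arr_c] \<otimes>\<^bsub>CA\<^esub> arrow_class (cyclic_arrow 2) = \<zero>\<^bsub>CA\<^esub>"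
  by (simp only: compute path_class_zero[OF paths(8) rel(4)])
 obtain n where n: "r = Suc n" using r by (cases r) auto
 have pow: "path_class 3 [arr_c] [^]\<^bsub>CA\<^esub> r = path_class 3 (replicate r arr_c)" using loop_power_class[of n] unfolding n[symmetric] .
 show "path_class 3 [arr_c] [^]\<^bsub>CA\<^esub> r = arrow_class (cyclic_arrow 2) \<otimes>\<^bsub>CA\<^esub>
   (arrow_class (cyclic_arrow 3) \<otimes>\<^bsub>CA\<^esub> (arrow_class (cyclic_arrow 0) \<otimes>\<^bsub>CA\<^esub> arrow_class (cyclic_arrow 1)))"
  unfolding pow path_class_eq[OF loop_path paths(11) rel(5)] by (simp only: compute)
 show "arrow_class (cyclic_arrow 1) \<otimes>\<^bsub>CA\<^esub> (arrow_class (cyclic_arrow 2) \<otimes>\<^bsub>CA\<^esub>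
    (arrow_class (cyclic_arrow 3) \<otimes>\<^bsub>CA\<^esub> arrow_class (cyclic_arrow 0))) =
   arrow_class (cyclic_arrow 3) \<otimes>\<^bsub>CA\<^esub> (arrow_class (cyclic_arrow 0) \<otimes>\<^bsub>CA\<^esub>
    (arrow_class (cyclic_arrow 1) \<otimes>\<^bsub>CA\<^esub> arrow_class (cyclic_arrow 2)))"
  by (simp only: compute path_class_eq[OF paths(14) paths(17) rel(6)])
qed

interpretation G: C_generators K CA r "\<lambda>v. path_class v []" "\<lambda>p. arrow_class (cyclic_arrow p)" "path_class 3 [arr_c]"
 by (rule generators)

lemma generated_arrow: "G.generated (arrow_monomial a) = arrow_class a"
proof -
 have p: "G.generated (Arc p 1) = arrow_class (cyclic_arrow p)" if "p < 4" for p
  using G.cycle_path_one[of p] that by (simp add: G.generated_def)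
 have "G.generated (Loop 1) = path_class 3 [arr_c]"
  using path_class_closed[OF arrow_path, of arr_c 3] by (simp add: G.generated_def)
 then show ?thesis using p[of 0] p[of 1] p[of 2] p[of 3] by (cases a) simp_all
qed

lemma generated_Null: "G.generated Null = \<zero>\<^bsub>CA\<^esub>"
 by (simp add: G.generated_def)

lemma path_class_normal_form:
 "(u, p) \<in> quiver_paths C_quiver ==> path_class u p = G.generated (normal_form r u p)"
proof (induction p arbitrary: u)
 case Nil
 show ?case by (simp add: G.generated_def)
next
 case (Cons a p)
 have path: "(C_target a, p) \<in> quiver_paths C_quiver" "C_source a = u" using Cons.prems by simp_all
 let ?t = "normal_form r (C_target a) p"
 have "path_class u (a # p) = path_class u [a] \<otimes>\<^bsub>CA\<^esub> path_class (C_target a) p"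
  unfolding path_class_mult[OF arrow_path[OF path(2)] path(1)] by simp
 also have "\<dots> = G.generated (arrow_monomial a) \<otimes>\<^bsub>CA\<^esub> G.generated ?t"
  unfolding Cons.IH[OF path(1)] generated_arrow path(2) ..
 also have "\<dots> = G.generated (mm r (arrow_monomial a) ?t)"
 proof (cases "?t = Null")
  case True
  have "G.generated (arrow_monomial a) \<in> carrier CA"
   unfolding generated_arrow by (rule path_class_closed[OF arrow_path[OF refl]])
  then show ?thesis unfolding True by (simp add: generated_Null)
 next
  case False
  then show ?thesis
   using normal_form_in[OF path(1)] by (intro G.generated_mult arrow_in_monomials[OF r arrow_monomial_in]) auto
 qed
 finally show ?case by simp
qed

text \<open>
A vanishing combination of the monomials lifts to an element of the relation ideal. All functionals vanish
there, in particular the coordinate at a given monomial.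
\<close>

theorem frame_exists: "CA.frame G.generated"
proof (rule CA.frame_combI)
 have gc: "G.generated b \<in> carrier CA" if b: "b \<in> monomials r" for b
 proof -
  obtain u p where up: "(u, p) \<in> quiver_paths C_quiver" "normal_form r u p = b"
   using monomial_is_normal_form[OF b] by blast
  show ?thesis using path_class_closed[OF up(1)] unfolding path_class_normal_form[OF up(1)] up(2) .
 qed
 show "G.generated b \<in> carrier CA" if "b \<in> monomials r" for b by (rule gc[OF that])
 show "G.generated Null = \<zero>\<^bsub>CA\<^esub>" by (rule generated_Null)
 show "G.generated s \<otimes>\<^bsub>CA\<^esub> G.generated t = G.generated (mm r s t)" if "s \<in> monomials r" "t \<in> monomials r" for s t
  by (rule G.generated_mult[OF that])
 have vp: "path_element K v [] \<in> carrier PA" if "v \<in> {1, 2, 3}" for v using that by (intro path_element_closed) simp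
 have gv: "G.generated (Vertex v) = path_class v []" for v by (simp add: G.generated_def)
 have v1: "path_element K 1 [] \<in> carrier PA" and v2: "path_element K 2 [] \<in> carrier PA"
  and v3: "path_element K 3 [] \<in> carrier PA" by (rule vp, simp)+
 have unit: "unit_path = (\<lambda>x. (path_element K 1 [] x \<oplus>\<^bsub>K\<^esub> path_element K 2 [] x) \<oplus>\<^bsub>K\<^esub> path_element K 3 [] x)"
  by (auto simp: fun_eq_iff unit_path_def path_element_def)
 show "G.generated (Vertex 1) \<oplus>\<^bsub>CA\<^esub> G.generated (Vertex 2) \<oplus>\<^bsub>CA\<^esub> G.generated (Vertex 3) = \<one>\<^bsub>CA\<^esub>"
  unfolding gv
  unfolding path_class_def coset_add[OF v1 v2] coset_add[OF PA_add_closed[OF v1 v2] v3] coset_one unit ..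
 have span: "\<exists>f\<in>monomials r \<rightarrow> carrier K. CA.comb G.generated f = coset h" if h: "h \<in> carrier PA" for h
  using h
 proof (induction h rule: path_algebra_induct)
  case zero
  have "CA.comb G.generated (\<lambda>b. K0) = \<zero>\<^bsub>CA\<^esub>"
   unfolding CA.comb_def by (rule CA.add.finprod_one_eqI) (simp add: gc)
  then show ?case unfolding coset_zero by (intro bexI[of _ "\<lambda>b. K0"]) auto
 next
  case (step c u p g)
  then obtain f where f: "f \<in> monomials r \<rightarrow> carrier K" "CA.comb G.generated f = coset g" by blast
  note pe = path_element_closed[OF step(2)]
  let ?b = "normal_form r u p"
  have "coset (c \<odot>\<^bsub>PA\<^esub> path_element K u p \<oplus>\<^bsub>PA\<^esub> g) = coset (\<lambda>x. c \<otimes>\<^bsub>K\<^esub> path_element K u p x) \<oplus>\<^bsub>CA\<^esub> coset g"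
   using coset_add[OF PA_smult_closed[OF step(1) pe] step(3)] by simp
  also have "coset (\<lambda>x. c \<otimes>\<^bsub>K\<^esub> path_element K u p x) = c \<odot>\<^bsub>CA\<^esub> path_class u p"
   unfolding path_class_def coset_smult[OF step(1) pe] ..
  finally have eq: "coset (c \<odot>\<^bsub>PA\<^esub> path_element K u p \<oplus>\<^bsub>PA\<^esub> g) = c \<odot>\<^bsub>CA\<^esub> G.generated ?b \<oplus>\<^bsub>CA\<^esub> CA.comb G.generated f"
   unfolding path_class_normal_form[OF step(2)] f(2) .
  have fc: "CA.comb G.generated f \<in> carrier CA" by (rule CA.comb_closed) (use gc f in auto)
  show ?case
  proof (cases "?b = Null")
   case True
   show ?thesis
    unfolding eq True generated_Null using step(1) f(1) fc by (intro bexI[of _ f]) simp_all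
  next
   case False
   then have b: "?b \<in> monomials r" using normal_form_in[OF step(2)] by simp
   let ?f = "\<lambda>b. (if ?b = b then c else K0) \<oplus>\<^bsub>K\<^esub> f b"
   have fK: "f b \<in> carrier K" if "b \<in> monomials r" for b using f(1) that by blast
   have "CA.comb G.generated ?f = (\<Oplus>\<^bsub>CA\<^esub>b\<in>monomials r.
     (if ?b = b then c \<odot>\<^bsub>CA\<^esub> G.generated b else \<zero>\<^bsub>CA\<^esub>) \<oplus>\<^bsub>CA\<^esub> f b \<odot>\<^bsub>CA\<^esub> G.generated b)"
    unfolding CA.comb_def using fK gc step(1)
    by (intro CA.finsum_cong') (auto simp: CA.smult_l_distr)
   also have "\<dots> = (\<Oplus>\<^bsub>CA\<^esub>b\<in>monomials r. if ?b = b then c \<odot>\<^bsub>CA\<^esub> G.generated b else \<zero>\<^bsub>CA\<^esub>)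
     \<oplus>\<^bsub>CA\<^esub> CA.comb G.generated f"
    unfolding CA.comb_def using fK gc step(1) by (intro CA.finsum_addf) auto
   also have "(\<Oplus>\<^bsub>CA\<^esub>b\<in>monomials r. if ?b = b then c \<odot>\<^bsub>CA\<^esub> G.generated b else \<zero>\<^bsub>CA\<^esub>) = c \<odot>\<^bsub>CA\<^esub> G.generated ?b"
    using gc step(1) by (intro CA.add.finprod_singleton[OF b]) auto
   finally have "CA.comb G.generated ?f = c \<odot>\<^bsub>CA\<^esub> G.generated ?b \<oplus>\<^bsub>CA\<^esub> CA.comb G.generated f" .
   moreover have "?f \<in> monomials r \<rightarrow> carrier K" using fK step(1) by auto
   ultimately show ?thesis unfolding eq by blast
  qed
 qed
 show "\<exists>f\<in>monomials r \<rightarrow> carrier K. CA.comb G.generated f = x" if x: "x \<in> carrier CA" for x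
  using x span unfolding coset_carrier by blast
 fix f b assume f: "f \<in> monomials r \<rightarrow> carrier K" and fz: "CA.comb G.generated f = \<zero>\<^bsub>CA\<^esub>" and b: "b \<in> monomials r"
 have fK: "f m \<in> carrier K" if "m \<in> monomials r" for m using f that by blast
 have "\<exists>x. x \<in> quiver_paths C_quiver \<and> normal_form r (fst x) (snd x) = m" if "m \<in> monomials r" for m
  using monomial_is_normal_form[OF that] by force
 then obtain word where word: "\<And>m. m \<in> monomials r ==> word m \<in> quiver_paths C_quiver"
  "\<And>m. m \<in> monomials r ==> normal_form r (fst (word m)) (snd (word m)) = m" by metis
 define t where "t = (\<lambda>m. f m \<odot>\<^bsub>PA\<^esub> path_element K (fst (word m)) (snd (word m)))"
 have pc: "path_element K (fst (word m)) (snd (word m)) \<in> carrier PA" if "m \<in> monomials r" for m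
  using word(1)[OF that] by (intro path_element_closed) simp
 have tc: "t m \<in> carrier PA" if "m \<in> monomials r" for m
  unfolding t_def by (rule PA.smult_closed[OF fK[OF that] pc[OF that]])
 let ?z = "\<Oplus>\<^bsub>PA\<^esub>m\<in>monomials r. t m"
 have zc: "?z \<in> carrier PA" by (rule PA.finsum_closed) (use tc in blast)
 have "coset ?z = (\<Oplus>\<^bsub>CA\<^esub>m\<in>monomials r. coset (t m))"
  by (rule finsum_additive[OF PA.abelian_monoid_axioms CA.abelian_monoid_axioms])
   (auto simp: coset_carrier coset_zero coset_add tc)
 also have "\<dots> = CA.comb G.generated f"
  unfolding CA.comb_def
 proof (rule CA.finsum_cong')
  fix m assume m: "m \<in> monomials r"
  have "coset (t m) = f m \<odot>\<^bsub>CA\<^esub> path_class (fst (word m)) (snd (word m))"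
   unfolding t_def path_class_def coset_smult[OF fK[OF m] pc[OF m]] by simp
  also have "\<dots> = f m \<odot>\<^bsub>CA\<^esub> G.generated m"
   using path_class_normal_form[of "fst (word m)" "snd (word m)"] word[OF m] by simp
  finally show "coset (t m) = f m \<odot>\<^bsub>CA\<^esub> G.generated m" .
 qed (use fK gc in auto)
 finally have "?z \<in> vanishing" using fz coset_eq_zero[OF zc] relation_ideal_vanishes by auto
 moreover define \<xi> where "\<xi> = (\<lambda>m. if m = b then K1 else K0)"
 have \<xi>: "\<xi> \<in> functionals" using b by (auto simp: functionals_def \<xi>_def)
 ultimately have "K0 = pairing ?z (along_normal_form \<xi>)" by (simp add: vanishing_def)
 also have "\<dots> = (\<Oplus>\<^bsub>K\<^esub>m\<in>monomials r. pairing (t m) (along_normal_form \<xi>))"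
  by (rule finsum_additive[OF PA.abelian_monoid_axioms abelian_monoid_axioms, where h = "\<lambda>f. pairing f (along_normal_form \<xi>)"])
   (use functional_KF[OF \<xi>] tc in \<open>auto simp: pairing_closed pairing_zero pairing_add\<close>)
 also have "\<dots> = (\<Oplus>\<^bsub>K\<^esub>m\<in>monomials r. if b = m then f m else K0)"
 proof (rule finsum_cong')
  fix m assume m: "m \<in> monomials r"
  have "pairing (t m) (along_normal_form \<xi>) = f m \<otimes>\<^bsub>K\<^esub> \<xi> m"
   using pairing_smult[OF fK[OF m] pc[OF m] functional_KF[OF \<xi>]] pairing_path_element[OF functional_KF[OF \<xi>]] word(2)[OF m]
   by (simp add: t_def case_prod_unfold)
  then show "pairing (t m) (along_normal_form \<xi>) = (if b = m then f m else K0)"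
   using fK[OF m] by (simp add: \<xi>_def)
 qed (use fK in auto)
 also have "\<dots> = f b" using fK by (intro add.finprod_singleton[OF b]) auto
 finally show "f b = K0" ..
qed

lemmas C_algebra_gradings_classified = CA.gradings_classified[OF frame_exists]

end

theorem corollary3p3:
  fixes K :: "('k, 'x) ring_scheme" and r :: nat
  assumes "algebraically_closed K"
    and "[(2 :: nat)] \<cdot>\<^bsub>K\<^esub> \<one>\<^bsub>K\<^esub> = \<zero>\<^bsub>K\<^esub>"
    and "r \<ge> 2"
  shows "equiv (gradings K (C_algebra K r)) (graded_Morita_rel K (C_algebra K r)) \<and>
    (\<exists>\<Phi>. bij_betw \<Phi> (gradings K (C_algebra K r) // graded_Morita_rel K (C_algebra K r))
            (UNIV :: (int \<times> int) set))"
proof -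
  interpret field K using assms(1) by (rule algebraically_closed.axioms(1))
  have "\<one>\<^bsub>K\<^esub> \<oplus>\<^bsub>K\<^esub> \<one>\<^bsub>K\<^esub> = [(2 :: nat)] \<cdot>\<^bsub>K\<^esub> \<one>\<^bsub>K\<^esub>"
    by (simp add: numeral_2_eq_2 add_pow_def)
  then have "C_presentation K r"
    using assms(2,3) by (intro C_presentation.intro C_presentation_axioms.intro field_axioms) simp_all
  from C_presentation.C_algebra_gradings_classified[OF this] show ?thesis by blast
qed

end
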